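(* Let $n\ge1$. The Poincar\'e polynomial $P^{sm}_n(q)$ of the smooth locus of the degenerate flag variety $\mathcal F^a_{n+1}$ satisfies $$P^{sm}_n(q)=q^{n(n-1)/2}\,r_n(q),$$ where $r_n(q)=\sum_{p} q^{\mathrm{diag}(p)}$, the sum being over all Schr\"oder paths $p$ from $(0,0)$ to $(n,n)$ and $\mathrm{diag}(p)$ being the number of $(1,1)$ steps in $p$.
   Context: Work over $\mathbb C$. Let $W$ be a vector space with basis $w_1,\dots,w_{n+1}$, and let $pr_k:W\to W$ be the linear map with $pr_kw_k=0$ and $pr_kw_i=w_i$ for $i\ne k$. The degenerate flag variety $\mathcal F^a_{n+1}\subset\prod_{k=1}^n\mathrm{Gr}_k(W)$ consists of collections $(V_1,\dots,V_n)$ with $\dim V_k=k$ and $pr_{k+1}V_k\subset V_{k+1}$ for $1\le k\le n-1$. A collection $\mathbf S=(S_1,\dots,S_n)$ of subsets of $\{1,\dots,n+1\}$ with $\#S_k=k$ is called admissible if $S_k\subset S_{k+1}\cup\{k+1\}$ for $1\le k\le n-1$; put $p_{\mathbf S}=(V_k)_{k=1}^n$ with $V_k=\mathrm{span}(w_i: i\in S_k)$. Consider the representation $M$ of the quiver $1\to2\to\dots\to n$ with $M_k=W$ and $pr_{k+1}$ on the arrow $k\to k+1$; points of $\mathcal F^a_{n+1}$ are its subrepresentations of dimension vector $(1,\dots,n)$. One has $M=P\oplus I$, where $P=\bigoplus_{k=1}^nP_k$, $I=\bigoplus_{k=1}^nI_k$, $P_k$ is spanned by the copies of $w_k$ at vertices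 $k,\dots,n$, and $I_k$ is spanned by the copies of $w_{k+1}$ at vertices $1,\dots,k$. Let $\mathfrak A\subset\mathrm{Aut}(M)$ be the subgroup of automorphisms whose component $I\to P$ is zero. It is known that the $\mathfrak A$-orbits in $\mathcal F^a_{n+1}$ are exactly the orbits $C_{\mathbf S}=\mathfrak A\,p_{\mathbf S}$, $\mathbf S$ admissible, that these are pairwise disjoint complex affine cells, and hence that the smooth locus is a union of such cells. The Poincar\'e polynomial of the smooth locus is $\sum q^{\dim_{\mathbb C} C_{\mathbf S}}$ over the cells $C_{\mathbf S}$ contained in the smooth locus. A Schr\"oder path is a lattice path from $(0,0)$ to $(n,n)$ with steps $(1,0)$, $(0,1)$, $(1,1)$ which never goes above the diagonal $y=x$. *)

theory Defs
  imports "HOL-Analysis.Analysis" "HOL-Library.Function_Algebras"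
    "HOL-Library.Extended_Nat" "HOL-Computational_Algebra.Polynomial"
begin

definition cscale :: "complex \<Rightarrow> ('i \<Rightarrow> complex) \<Rightarrow> 'i \<Rightarrow> complex" where
  "cscale c v = (\<lambda>i. c * v i)"

interpretation cfun: vector_space "cscale :: complex \<Rightarrow> ('i \<Rightarrow> complex) \<Rightarrow> 'i \<Rightarrow> complex"
  by unfold_locales (auto simp: cscale_def fun_eq_iff algebra_simps)

definition coord_space :: "'i set \<Rightarrow> ('i \<Rightarrow> complex) set" where
  "coord_space C = {a. \<forall>i. i \<notin> C \<longrightarrow> a i = 0}"


section \<open>Krull dimension of topological spaces\<close>

definition irreducible_closedin :: "'a topology \<Rightarrow> 'a set \<Rightarrow> bool" where
  "irreducible_closedin T Z \<longleftrightarrow> closedin T Z \<and> Z \<noteq> {} \<and>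
     (\<forall>A B. closedin T A \<and> closedin T B \<and> Z = A \<union> B \<longrightarrow> Z = A \<or> Z = B)"

definition krull_dim :: "'a topology \<Rightarrow> enat" where
  "krull_dim T = Sup {enat m | m. \<exists>Z :: nat \<Rightarrow> 'a set.
     (\<forall>i\<le>m. irreducible_closedin T (Z i)) \<and> (\<forall>i<m. Z i \<subset> Z (Suc i))}"

definition local_krull_dim :: "'a topology \<Rightarrow> 'a \<Rightarrow> enat" where
  "local_krull_dim T x = (INF U \<in> {U. openin T U \<and> x \<in> U}. krull_dim (subtopology T U))"


section \<open>Affine algebraic sets\<close>

text \<open>Polynomial functions; since the field is infinite these are the same as polynomials.\<close>

inductive_set polyfun :: "(('i \<Rightarrow> complex) \<Rightarrow> complex) set" where
  const: "(\<lambda>a. c) \<in> polyfun"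
| coord: "(\<lambda>a. a i) \<in> polyfun"
| add: "f \<in> polyfun \<Longrightarrow> g \<in> polyfun \<Longrightarrow> (\<lambda>a. f a + g a) \<in> polyfun"
| mult: "f \<in> polyfun \<Longrightarrow> g \<in> polyfun \<Longrightarrow> (\<lambda>a. f a * g a) \<in> polyfun"

definition zero_locus :: "'i set \<Rightarrow> (('i \<Rightarrow> complex) \<Rightarrow> complex) set \<Rightarrow> ('i \<Rightarrow> complex) set" where
  "zero_locus C F = {a \<in> coord_space C. \<forall>f\<in>F. f a = 0}"

definition algebraic_set :: "'i set \<Rightarrow> ('i \<Rightarrow> complex) set \<Rightarrow> bool" where
  "algebraic_set C Z \<longleftrightarrow> (\<exists>F \<subseteq> polyfun. Z = zero_locus C F)"

definition vanishing_ideal :: "('i \<Rightarrow> complex) set \<Rightarrow> (('i \<Rightarrow> complex) \<Rightarrow> complex) set" where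
  "vanishing_ideal Y = {f \<in> polyfun. \<forall>a\<in>Y. f a = 0}"

text \<open>The Zariski tangent space at \<open>a\<close> of an algebraic set \<open>Y\<close> (with its reduced structure):
  the vectors killed by the differentials at \<open>a\<close> of all \<open>f\<close> in the ideal of \<open>Y\<close>.\<close>

definition zariski_tangent ::
  "'i set \<Rightarrow> ('i \<Rightarrow> complex) set \<Rightarrow> ('i \<Rightarrow> complex) \<Rightarrow> ('i \<Rightarrow> complex) set" where
  "zariski_tangent C Y a =
     {v \<in> coord_space C. \<forall>f \<in> vanishing_ideal Y. deriv (\<lambda>t. f (a + cscale t v)) 0 = 0}"

lemma algebraic_set_Un:
  assumes "algebraic_set C A" "algebraic_set C B"
  shows "algebraic_set C (A \<union> B)"
proof -
  obtain F G where F: "F \<subseteq> polyfun" "A = zero_locus C F" and G: "G \<subseteq> polyfun" "B = zero_locus C G"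
    using assms unfolding algebraic_set_def by blast
  define H where "H = {(\<lambda>a. f a * g a) | f g. f \<in> F \<and> g \<in> G}"
  have "H \<subseteq> polyfun"
    unfolding H_def using F(1) G(1) by (auto intro: polyfun.mult)
  moreover have "A \<union> B = zero_locus C H"
    unfolding F G zero_locus_def H_def by fastforce
  ultimately show ?thesis
    unfolding algebraic_set_def by blast
qed

lemma algebraic_set_INT:
  assumes "\<And>k. k \<in> K \<Longrightarrow> algebraic_set C (A k)"
  shows "algebraic_set C {a \<in> coord_space C. \<forall>k\<in>K. a \<in> A k}"
proof -
  obtain F where F: "\<And>k. k \<in> K \<Longrightarrow> F k \<subseteq> polyfun \<and> A k = zero_locus C (F k)"
    using assms unfolding algebraic_set_def by metis
  have "{a \<in> coord_space C. \<forall>k\<in>K. a \<in> A k} = zero_locus C (\<Union>k\<in>K. F k)"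
    using F unfolding zero_locus_def by fastforce
  moreover have "(\<Union>k\<in>K. F k) \<subseteq> polyfun"
    using F by blast
  ultimately show ?thesis
    unfolding algebraic_set_def by blast
qed


section \<open>The product of Grassmannians\<close>

definition W :: "nat \<Rightarrow> (nat \<Rightarrow> complex) set" where
  "W n = coord_space {1..n+1}"

definition w :: "nat \<Rightarrow> nat \<Rightarrow> complex" where
  "w i = (\<lambda>j. if j = i then 1 else 0)"

definition pr :: "nat \<Rightarrow> (nat \<Rightarrow> complex) \<Rightarrow> nat \<Rightarrow> complex" where
  "pr k v = v(k := 0)"

definition Gr :: "nat \<Rightarrow> nat \<Rightarrow> (nat \<Rightarrow> complex) set set" where
  "Gr n k = {V. cfun.subspace V \<and> V \<subseteq> W n \<and> cfun.dim V = k}"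

definition prod_Gr :: "nat \<Rightarrow> (nat \<Rightarrow> (nat \<Rightarrow> complex) set) set" where
  "prod_Gr n = (\<Pi>\<^sub>E k\<in>{1..n}. Gr n k)"

definition subset_tuples :: "nat \<Rightarrow> (nat \<Rightarrow> nat set) set" where
  "subset_tuples n = (\<Pi>\<^sub>E k\<in>{1..n}. {A. A \<subseteq> {1..n+1} \<and> card A = k})"

text \<open>The standard affine chart of \<open>prod_Gr n\<close> attached to \<open>J \<in> subset_tuples n\<close>: in the
  \<open>k\<close>-th factor, the subspaces complementary to the span of the \<open>w i\<close> with \<open>i \<notin> J k\<close>, written
  as graphs. The coordinate \<open>(k, i, j)\<close> is the coefficient of \<open>w i\<close> in the basis vector
  \<open>w j + \<dots>\<close> of the \<open>k\<close>-th subspace.\<close>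

definition chart_coords :: "nat \<Rightarrow> (nat \<Rightarrow> nat set) \<Rightarrow> (nat \<times> nat \<times> nat) set" where
  "chart_coords n J = {(k, i, j). k \<in> {1..n} \<and> i \<in> {1..n+1} - J k \<and> j \<in> J k}"

definition chart ::
  "nat \<Rightarrow> (nat \<Rightarrow> nat set) \<Rightarrow> (nat \<times> nat \<times> nat \<Rightarrow> complex) \<Rightarrow> nat \<Rightarrow> (nat \<Rightarrow> complex) set" where
  "chart n J a = (\<lambda>k\<in>{1..n}. cfun.span
     ((\<lambda>j. w j + (\<Sum>i\<in>{1..n+1} - J k. cscale (a (k, i, j)) (w i))) ` J k))"

definition chart_preimage ::
  "nat \<Rightarrow> (nat \<Rightarrow> nat set) \<Rightarrow> (nat \<Rightarrow> (nat \<Rightarrow> complex) set) set \<Rightarrow>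
    (nat \<times> nat \<times> nat \<Rightarrow> complex) set" where
  "chart_preimage n J X = {a \<in> coord_space (chart_coords n J). chart n J a \<in> X}"

text \<open>The Zariski topology glued from the charts: a set is closed iff its trace on every chart is
  an algebraic set.\<close>

definition zariski_open :: "nat \<Rightarrow> (nat \<Rightarrow> (nat \<Rightarrow> complex) set) set \<Rightarrow> bool" where
  "zariski_open n U \<longleftrightarrow> U \<subseteq> prod_Gr n \<and>
     (\<forall>J \<in> subset_tuples n. algebraic_set (chart_coords n J) (chart_preimage n J (- U)))"

definition zariski :: "nat \<Rightarrow> (nat \<Rightarrow> (nat \<Rightarrow> complex) set) topology" where
  "zariski n = topology (zariski_open n)"

lemma istopology_zariski_open: "istopology (zariski_open n)"
  unfolding istopology_def
proof (intro conjI allI impI)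
  fix U V assume U: "zariski_open n U" and V: "zariski_open n V"
  have "chart_preimage n J (- (U \<inter> V)) = chart_preimage n J (- U) \<union> chart_preimage n J (- V)" for J
    unfolding chart_preimage_def by blast
  then show "zariski_open n (U \<inter> V)"
    using U V unfolding zariski_open_def by (auto intro: algebraic_set_Un)
next
  fix \<K> assume K: "\<forall>U\<in>\<K>. zariski_open n U"
  have "chart_preimage n J (- \<Union>\<K>) =
    {a \<in> coord_space (chart_coords n J). \<forall>U\<in>\<K>. a \<in> chart_preimage n J (- U)}" for J
    unfolding chart_preimage_def by blast
  then show "zariski_open n (\<Union>\<K>)"
    using K unfolding zariski_open_def by (auto intro: algebraic_set_INT)
qed

lemma openin_zariski: "openin (zariski n) U \<longleftrightarrow> zariski_open n U"
  unfolding zariski_def by (simp add: topology_inverse' istopology_zariski_open)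


section \<open>The degenerate flag variety and its smooth locus\<close>

definition deg_flag :: "nat \<Rightarrow> (nat \<Rightarrow> (nat \<Rightarrow> complex) set) set" where
  "deg_flag n = {V \<in> prod_Gr n. \<forall>k\<in>{1..<n}. pr (k+1) ` V k \<subseteq> V (k+1)}"

text \<open>A point is smooth iff the dimension of the Zariski tangent space equals the local dimension
  of the variety, that is, iff the local ring is regular. The tangent space is computed in a
  chart around the point; its dimension does not depend on the chart.\<close>

definition smooth_locus :: "nat \<Rightarrow> (nat \<Rightarrow> (nat \<Rightarrow> complex) set) set" where
  "smooth_locus n = {V \<in> deg_flag n. \<exists>J \<in> subset_tuples n. \<exists>a \<in> coord_space (chart_coords n J).
     chart n J a = V \<and>
     enat (cfun.dim (zariski_tangent (chart_coords n J) (chart_preimage n J (deg_flag n)) a)) =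
       local_krull_dim (subtopology (zariski n) (deg_flag n)) V}"


section \<open>The cells\<close>

definition admissible :: "nat \<Rightarrow> (nat \<Rightarrow> nat set) \<Rightarrow> bool" where
  "admissible n S \<longleftrightarrow> S \<in> subset_tuples n \<and> (\<forall>k\<in>{1..<n}. S k \<subseteq> S (k+1) \<union> {k+1})"

definition pt :: "nat \<Rightarrow> (nat \<Rightarrow> nat set) \<Rightarrow> nat \<Rightarrow> (nat \<Rightarrow> complex) set" where
  "pt n S = (\<lambda>k\<in>{1..n}. cfun.span (w ` S k))"

definition lin_aut :: "nat \<Rightarrow> ((nat \<Rightarrow> complex) \<Rightarrow> nat \<Rightarrow> complex) \<Rightarrow> bool" where
  "lin_aut n f \<longleftrightarrow> bij_betw f (W n) (W n) \<and>
     (\<forall>u\<in>W n. \<forall>v\<in>W n. f (u + v) = f u + f v) \<and>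
     (\<forall>c. \<forall>v\<in>W n. f (cscale c v) = cscale c (f v))"

definition aut_M :: "nat \<Rightarrow> (nat \<Rightarrow> (nat \<Rightarrow> complex) \<Rightarrow> nat \<Rightarrow> complex) set" where
  "aut_M n = {g. (\<forall>k\<in>{1..n}. lin_aut n (g k)) \<and>
     (\<forall>k\<in>{1..<n}. \<forall>v\<in>W n. g (k+1) (pr (k+1) v) = pr (k+1) (g k v))}"

text \<open>The components at vertex \<open>k\<close> of the summands \<open>P\<close> and \<open>I\<close> of \<open>M\<close>: \<open>P_l\<close> contributes
  \<open>w l\<close> at the vertices \<open>l, \<dots>, n\<close>, and \<open>I_l\<close> contributes \<open>w (l+1)\<close> at the vertices
  \<open>1, \<dots>, l\<close>.\<close>

definition rep_P :: "nat \<Rightarrow> nat \<Rightarrow> (nat \<Rightarrow> complex) set" where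
  "rep_P n k = cfun.span {w l | l. l \<in> {1..n} \<and> k \<in> {l..n}}"

definition rep_I :: "nat \<Rightarrow> nat \<Rightarrow> (nat \<Rightarrow> complex) set" where
  "rep_I n k = cfun.span {w (l+1) | l. l \<in> {1..n} \<and> k \<in> {1..l}}"

definition grp_A :: "nat \<Rightarrow> (nat \<Rightarrow> (nat \<Rightarrow> complex) \<Rightarrow> nat \<Rightarrow> complex) set" where
  "grp_A n = {g \<in> aut_M n. \<forall>k\<in>{1..n}. \<forall>v\<in>rep_I n k. \<forall>x\<in>rep_P n k. \<forall>y\<in>rep_I n k.
     g k v = x + y \<longrightarrow> x = 0}"

definition cell :: "nat \<Rightarrow> (nat \<Rightarrow> nat set) \<Rightarrow> (nat \<Rightarrow> (nat \<Rightarrow> complex) set) set" where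
  "cell n S = {(\<lambda>k\<in>{1..n}. g k ` pt n S k) | g. g \<in> grp_A n}"

definition smooth_cells :: "nat \<Rightarrow> (nat \<Rightarrow> (nat \<Rightarrow> complex) set) set set" where
  "smooth_cells n = {cell n S | S. admissible n S \<and> cell n S \<subseteq> smooth_locus n}"

definition poincare_smooth :: "nat \<Rightarrow> int poly" where
  "poincare_smooth n =
     (\<Sum>C\<in>smooth_cells n. monom 1 (the_enat (krull_dim (subtopology (zariski n) C))))"


section \<open>Schroeder paths\<close>

text \<open>A path starting at \<open>(0, 0)\<close> is given by its list of steps. As the region below the diagonal
  is convex, it suffices to constrain the lattice points visited.\<close>

definition schroeder_paths :: "nat \<Rightarrow> (nat \<times> nat) list set" where
  "schroeder_paths n = {p. set p \<subseteq> {(1, 0), (0, 1), (1, 1)} \<and>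
     (\<Sum>s\<leftarrow>p. fst s) = n \<and> (\<Sum>s\<leftarrow>p. snd s) = n \<and>
     (\<forall>m\<le>length p. (\<Sum>s\<leftarrow>take m p. snd s) \<le> (\<Sum>s\<leftarrow>take m p. fst s))}"

definition schroeder_poly :: "nat \<Rightarrow> int poly" where
  "schroeder_poly n = (\<Sum>p\<in>schroeder_paths n. monom 1 (count_list p (1, 1)))"

end

theory Submission
  imports Defs "HOL-Combinatorics.Permutations" "Jordan_Normal_Form.Determinant"
begin

text \<open>In the chart around \<open>p\<^sub>S\<close> the degenerate flag variety is given by equations with bilinear terms, and the group is
  triangular for a cyclic order of the basis. Hence the cell of \<open>S\<close> is cut out in this chart by equations that can be
  solved one after the other; it is an affine space, and counting its free coordinates gives its dimension, at most
  \<open>N = n (n + 1) / 2\<close>. As the cells cover the variety, no local dimension exceeds \<open>N\<close>.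

  If there are \<open>2 \<le> l \<le> j \<le> n\<close> with \<open>j \<in> S (l - 1)\<close> and \<open>l \<notin> S j\<close>, then the linear parts of the equations at \<open>p\<^sub>S\<close> are
  dependent, the tangent space has dimension greater than \<open>N\<close>, and \<open>p\<^sub>S\<close> is singular. Otherwise
  \<open>S k = {i. \<pi> i \<le> k}\<close> for a permutation \<open>\<pi>\<close> of \<open>{1..n+1}\<close> without \<open>\<pi> j < l < j < \<pi> l\<close>, and the equations of
  the whole variety in the chart can be solved successively with \<open>N\<close> free coordinates, so that the cell is smooth.

  The codimension of the cell is a statistic of \<open>\<pi>\<close>. Splitting such a permutation at the preimage of its first
  point gives for the generating polynomial of this statistic the recursion that Schroeder paths satisfy by
  decomposition at the first return to the diagonal.

  Krull dimensions are bounded from above by counting monomials: a chain of irreducible closed sets of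
  length \<open>m\<close> yields \<open>m\<close> polynomial functions satisfying no nontrivial relation, which is impossible on a finite
  union of images of affine spaces of smaller dimension under rational maps.\<close>


section \<open>Non-crossing permutations\<close>

text \<open>Smoothness compares a tangent space, defined through the full vanishing ideal, with a
  local Krull dimension, and generators of that ideal are not known in advance. The proof avoids
  them. At a bad point only a lower bound for the tangent space is needed; it comes from lines
  through p_S that lie on the variety, and the local dimension need only be at most N. At a good
  point the variety in the chart is the graph of a polynomial map over a coordinate space, which
  gives the tangent space and the local dimension together. The case l = j of a bad pair says that l
  lies in S (l - 1) but not in S l. Excluding it turns S into an increasing chain, and \<pi> records
  when each index enters; excluding l < j is then the non-crossing condition. Since N = n (n - 1) /
  2 + n, what remains is that the sum of q^(n - stat \<pi>) over the non-crossing permutations of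
  {1..n+1} is r_n. Permutations fixing the first point correspond to paths beginning with a diagonal
  step and contribute the factor q.\<close>

definition nocross :: "(nat \<Rightarrow> nat) \<Rightarrow> bool" where
  "nocross \<pi> \<longleftrightarrow> \<not> (\<exists>l j. \<pi> j < l \<and> l < j \<and> j < \<pi> l)"

text \<open>The contribution of \<open>i\<close> to the codimension of the cell attached to \<open>\<pi>\<close>.\<close>

definition cross_count :: "(nat \<Rightarrow> nat) \<Rightarrow> nat \<Rightarrow> nat" where
  "cross_count \<pi> i = (if \<pi> i < i then Suc (card {j. \<pi> j < \<pi> i \<and> \<pi> i < j \<and> j < i})
     else card {l. i < l \<and> l \<le> \<pi> i \<and> \<pi> i < \<pi> l})"

definition stat :: "(nat \<Rightarrow> nat) \<Rightarrow> nat" where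
  "stat \<pi> = (\<Sum>i | \<pi> i \<noteq> i. cross_count \<pi> i)"

text \<open>Arbitrary intervals are needed because the recursion cuts the ground set into {p+1..a}
  and {a..q}, which share the point a.\<close>

definition nc_perms :: "nat \<Rightarrow> nat \<Rightarrow> (nat \<Rightarrow> nat) set" where
  "nc_perms p q = {\<pi>. \<pi> permutes {p..q} \<and> nocross \<pi>}"

text \<open>A non-crossing permutation of \<open>{p..q}\<close> with \<open>\<pi> p \<noteq> p\<close> is uniquely of this form, where \<open>\<pi> a = p\<close>, \<open>\<sigma>\<close> permutes
  \<open>{p+1..a}\<close> and \<open>\<rho>\<close> permutes \<open>{a..q}\<close>: the counterpart of the first return of a path to the diagonal.\<close>

definition glue :: "nat \<Rightarrow> nat \<Rightarrow> (nat \<Rightarrow> nat) \<Rightarrow> (nat \<Rightarrow> nat) \<Rightarrow> nat \<Rightarrow> nat" where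
  "glue p a \<sigma> \<rho> = \<sigma> \<circ> \<rho> \<circ> Transposition.transpose p a"

lemma cross_count_fixed: "\<pi> i = i \<Longrightarrow> cross_count \<pi> i = 0"
  unfolding cross_count_def by (auto simp: card_eq_0_iff)

lemma stat_eq_sum:
  assumes "\<pi> permutes A" "A \<subseteq> B" "finite B"
  shows "stat \<pi> = (\<Sum>i\<in>B. cross_count \<pi> i)"
  unfolding stat_def
proof (rule sum.mono_neutral_left)
  show "{i. \<pi> i \<noteq> i} \<subseteq> B" using assms permutes_not_in by fastforce
qed (use assms cross_count_fixed in auto)

text \<open>Counting {..v} by arguments and by values gives the same number of points that stay
  inside, so as many arrows leave as enter.\<close>

lemma permutes_crossing_balance:
  assumes "\<pi> permutes A" "finite A"
  shows "card {l. l \<le> v \<and> v < \<pi> l} = card {j. \<pi> j \<le> v \<and> v < (j::nat)}"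
proof -
  define X where "X = {l. l \<le> v \<and> \<pi> l \<le> v}"
  have fX: "finite X" unfolding X_def by (rule finite_subset[of _ "{..v}"]) auto
  have inj: "inj \<pi>" "surj \<pi>" using assms permutes_inj permutes_surj by blast+
  have "{..v} = X \<union> {l. l \<le> v \<and> v < \<pi> l}" unfolding X_def by auto
  moreover have "X \<inter> {l. l \<le> v \<and> v < \<pi> l} = {}" unfolding X_def by auto
  ultimately have 1: "card {..v} = card X + card {l. l \<le> v \<and> v < \<pi> l}"
    using fX by (metis card_Un_disjoint finite_Un finite_atMost)
  have fY: "finite {j. \<pi> j \<le> v \<and> v < j}"
  proof (rule finite_subset[of _ A])
    show "{j. \<pi> j \<le> v \<and> v < j} \<subseteq> A"
    proof
      fix j assume "j \<in> {j. \<pi> j \<le> v \<and> v < j}"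
      then have "\<pi> j \<noteq> j" by auto
      then show "j \<in> A" using assms(1) permutes_not_in by metis
    qed
  qed (use assms in auto)
  have "{..v} = \<pi> ` (X \<union> {j. \<pi> j \<le> v \<and> v < j})"
  proof
    show "{..v} \<subseteq> \<pi> ` (X \<union> {j. \<pi> j \<le> v \<and> v < j})"
    proof
      fix x assume "x \<in> {..v}"
      obtain y where "x = \<pi> y" using inj(2) by (metis surjD)
      then show "x \<in> \<pi> ` (X \<union> {j. \<pi> j \<le> v \<and> v < j})"
        using \<open>x \<in> {..v}\<close> unfolding X_def by (cases "y \<le> v") auto
    qed
  qed (auto simp: X_def)
  then have "card {..v} = card (X \<union> {j. \<pi> j \<le> v \<and> v < j})"
    using inj(1) by (metis card_image inj_on_subset subset_UNIV)
  also have "\<dots> = card X + card {j. \<pi> j \<le> v \<and> v < j}"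
    by (rule card_Un_disjoint) (use fX fY in \<open>auto simp: X_def\<close>)
  finally show ?thesis using 1 by simp
qed

context
  fixes p a q :: nat and \<sigma> \<rho> :: "nat \<Rightarrow> nat"
  assumes pa: "p < a" "a \<le> q"
    and sg: "\<sigma> permutes {Suc p..a}" and rh: "\<rho> permutes {a..q}"
begin

text \<open>The factors \<sigma> and \<rho> interact only at a: the value \<sigma> a is taken over
  by the point that \<rho> sends to a, and by p itself when \<rho> fixes a.\<close>

lemma glue_values:
  shows "glue p a \<sigma> \<rho> a = p"
    and "\<rho> a = a \<Longrightarrow> glue p a \<sigma> \<rho> p = \<sigma> a"
    and "\<rho> a \<noteq> a \<Longrightarrow> glue p a \<sigma> \<rho> p = \<rho> a"
    and "p < x \<Longrightarrow> x < a \<Longrightarrow> glue p a \<sigma> \<rho> x = \<sigma> x"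
    and "a < x \<Longrightarrow> \<rho> x = a \<Longrightarrow> glue p a \<sigma> \<rho> x = \<sigma> a"
    and "a < x \<Longrightarrow> \<rho> x \<noteq> a \<Longrightarrow> glue p a \<sigma> \<rho> x = \<rho> x"
    and "p < x \<Longrightarrow> x \<le> a \<Longrightarrow> p < \<sigma> x \<and> \<sigma> x \<le> a"
    and "a \<le> x \<Longrightarrow> a \<le> \<rho> x"
    and "x < p \<Longrightarrow> glue p a \<sigma> \<rho> x = x"
proof -
  have s: "\<sigma> x = x" if "x \<notin> {Suc p..a}" for x using sg that by (rule permutes_not_in)
  have r: "\<rho> x = x" if "x \<notin> {a..q}" for x using rh that by (rule permutes_not_in)
  have s2: "p < \<sigma> x \<and> \<sigma> x \<le> a" if "p < x" "x \<le> a" for x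
    using permutes_in_image[OF sg, of x] that by auto
  have r2: "a \<le> \<rho> x" if "a \<le> x" for x
    using permutes_in_image[OF rh, of x] r[of x] that by (cases "x \<le> q") auto
  show "p < x \<Longrightarrow> x \<le> a \<Longrightarrow> p < \<sigma> x \<and> \<sigma> x \<le> a" using s2 .
  show "a \<le> x \<Longrightarrow> a \<le> \<rho> x" using r2 .
  show "glue p a \<sigma> \<rho> a = p" unfolding glue_def using pa r[of p] s[of p] by simp
  show "\<rho> a = a \<Longrightarrow> glue p a \<sigma> \<rho> p = \<sigma> a" unfolding glue_def by simp
  show "\<rho> a \<noteq> a \<Longrightarrow> glue p a \<sigma> \<rho> p = \<rho> a" unfolding glue_def using r2[of a] s[of "\<rho> a"] by simp
  show "p < x \<Longrightarrow> x < a \<Longrightarrow> glue p a \<sigma> \<rho> x = \<sigma> x" unfolding glue_def using r[of x] by simp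
  show "a < x \<Longrightarrow> \<rho> x = a \<Longrightarrow> glue p a \<sigma> \<rho> x = \<sigma> a" unfolding glue_def using pa by simp
  show "a < x \<Longrightarrow> \<rho> x \<noteq> a \<Longrightarrow> glue p a \<sigma> \<rho> x = \<rho> x"
    unfolding glue_def using pa r2[of x] s[of "\<rho> x"] by simp
  show "x < p \<Longrightarrow> glue p a \<sigma> \<rho> x = x" unfolding glue_def using pa r[of x] s[of x] by simp
qed

lemma glue_permutes: "glue p a \<sigma> \<rho> permutes {p..q}"
proof -
  have "\<sigma> permutes {p..q}" "\<rho> permutes {p..q}"
    using permutes_subset[OF sg] permutes_subset[OF rh] pa by auto
  moreover have "Transposition.transpose p a permutes {p..q}" using pa by (simp add: permutes_swap_id)
  ultimately show ?thesis unfolding glue_def by (simp add: permutes_compose)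
qed

text \<open>A crossing cannot mix the two sides. Strictly between p and a the glued map is \<sigma>,
  with values at most a. Beyond a it is \<rho>, except that the value a drops to \<sigma> a, and
  this does not affect comparisons with indices above a.\<close>

lemma glue_nocross: "nocross (glue p a \<sigma> \<rho>) \<longleftrightarrow> nocross \<sigma> \<and> nocross \<rho>"
proof (intro iffI conjI)
  let ?\<pi> = "glue p a \<sigma> \<rho>"
  note V = glue_values
  have s: "\<sigma> x = x" if "x \<notin> {Suc p..a}" for x using sg that by (rule permutes_not_in)
  have r: "\<rho> x = x" if "x \<notin> {a..q}" for x using rh that by (rule permutes_not_in)
  {
    assume nc: "nocross ?\<pi>"
    show "nocross \<sigma>" unfolding nocross_def
    proof (intro notI, elim exE conjE)
      fix l j assume *: "\<sigma> j < l" "l < j" "j < \<sigma> l"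
      then have j: "p < j" "j \<le> a" using s[of j] by (cases "j \<in> {Suc p..a}"; auto)+
      have l: "p < l" "l < a" using * j V(7)[of j] by auto
      have "j < a" using * V(7)[of l] l by auto
      then have "?\<pi> j = \<sigma> j" "?\<pi> l = \<sigma> l" using j l V(4) by auto
      then show False using nc * unfolding nocross_def by metis
    qed
    show "nocross \<rho>" unfolding nocross_def
    proof (intro notI, elim exE conjE)
      fix l j assume *: "\<rho> j < l" "l < j" "j < \<rho> l"
      then have j: "a \<le> j" using r[of j] by (cases "j \<in> {a..q}"; auto)+
      have l: "a < l" using * j V(8)[of j] by auto
      have pl: "?\<pi> l = \<rho> l" using * l V(6)[of l] by auto
      have "?\<pi> j < l"
      proof (cases "\<rho> j = a")
        case True then show ?thesis using V(5)[of j] V(7)[of a] l * pa by auto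
      next
        case False then show ?thesis using V(6)[of j] l * by auto
      qed
      then show False using nc * pl unfolding nocross_def by metis
    qed
  }
  assume nc: "nocross \<sigma> \<and> nocross \<rho>"
  show "nocross ?\<pi>" unfolding nocross_def
  proof (intro notI, elim exE conjE)
    fix l j assume *: "?\<pi> j < l" "l < j" "j < ?\<pi> l"
    consider "j < p" | "j = p" | "p < j" "j < a" | "j = a" | "a < j" "\<rho> j \<noteq> a" | "a < j" "\<rho> j = a"
      by linarith
    then show False
    proof cases
      case 1 then show False using * V(9)[of j] by simp
    next
      case 2
      then show False using * V(9)[of l] by simp
    next
      case 3
      then have "?\<pi> j = \<sigma> j" "p < \<sigma> j" using V(4,7) by auto
      then have "?\<pi> l = \<sigma> l" using V(4)[of l] * 3 by auto
      then show False using nc * \<open>?\<pi> j = \<sigma> j\<close> unfolding nocross_def by metis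
    next
      case 4
      then have "?\<pi> j = p" using V(1) by simp
      then have "?\<pi> l = \<sigma> l" "\<sigma> l \<le> a" using V(4,7) * 4 by auto
      then show False using * 4 by simp
    next
      case 5
      then have e: "?\<pi> j = \<rho> j" using V(6) by simp
      then have l: "a < l" using V(8)[of j] 5 * by simp
      then have "?\<pi> l = \<rho> l" using V(5)[of l] V(6)[of l] V(7)[of a] * 5 pa by (cases "\<rho> l = a") auto
      then show False using nc * e unfolding nocross_def by metis
    next
      case 6
      then have e: "?\<pi> j = \<sigma> a" "p < \<sigma> a" using V(5,7) pa by auto
      have l: "a < l"
      proof (rule ccontr)
        assume "\<not> a < l"
        then consider "l = a" | "p < l" "l < a" using * e by linarith
        then show False using V(1) V(4)[of l] V(7)[of l] * 6 pa by cases auto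
      qed
      then have "?\<pi> l = \<rho> l" using V(5)[of l] V(6)[of l] V(7)[of a] * 6 pa by (cases "\<rho> l = a") auto
      then show False using nc * l 6 unfolding nocross_def by metis
    qed
  qed
qed

text \<open>Contributions change only at p, at a and at the \<rho>-preimage x0 of a. The point a
  always contributes 1, the source of the \<open>Suc\<close>. If \<rho> fixes a, then p takes over
  the contribution of \<sigma> at a. Otherwise p takes over that of \<rho> at a, and x0 adds that of
  \<sigma> at a to its own.\<close>

lemma glue_stat: "stat (glue p a \<sigma> \<rho>) = Suc (stat \<sigma> + stat \<rho>)"
proof -
  let ?\<pi> = "glue p a \<sigma> \<rho>"
  note V = glue_values
  let ?c = "cross_count"
  let ?low = "\<lambda>f i. {j. f j < f i \<and> f i < j \<and> j < (i::nat)} :: nat set"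
  let ?up = "\<lambda>f i. {l. i < l \<and> l \<le> f i \<and> f i < f l} :: nat set"
  have pl: "?\<pi> l = l" if "l < p" for l using V(9) that .
  have ca: "?c ?\<pi> a = 1"
  proof -
    have "\<not> (?\<pi> j < p \<and> p < j \<and> j < a)" for j
      using V(4)[of j] V(7)[of j] by auto
    then have "?low ?\<pi> a = {}" unfolding V(1) by blast
    then show ?thesis unfolding cross_count_def using V(1) pa by simp
  qed
  have cmid: "?c ?\<pi> x = ?c \<sigma> x" if x: "p < x" "x < a" for x
  proof -
    have px: "?\<pi> x = \<sigma> x" and sx: "p < \<sigma> x" "\<sigma> x \<le> a" using V(4,7) x by auto
    have 1: "?low ?\<pi> x = ?low \<sigma> x" if "\<sigma> x < x"
    proof -
      have "(?\<pi> j < ?\<pi> x \<and> ?\<pi> x < j \<and> j < x) = (\<sigma> j < \<sigma> x \<and> \<sigma> x < j \<and> j < x)" for j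
        using V(4)[of j] sx x unfolding px by auto
      then show ?thesis by presburger
    qed
    have 2: "?up ?\<pi> x = ?up \<sigma> x"
    proof -
      have "(\<sigma> x < ?\<pi> l) = (\<sigma> x < \<sigma> l)" if "x < l" "l \<le> \<sigma> x" for l
      proof (cases "l < a")
        case True then show ?thesis using V(4)[of l] that x by simp
      next
        case False
        then have "l = a" "\<sigma> x = a" using that sx by auto
        then show ?thesis using V(1) V(7)[of a] pa by auto
      qed
      then show ?thesis unfolding px by blast
    qed
    show ?thesis unfolding cross_count_def using 1 2 unfolding px by simp
  qed
  have chigh: "?c ?\<pi> x = ?c \<rho> x" if x: "a < x" "\<rho> x \<noteq> a" for x
  proof -
    have px: "?\<pi> x = \<rho> x" and rx: "a < \<rho> x" using V(6,8)[of x] x by auto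
    have hi: "?\<pi> l < \<rho> x \<longleftrightarrow> \<rho> l < \<rho> x" "\<rho> x < ?\<pi> l \<longleftrightarrow> \<rho> x < \<rho> l" if "a < l" for l
      using V(5)[of l] V(6)[of l] V(7)[of a] rx pa that by (cases "\<rho> l = a"; auto)+
    have "(?\<pi> j < \<rho> x \<and> \<rho> x < j \<and> j < x) = (\<rho> j < \<rho> x \<and> \<rho> x < j \<and> j < x)" for j
      using hi(1)[of j] rx by auto
    then have 1: "?low ?\<pi> x = ?low \<rho> x" unfolding px by presburger
    have "(x < l \<and> l \<le> \<rho> x \<and> \<rho> x < ?\<pi> l) = (x < l \<and> l \<le> \<rho> x \<and> \<rho> x < \<rho> l)" for l
      using hi(2)[of l] x by auto
    then have 2: "?up ?\<pi> x = ?up \<rho> x" unfolding px by presburger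
    show ?thesis unfolding cross_count_def using 1 2 unfolding px by simp
  qed
  define v where "v = \<sigma> a"
  have v: "p < v" "v \<le> a" using V(7)[of a] pa unfolding v_def by auto
  have csa: "?c \<sigma> a = (if v < a then Suc (card (?low \<sigma> a)) else 0)"
    using v cross_count_fixed[of \<sigma> a] unfolding cross_count_def v_def by auto
  have stat\<sigma>: "stat \<sigma> = (\<Sum>i\<in>{Suc p..<a}. ?c \<sigma> i) + ?c \<sigma> a"
    using stat_eq_sum[OF sg, of "{Suc p..a}"] pa by (simp add: sum.last_plus add.commute)
  have stat\<rho>: "stat \<rho> = ?c \<rho> a + (\<Sum>i\<in>{a<..q}. ?c \<rho> i)"
    using stat_eq_sum[OF rh, of "{a..q}"] pa by (simp add: sum.head)
  have "{p..q} = {p} \<union> ({Suc p..<a} \<union> ({a} \<union> {a<..q}))" using pa by auto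
  then have "stat ?\<pi> = (\<Sum>i\<in>{p} \<union> ({Suc p..<a} \<union> ({a} \<union> {a<..q})). ?c ?\<pi> i)"
    using stat_eq_sum[OF glue_permutes, of "{p..q}"] by simp
  also have "\<dots> = ?c ?\<pi> p + ((\<Sum>i\<in>{Suc p..<a}. ?c ?\<pi> i) + (?c ?\<pi> a + (\<Sum>i\<in>{a<..q}. ?c ?\<pi> i)))"
    using pa by (subst sum.union_disjoint; auto)+
  also have "(\<Sum>i\<in>{Suc p..<a}. ?c ?\<pi> i) = (\<Sum>i\<in>{Suc p..<a}. ?c \<sigma> i)"
    using cmid by (intro sum.cong) auto
  finally have tot: "stat ?\<pi> = ?c ?\<pi> p + (\<Sum>i\<in>{Suc p..<a}. ?c \<sigma> i) + 1 + (\<Sum>i\<in>{a<..q}. ?c ?\<pi> i)"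
    using ca by simp
  show ?thesis
  proof (cases "\<rho> a = a")
    case True
    have "\<rho> x \<noteq> a" if "a < x" for x
      using True permutes_inj[OF rh] that by (metis injD less_irrefl)
    then have S: "(\<Sum>i\<in>{a<..q}. ?c ?\<pi> i) = (\<Sum>i\<in>{a<..q}. ?c \<rho> i)"
      using chigh by (intro sum.cong) auto
    have pp: "?\<pi> p = v" using V(2)[OF True] v_def by simp
    have "?c ?\<pi> p = card (?up ?\<pi> p)" unfolding cross_count_def pp using v by simp
    also have "?up ?\<pi> p = {l. l \<le> v \<and> v < \<sigma> l} - {a}"
    proof -
      have "(p < l \<and> v < ?\<pi> l) = (v < \<sigma> l \<and> l \<noteq> a)" if "l \<le> v" for l
      proof -
        have "\<sigma> l = l" if "l \<le> p" using that by (intro permutes_not_in[OF sg]) auto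
        then show ?thesis using V(4)[of l] V(1) that v by (cases "l = a"; cases "l \<le> p") auto
      qed
      then show ?thesis unfolding pp by auto
    qed
    also have "{l. l \<le> v \<and> v < \<sigma> l} - {a} = {l. l \<le> v \<and> v < \<sigma> l}" using v_def by auto
    \<comment> \<open>The contribution of p counts upward arrows of \<sigma> over the level v, that
      of a under \<sigma> counts downward ones; the balance of crossings identifies them.\<close>
    also have "card \<dots> = card {j. \<sigma> j \<le> v \<and> v < j}"
      by (rule permutes_crossing_balance[OF sg]) simp
    also have "\<dots> = ?c \<sigma> a"
    proof (cases "v < a")
      case True
      have "\<sigma> j = j" if "a < j" for j using that by (intro permutes_not_in[OF sg]) auto
      moreover have "\<sigma> j \<noteq> v" if "j \<noteq> a" for j
        using permutes_inj[OF sg] that unfolding v_def by (metis injD)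
      ultimately have "(\<sigma> j \<le> v \<and> v < j) = (j = a \<or> \<sigma> j < v \<and> v < j \<and> j < a)" for j
        using True v v_def by (cases j a rule: linorder_cases) (auto simp: order.order_iff_strict)
      then have "{j. \<sigma> j \<le> v \<and> v < j} = insert a (?low \<sigma> a)"
        unfolding v_def[symmetric] by auto
      moreover have "finite (?low \<sigma> a)" by (rule finite_subset[of _ "{..a}"]) auto
      ultimately show ?thesis unfolding csa using True by simp
    next
      case False
      have "\<sigma> j = j" if "a < j" for j using that by (intro permutes_not_in[OF sg]) auto
      then have E: "{j. \<sigma> j \<le> v \<and> v < j} = {}" using False v by auto
      show ?thesis unfolding csa E using False by simp
    qed
    finally show ?thesis using tot S stat\<sigma> stat\<rho> cross_count_fixed[of \<rho> a] True by simp
  next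
    case False
    have ra: "a < \<rho> a" using V(8)[of a] False by simp
    have pp: "?\<pi> p = \<rho> a" using V(3)[OF False] .
    have "?up ?\<pi> p = ?up \<rho> a"
    proof -
      have "(p < l \<and> \<rho> a < ?\<pi> l) = (a < l \<and> \<rho> a < \<rho> l)" if "l \<le> \<rho> a" for l
      proof -
        consider "l \<le> p" | "p < l" "l < a" | "l = a" | "a < l" "\<rho> l = a" | "a < l" "\<rho> l \<noteq> a" by linarith
        then show ?thesis
        proof cases
          case 2 then show ?thesis using V(4)[of l] V(7)[of l] ra by auto
        next
          case 4 then show ?thesis using V(5)[of l] V(7)[of a] ra pa by auto
        next
          case 5 then show ?thesis using V(6)[of l] ra pa by auto
        qed (use V(1) ra pa in auto)
      qed
      then show ?thesis unfolding pp by blast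
    qed
    then have cp: "?c ?\<pi> p = ?c \<rho> a" unfolding cross_count_def pp using ra pa by simp
    obtain x0 where x0: "\<rho> x0 = a" using permutes_surj[OF rh] by (metis surjD)
    have x0a: "a < x0"
    proof (rule ccontr)
      assume "\<not> a < x0"
      then have "x0 < a" using x0 False by (metis linorder_neqE_nat)
      then have "\<rho> x0 = x0" by (intro permutes_not_in[OF rh]) auto
      then show False using x0 \<open>x0 < a\<close> by simp
    qed
    have x0q: "x0 \<le> q" 
    proof (rule ccontr)
      assume "\<not> x0 \<le> q"
      then have "\<rho> x0 = x0" by (intro permutes_not_in[OF rh]) auto
      then show False using x0 x0a by simp
    qed
    have uniq: "\<rho> x \<noteq> a" if "x \<noteq> x0" for x using x0 permutes_inj[OF rh] that by (metis injD)
    have px0: "?\<pi> x0 = v" using V(5)[OF x0a x0] v_def by simp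
    have "?low \<rho> x0 = {}"
    proof -
      have "\<not> \<rho> j < a" if "a < j" for j using V(8)[of j] that by auto
      then show ?thesis using x0 by auto
    qed
    then have cr: "?c \<rho> x0 = 1" unfolding cross_count_def using x0 x0a by simp
    have "?low ?\<pi> x0 = (if v < a then insert a (?low \<sigma> a) else {})"
    proof -
      have sv: "\<sigma> a = v" using v_def by simp
      have "(?\<pi> j < v \<and> v < j \<and> j < x0) = (v < a \<and> (j = a \<or> \<sigma> j < v \<and> v < j \<and> j < a))" for j
      proof -
        consider "j < a" | "j = a" | "a < j" "j \<noteq> x0" | "j = x0" by linarith
        then show ?thesis
        proof cases
          case 1 then show ?thesis using V(4)[of j] v x0a by auto
        next
          case 2 then show ?thesis using V(1) v x0a by auto
        next
          case 3
          then have "?\<pi> j = \<rho> j" "a \<le> \<rho> j" using V(6,8)[of j] uniq by auto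
          then show ?thesis using 3 v by auto
        next
          case 4 then show ?thesis using x0a by auto
        qed
      qed
      then show ?thesis unfolding px0 sv by auto
    qed
    moreover have "finite (?low \<sigma> a)" by (rule finite_subset[of _ "{..a}"]) auto
    ultimately have cx0: "?c ?\<pi> x0 = 1 + ?c \<sigma> a"
      unfolding csa cross_count_def[of ?\<pi>] using px0 v x0a by auto
    have "(\<Sum>i\<in>{a<..q}. ?c ?\<pi> i) = ?c ?\<pi> x0 + (\<Sum>i\<in>{a<..q}-{x0}. ?c ?\<pi> i)"
      using x0a x0q by (intro sum.remove) auto
    also have "(\<Sum>i\<in>{a<..q}-{x0}. ?c ?\<pi> i) = (\<Sum>i\<in>{a<..q}-{x0}. ?c \<rho> i)"
      using chigh uniq by (intro sum.cong) auto
    finally have "(\<Sum>i\<in>{a<..q}. ?c ?\<pi> i) = ?c \<sigma> a + (?c \<rho> x0 + (\<Sum>i\<in>{a<..q}-{x0}. ?c \<rho> i))"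
      using cx0 cr by simp
    also have "?c \<rho> x0 + (\<Sum>i\<in>{a<..q}-{x0}. ?c \<rho> i) = (\<Sum>i\<in>{a<..q}. ?c \<rho> i)"
      using x0a x0q by (intro sum.remove[symmetric]) auto
    finally show ?thesis using tot cp stat\<sigma> stat\<rho> by simp
  qed
qed

end

text \<open>Cancelling the transposition leaves \<sigma> after \<rho>. Left of a the map \<rho> is
  the identity, right of a the map \<sigma> is; so \<sigma> is known off a, and a permutation known
  off one point is known there too.\<close>

lemma glue_inj:
  assumes pa: "p < a" "a \<le> q"
    and "\<sigma> permutes {Suc p..a}" "\<rho> permutes {a..q}" "\<sigma>' permutes {Suc p..a}" "\<rho>' permutes {a..q}"
    and eq: "glue p a \<sigma> \<rho> = glue p a \<sigma>' \<rho>'"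
  shows "\<sigma> = \<sigma>' \<and> \<rho> = \<rho>'"
proof -
  have s: "\<sigma> \<circ> \<rho> = \<sigma>' \<circ> \<rho>'"
  proof -
    have "glue p a \<sigma> \<rho> \<circ> Transposition.transpose p a = glue p a \<sigma>' \<rho>' \<circ> Transposition.transpose p a" using eq by simp
    then show ?thesis unfolding glue_def by (simp add: comp_assoc)
  qed
  have out: "\<sigma> x = \<sigma>' x" if "x \<noteq> a" for x
  proof (cases "x < a")
    case True
    then have "\<rho> x = x" "\<rho>' x = x" using permutes_not_in[OF assms(4), of x] permutes_not_in[OF assms(6), of x] by auto
    then show ?thesis using fun_cong[OF s, of x] by simp
  next
    case False
    then have "\<sigma> x = x" "\<sigma>' x = x" using permutes_not_in[OF assms(3), of x] permutes_not_in[OF assms(5), of x] that by auto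
    then show ?thesis by simp
  qed
  have "\<sigma> a = \<sigma>' a"
  proof -
    obtain y where y: "\<sigma> y = \<sigma>' a" using permutes_surj[OF assms(3)] by (metis surjD)
    show ?thesis
    proof (cases "y = a")
      case False
      then have "\<sigma>' y = \<sigma>' a" using out y by simp
      then show ?thesis using permutes_inj[OF assms(5)] False by (metis injD)
    qed (use y in simp)
  qed
  then have "\<sigma> = \<sigma>'" using out by (metis ext)
  moreover have "\<rho> = \<rho>'"
  proof
    fix x
    have "\<sigma> (\<rho> x) = \<sigma> (\<rho>' x)" using fun_cong[OF s, of x] \<open>\<sigma> = \<sigma>'\<close> by simp
    then show "\<rho> x = \<rho>' x" using permutes_inj[OF assms(3)] by (metis injD)
  qed
  ultimately show ?thesis by simp
qed

text \<open>The pair (x, a) with p < x < a must not cross, and \<pi> a = p, so \<pi> x is at most a.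
  Hence \<pi> maps {p+1..a-1} into {p+1..a} and misses exactly one value v. Sending a to v completes
  this restriction to \<sigma>, and \<rho> is the remaining quotient.\<close>

lemma glue_surj:
  assumes "p < a" "a \<le> q" "\<pi> permutes {p..q}" "nocross \<pi>" "\<pi> a = p"
  shows "\<exists>\<sigma> \<rho>. \<sigma> permutes {Suc p..a} \<and> \<rho> permutes {a..q} \<and> \<pi> = glue p a \<sigma> \<rho>"
proof -
  define \<kappa> where "\<kappa> = \<pi> \<circ> Transposition.transpose p a"
  have kp: "\<kappa> permutes {p..q}"
    unfolding \<kappa>_def using assms by (intro permutes_compose permutes_swap_id) auto
  have "\<kappa> p = p" unfolding \<kappa>_def using assms by simp
  have kmid: "\<kappa> x = \<pi> x" "p < \<pi> x" "\<pi> x \<le> a" if "p < x" "x < a" for x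
  proof -
    show "\<kappa> x = \<pi> x" unfolding \<kappa>_def using that by simp
    have "\<pi> x \<in> {p..q}" using permutes_in_image[OF assms(3), of x] that assms by auto
    moreover have "\<pi> x \<noteq> p" using assms(5) permutes_inj[OF assms(3)] that by (metis injD less_irrefl)
    ultimately show "p < \<pi> x" by auto
    show "\<pi> x \<le> a"
    proof (rule ccontr)
      assume "\<not> \<pi> x \<le> a"
      then have "\<pi> a < x \<and> x < a \<and> a < \<pi> x" using that assms(5) by simp
      then show False using assms(4) unfolding nocross_def by blast
    qed
  qed
  have injk: "inj \<kappa>" using permutes_inj[OF kp] .
  have sub: "\<kappa> ` {Suc p..<a} \<subseteq> {Suc p..a}" using kmid by (auto simp: Suc_le_eq)
  have "card (\<kappa> ` {Suc p..<a}) = card {Suc p..<a}" using injk by (simp add: card_image inj_on_subset)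
  then have "card ({Suc p..a} - \<kappa> ` {Suc p..<a}) = 1"
    using sub assms(1) by (subst card_Diff_subset) auto
  then obtain v where v: "{Suc p..a} - \<kappa> ` {Suc p..<a} = {v}" by (auto simp: card_1_singleton_iff)
  define \<sigma> where "\<sigma> = (\<lambda>x. if p < x \<and> x < a then \<kappa> x else if x = a then v else x)"
  have "\<sigma> permutes {Suc p..a}"
  proof (rule bij_imp_permutes)
    have im: "\<sigma> ` {Suc p..<a} = \<kappa> ` {Suc p..<a}" unfolding \<sigma>_def by (intro image_cong) auto
    have "{Suc p..a} = insert a {Suc p..<a}" using assms by auto
    then have "\<sigma> ` {Suc p..a} = insert (\<sigma> a) (\<kappa> ` {Suc p..<a})" using im by simp
    also have "\<dots> = {Suc p..a}" using v sub unfolding \<sigma>_def by auto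
    finally have "\<sigma> ` {Suc p..a} = {Suc p..a}" .
    then show "bij_betw \<sigma> {Suc p..a} {Suc p..a}"
      by (simp add: bij_betw_def finite_surj_inj)
    show "\<sigma> x = x" if "x \<notin> {Suc p..a}" for x using that assms unfolding \<sigma>_def by auto
  qed
  define \<rho> where "\<rho> = inv_into UNIV \<sigma> \<circ> \<kappa>"
  have bs: "bij \<sigma>" using \<open>\<sigma> permutes _\<close> permutes_bij by blast
  have "\<sigma> permutes {p..q}" using permutes_subset[OF \<open>\<sigma> permutes _\<close>] assms by auto
  then have rp: "\<rho> permutes {p..q}"
    unfolding \<rho>_def by (intro permutes_compose[OF kp] permutes_inv)
  have "\<rho> permutes {a..q}"
  proof (rule permutes_superset[OF rp])
    fix x assume x: "x \<in> {p..q} - {a..q}"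
    show "\<rho> x = x"
    proof (cases "x = p")
      case True
      have "\<sigma> p = p" unfolding \<sigma>_def using assms by auto
      then have "inv_into UNIV \<sigma> p = p" using bs by (metis bij_inv_eq_iff)
      then show ?thesis unfolding \<rho>_def using True \<open>\<kappa> p = p\<close> by simp
    next
      case False
      then have "\<sigma> x = \<kappa> x" using x unfolding \<sigma>_def by auto
      then show ?thesis unfolding \<rho>_def using bs by (metis bij_inv_eq_iff comp_apply)
    qed
  qed
  moreover have "\<pi> = glue p a \<sigma> \<rho>"
  proof -
    have "\<sigma> \<circ> \<rho> = \<kappa>" unfolding \<rho>_def using bs by (simp add: fun_eq_iff bij_is_surj surj_f_inv_f)
    then show ?thesis unfolding glue_def \<kappa>_def by (simp add: comp_assoc)
  qed
  ultimately show ?thesis using \<open>\<sigma> permutes {Suc p..a}\<close> by blast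
qed


section \<open>Decomposition of Schroeder paths\<close>

definition excess :: "(nat \<times> nat) list \<Rightarrow> int" where
  "excess p = (\<Sum>s\<leftarrow>p. int (fst s) - int (snd s))"

definition dyck_like :: "(nat \<times> nat) list \<Rightarrow> bool" where
  "dyck_like p \<longleftrightarrow> set p \<subseteq> {(1, 0), (0, 1), (1, 1)} \<and> excess p = 0 \<and> (\<forall>m. 0 \<le> excess (take m p))"

definition lift_concat :: "(nat \<times> nat) list \<times> (nat \<times> nat) list \<Rightarrow> (nat \<times> nat) list" where
  "lift_concat = (\<lambda>(p, p'). (1, 0) # p @ (0, 1) # p')"

lemma excess_simps [simp]:
  "excess [] = 0" "excess (s # p) = int (fst s) - int (snd s) + excess p"
  "excess (p @ p') = excess p + excess p'"
  unfolding excess_def by auto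

lemma excess_alt: "excess p = int (\<Sum>s\<leftarrow>p. fst s) - int (\<Sum>s\<leftarrow>p. snd s)"
  by (induction p) auto

lemma schroeder_paths_alt: "schroeder_paths n = {p. dyck_like p \<and> (\<Sum>s\<leftarrow>p. fst s) = n}"
proof -
  have "(\<forall>m\<le>length p. (\<Sum>s\<leftarrow>take m p. snd s) \<le> (\<Sum>s\<leftarrow>take m p. fst s)) \<longleftrightarrow> (\<forall>m. 0 \<le> excess (take m p))"
    for p :: "(nat \<times> nat) list"
    by (auto simp: excess_alt) (metis nle_le take_all_iff)
  then show ?thesis unfolding schroeder_paths_def dyck_like_def by (auto simp: excess_alt)
qed

lemma dyck_like_Nil: "dyck_like []"
  unfolding dyck_like_def by simp

lemma dyck_like_diag: "dyck_like ((1, 1) # p) \<longleftrightarrow> dyck_like p"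
proof -
  have "(\<forall>m. 0 \<le> excess (take m ((1, 1) # p))) \<longleftrightarrow> (\<forall>m. 0 \<le> excess (take m p))"
  proof (intro iffI allI)
    fix m assume *: "\<forall>m. 0 \<le> excess (take m ((1, 1) # p))"
    show "0 \<le> excess (take m p)" using *[rule_format, of "Suc m"] by simp
  next
    fix m assume "\<forall>m. 0 \<le> excess (take m p)"
    then show "0 \<le> excess (take m ((1, 1) # p))" by (cases m) auto
  qed
  then show ?thesis unfolding dyck_like_def by auto
qed

lemma dyck_like_lift_concat:
  assumes "dyck_like p" "dyck_like p'"
  shows "dyck_like (lift_concat (p, p'))"
proof -
  have "0 \<le> excess (take m ((1, 0) # p @ (0, 1) # p'))" for m
  proof (cases m)
    case (Suc k)
    have 1: "0 \<le> excess (take k p)" "0 \<le> excess (take (k - Suc (length p)) p')" "excess p = 0"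
      using assms unfolding dyck_like_def by auto
    show ?thesis
    proof (cases "k \<le> length p")
      case True then show ?thesis using 1 Suc by simp
    next
      case False
      then obtain j where "k - length p = Suc j" by (metis Suc_diff_le diff_is_0_eq not0_implies_Suc)
      moreover from this have "k - Suc (length p) = j" by simp
      ultimately show ?thesis using 1 Suc False by auto
    qed
  qed simp
  then show ?thesis using assms unfolding dyck_like_def lift_concat_def by auto
qed

text \<open>After an initial (1, 0), the first return is the first prefix of the rest with excess
  -1. A step lowers the excess by at most 1, and only (0, 1) lowers it, so this prefix ends with (0,
  1) and its other steps form a path of the same kind.\<close>

lemma dyck_like_cases:
  assumes "dyck_like p"
  obtains "p = []" | p' where "p = (1, 1) # p'" "dyck_like p'"
    | p1 p2 where "p = lift_concat (p1, p2)" "dyck_like p1" "dyck_like p2"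
proof (cases p)
  case Nil then show thesis using that by simp
next
  case (Cons s q)
  have "0 \<le> excess (take (Suc 0) p)" using assms unfolding dyck_like_def by blast
  then have "s = (1, 1) \<or> s = (1, 0)" using assms Cons unfolding dyck_like_def by auto
  then show thesis
  proof
    assume "s = (1, 1)" then show thesis using that(2) assms Cons dyck_like_diag by simp
  next
    assume s: "s = (1, 0)"
    have q: "excess q = -1" "set q \<subseteq> {(1, 0), (0, 1), (1, 1)}"
      using assms Cons s unfolding dyck_like_def by auto
    have pre: "-1 \<le> excess (take m q)" for m
    proof -
      have "0 \<le> excess (take (Suc m) p)" using assms unfolding dyck_like_def by blast
      then show ?thesis using Cons s by simp
    qed
    define m where "m = (LEAST m. excess (take m q) = -1)"
    have ex: "excess (take (length q) q) = -1" using q by simp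
    have m: "excess (take m q) = -1" unfolding m_def by (rule LeastI[of _ "length q"]) (rule ex)
    have mle: "m \<le> length q" unfolding m_def by (rule Least_le) (rule ex)
    have less: "0 \<le> excess (take k q)" if "k < m" for k
      using not_less_Least[of k "\<lambda>m. excess (take m q) = -1"] that pre[of k] unfolding m_def by auto
    obtain k where k: "m = Suc k" using m by (cases m) auto
    have kl: "k < length q" using mle k by simp
    have tk: "take m q = take k q @ [q ! k]" using k kl by (simp add: take_Suc_conv_app_nth)
    have qk: "q ! k \<in> {(1, 0), (0, 1), (1, 1)}" using q(2) kl nth_mem by blast
    have "q ! k = (0, 1)" "excess (take k q) = 0"
      using m tk less[of k] k qk by auto
    then have qq: "q = take k q @ (0, 1) # drop m q" using k kl by (metis id_take_nth_drop)
    have d1: "dyck_like (take k q)" unfolding dyck_like_def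
      using \<open>excess (take k q) = 0\<close> less k q(2) by (auto simp: min_def dest: in_set_takeD)
    have d2: "dyck_like (drop m q)" unfolding dyck_like_def
    proof (intro conjI allI)
      show "set (drop m q) \<subseteq> {(1, 0), (0, 1), (1, 1)}" using q(2) set_drop_subset by fastforce
      have "excess (take m q @ drop m q) = -1" using q by simp
      then show "excess (drop m q) = 0" using m unfolding excess_simps by simp
      fix j
      have "take (m + j) q = take m q @ take j (drop m q)" by (rule take_add)
      then show "0 \<le> excess (take j (drop m q))" using pre[of "m + j"] m by simp
    qed
    show thesis using that(3)[of "take k q" "drop m q"] d1 d2 qq Cons s unfolding lift_concat_def by simp
  qed
qed

text \<open>If one of two first components were longer, it would contain the other followed by (0,
  1), a prefix with excess -1. Equal lengths then determine both components.\<close>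

lemma inj_on_lift_concat: "inj_on lift_concat ({p. dyck_like p} \<times> UNIV)"
proof -
  have no: False if eq: "p @ (0, 1) # r = p' @ (0, 1) # r'" and d: "dyck_like p" "dyck_like p'"
    and l: "length p < length p'" for p p' r r' :: "(nat \<times> nat) list"
  proof -
    have "take (Suc (length p)) (p' @ (0, 1) # r') = p @ [(0, 1)]" using eq[symmetric] by simp
    then have "take (Suc (length p)) p' = p @ [(0, 1)]" using l by simp
    then have "excess (take (Suc (length p)) p') = -1" using d(1) unfolding dyck_like_def by simp
    then show False using d(2) unfolding dyck_like_def by (metis neg_0_le_iff_le not_one_le_zero)
  qed
  show ?thesis
  proof (rule inj_onI, clarsimp simp: lift_concat_def)
    fix p p' r r' :: "(nat \<times> nat) list"
    assume d: "dyck_like p" "dyck_like p'" and eq: "p @ (0, Suc 0) # r = p' @ (0, Suc 0) # r'"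
    have "length p = length p'"
      using no[of p r p' r'] no[of p' r' p r] eq d by (metis One_nat_def linorder_neqE_nat)
    then show "p = p' \<and> r = r'" using eq by simp
  qed
qed

lemma schroeder_paths_0: "schroeder_paths 0 = {[]}"
  unfolding schroeder_paths_alt
  by (auto simp: dyck_like_Nil lift_concat_def elim: dyck_like_cases)

lemma schroeder_paths_Suc:
  "schroeder_paths (Suc n) = Cons (1, 1) ` schroeder_paths n \<union>
     (\<Union>k\<le>n. lift_concat ` (schroeder_paths k \<times> schroeder_paths (n - k)))" (is "_ = ?A \<union> ?B")
proof
  show "schroeder_paths (Suc n) \<subseteq> ?A \<union> ?B"
  proof
    fix p assume "p \<in> schroeder_paths (Suc n)"
    then have p: "dyck_like p" "(\<Sum>s\<leftarrow>p. fst s) = Suc n" unfolding schroeder_paths_alt by auto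
    from p(1) show "p \<in> ?A \<union> ?B"
    proof (cases rule: dyck_like_cases)
      case 1 then show ?thesis using p by simp
    next
      case (2 p') then show ?thesis using p unfolding schroeder_paths_alt by auto
    next
      case (3 p1 p2)
      then have "(\<Sum>s\<leftarrow>p1. fst s) + (\<Sum>s\<leftarrow>p2. fst s) = n" using p(2) unfolding lift_concat_def by simp
      then have "(\<Sum>s\<leftarrow>p1. fst s) \<le> n" "(\<Sum>s\<leftarrow>p2. fst s) = n - (\<Sum>s\<leftarrow>p1. fst s)" by auto
      then show ?thesis using 3 unfolding schroeder_paths_alt by blast
    qed
  qed
  show "?A \<union> ?B \<subseteq> schroeder_paths (Suc n)"
    unfolding schroeder_paths_alt
    using dyck_like_lift_concat dyck_like_diag by (fastforce simp: lift_concat_def)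
qed

lemma finite_schroeder_paths: "finite (schroeder_paths n)"
proof (induction n rule: less_induct)
  case (less n)
  then show ?case by (cases n) (auto simp: schroeder_paths_0 schroeder_paths_Suc)
qed

lemma schroeder_poly_0: "schroeder_poly 0 = 1"
  unfolding schroeder_poly_def schroeder_paths_0 by simp

lemma schroeder_poly_Suc:
  "schroeder_poly (Suc n) = monom 1 1 * schroeder_poly n + (\<Sum>k\<le>n. schroeder_poly k * schroeder_poly (n - k))"
proof -
  let ?f = "\<lambda>p. monom 1 (count_list p (1, 1)) :: int poly"
  let ?S = schroeder_paths
  have sub: "?S k \<times> ?S j \<subseteq> {p. dyck_like p} \<times> UNIV" for k j unfolding schroeder_paths_alt by auto
  have inj: "inj_on lift_concat (?S k \<times> ?S j)" for k j
    using inj_on_subset[OF inj_on_lift_concat sub] .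
  have disj: "lift_concat ` (?S k \<times> ?S (n - k)) \<inter> lift_concat ` (?S j \<times> ?S (n - j)) = {}" if "k \<noteq> j" for k j
  proof (rule ccontr)
    assume "\<not> ?thesis"
    then obtain x y where xy: "x \<in> ?S k \<times> ?S (n - k)" "y \<in> ?S j \<times> ?S (n - j)" "lift_concat x = lift_concat y"
      by auto
    then have "x = y" using inj_onD[OF inj_on_lift_concat xy(3)] sub by blast
    then show False using xy that unfolding schroeder_paths_alt by auto
  qed
  have fin: "finite (lift_concat ` (?S k \<times> ?S j))" for k j using finite_schroeder_paths by blast
  have "schroeder_poly (Suc n) = sum ?f (Cons (1, 1) ` ?S n) + sum ?f (\<Union>k\<le>n. lift_concat ` (?S k \<times> ?S (n - k)))"
    unfolding schroeder_poly_def schroeder_paths_Suc using finite_schroeder_paths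
    by (intro sum.union_disjoint) (auto simp: lift_concat_def)
  also have "sum ?f (Cons (1, 1) ` ?S n) = monom 1 1 * schroeder_poly n"
    unfolding schroeder_poly_def by (subst sum.reindex) (auto simp: sum_distrib_left mult_monom)
  also have "sum ?f (\<Union>k\<le>n. lift_concat ` (?S k \<times> ?S (n - k))) =
      (\<Sum>k\<le>n. sum ?f (lift_concat ` (?S k \<times> ?S (n - k))))"
    using disj fin by (intro sum.UNION_disjoint) auto
  also have "\<dots> = (\<Sum>k\<le>n. schroeder_poly k * schroeder_poly (n - k))"
  proof (rule sum.cong[OF refl])
    fix k
    have "sum ?f (lift_concat ` (?S k \<times> ?S (n - k))) = (\<Sum>x\<in>?S k \<times> ?S (n - k). ?f (lift_concat x))"
      using sum.reindex[OF inj] by simp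
    also have "\<dots> = (\<Sum>(p, p')\<in>?S k \<times> ?S (n - k). ?f p * ?f p')"
      by (intro sum.cong) (auto simp: lift_concat_def mult_monom)
    also have "\<dots> = schroeder_poly k * schroeder_poly (n - k)"
      unfolding schroeder_poly_def sum_product by (rule sum.cartesian_product[symmetric])
    finally show "sum ?f (lift_concat ` (?S k \<times> ?S (n - k))) = schroeder_poly k * schroeder_poly (n - k)" .
  qed
  finally show ?thesis .
qed


section \<open>Enumeration of non-crossing permutations\<close>

lemma finite_nc_perms: "finite (nc_perms p q)"
  unfolding nc_perms_def by (rule finite_subset[of _ "{\<pi>. \<pi> permutes {p..q}}"]) (auto simp: finite_permutations)

lemma nc_perms_singleton: "nc_perms p p = {id}"
proof -
  have "\<pi> permutes {p..p} \<longleftrightarrow> \<pi> = id" for \<pi> :: "nat \<Rightarrow> nat" by simp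
  moreover have "nocross id" unfolding nocross_def by auto
  ultimately show ?thesis unfolding nc_perms_def by auto
qed

text \<open>The permutations are sorted by the preimage a of the first point p; a = p leaves a
  permutation of the shorter interval.\<close>

lemma nc_perms_decomp:
  assumes "p < q"
  shows "nc_perms p q = nc_perms (Suc p) q \<union>
     (\<Union>a\<in>{p<..q}. case_prod (glue p a) ` (nc_perms (Suc p) a \<times> nc_perms a q))" (is "_ = ?A \<union> ?B")
proof
  show "nc_perms p q \<subseteq> ?A \<union> ?B"
  proof
    fix \<pi> assume "\<pi> \<in> nc_perms p q"
    then have \<pi>: "\<pi> permutes {p..q}" "nocross \<pi>" unfolding nc_perms_def by auto
    obtain a where a: "\<pi> a = p" using permutes_surj[OF \<pi>(1)] by (metis surjD)
    have aq: "a \<in> {p..q}" using permutes_in_image[OF \<pi>(1), of a] a assms by auto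
    show "\<pi> \<in> ?A \<union> ?B"
    proof (cases "a = p")
      case True
      have "\<pi> permutes {Suc p..q}"
      proof (rule permutes_superset[OF \<pi>(1)])
        fix x assume "x \<in> {p..q} - {Suc p..q}"
        then have "x = p" by auto
        then show "\<pi> x = x" using a True by simp
      qed
      then show ?thesis using \<pi> unfolding nc_perms_def by auto
    next
      case False
      then have pa: "p < a" "a \<le> q" using aq by auto
      obtain \<sigma> \<rho> where sr: "\<sigma> permutes {Suc p..a}" "\<rho> permutes {a..q}" "\<pi> = glue p a \<sigma> \<rho>"
        using glue_surj[OF pa \<pi> a] by blast
      then have "nocross \<sigma>" "nocross \<rho>" using glue_nocross[OF pa sr(1,2)] \<pi>(2) by auto
      then have "(\<sigma>, \<rho>) \<in> nc_perms (Suc p) a \<times> nc_perms a q" using sr unfolding nc_perms_def by auto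
      then show ?thesis using sr(3) pa by (intro UnI2 UN_I[of a]) force+
    qed
  qed
  have "?A \<subseteq> nc_perms p q"
    unfolding nc_perms_def using permutes_subset[of _ "{Suc p..q}" "{p..q}"] by auto
  moreover have "?B \<subseteq> nc_perms p q"
    unfolding nc_perms_def using glue_permutes glue_nocross by auto
  ultimately show "?A \<union> ?B \<subseteq> nc_perms p q" by blast
qed

text \<open>The bound on \<open>stat\<close> is carried through the induction because the exponent
  is a truncated difference. The \<open>Suc\<close> in \<open>glue_stat\<close> is absorbed by the
  lengths, since q - p - 1 = (a - (p + 1)) + (q - a). A permutation that fixes p loses one unit of
  length but none of \<open>stat\<close>, hence the factor q.\<close>

lemma nc_perms_sum:
  assumes "p \<le> q"
  shows "(\<forall>\<pi>\<in>nc_perms p q. stat \<pi> \<le> q - p) \<and>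
    (\<Sum>\<pi>\<in>nc_perms p q. monom 1 (q - p - stat \<pi>)) = schroeder_poly (q - p)"
  using assms
proof (induction "q - p" arbitrary: p q rule: less_induct)
  case less
  show ?case
  proof (cases "p = q")
    case True
    have "stat id = 0" unfolding stat_def by simp
    then show ?thesis using True by (simp add: nc_perms_singleton schroeder_poly_0)
  next
    case False
    then have pq: "p < q" using less.prems by simp
    let ?w = "\<lambda>p q \<pi>. monom 1 (q - p - stat \<pi>) :: int poly"
    let ?X = "\<lambda>a. nc_perms (Suc p) a \<times> nc_perms a q"
    let ?G = "\<lambda>a. case_prod (glue p a) ` ?X a"
    define n where "n = q - Suc p"
    have n: "q - p = Suc n" using pq unfolding n_def by simp
    have IH1: "stat \<pi> \<le> n" if "\<pi> \<in> nc_perms (Suc p) q" for \<pi>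
      using less.hyps[of q "Suc p"] pq that unfolding n_def by auto
    have IHs: "(\<Sum>\<pi>\<in>nc_perms (Suc p) q. ?w (Suc p) q \<pi>) = schroeder_poly n"
      using less.hyps[of q "Suc p"] pq unfolding n_def by auto
    have IHa: "\<forall>\<pi>\<in>nc_perms (Suc p) a. stat \<pi> \<le> a - Suc p" "\<forall>\<pi>\<in>nc_perms a q. stat \<pi> \<le> q - a"
      "(\<Sum>\<pi>\<in>nc_perms (Suc p) a. ?w (Suc p) a \<pi>) = schroeder_poly (a - Suc p)"
      "(\<Sum>\<pi>\<in>nc_perms a q. ?w a q \<pi>) = schroeder_poly (q - a)" if "a \<in> {p<..q}" for a
      using less.hyps[of a "Suc p"] less.hyps[of q a] pq that by auto
    have gst: "stat (glue p a \<sigma> \<rho>) = Suc (stat \<sigma> + stat \<rho>)" "glue p a \<sigma> \<rho> a = p"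
      if "a \<in> {p<..q}" "(\<sigma>, \<rho>) \<in> ?X a" for a \<sigma> \<rho>
      using that glue_stat[of p a q \<sigma> \<rho>] glue_values(1)[of p a q \<sigma> \<rho>] unfolding nc_perms_def by auto
    have le: "stat \<sigma> \<le> a - Suc p" "stat \<rho> \<le> q - a" if "a \<in> {p<..q}" "(\<sigma>, \<rho>) \<in> ?X a" for a \<sigma> \<rho>
      using IHa(1,2)[OF that(1)] that(2) by auto
    have dec: "nc_perms p q = nc_perms (Suc p) q \<union> (\<Union>a\<in>{p<..q}. ?G a)"
      by (rule nc_perms_decomp[OF pq])
    have bound: "\<forall>\<pi>\<in>nc_perms p q. stat \<pi> \<le> q - p"
    proof
      fix \<pi> assume "\<pi> \<in> nc_perms p q"
      then consider "\<pi> \<in> nc_perms (Suc p) q"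
        | a \<sigma> \<rho> where "a \<in> {p<..q}" "(\<sigma>, \<rho>) \<in> ?X a" "\<pi> = glue p a \<sigma> \<rho>"
        unfolding dec by auto
      then show "stat \<pi> \<le> q - p"
      proof cases
        case 1 then show ?thesis using IH1[of \<pi>] n by simp
      next
        case 2
        have "p < a" "a \<le> q" using 2(1) by auto
        then show ?thesis using gst(1)[OF 2(1,2)] le[OF 2(1,2)] unfolding 2(3) by linarith
      qed
    qed
    have injG: "inj_on (case_prod (glue p a)) (?X a)" if "a \<in> {p<..q}" for a
      using glue_inj[of p a q] that by (fastforce simp: inj_on_def nc_perms_def)
    have val: "\<pi> a = p" if "a \<in> {p<..q}" "\<pi> \<in> ?G a" for \<pi> a
      using that gst(2) by auto
    have permp: "inj \<pi>" if "\<pi> \<in> nc_perms p q" for \<pi> using that permutes_inj unfolding nc_perms_def by blast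
    have disj: "?G a \<inter> ?G b = {}" if "a \<in> {p<..q}" "b \<in> {p<..q}" "a \<noteq> b" for a b
    proof (rule ccontr)
      assume "?G a \<inter> ?G b \<noteq> {}"
      then obtain \<pi> where *: "\<pi> \<in> ?G a" "\<pi> \<in> ?G b" by blast
      then have "\<pi> \<in> nc_perms p q" using dec that(1) by blast
      then have "\<pi> a = \<pi> b" "inj \<pi>" using val[OF that(1) *(1)] val[OF that(2) *(2)] permp by auto
      then show False using that(3) by (metis injD)
    qed
    have disjA: "nc_perms (Suc p) q \<inter> (\<Union>a\<in>{p<..q}. ?G a) = {}"
    proof (rule ccontr)
      assume "\<not> ?thesis"
      then obtain \<pi> a where *: "\<pi> \<in> nc_perms (Suc p) q" "a \<in> {p<..q}" "\<pi> \<in> ?G a" by blast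
      then have "\<pi> p = p" using permutes_not_in[of \<pi> "{Suc p..q}" p] unfolding nc_perms_def by auto
      moreover have "\<pi> a = p" "inj \<pi>" using val * permp unfolding dec by auto
      ultimately show False using * by (metis injD less_irrefl greaterThanAtMost_iff)
    qed
    have "(\<Sum>\<pi>\<in>nc_perms p q. ?w p q \<pi>) =
        (\<Sum>\<pi>\<in>nc_perms (Suc p) q. ?w p q \<pi>) + (\<Sum>\<pi>\<in>(\<Union>a\<in>{p<..q}. ?G a). ?w p q \<pi>)"
      unfolding dec using disjA finite_nc_perms by (intro sum.union_disjoint) auto
    also have "(\<Sum>\<pi>\<in>nc_perms (Suc p) q. ?w p q \<pi>) = monom 1 1 * schroeder_poly n"
      unfolding IHs[symmetric] sum_distrib_left
    proof (rule sum.cong[OF refl])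
      fix \<pi> assume "\<pi> \<in> nc_perms (Suc p) q"
      then show "?w p q \<pi> = monom 1 1 * ?w (Suc p) q \<pi>"
        using IH1[of \<pi>] n n_def by (simp add: mult_monom Suc_diff_le)
    qed
    also have "(\<Sum>\<pi>\<in>(\<Union>a\<in>{p<..q}. ?G a). ?w p q \<pi>) = (\<Sum>a\<in>{p<..q}. \<Sum>\<pi>\<in>?G a. ?w p q \<pi>)"
      using disj finite_nc_perms by (intro sum.UNION_disjoint) auto
    also have "\<dots> = (\<Sum>a\<in>{p<..q}. schroeder_poly (a - Suc p) * schroeder_poly (q - a))"
    proof (rule sum.cong[OF refl])
      fix a assume a: "a \<in> {p<..q}"
      have "(\<Sum>\<pi>\<in>?G a. ?w p q \<pi>) = (\<Sum>x\<in>?X a. ?w p q (case_prod (glue p a) x))"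
        using sum.reindex[OF injG[OF a]] by simp
      also have "\<dots> = (\<Sum>(\<sigma>, \<rho>)\<in>?X a. ?w (Suc p) a \<sigma> * ?w a q \<rho>)"
      proof (rule sum.cong[OF refl])
        fix x assume x: "x \<in> ?X a"
        obtain \<sigma> \<rho> where xe: "x = (\<sigma>, \<rho>)" by (cases x)
        have "q - p - stat (glue p a \<sigma> \<rho>) = (a - Suc p - stat \<sigma>) + (q - a - stat \<rho>)"
          using gst(1)[of a \<sigma> \<rho>] le[of a \<sigma> \<rho>] a x unfolding xe by auto
        then show "?w p q (case_prod (glue p a) x) = (case x of (\<sigma>, \<rho>) \<Rightarrow> ?w (Suc p) a \<sigma> * ?w a q \<rho>)"
          unfolding xe by (simp add: mult_monom)
      qed
      also have "\<dots> = (\<Sum>\<sigma>\<in>nc_perms (Suc p) a. ?w (Suc p) a \<sigma>) * (\<Sum>\<rho>\<in>nc_perms a q. ?w a q \<rho>)"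
        unfolding sum_product by (rule sum.cartesian_product[symmetric])
      finally show "(\<Sum>\<pi>\<in>?G a. ?w p q \<pi>) = schroeder_poly (a - Suc p) * schroeder_poly (q - a)"
        using IHa(3,4)[OF a] by simp
    qed
    also have "\<dots> = (\<Sum>k\<le>n. schroeder_poly k * schroeder_poly (n - k))"
      \<comment> \<open>The length k = a - (p + 1) of the interval of \<sigma> plays the role of the
        size of the path below the first arch.\<close>
      by (rule sum.reindex_bij_witness[of _ "\<lambda>k. k + Suc p" "\<lambda>a. a - Suc p"]) (use n pq in \<open>auto simp: n_def\<close>)
    finally show ?thesis using bound schroeder_poly_Suc[of n] n by simp
  qed
qed


lemma sum_fun_apply: "(\<Sum>i\<in>A. f i) x = (\<Sum>i\<in>A. f i x :: 'b::comm_monoid_add)"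
  by (induction A rule: infinite_finite_induct) auto

section \<open>Polynomial functions\<close>

lemma polyfun_sum: "(\<And>i. i \<in> A \<Longrightarrow> f i \<in> polyfun) \<Longrightarrow> (\<lambda>a. \<Sum>i\<in>A. f i a) \<in> polyfun"
  by (induction A rule: infinite_finite_induct) (auto intro: polyfun.intros)

lemma polyfun_prod: "(\<And>i. i \<in> A \<Longrightarrow> f i \<in> polyfun) \<Longrightarrow> (\<lambda>a. \<Prod>i\<in>A. f i a) \<in> polyfun"
  by (induction A rule: infinite_finite_induct) (auto intro: polyfun.intros)

lemma polyfun_power: "f \<in> polyfun \<Longrightarrow> (\<lambda>a. f a ^ k) \<in> polyfun"
  by (induction k) (auto intro: polyfun.intros)

lemma polyfun_diff: "f \<in> polyfun \<Longrightarrow> g \<in> polyfun \<Longrightarrow> (\<lambda>a. f a - g a) \<in> polyfun"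
  using polyfun.add[of f "\<lambda>a. (-1) * g a"] polyfun.mult[OF polyfun.const[of "-1"], of g] by simp

lemma polyfun_if: "(P \<Longrightarrow> f \<in> polyfun) \<Longrightarrow> (\<not> P \<Longrightarrow> g \<in> polyfun) \<Longrightarrow> (\<lambda>a. if P then f a else g a) \<in> polyfun"
  by (cases P) simp_all

lemma polyfun_compose:
  assumes "f \<in> polyfun" "\<And>i. g i \<in> polyfun"
  shows "(\<lambda>y. f (\<lambda>i. g i y)) \<in> polyfun"
  using assms(1)
proof induction
  case (coord i) show ?case using assms(2)[of i] by simp
qed (simp_all add: polyfun.const polyfun.add polyfun.mult)

lemma polyfun_curve:
  assumes "f \<in> polyfun"
  shows "\<exists>P. \<forall>t. f (\<lambda>i. poly (G i) t) = poly P t"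
  using assms
proof induction
  case (const c) show ?case by (rule exI[of _ "[:c:]"]) simp
next
  case (coord i) show ?case by blast
next
  case (add f g)
  then obtain P Q where "\<And>t. f (\<lambda>i. poly (G i) t) = poly P t" "\<And>t. g (\<lambda>i. poly (G i) t) = poly Q t" by blast
  then show ?case by (intro exI[of _ "P + Q"]) simp
next
  case (mult f g)
  then obtain P Q where "\<And>t. f (\<lambda>i. poly (G i) t) = poly P t" "\<And>t. g (\<lambda>i. poly (G i) t) = poly Q t" by blast
  then show ?case by (intro exI[of _ "P * Q"]) simp
qed

text \<open>On the line each member of \<open>fs\<close> is a nonzero polynomial in one variable,
  and finitely many roots do not exhaust the complex numbers. This stands in for the density of
  nonempty open sets.\<close>

lemma polyfun_line_avoid:
  fixes fs :: "(('i \<Rightarrow> complex) \<Rightarrow> complex) set"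
  assumes "finite fs" "fs \<subseteq> polyfun" "finite B"
    and "\<And>f. f \<in> fs \<Longrightarrow> \<exists>t. f (\<lambda>i. a i + t * v i) \<noteq> 0"
  shows "\<exists>t. t \<notin> B \<and> (\<forall>f\<in>fs. f (\<lambda>i. a i + t * v i) \<noteq> 0)"
proof -
  have "finite {t. f (\<lambda>i. a i + t * v i) = 0}" if "f \<in> fs" for f
  proof -
    have "f \<in> polyfun" using that assms(2) by blast
    from polyfun_curve[OF this, of "\<lambda>i. [:a i, v i:]"]
    obtain P where P: "\<And>t. f (\<lambda>i. poly [:a i, v i:] t) = poly P t" by blast
    then have e: "f (\<lambda>i. a i + t * v i) = poly P t" for t
      using P[of t] by simp
    then have "P \<noteq> 0" using assms(4)[OF that] by auto
    then show ?thesis using poly_roots_finite[of P] e by simp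
  qed
  then have "finite (B \<union> (\<Union>f\<in>fs. {t. f (\<lambda>i. a i + t * v i) = 0}))" using assms by auto
  then have "B \<union> (\<Union>f\<in>fs. {t. f (\<lambda>i. a i + t * v i) = 0}) \<noteq> UNIV"
    using infinite_UNIV_char_0[where 'a=complex] by metis
  then show ?thesis by blast
qed

section \<open>Krull dimension\<close>

lemma krull_dim_ge:
  assumes "\<And>i. i \<le> m \<Longrightarrow> irreducible_closedin T (Z i)" "\<And>i. i < m \<Longrightarrow> Z i \<subset> Z (Suc i)"
  shows "enat m \<le> krull_dim T"
  unfolding krull_dim_def by (rule Sup_upper) (use assms in blast)

lemma krull_dim_le:
  assumes "\<And>m Z. (\<And>i. i \<le> m \<Longrightarrow> irreducible_closedin T (Z i)) \<Longrightarrow> (\<And>i. i < m \<Longrightarrow> Z i \<subset> Z (Suc i)) \<Longrightarrow> enat m \<le> N"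
  shows "krull_dim T \<le> N"
  unfolding krull_dim_def by (rule Sup_least) (use assms in blast)

lemma irreducible_closedin_homeomorphic:
  assumes h: "homeomorphic_maps T T' f g" and Z: "irreducible_closedin T Z"
  shows "irreducible_closedin T' (f ` Z)"
proof -
  have fc: "closed_map T T' f" and gc: "closed_map T' T g"
    using h homeomorphic_maps_map homeomorphic_imp_closed_map by metis+
  have cl: "closedin T Z" "Z \<noteq> {}" using Z unfolding irreducible_closedin_def by auto
  have ZT: "Z \<subseteq> topspace T" using closedin_subset[OF cl(1)] .
  have gf: "g (f x) = x" if "x \<in> topspace T" for x using h that unfolding homeomorphic_maps_def by simp
  have fg: "f (g y) = y" if "y \<in> topspace T'" for y using h that unfolding homeomorphic_maps_def by simp
  have key: "f ` Z = A \<or> f ` Z = B" if AB: "closedin T' A" "closedin T' B" "f ` Z = A \<union> B" for A B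
  proof -
    have cg: "closedin T (g ` A)" "closedin T (g ` B)" using gc AB unfolding closed_map_def by auto
    have "g ` f ` Z = Z" using gf ZT by force
    then have "Z = g ` A \<union> g ` B" using AB(3) by (simp add: image_Un)
    then consider "Z = g ` A" | "Z = g ` B" using Z cg unfolding irreducible_closedin_def by blast
    then show ?thesis
    proof cases
      case 1
      have "f ` g ` A = A" using fg closedin_subset[OF AB(1)] by force
      then show ?thesis using 1 by simp
    next
      case 2
      have "f ` g ` B = B" using fg closedin_subset[OF AB(2)] by force
      then show ?thesis using 2 by simp
    qed
  qed
  show ?thesis unfolding irreducible_closedin_def
    using cl fc key unfolding closed_map_def by blast
qed

lemma krull_dim_homeomorphic_le:
  assumes "homeomorphic_maps T T' f g"
  shows "krull_dim T \<le> krull_dim T'"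
proof (rule krull_dim_le)
  fix m Z assume Z: "\<And>i. i \<le> m \<Longrightarrow> irreducible_closedin T (Z i)" and S: "\<And>i. i < m \<Longrightarrow> Z i \<subset> Z (Suc i)"
  have inj: "inj_on f (topspace T)"
    using assms unfolding homeomorphic_maps_def by (metis inj_onI)
  have "f ` Z i \<subset> f ` Z (Suc i)" if "i < m" for i
  proof -
    have "Z (Suc i) \<subseteq> topspace T"
      using Z[of "Suc i"] that closedin_subset unfolding irreducible_closedin_def by auto
    then have "inj_on f (Z (Suc i))" using inj inj_on_subset by blast
    then show ?thesis using S[OF that] by (metis image_strict_mono)
  qed
  then show "enat m \<le> krull_dim T'"
    using irreducible_closedin_homeomorphic[OF assms Z] by (intro krull_dim_ge[of m T' "\<lambda>i. f ` Z i"]) auto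
qed

lemma krull_dim_homeomorphic:
  assumes "homeomorphic_map T T' f"
  shows "krull_dim T = krull_dim T'"
proof -
  obtain g where "homeomorphic_maps T T' f g" using assms homeomorphic_map_maps by blast
  then show ?thesis
    using krull_dim_homeomorphic_le homeomorphic_maps_sym by (metis order_antisym)
qed

text \<open>Closures in the whole space of the members of a chain are irreducible, and intersecting
  with S recovers the members, so the inclusions stay strict. The subset S is arbitrary.\<close>

lemma krull_dim_subtopology_le: "krull_dim (subtopology T S) \<le> krull_dim T"
proof (rule krull_dim_le)
  fix m Z assume Z: "\<And>i. i \<le> m \<Longrightarrow> irreducible_closedin (subtopology T S) (Z i)"
    and S: "\<And>i. i < m \<Longrightarrow> Z i \<subset> Z (Suc i)"
  have int: "(T closure_of Z i) \<inter> S = Z i" and ZT: "Z i \<subseteq> topspace T" if im: "i \<le> m" for i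
  proof -
    obtain F where F: "closedin T F" "Z i = F \<inter> S"
      using Z[OF im] unfolding irreducible_closedin_def closedin_subtopology by blast
    then have "T closure_of Z i \<subseteq> F" by (intro closure_of_minimal) auto
    moreover have *: "Z i \<subseteq> topspace T" using F closedin_subset by blast
    ultimately show "(T closure_of Z i) \<inter> S = Z i" using F closure_of_subset by blast
    show "Z i \<subseteq> topspace T" by (rule *)
  qed
  have irr: "irreducible_closedin T (T closure_of Z i)" if im: "i \<le> m" for i
    unfolding irreducible_closedin_def
  proof (intro conjI allI impI)
    show "T closure_of Z i \<noteq> {}"
      using Z[OF im] closure_of_subset[OF ZT[OF im]] unfolding irreducible_closedin_def by blast
    fix A B assume AB: "closedin T A \<and> closedin T B \<and> T closure_of Z i = A \<union> B"
    have cl: "closedin (subtopology T S) (Z i)" using Z[OF im] unfolding irreducible_closedin_def by blast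
    have "closedin (subtopology T S) (Z i \<inter> (A \<inter> S))" "closedin (subtopology T S) (Z i \<inter> (B \<inter> S))"
      using AB cl by (auto intro!: closedin_Int closedin_subtopology_Int_closed simp: closedin_subtopology)
    moreover have "Z i = (Z i \<inter> (A \<inter> S)) \<union> (Z i \<inter> (B \<inter> S))"
      using int[OF im] AB by blast
    ultimately have "Z i = Z i \<inter> (A \<inter> S) \<or> Z i = Z i \<inter> (B \<inter> S)"
      using Z[OF im] unfolding irreducible_closedin_def by blast
    then have "Z i \<subseteq> A \<or> Z i \<subseteq> B" by blast
    then have "T closure_of Z i \<subseteq> A \<or> T closure_of Z i \<subseteq> B" using AB closure_of_minimal by metis
    then show "T closure_of Z i = A \<or> T closure_of Z i = B" using AB by blast
  qed simp
  have "T closure_of Z i \<subset> T closure_of Z (Suc i)" if "i < m" for i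
  proof
    show "T closure_of Z i \<subseteq> T closure_of Z (Suc i)" using closure_of_mono S[OF that] by blast
    show "T closure_of Z i \<noteq> T closure_of Z (Suc i)"
      using int[of i] int[of "Suc i"] S[OF that] that by (metis Suc_leI less_imp_le psubsetE subset_refl)
  qed
  then show "enat m \<le> krull_dim T"
    using irr by (intro krull_dim_ge[of m T "\<lambda>i. T closure_of Z i"]) auto
qed

lemma krull_dim_subset_le:
  assumes "X \<subseteq> Y"
  shows "krull_dim (subtopology T X) \<le> krull_dim (subtopology T Y)"
proof -
  have *: "subtopology T X = subtopology (subtopology T Y) X"
    unfolding subtopology_subtopology using assms by (simp add: inf.absorb2)
  show ?thesis by (subst *) (rule krull_dim_subtopology_le)
qed

section \<open>The Zariski topology of affine space\<close>

lemma algebraic_setI: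
  assumes "F \<subseteq> polyfun" "\<And>a. a \<in> Z \<longleftrightarrow> a \<in> coord_space C \<and> (\<forall>f\<in>F. f a = 0)"
  shows "algebraic_set C Z"
  unfolding algebraic_set_def zero_locus_def using assms by blast

lemma algebraic_set_zeros:
  assumes "f \<in> polyfun"
  shows "algebraic_set C {a \<in> coord_space C. f a = 0}"
  by (rule algebraic_setI[of "{f}"]) (use assms in auto)

lemma algebraic_set_empty: "algebraic_set C {}"
  by (rule algebraic_setI[of "{\<lambda>_. 1}"]) (simp_all add: polyfun.const)

definition zar :: "'i set \<Rightarrow> ('i \<Rightarrow> complex) topology" where
  "zar C = topology (\<lambda>U. U \<subseteq> coord_space C \<and> algebraic_set C (coord_space C - U))"

lemma openin_zar: "openin (zar C) U \<longleftrightarrow> U \<subseteq> coord_space C \<and> algebraic_set C (coord_space C - U)"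
proof -
  let ?P = "\<lambda>U. U \<subseteq> coord_space C \<and> algebraic_set C (coord_space C - U)"
  have "istopology ?P" unfolding istopology_def
  proof (intro conjI allI impI)
    fix U V assume "?P U" "?P V"
    moreover have "coord_space C - U \<inter> V = (coord_space C - U) \<union> (coord_space C - V)" by blast
    ultimately show "algebraic_set C (coord_space C - U \<inter> V)" by (simp add: algebraic_set_Un)
  next
    fix K assume K: "\<forall>U\<in>K. ?P U"
    have "coord_space C - \<Union>K = {a \<in> coord_space C. \<forall>U\<in>K. a \<in> coord_space C - U}" by blast
    then show "algebraic_set C (coord_space C - \<Union>K)" using K algebraic_set_INT[of K C "\<lambda>U. coord_space C - U"] by simp
  qed auto
  then show ?thesis unfolding zar_def by (simp add: topology_inverse')
qed

lemma algebraic_set_subset: "algebraic_set C Z \<Longrightarrow> Z \<subseteq> coord_space C"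
  unfolding algebraic_set_def zero_locus_def by auto

lemma topspace_zar [simp]: "topspace (zar C) = coord_space C"
proof -
  have "openin (zar C) (coord_space C)" unfolding openin_zar by (simp add: algebraic_set_empty)
  then have "coord_space C \<subseteq> topspace (zar C)" by (rule openin_subset)
  moreover have "topspace (zar C) \<subseteq> coord_space C"
    using openin_topspace[of "zar C"] unfolding openin_zar by (rule conjunct1)
  ultimately show ?thesis by (rule equalityI[rotated])
qed

lemma closedin_zar: "closedin (zar C) Z \<longleftrightarrow> algebraic_set C Z"
proof -
  have dd: "coord_space C - (coord_space C - Z) = Z" if "Z \<subseteq> coord_space C" using that by (rule double_diff) simp
  show ?thesis
  proof
    assume "closedin (zar C) Z"
    then have "Z \<subseteq> coord_space C" "openin (zar C) (coord_space C - Z)"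
      unfolding closedin_def topspace_zar by (rule conjunct1, rule conjunct2)
    then have "algebraic_set C (coord_space C - (coord_space C - Z))" unfolding openin_zar by blast
    then show "algebraic_set C Z" unfolding dd[OF \<open>Z \<subseteq> coord_space C\<close>] .
  next
    assume a: "algebraic_set C Z"
    then have "Z \<subseteq> coord_space C" by (rule algebraic_set_subset)
    then show "closedin (zar C) Z"
      unfolding closedin_def openin_zar topspace_zar using a dd by (intro conjI) simp_all
  qed
qed

text \<open>Primality of the vanishing ideal, a form of irreducibility that does not mention the
  surrounding topology.\<close>

definition poly_irreducible :: "('i \<Rightarrow> complex) set \<Rightarrow> bool" where
  "poly_irreducible Z \<longleftrightarrow> Z \<noteq> {} \<and> (\<forall>f\<in>polyfun. \<forall>g\<in>polyfun. (\<forall>z\<in>Z. f z * g z = 0) \<longrightarrow>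
     (\<forall>z\<in>Z. f z = 0) \<or> (\<forall>z\<in>Z. g z = 0))"

lemma poly_irreducibleD:
  assumes "poly_irreducible Z" "f \<in> polyfun" "g \<in> polyfun" "\<forall>z\<in>Z. f z * g z = 0"
  shows "(\<forall>z\<in>Z. f z = 0) \<or> (\<forall>z\<in>Z. g z = 0)"
  using assms(1)[unfolded poly_irreducible_def, THEN conjunct2, rule_format, OF assms(2,3)] assms(4) by simp

lemma poly_irreducible_prod:
  assumes Z: "poly_irreducible Z" and "finite E"
    and "\<And>e. e \<in> E \<Longrightarrow> P e \<in> polyfun" and "\<forall>z\<in>Z. (\<Prod>e\<in>E. P e z) = 0"
  shows "\<exists>e\<in>E. \<forall>z\<in>Z. P e z = 0"
  using assms(2-4)
proof (induction E rule: finite_induct)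
  case empty then show ?case using Z unfolding poly_irreducible_def by auto
next
  case (insert e E)
  have "\<forall>z\<in>Z. P e z * (\<Prod>e\<in>E. P e z) = 0" using insert by simp
  moreover have "P e \<in> polyfun" "(\<lambda>z. \<Prod>e\<in>E. P e z) \<in> polyfun" using insert.prems polyfun_prod[of E P] by auto
  ultimately have "(\<forall>z\<in>Z. P e z = 0) \<or> (\<forall>z\<in>Z. (\<Prod>e\<in>E. P e z) = 0)"
    using poly_irreducibleD[OF Z] by simp
  then show ?case using insert by auto
qed

lemma closedin_sub_zar_separate:
  assumes "closedin (subtopology (zar C) Y) Z" "z \<in> Y" "z \<in> coord_space C" "z \<notin> Z"
  obtains f where "f \<in> polyfun" "\<forall>x\<in>Z. f x = 0" "f z \<noteq> 0"
proof -
  obtain A where A: "algebraic_set C A" "Z = A \<inter> Y"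
    using assms(1) unfolding closedin_subtopology closedin_zar by blast
  then obtain F where F: "F \<subseteq> polyfun" "A = zero_locus C F" unfolding algebraic_set_def by blast
  then obtain f where "f \<in> F" "f z \<noteq> 0" using assms A unfolding zero_locus_def by blast
  then show thesis using that[of f] F A unfolding zero_locus_def by blast
qed

text \<open>If f g vanishes on Z, the zero sets of f and g cover Z. Conversely, for a cover of Z by
  two proper closed parts, polynomials vanishing on one part each, but not on all of Z, have a
  product vanishing on Z.\<close>

lemma irreducible_closedin_zar:
  assumes "Y \<subseteq> coord_space C"
  shows "irreducible_closedin (subtopology (zar C) Y) Z \<longleftrightarrow>
    closedin (subtopology (zar C) Y) Z \<and> poly_irreducible Z"
proof (intro iffI conjI)
  assume irr: "irreducible_closedin (subtopology (zar C) Y) Z"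
  then show cl: "closedin (subtopology (zar C) Y) Z" unfolding irreducible_closedin_def by blast
  then have ZY: "Z \<subseteq> Y" using closedin_subset by force
  show "poly_irreducible Z" unfolding poly_irreducible_def
  proof (intro conjI ballI impI)
    show "Z \<noteq> {}" using irr unfolding irreducible_closedin_def by blast
    fix f g :: "('a \<Rightarrow> complex) \<Rightarrow> complex"
    assume fg: "f \<in> polyfun" "g \<in> polyfun" "\<forall>z\<in>Z. f z * g z = 0"
    have cz: "closedin (subtopology (zar C) Y) {z \<in> Z. h z = 0}" if "h \<in> polyfun" for h
    proof -
      have "closedin (zar C) {a \<in> coord_space C. h a = 0}"
        unfolding closedin_zar by (rule algebraic_set_zeros[OF that])
      then have "closedin (subtopology (zar C) Y) (Y \<inter> {a \<in> coord_space C. h a = 0})"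
        by (metis closedin_subtopology inf_commute)
      then have "closedin (subtopology (zar C) Y) (Z \<inter> (Y \<inter> {a \<in> coord_space C. h a = 0}))"
        using cl by blast
      moreover have "Z \<inter> (Y \<inter> {a \<in> coord_space C. h a = 0}) = {z \<in> Z. h z = 0}" using ZY assms by blast
      ultimately show ?thesis by simp
    qed
    have "Z = {z \<in> Z. f z = 0} \<union> {z \<in> Z. g z = 0}" using fg by auto
    then have "Z = {z \<in> Z. f z = 0} \<or> Z = {z \<in> Z. g z = 0}"
      using irr cz[OF fg(1)] cz[OF fg(2)] unfolding irreducible_closedin_def by blast
    then show "(\<forall>z\<in>Z. f z = 0) \<or> (\<forall>z\<in>Z. g z = 0)" by blast
  qed
next
  assume *: "closedin (subtopology (zar C) Y) Z \<and> poly_irreducible Z"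
  then have ZY: "Z \<subseteq> Y" using closedin_subset by force
  show "irreducible_closedin (subtopology (zar C) Y) Z" unfolding irreducible_closedin_def
  proof (intro conjI allI impI)
    fix A B assume AB: "closedin (subtopology (zar C) Y) A \<and> closedin (subtopology (zar C) Y) B \<and> Z = A \<union> B"
    show "Z = A \<or> Z = B"
    proof (rule ccontr)
      assume "\<not> ?thesis"
      then obtain x y where xy: "x \<in> Z" "x \<notin> A" "y \<in> Z" "y \<notin> B" using AB by blast
      obtain f where f: "f \<in> polyfun" "\<forall>x\<in>A. f x = 0" "f x \<noteq> 0"
        using closedin_sub_zar_separate[of C Y A x] AB xy ZY assms by blast
      obtain g where g: "g \<in> polyfun" "\<forall>x\<in>B. g x = 0" "g y \<noteq> 0"
        using closedin_sub_zar_separate[of C Y B y] AB xy ZY assms by blast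
      have "\<forall>z\<in>Z. f z * g z = 0" using AB f g by auto
      then have "(\<forall>z\<in>Z. f z = 0) \<or> (\<forall>z\<in>Z. g z = 0)"
        using poly_irreducibleD[of Z f g] * f g by simp
      then show False using f g xy by blast
    qed
  qed (use * in \<open>auto simp: poly_irreducible_def\<close>)
qed

text \<open>The chain consists of the sections of U by coordinate subspaces through a fixed point x,
  releasing one coordinate at a time. Any two points of a section lie on a line in the coordinate
  subspace, and this makes the section irreducible.\<close>

lemma krull_dim_open_ge:
  fixes D :: "'i set"
  assumes D: "finite D" and U: "openin (zar D) U" "U \<noteq> {}"
  shows "enat (card D) \<le> krull_dim (subtopology (zar D) U)"
proof -
  obtain x where x: "x \<in> U" using U(2) by blast
  have UD: "U \<subseteq> coord_space D" using U(1) openin_zar by blast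
  obtain F where F: "F \<subseteq> polyfun" "coord_space D - U = zero_locus D F"
    using U(1) unfolding openin_zar algebraic_set_def by blast
  have sepU: "\<exists>h\<in>F. h z \<noteq> 0" if "z \<in> U" for z
    using that F(2) UD unfolding zero_locus_def by blast
  have inU: "z \<in> U" if "z \<in> coord_space D" "h \<in> F" "h z \<noteq> 0" for z h
    using that F(2) unfolding zero_locus_def by blast
  obtain e where e: "bij_betw e {0..<card D} D" using ex_bij_betw_nat_finite[OF D] by blast
  define Z where "Z i = {z \<in> U. \<forall>c\<in>D - e ` {0..<i}. z c = x c}" for i
  have "irreducible_closedin (subtopology (zar D) U) (Z i)" for i
    unfolding irreducible_closedin_zar[OF UD]
  proof
    have "closedin (zar D) {z \<in> coord_space D. \<forall>c\<in>D - e ` {0..<i}. z c = x c}"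
      unfolding closedin_zar
    proof (rule algebraic_setI[of "(\<lambda>c z. z c - x c) ` (D - e ` {0..<i})"])
      show "(\<lambda>c z. z c - x c) ` (D - e ` {0..<i}) \<subseteq> polyfun"
        by (auto intro!: polyfun_diff polyfun.const polyfun.coord)
    qed auto
    moreover have "Z i = {z \<in> coord_space D. \<forall>c\<in>D - e ` {0..<i}. z c = x c} \<inter> U"
      unfolding Z_def using UD by auto
    ultimately show "closedin (subtopology (zar D) U) (Z i)"
      unfolding closedin_subtopology by blast
    show "poly_irreducible (Z i)" unfolding poly_irreducible_def
    proof (intro conjI ballI impI)
      show "Z i \<noteq> {}" using x unfolding Z_def by auto
      fix f g :: "('i \<Rightarrow> complex) \<Rightarrow> complex"
      assume fg: "f \<in> polyfun" "g \<in> polyfun" "\<forall>z\<in>Z i. f z * g z = 0"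
      show "(\<forall>z\<in>Z i. f z = 0) \<or> (\<forall>z\<in>Z i. g z = 0)"
      proof (rule ccontr)
        assume "\<not> ?thesis"
        then obtain y z where yz: "y \<in> Z i" "f y \<noteq> 0" "z \<in> Z i" "g z \<noteq> 0" by blast
        obtain h where h: "h \<in> F" "h y \<noteq> 0" using sepU[of y] yz unfolding Z_def by blast
        \<comment> \<open>At t = 0 neither f nor h vanishes and at t = 1 the polynomial g does not,
          so some point of the line avoids all three zero sets; h keeps that point inside U.\<close>
        let ?l = "\<lambda>t i. y i + t * (z i - y i)"
        have "\<exists>t. t \<notin> {} \<and> (\<forall>k\<in>{f, g, h}. k (?l t) \<noteq> 0)"
        proof (rule polyfun_line_avoid)
          fix k assume "k \<in> {f, g, h}"
          then have "k (?l 0) \<noteq> 0 \<or> k (?l 1) \<noteq> 0" using yz h by auto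
          then show "\<exists>t. k (?l t) \<noteq> 0" by blast
        qed (use fg h F in auto)
        then obtain t where t: "f (?l t) \<noteq> 0" "g (?l t) \<noteq> 0" "h (?l t) \<noteq> 0" by auto
        have "y \<in> coord_space D" "z \<in> coord_space D" using yz UD unfolding Z_def by blast+
        then have "?l t \<in> coord_space D" unfolding coord_space_def by simp
        then have "?l t \<in> U" using inU h t by blast
        then have "?l t \<in> Z i" using yz unfolding Z_def by auto
        then show False using fg t by (metis mult_eq_0_iff)
      qed
    qed
  qed
  moreover have "Z i \<subset> Z (Suc i)" if i: "i < card D" for i
  proof
    show "Z i \<subseteq> Z (Suc i)" unfolding Z_def by auto
    have ei: "e i \<in> D" "e i \<notin> e ` {0..<i}" using e i unfolding bij_betw_def inj_on_def by force+
    obtain h where h: "h \<in> F" "h x \<noteq> 0" using sepU x by blast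
    let ?v = "\<lambda>c. if c = e i then 1 else 0 :: complex"
    have "\<exists>t. t \<notin> {0} \<and> (\<forall>k\<in>{h}. k (\<lambda>c. x c + t * ?v c) \<noteq> 0)"
    proof (rule polyfun_line_avoid)
      fix k assume "k \<in> {h}"
      then have "k (\<lambda>c. x c + 0 * ?v c) \<noteq> 0" using h by simp
      then show "\<exists>t. k (\<lambda>c. x c + t * ?v c) \<noteq> 0" by blast
    qed (use h F in auto)
    then obtain t where t: "t \<noteq> 0" "h (\<lambda>c. x c + t * ?v c) \<noteq> 0" by auto
    have "(\<lambda>c. x c + t * ?v c) \<in> coord_space D" using x UD ei unfolding coord_space_def by auto
    then have "(\<lambda>c. x c + t * ?v c) \<in> U" using inU h t by blast
    then have "(\<lambda>c. x c + t * ?v c) \<in> Z (Suc i)" unfolding Z_def by auto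
    moreover have "(\<lambda>c. x c + t * ?v c) \<notin> Z i" unfolding Z_def using ei t by auto
    ultimately show "Z i \<noteq> Z (Suc i)" by blast
  qed
  ultimately show ?thesis using krull_dim_ge[of "card D" "subtopology (zar D) U" Z] by presburger
qed


section \<open>Dimension of rational images\<close>

text \<open>The digits of \<open>k\<close> in base \<open>L\<close> serve as exponents, so that \<open>k < L ^ m\<close> enumerates all monomials in
  \<open>f 0, \<dots>, f (m - 1)\<close> with exponents below \<open>L\<close>.\<close>

fun multi_mon :: "nat \<Rightarrow> (nat \<Rightarrow> 'a \<Rightarrow> complex) \<Rightarrow> nat \<Rightarrow> nat \<Rightarrow> 'a \<Rightarrow> complex" where
  "multi_mon L f 0 k x = 1"
| "multi_mon L f (Suc m) k x = f m x ^ (k div L ^ m) * multi_mon L f m (k mod L ^ m) x"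

lemma polyfun_multi_mon: "(\<And>i. i < m \<Longrightarrow> f i \<in> polyfun) \<Longrightarrow> multi_mon L f m k \<in> polyfun"
proof (induction m arbitrary: k)
  case 0
  have "multi_mon L f 0 k = (\<lambda>_. 1)" by (rule ext) simp
  then show ?case by (simp add: polyfun.const)
next
  case (Suc m)
  have "multi_mon L f (Suc m) k = (\<lambda>x. f m x ^ (k div L ^ m) * multi_mon L f m (k mod L ^ m) x)"
    by (rule ext) simp
  moreover have "(\<lambda>x. f m x ^ (k div L ^ m) * multi_mon L f m (k mod L ^ m) x) \<in> polyfun"
    by (rule polyfun.mult[OF polyfun_power[OF Suc.prems] Suc.IH[OF Suc.prems]]) simp_all
  ultimately show ?case by simp
qed

lemma sum_lessThan_add:
  fixes g :: "nat \<Rightarrow> 'b::comm_monoid_add"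
  shows "(\<Sum>k<a + b. g k) = (\<Sum>k<a. g k) + (\<Sum>k<b. g (a + k))"
  by (induction b) (simp_all add: add.assoc)

lemma sum_base_expansion:
  fixes g :: "nat \<Rightarrow> 'b::comm_monoid_add"
  shows "(\<Sum>k<L * M. g k) = (\<Sum>e<L. \<Sum>b<M. g (e * M + b))"
proof (induction L)
  case (Suc L)
  have "Suc L * M = L * M + M" by simp
  then show ?case using Suc by (simp only: sum_lessThan_add sum.lessThan_Suc)
qed simp

text \<open>If \<open>f m\<close> cuts \<open>Z m\<close> out of \<open>Z (m + 1)\<close> and a relation among the \<open>f i\<close> holds on \<open>Z (m + 1)\<close>, divide
  it by the largest power of \<open>f m\<close> and restrict it to \<open>Z m\<close>.\<close>

lemma multi_mon_independent:
  assumes "\<And>i. i \<le> m \<Longrightarrow> poly_irreducible (Z i)" "\<And>i. i < m \<Longrightarrow> Z i \<subseteq> Z (Suc i)"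
    and "\<And>i. i < m \<Longrightarrow> f i \<in> polyfun" "\<And>i z. i < m \<Longrightarrow> z \<in> Z i \<Longrightarrow> f i z = 0"
    and "\<And>i. i < m \<Longrightarrow> \<exists>z\<in>Z (Suc i). f i z \<noteq> 0" and L: "L > 0"
    and "\<forall>z\<in>Z m. (\<Sum>k<L ^ m. c k * multi_mon L f m k z) = 0"
  shows "\<forall>k<L ^ m. c k = 0"
  using assms(1-5,7)
proof (induction m arbitrary: c)
  case 0
  then have "Z 0 \<noteq> {}" unfolding poly_irreducible_def by blast
  then show ?case using 0 by auto
next
  case (Suc m)
  define P where "P e z = (\<Sum>b<L ^ m. c (e * L ^ m + b) * multi_mon L f m b z)" for e z
  have Pp: "P e \<in> polyfun" for e
    unfolding P_def using Suc.prems(3)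
    by (intro polyfun_sum polyfun.mult[OF polyfun.const] polyfun_multi_mon) simp
  have fm: "f m \<in> polyfun" using Suc.prems(3) by simp
  have irr: "poly_irreducible (Z (Suc m))" using Suc.prems(1) by blast
  have tot: "(\<Sum>e<L. f m z ^ e * P e z) = 0" if "z \<in> Z (Suc m)" for z
  proof -
    have "(\<Sum>k<L * L ^ m. c k * multi_mon L f (Suc m) k z) = (\<Sum>e<L. f m z ^ e * P e z)"
      unfolding sum_base_expansion P_def sum_distrib_left
    proof (intro sum.cong refl)
        fix e b assume "b \<in> {..<L ^ m}"
        then have "(e * L ^ m + b) div L ^ m = e" "(e * L ^ m + b) mod L ^ m = b" using L by auto
        then show "c (e * L ^ m + b) * multi_mon L f (Suc m) (e * L ^ m + b) z =
            f m z ^ e * (c (e * L ^ m + b) * multi_mon L f m b z)"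
          by (simp only: multi_mon.simps) (simp add: algebra_simps)
    qed
    then show ?thesis using Suc.prems(6) that by simp
  qed
  have zero: "e < L \<Longrightarrow> \<forall>b<L ^ m. c (e * L ^ m + b) = 0" for e
  proof (induction e rule: less_induct)
    case (less e)
    have P0: "P e' z = 0" if "e' < e" for e' z
      using less.IH[OF that] less.prems that unfolding P_def by simp
    define R where "R z = (\<Sum>j<L - e. f m z ^ j * P (e + j) z)" for z
    have Rp: "R \<in> polyfun"
      unfolding R_def by (intro polyfun_sum polyfun.mult polyfun_power fm Pp)
    have "f m z ^ e * R z = 0" if "z \<in> Z (Suc m)" for z
    proof -
      have "(\<Sum>e<L. f m z ^ e * P e z) = (\<Sum>e'\<in>{e..<L}. f m z ^ e' * P e' z)"
        using P0 less.prems by (intro sum.mono_neutral_right) auto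
      also have "\<dots> = (\<Sum>j<L - e. f m z ^ (e + j) * P (e + j) z)"
        by (rule sum.reindex_bij_witness[of _ "\<lambda>j. e + j" "\<lambda>e'. e' - e"]) auto
      also have "\<dots> = f m z ^ e * R z"
        unfolding R_def sum_distrib_left by (intro sum.cong) (auto simp: power_add)
      finally show ?thesis using tot[OF that] by simp
    qed
    then have "(\<forall>z\<in>Z (Suc m). f m z ^ e = 0) \<or> (\<forall>z\<in>Z (Suc m). R z = 0)"
      using poly_irreducibleD[OF irr polyfun_power[OF fm] Rp] by simp
    moreover have "\<not> (\<forall>z\<in>Z (Suc m). f m z ^ e = 0)" using Suc.prems(5)[of m] by auto
    ultimately have R0: "R z = 0" if "z \<in> Z (Suc m)" for z using that by blast
    have "P e z = 0" if z: "z \<in> Z m" for z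
    proof -
      have "z \<in> Z (Suc m)" using z Suc.prems(2)[of m] by blast
      have "f m z = 0" using Suc.prems(4)[of m] z by simp
      then have "R z = (\<Sum>j<L - e. if j = 0 then P e z else 0)"
        unfolding R_def by (intro sum.cong) auto
      also have "\<dots> = P e z" using less.prems by (simp add: sum.delta')
      finally show ?thesis using R0[OF \<open>z \<in> Z (Suc m)\<close>] by simp
    qed
    then have "\<forall>z\<in>Z m. (\<Sum>b<L ^ m. c (e * L ^ m + b) * multi_mon L f m b z) = 0"
      unfolding P_def by simp
    then show ?case
      using Suc.IH[of "\<lambda>b. c (e * L ^ m + b)"] Suc.prems(1-5) by simp
  qed
  show ?case
  proof (intro allI impI)
    fix k assume "k < L ^ Suc m"
    then have "k div L ^ m < L" by (simp add: less_mult_imp_div_less)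
    moreover have "k mod L ^ m < L ^ m" using L by simp
    ultimately have "c (k div L ^ m * L ^ m + k mod L ^ m) = 0" using zero by blast
    then show "c k = 0" by (simp only: div_mult_mod_eq)
  qed
qed

text \<open>Each exponent is bounded separately instead of the total degree: the bounds still add
  under multiplication, and the number of spanning monomials is at most the plain power (K +
  1)^(card D).\<close>

definition box_polys :: "'i set \<Rightarrow> nat \<Rightarrow> (('i \<Rightarrow> complex) \<Rightarrow> complex) set" where
  "box_polys D K = cfun.span ((\<lambda>\<beta> y. \<Prod>i\<in>D. y i ^ \<beta> i) ` (D \<rightarrow>\<^sub>E {..K}))"

lemma box_polys_mono: "K \<le> K' \<Longrightarrow> box_polys D K \<subseteq> box_polys D K'"
  unfolding box_polys_def by (intro cfun.span_mono image_mono PiE_mono) auto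

lemma box_polys_const: "(\<lambda>y. c) \<in> box_polys D K"
proof -
  have "(\<lambda>y. \<Prod>i\<in>D. y i ^ (restrict (\<lambda>_. 0) D) i) \<in> box_polys D K"
    unfolding box_polys_def by (intro cfun.span_base imageI) auto
  moreover have "(\<lambda>y. \<Prod>i\<in>D. y i ^ (restrict (\<lambda>_. 0) D) i) = (\<lambda>y::'a \<Rightarrow> complex. 1)" by simp
  ultimately have "cscale c (\<lambda>y. 1) \<in> box_polys D K"
    unfolding box_polys_def by (intro cfun.span_scale) simp
  then show ?thesis unfolding cscale_def by simp
qed

lemma box_polys_coord:
  assumes "finite D" "i \<in> D"
  shows "(\<lambda>y. y i) \<in> box_polys D 1"
proof -
  have "(\<lambda>y. \<Prod>j\<in>D. y j ^ (restrict (\<lambda>j. if j = i then 1 else 0) D) j) \<in> box_polys D 1"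
    unfolding box_polys_def by (intro cfun.span_base imageI) auto
  moreover have "(\<Prod>j\<in>D. y j ^ (restrict (\<lambda>j. if j = i then 1 else 0) D) j) = y i" for y :: "'a \<Rightarrow> complex"
  proof -
    have "(\<Prod>j\<in>D. y j ^ (restrict (\<lambda>j. if j = i then 1 else 0) D) j) = (\<Prod>j\<in>D. if j = i then y j else 1)"
      by (intro prod.cong) auto
    then show ?thesis using assms by (simp add: prod.delta)
  qed
  ultimately show ?thesis by simp
qed

lemma box_polys_add: "p \<in> box_polys D K \<Longrightarrow> q \<in> box_polys D K \<Longrightarrow> (\<lambda>y. p y + q y) \<in> box_polys D K"
  unfolding box_polys_def using cfun.span_add[of p _ q] by (simp add: plus_fun_def)

lemma box_polys_scale: "p \<in> box_polys D K \<Longrightarrow> (\<lambda>y. c * p y) \<in> box_polys D K"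
  unfolding box_polys_def using cfun.span_scale[of p _ c] by (simp add: cscale_def)

lemma box_polys_mult:
  assumes "p \<in> box_polys D K" "q \<in> box_polys D K'"
  shows "(\<lambda>y. p y * q y) \<in> box_polys D (K + K')"
  using assms(1)[unfolded box_polys_def]
proof (induction p rule: cfun.span_induct_alt)
  case base
  show ?case using box_polys_const[of 0] by (simp add: zero_fun_def)
next
  case (step c x p)
  then obtain \<beta> where \<beta>: "\<beta> \<in> D \<rightarrow>\<^sub>E {..K}" "x = (\<lambda>y. \<Prod>i\<in>D. y i ^ \<beta> i)" by blast
  have "(\<lambda>y. x y * q y) \<in> box_polys D (K + K')"
    using assms(2)[unfolded box_polys_def]
  proof (induction q rule: cfun.span_induct_alt)
    case base
    show ?case using box_polys_const[of 0] by (simp add: zero_fun_def)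
  next
    case (step d z q)
    then obtain \<gamma> where \<gamma>: "\<gamma> \<in> D \<rightarrow>\<^sub>E {..K'}" "z = (\<lambda>y. \<Prod>i\<in>D. y i ^ \<gamma> i)" by blast
    have "(\<lambda>y. \<Prod>i\<in>D. y i ^ (restrict (\<lambda>i. \<beta> i + \<gamma> i) D) i) \<in> box_polys D (K + K')"
      unfolding box_polys_def
    proof (intro cfun.span_base imageI PiE_I)
      fix i assume "i \<in> D"
      then have "\<beta> i \<le> K" "\<gamma> i \<le> K'" using \<beta>(1) \<gamma>(1) by auto
      then show "restrict (\<lambda>i. \<beta> i + \<gamma> i) D i \<in> {..K + K'}" using \<open>i \<in> D\<close> by simp
    qed simp
    moreover have "(\<Prod>i\<in>D. y i ^ (restrict (\<lambda>i. \<beta> i + \<gamma> i) D) i) = x y * z y" for y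
      unfolding \<beta>(2) \<gamma>(2) prod.distrib[symmetric] by (intro prod.cong) (auto simp: power_add)
    ultimately have "(\<lambda>y. x y * z y) \<in> box_polys D (K + K')" by simp
    from box_polys_add[OF box_polys_scale[OF this, of d] step(2)]
    show ?case by (simp add: cscale_def algebra_simps)
  qed
  from box_polys_add[OF box_polys_scale[OF this, of c] step(2)]
  show ?case by (simp add: cscale_def algebra_simps)
qed

lemma box_polys_power:
  assumes "p \<in> box_polys D K"
  shows "(\<lambda>y. p y ^ j) \<in> box_polys D (j * K)"
proof (induction j)
  case 0 show ?case using box_polys_const by simp
next
  case (Suc j)
  from box_polys_mult[OF assms this] show ?case by simp
qed

text \<open>Agreement is claimed only on \<open>coord_space D\<close>, where the coordinates outside
  D vanish and may be replaced by 0.\<close>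

lemma polyfun_box_polys:
  assumes "f \<in> polyfun" and D: "finite D"
  shows "\<exists>K q. q \<in> box_polys D K \<and> (\<forall>y\<in>coord_space D. f y = q y)"
  using assms(1)
proof induction
  case (const c) show ?case by (rule exI[of _ 0], rule exI[of _ "\<lambda>_. c"], rule conjI[OF box_polys_const]) simp
next
  case (coord i)
  show ?case
  proof (cases "i \<in> D")
    case True
    show ?thesis by (rule exI, rule exI, rule conjI[OF box_polys_coord[OF D True]]) simp
  next
    case False
    then have *: "\<forall>y\<in>coord_space D. y i = 0" unfolding coord_space_def by simp
    show ?thesis by (rule exI[of _ 0], rule exI[of _ "\<lambda>_. 0"], rule conjI[OF box_polys_const]) (rule *)
  qed
next
  case (add f g)
  then obtain K K' p q where *: "p \<in> box_polys D K" "\<forall>y\<in>coord_space D. f y = p y"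
    "q \<in> box_polys D K'" "\<forall>y\<in>coord_space D. g y = q y" by blast
  have "p \<in> box_polys D (K + K')" "q \<in> box_polys D (K + K')"
    using * box_polys_mono[of K "K + K'" D] box_polys_mono[of K' "K + K'" D] by auto
  then have "(\<lambda>y. p y + q y) \<in> box_polys D (K + K')" by (rule box_polys_add)
  moreover have "\<forall>y\<in>coord_space D. f y + g y = p y + q y" using * by simp
  ultimately show ?case by (intro exI conjI)
next
  case (mult f g)
  then obtain K K' p q where *: "p \<in> box_polys D K" "\<forall>y\<in>coord_space D. f y = p y"
    "q \<in> box_polys D K'" "\<forall>y\<in>coord_space D. g y = q y" by blast
  have "\<forall>y\<in>coord_space D. f y * g y = p y * q y" using * by simp
  then show ?case using box_polys_mult[OF *(1,3)] by (intro exI conjI)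
qed

text \<open>An indexed family may repeat a member; a repetition gives the relation with coefficients
  1 and -1, and otherwise the independence bound for sets applies.\<close>

lemma family_dependent:
  fixes G :: "nat \<Rightarrow> 'x \<Rightarrow> complex"
  assumes "finite B" "card B < M" "\<And>a. a < M \<Longrightarrow> G a \<in> cfun.span B"
  shows "\<exists>c. (\<exists>a<M. c a \<noteq> 0) \<and> (\<forall>x. (\<Sum>a<M. c a * G a x) = 0)"
proof (cases "inj_on G {..<M}")
  case False
  then obtain a b where ab: "a < M" "b < M" "a \<noteq> b" "G a = G b" unfolding inj_on_def by blast
  let ?c = "\<lambda>k. if k = a then 1 else if k = b then -1 else 0 :: complex"
  have "(\<Sum>k<M. ?c k * G k x) = 0" for x
  proof -
    have "(\<Sum>k<M. ?c k * G k x) = (\<Sum>k\<in>{a, b}. ?c k * G k x)"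
      using ab by (intro sum.mono_neutral_right) auto
    then show ?thesis using ab by simp
  qed
  then show ?thesis using ab by (intro exI[of _ ?c]) auto
next
  case True
  have "cfun.dependent (G ` {..<M})"
  proof (rule ccontr)
    assume "\<not> cfun.dependent (G ` {..<M})"
    then have "card (G ` {..<M}) \<le> card B"
      using cfun.independent_span_bound[OF assms(1)] assms(3) by blast
    then show False using True assms(2) by (simp add: card_image)
  qed
  then obtain u v where u: "v \<in> G ` {..<M}" "u v \<noteq> 0" "(\<Sum>v\<in>G ` {..<M}. cscale (u v) v) = 0"
    using cfun.dependent_finite[of "G ` {..<M}"] by auto
  have "(\<Sum>a<M. u (G a) * G a x) = 0" for x
  proof -
    have "(\<Sum>a<M. cscale (u (G a)) (G a)) = 0" using u(3) True by (simp add: sum.reindex)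
    then have "(\<Sum>a<M. cscale (u (G a)) (G a)) x = 0" by simp
    then show ?thesis unfolding sum_fun_apply cscale_def .
  qed
  then show ?thesis using u by (intro exI[of _ "\<lambda>a. u (G a)"]) auto
qed

text \<open>This is the substitution x = p / h followed by multiplication with a power of h. The
  hypothesis x c * h y = p c y keeps division out of the induction; sums are brought over the
  product of the two denominators.\<close>

lemma polyfun_clear_denominator:
  fixes h :: "('j \<Rightarrow> complex) \<Rightarrow> complex"
  assumes "f \<in> polyfun" "h \<in> polyfun" "\<And>c. p c \<in> polyfun"
  shows "\<exists>e F. F \<in> polyfun \<and> (\<forall>x y. x \<in> coord_space C \<longrightarrow> (\<forall>c\<in>C. x c * h y = p c y) \<longrightarrow> f x * h y ^ e = F y)"
  using assms(1)
proof induction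
  case (const c)
  show ?case by (rule exI[of _ 0], rule exI, rule conjI[OF polyfun.const[of c]]) simp
next
  case (coord i)
  show ?case
  proof (cases "i \<in> C")
    case True
    show ?thesis by (rule exI[of _ 1], rule exI[of _ "p i"], rule conjI[OF assms(3)]) (use True in simp)
  next
    case False
    show ?thesis
      by (rule exI[of _ 0], rule exI[of _ "\<lambda>_. 0"], rule conjI[OF polyfun.const])
        (use False in \<open>simp add: coord_space_def\<close>)
  qed
next
  case (add f g)
  then obtain e F e' F' where *: "F \<in> polyfun" "F' \<in> polyfun"
    "\<And>x y. x \<in> coord_space C \<Longrightarrow> (\<forall>c\<in>C. x c * h y = p c y) \<Longrightarrow> f x * h y ^ e = F y"
    "\<And>x y. x \<in> coord_space C \<Longrightarrow> (\<forall>c\<in>C. x c * h y = p c y) \<Longrightarrow> g x * h y ^ e' = F' y" by blast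
  have "(f x + g x) * h y ^ (e + e') = F y * h y ^ e' + F' y * h y ^ e"
    if "x \<in> coord_space C" "\<forall>c\<in>C. x c * h y = p c y" for x y
    using *(3,4)[OF that, symmetric] by (simp add: algebra_simps power_add)
  moreover have "(\<lambda>y. F y * h y ^ e' + F' y * h y ^ e) \<in> polyfun"
    by (intro polyfun.add polyfun.mult polyfun_power * assms)
  ultimately show ?case by (intro exI conjI allI impI)
next
  case (mult f g)
  then obtain e F e' F' where *: "F \<in> polyfun" "F' \<in> polyfun"
    "\<And>x y. x \<in> coord_space C \<Longrightarrow> (\<forall>c\<in>C. x c * h y = p c y) \<Longrightarrow> f x * h y ^ e = F y"
    "\<And>x y. x \<in> coord_space C \<Longrightarrow> (\<forall>c\<in>C. x c * h y = p c y) \<Longrightarrow> g x * h y ^ e' = F' y" by blast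
  have "(f x * g x) * h y ^ (e + e') = F y * F' y"
    if "x \<in> coord_space C" "\<forall>c\<in>C. x c * h y = p c y" for x y
    using *(3,4)[OF that, symmetric] by (simp add: algebra_simps power_add)
  moreover have "(\<lambda>y. F y * F' y) \<in> polyfun" by (intro polyfun.mult *)
  ultimately show ?case by (intro exI conjI allI impI)
qed

text \<open>A digit j < L needs only h^(e j), but is padded to h^(e L). All monomials thus receive
  the same denominator h^(e L m) and can be added, while the degree bound stays linear in L.\<close>

lemma multi_mon_box_polys:
  assumes "\<And>i. i < m \<Longrightarrow> F i \<in> box_polys D K" "h \<in> box_polys D K" "k < L ^ m"
  shows "\<exists>G. G \<in> box_polys D (m * ((1 + e) * L * K)) \<and> (\<forall>y t. (\<forall>i<m. t i * h y ^ e = F i y) \<longrightarrow>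
    multi_mon L (\<lambda>i _. t i) m k y * h y ^ (e * L * m) = G y)"
  using assms(1,3)
proof (induction m arbitrary: k)
  case 0
  show ?case by (rule exI[of _ "\<lambda>_. 1"], rule conjI[OF box_polys_const]) simp
next
  case (Suc m)
  define j where "j = k div L ^ m"
  have L: "L > 0" using Suc.prems(2) by (cases L) auto
  have jL: "j < L" using Suc.prems(2) unfolding j_def by (simp add: less_mult_imp_div_less)
  have "k mod L ^ m < L ^ m" using L by simp
  then obtain G where G: "G \<in> box_polys D (m * ((1 + e) * L * K))"
    "\<And>y t. (\<forall>i<m. t i * h y ^ e = F i y) \<Longrightarrow> multi_mon L (\<lambda>i _. t i) m (k mod L ^ m) y * h y ^ (e * L * m) = G y"
    using Suc.IH[of "k mod L ^ m"] Suc.prems(1) by auto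
  let ?H = "\<lambda>y. (F m y ^ j * h y ^ (e * (L - j))) * G y"
  have "(\<lambda>y. F m y ^ j * h y ^ (e * (L - j))) \<in> box_polys D (j * K + e * (L - j) * K)"
    using Suc.prems(1) by (intro box_polys_mult box_polys_power assms(2)) auto
  moreover have "j * K + e * (L - j) * K \<le> (1 + e) * L * K"
  proof -
    have "e * (L - j) \<le> e * L" by (rule mult_le_mono2) simp
    then have "j + e * (L - j) \<le> L + e * L" using jL by linarith
    then have "(j + e * (L - j)) * K \<le> (L + e * L) * K" by (rule mult_le_mono1)
    then show ?thesis by (simp add: algebra_simps)
  qed
  ultimately have "(\<lambda>y. F m y ^ j * h y ^ (e * (L - j))) \<in> box_polys D ((1 + e) * L * K)"
    using box_polys_mono by blast
  from box_polys_mult[OF this G(1)] have "?H \<in> box_polys D (Suc m * ((1 + e) * L * K))" by simp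
  moreover have "multi_mon L (\<lambda>i _. t i) (Suc m) k y * h y ^ (e * L * Suc m) = ?H y"
    if *: "\<forall>i<Suc m. t i * h y ^ e = F i y" for y t
  proof -
    have "e * L = e * j + e * (L - j)" using jL by (simp add: add_mult_distrib2[symmetric])
    then have eq: "e * L * Suc m = e * j + e * (L - j) + e * L * m" by simp
    have "h y ^ (e * L * Suc m) = (h y ^ e) ^ j * h y ^ (e * (L - j)) * h y ^ (e * L * m)"
      unfolding eq power_add power_mult[of "h y" e j] ..
    then have "multi_mon L (\<lambda>i _. t i) (Suc m) k y * h y ^ (e * L * Suc m) =
      (t m ^ j * (h y ^ e) ^ j) * h y ^ (e * (L - j)) * (multi_mon L (\<lambda>i _. t i) m (k mod L ^ m) y * h y ^ (e * L * m))"
      unfolding j_def multi_mon.simps by (simp only: mult_ac)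
    also have "\<dots> = (t m * h y ^ e) ^ j * h y ^ (e * (L - j)) * (multi_mon L (\<lambda>i _. t i) m (k mod L ^ m) y * h y ^ (e * L * m))"
      unfolding power_mult_distrib ..
    also have "\<dots> = ?H y" using G(2)[of t y] * by simp
    finally show ?thesis .
  qed
  ultimately show ?case by (intro exI conjI allI impI)
qed

lemma multi_mon_eval: "multi_mon L f m k x = multi_mon L (\<lambda>i _. f i x) m k y"
  by (induction m arbitrary: k) auto

text \<open>Y has to be covered by the image of p / h, not equal to it. The parameters are indexed
  by the same type as the target, since a predicate cannot quantify over types.\<close>

definition rational_image :: "'i set \<Rightarrow> nat \<Rightarrow> ('i \<Rightarrow> complex) set \<Rightarrow> bool" where
  "rational_image C N Y \<longleftrightarrow> (\<exists>(D :: 'i set) h p. finite D \<and> card D \<le> N \<and> h \<in> polyfun \<and> (\<forall>c. p c \<in> polyfun) \<and>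
     (\<forall>x\<in>Y. \<exists>y\<in>coord_space D. h y \<noteq> 0 \<and> (\<forall>c\<in>C. x c * h y = p c y)))"

text \<open>Let d = card D < m. Over a common denominator the L^m monomials with exponents below L
  lie in a space of dimension at most (\<kappa> L + 1)^d, with \<kappa> independent of L. For large
  L this is smaller than L^m, and the resulting linear relation survives division by the power of
  h.\<close>

lemma rational_image_dependent:
  assumes Y: "rational_image C N Y" "Y \<subseteq> coord_space C" and f: "\<And>i. i < m \<Longrightarrow> f i \<in> polyfun" and m: "N < m"
  shows "\<exists>L c. L > 0 \<and> (\<exists>k<L ^ m. c k \<noteq> 0) \<and> (\<forall>x\<in>Y. (\<Sum>k<L ^ m. c k * multi_mon L f m k x) = 0)"
proof -
  obtain D h p where "finite (D :: 'a set) \<and> card D \<le> N \<and> h \<in> polyfun \<and> (\<forall>c. p c \<in> polyfun) \<and>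
     (\<forall>x\<in>Y. \<exists>y\<in>coord_space D. h y \<noteq> 0 \<and> (\<forall>c\<in>C. x c * h y = p c y))"
    using Y(1) unfolding rational_image_def by (elim exE)
  then have D: "finite D" "card D \<le> N" and h: "h \<in> polyfun" and p: "\<And>c. p c \<in> polyfun"
    and par: "\<And>x. x \<in> Y \<Longrightarrow> \<exists>y\<in>coord_space D. h y \<noteq> 0 \<and> (\<forall>c\<in>C. x c * h y = p c y)"
    by simp_all
  have "\<forall>i\<in>{..<m}. \<exists>e F. F \<in> polyfun \<and> (\<forall>x y. x \<in> coord_space C \<longrightarrow> (\<forall>c\<in>C. x c * h y = p c y) \<longrightarrow> f i x * h y ^ e = F y)"
    by (rule ballI, rule polyfun_clear_denominator) (simp_all add: f h p)
  from bchoice[OF this] obtain E where "\<forall>i\<in>{..<m}. \<exists>F. F \<in> polyfun \<and>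
    (\<forall>x y. x \<in> coord_space C \<longrightarrow> (\<forall>c\<in>C. x c * h y = p c y) \<longrightarrow> f i x * h y ^ E i = F y)" ..
  from bchoice[OF this] obtain F where "\<forall>i\<in>{..<m}. F i \<in> polyfun \<and>
    (\<forall>x y. x \<in> coord_space C \<longrightarrow> (\<forall>c\<in>C. x c * h y = p c y) \<longrightarrow> f i x * h y ^ E i = F i y)" ..
  then have EF: "\<And>i. i < m \<Longrightarrow> F i \<in> polyfun"
    "\<And>i x y. i < m \<Longrightarrow> x \<in> coord_space C \<Longrightarrow> (\<forall>c\<in>C. x c * h y = p c y) \<Longrightarrow> f i x * h y ^ E i = F i y"
    by simp_all
  define e where "e = (\<Sum>i<m. E i)"
  have Ee: "E i \<le> e" if "i < m" for i unfolding e_def using that by (intro member_le_sum) auto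
  \<comment> \<open>The individual exponents are raised to one common e, so that all f i have the
    denominator h^e.\<close>
  define F' where "F' i y = F i y * h y ^ (e - E i)" for i y
  have F'p: "F' i \<in> polyfun" if "i < m" for i
    unfolding F'_def using EF(1)[OF that] by (intro polyfun.mult polyfun_power h)
  have F'e: "f i x * h y ^ e = F' i y"
    if "i < m" "x \<in> coord_space C" "\<forall>c\<in>C. x c * h y = p c y" for i x y
  proof -
    have "h y ^ e = h y ^ E i * h y ^ (e - E i)" using Ee[OF that(1)] by (simp add: power_add[symmetric])
    then show ?thesis unfolding F'_def using EF(2)[OF that] by (simp add: mult.assoc[symmetric])
  qed
  have "\<forall>i\<in>{..<m}. \<exists>K q. q \<in> box_polys D K \<and> (\<forall>y\<in>coord_space D. F' i y = q y)"
    by (rule ballI, rule polyfun_box_polys[OF F'p D(1)]) simp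
  from bchoice[OF this] obtain KF where
    "\<forall>i\<in>{..<m}. \<exists>q. q \<in> box_polys D (KF i) \<and> (\<forall>y\<in>coord_space D. F' i y = q y)" ..
  from bchoice[OF this] obtain q where
    "\<forall>i\<in>{..<m}. q i \<in> box_polys D (KF i) \<and> (\<forall>y\<in>coord_space D. F' i y = q i y)" ..
  then have q: "\<And>i. i < m \<Longrightarrow> q i \<in> box_polys D (KF i)"
    "\<And>i y. i < m \<Longrightarrow> y \<in> coord_space D \<Longrightarrow> F' i y = q i y" by simp_all
  obtain Kh qh where qh: "qh \<in> box_polys D Kh" "\<forall>y\<in>coord_space D. h y = qh y"
    using polyfun_box_polys[OF h D(1)] by blast
  define K where "K = (\<Sum>i<m. KF i) + Kh"
  have qK: "q i \<in> box_polys D K" if "i < m" for i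
  proof -
    have "KF i \<le> (\<Sum>i<m. KF i)" using that by (intro member_le_sum) auto
    then have "KF i \<le> K" unfolding K_def by simp
    then show ?thesis using box_polys_mono q(1)[OF that] by blast
  qed
  have qhK: "qh \<in> box_polys D K" using box_polys_mono[of Kh K D] qh(1) unfolding K_def by auto
  define \<kappa> where "\<kappa> = m * ((1 + e) * K)"
  \<comment> \<open>With d = card D this gives (\<kappa> L + 1)^d \<le> ((\<kappa> + 1) L)^d < L^(d
    + 1) \<le> L^m.\<close>
  define L where "L = Suc ((Suc \<kappa>) ^ card D)"
  define B :: "(('a \<Rightarrow> complex) \<Rightarrow> complex) set"
    where "B = (\<lambda>\<beta> y. \<Prod>i\<in>D. y i ^ \<beta> i) ` (D \<rightarrow>\<^sub>E {..\<kappa> * L})"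
  have finB: "finite B" unfolding B_def using D(1) by (intro finite_imageI finite_PiE) auto
  have "card B \<le> card (D \<rightarrow>\<^sub>E {..\<kappa> * L})" unfolding B_def using D(1) by (intro card_image_le finite_PiE) auto
  also have "\<dots> = Suc (\<kappa> * L) ^ card D" using D(1) by (simp add: card_PiE)
  also have "\<dots> \<le> (Suc \<kappa> * L) ^ card D" unfolding L_def by (intro power_mono) auto
  also have "\<dots> = (Suc \<kappa>) ^ card D * L ^ card D" by (rule power_mult_distrib)
  also have "\<dots> < L * L ^ card D" unfolding L_def by simp
  also have "\<dots> = L ^ Suc (card D)" by simp
  also have "\<dots> \<le> L ^ m" using m D(2) unfolding L_def by (intro power_increasing) auto
  finally have card: "card B < L ^ m" .
  have "\<forall>k\<in>{..<L ^ m}. \<exists>G. G \<in> box_polys D (m * ((1 + e) * L * K)) \<and> (\<forall>y t. (\<forall>i<m. t i * qh y ^ e = q i y) \<longrightarrow>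
    multi_mon L (\<lambda>i _. t i) m k y * qh y ^ (e * L * m) = G y)"
    by (rule ballI, rule multi_mon_box_polys[OF qK qhK]) simp_all
  from bchoice[OF this] obtain G where "\<forall>k\<in>{..<L ^ m}. G k \<in> box_polys D (m * ((1 + e) * L * K)) \<and>
    (\<forall>y t. (\<forall>i<m. t i * qh y ^ e = q i y) \<longrightarrow> multi_mon L (\<lambda>i _. t i) m k y * qh y ^ (e * L * m) = G k y)" ..
  then have G: "\<And>k. k < L ^ m \<Longrightarrow> G k \<in> box_polys D (m * ((1 + e) * L * K))"
    "\<And>k y t. k < L ^ m \<Longrightarrow> (\<forall>i<m. t i * qh y ^ e = q i y) \<Longrightarrow>
      multi_mon L (\<lambda>i _. t i) m k y * qh y ^ (e * L * m) = G k y"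
    by simp_all
  have "m * ((1 + e) * L * K) = \<kappa> * L" unfolding \<kappa>_def by (simp add: algebra_simps)
  then have "G k \<in> cfun.span B" if "k < L ^ m" for k using G(1)[OF that] unfolding box_polys_def B_def by simp
  then obtain c where c: "\<exists>k<L ^ m. c k \<noteq> 0" "\<And>y. (\<Sum>k<L ^ m. c k * G k y) = 0"
    using family_dependent[OF finB card, of G] by blast
  have "(\<Sum>k<L ^ m. c k * multi_mon L f m k x) = 0" if x: "x \<in> Y" for x
  proof -
    obtain y where y: "y \<in> coord_space D" "h y \<noteq> 0" "\<forall>c\<in>C. x c * h y = p c y" using par[OF x] by blast
    have xC: "x \<in> coord_space C" using Y(2) x by blast
    have hq: "h y = qh y" using qh(2) y(1) by blast
    have "f i x * qh y ^ e = q i y" if "i < m" for i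
      using F'e[OF that xC y(3)] q(2)[OF that y(1)] hq by simp
    then have "multi_mon L (\<lambda>i _. f i x) m k y * qh y ^ (e * L * m) = G k y" if "k < L ^ m" for k
      using G(2)[OF that, of "\<lambda>i. f i x" y] by blast
    then have g: "multi_mon L f m k x * qh y ^ (e * L * m) = G k y" if "k < L ^ m" for k
      using that multi_mon_eval[of L f m k x y] by simp
    have "(\<Sum>k<L ^ m. c k * multi_mon L f m k x) * qh y ^ (e * L * m) = (\<Sum>k<L ^ m. c k * G k y)"
      unfolding sum_distrib_right using g by (intro sum.cong) (auto simp: mult.assoc)
    then show ?thesis using c(2)[of y] y(2) hq by simp
  qed
  then have "L > 0 \<and> (\<exists>k<L ^ m. c k \<noteq> 0) \<and> (\<forall>x\<in>Y. (\<Sum>k<L ^ m. c k * multi_mon L f m k x) = 0)"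
    using c(1) unfolding L_def by simp
  then show ?thesis by (rule exI[of _ c, THEN exI[of _ L]])
qed

text \<open>A chain of length m > N yields functions f i that vanish on Z i but not on Z (i + 1).
  Every piece of the cover satisfies some relation among them. The product of these relations
  vanishes on Z m, so by irreducibility one of them holds on all of Z m, contrary to
  \<open>multi_mon_independent\<close>.\<close>

lemma krull_dim_rational_image_le:
  fixes C :: "'i set"
  assumes Y: "Y \<subseteq> coord_space C" and E: "finite E" "Y \<subseteq> \<Union>E" and r: "\<And>S. S \<in> E \<Longrightarrow> rational_image C N (S \<inter> Y)"
  shows "krull_dim (subtopology (zar C) Y) \<le> enat N"
proof (rule krull_dim_le, rule ccontr)
  fix m Z assume Z: "\<And>i. i \<le> m \<Longrightarrow> irreducible_closedin (subtopology (zar C) Y) (Z i)"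
    and S: "\<And>i. i < m \<Longrightarrow> Z i \<subset> Z (Suc i)" and "\<not> enat m \<le> enat N"
  then have m: "N < m" by simp
  have irr: "poly_irreducible (Z i)" and cl: "closedin (subtopology (zar C) Y) (Z i)" if "i \<le> m" for i
    using Z[OF that] irreducible_closedin_zar[OF Y] by auto
  have ZY: "Z i \<subseteq> Y" if "i \<le> m" for i using closedin_subset[OF cl[OF that]] by auto
  have "\<forall>i\<in>{..<m}. \<exists>f. f \<in> polyfun \<and> (\<forall>z\<in>Z i. f z = 0) \<and> (\<exists>z\<in>Z (Suc i). f z \<noteq> 0)"
  proof
    fix i assume "i \<in> {..<m}"
    then have i: "i < m" by simp
    obtain z where z: "z \<in> Z (Suc i)" "z \<notin> Z i" using S[OF i] by blast
    have "z \<in> Y" "z \<in> coord_space C" using z(1) ZY[of "Suc i"] i Y by auto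
    then obtain f where "f \<in> polyfun" "\<forall>x\<in>Z i. f x = 0" "f z \<noteq> 0"
      using closedin_sub_zar_separate[OF cl[of i], of z] i z by auto
    then show "\<exists>f. f \<in> polyfun \<and> (\<forall>z\<in>Z i. f z = 0) \<and> (\<exists>z\<in>Z (Suc i). f z \<noteq> 0)" using z by blast
  qed
  from bchoice[OF this] obtain f where
    "\<forall>i\<in>{..<m}. f i \<in> polyfun \<and> (\<forall>z\<in>Z i. f i z = 0) \<and> (\<exists>z\<in>Z (Suc i). f i z \<noteq> 0)" ..
  then have f: "\<And>i. i < m \<Longrightarrow> f i \<in> polyfun" "\<And>i z. i < m \<Longrightarrow> z \<in> Z i \<Longrightarrow> f i z = 0"
    "\<And>i. i < m \<Longrightarrow> \<exists>z\<in>Z (Suc i). f i z \<noteq> 0" by simp_all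
  have "\<forall>T\<in>E. \<exists>L c. L > 0 \<and> (\<exists>k<L ^ m. c k \<noteq> 0) \<and> (\<forall>x\<in>T \<inter> Y. (\<Sum>k<L ^ m. c k * multi_mon L f m k x) = 0)"
  proof
    fix T assume "T \<in> E"
    have "T \<inter> Y \<subseteq> coord_space C" using Y by blast
    from rational_image_dependent[OF r[OF \<open>T \<in> E\<close>] this f(1) m]
    show "\<exists>L c. L > 0 \<and> (\<exists>k<L ^ m. c k \<noteq> 0) \<and> (\<forall>x\<in>T \<inter> Y. (\<Sum>k<L ^ m. c k * multi_mon L f m k x) = 0)" .
  qed
  from bchoice[OF this] obtain L where
    "\<forall>T\<in>E. \<exists>c. L T > 0 \<and> (\<exists>k<L T ^ m. c k \<noteq> 0) \<and> (\<forall>x\<in>T \<inter> Y. (\<Sum>k<L T ^ m. c k * multi_mon (L T) f m k x) = 0)" ..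
  from bchoice[OF this] obtain c where
    "\<forall>T\<in>E. L T > 0 \<and> (\<exists>k<L T ^ m. c T k \<noteq> 0) \<and> (\<forall>x\<in>T \<inter> Y. (\<Sum>k<L T ^ m. c T k * multi_mon (L T) f m k x) = 0)" ..
  then have Lc: "\<And>T. T \<in> E \<Longrightarrow> L T > (0::nat)" "\<And>T. T \<in> E \<Longrightarrow> \<exists>k<L T ^ m. c T k \<noteq> 0"
    "\<And>T x. T \<in> E \<Longrightarrow> x \<in> T \<inter> Y \<Longrightarrow> (\<Sum>k<L T ^ m. c T k * multi_mon (L T) f m k x) = 0"
    by simp_all
  define P where "P T x = (\<Sum>k<L T ^ m. c T k * multi_mon (L T) f m k x)" for T x
  have Pp: "P T \<in> polyfun" for T
    unfolding P_def by (intro polyfun_sum polyfun.mult[OF polyfun.const] polyfun_multi_mon f)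
  have "\<forall>z\<in>Z m. (\<Prod>T\<in>E. P T z) = 0"
  proof
    fix z assume "z \<in> Z m"
    then have "z \<in> Y" using ZY by blast
    then obtain T where "T \<in> E" "z \<in> T" using E by blast
    then show "(\<Prod>T\<in>E. P T z) = 0" using Lc(3)[of T z] \<open>z \<in> Y\<close> E(1) unfolding P_def by (intro prod_zero) auto
  qed
  then obtain T where T: "T \<in> E" "\<forall>z\<in>Z m. P T z = 0"
    using poly_irreducible_prod[OF irr[of m] E(1), of P] Pp by auto
  have "\<forall>k<L T ^ m. c T k = 0"
  proof (rule multi_mon_independent)
    show "Z i \<subseteq> Z (Suc i)" if "i < m" for i using S[OF that] by blast
  qed (use irr f Lc(1)[OF T(1)] T(2) in \<open>simp_all add: P_def\<close>)
  then show False using Lc(2)[OF T(1)] by blast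
qed

lemma krull_dim_zar:
  assumes "finite D"
  shows "krull_dim (zar D) = enat (card D)"
proof (rule antisym)
  have top: "subtopology (zar D) (coord_space D) = zar D" using subtopology_topspace[of "zar D"] by simp
  have "rational_image D (card D) (coord_space D \<inter> coord_space D)"
    unfolding rational_image_def
  proof (rule exI[of _ D], rule exI[of _ "\<lambda>_. 1"], rule exI[of _ "\<lambda>c y. y c"], intro conjI allI ballI)
    fix x assume "x \<in> coord_space D \<inter> coord_space D"
    then show "\<exists>y\<in>coord_space D. 1 \<noteq> (0::complex) \<and> (\<forall>c\<in>D. x c * 1 = y c)" by (intro bexI[of _ x]) auto
  qed (simp_all add: assms polyfun.const polyfun.coord)
  then show "krull_dim (zar D) \<le> enat (card D)"
    using krull_dim_rational_image_le[of "coord_space D" D "{coord_space D}" "card D"] top by simp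
  have "openin (zar D) (coord_space D)" using openin_topspace[of "zar D"] by simp
  moreover have "coord_space D \<noteq> {}" unfolding coord_space_def by auto
  ultimately show "enat (card D) \<le> krull_dim (zar D)"
    using krull_dim_open_ge[OF assms, of "coord_space D"] top by simp
qed


section \<open>Polynomial matrices\<close>

lemma polyfun_det:
  assumes "\<And>i j. i < k \<Longrightarrow> j < k \<Longrightarrow> (\<lambda>y. B i j y) \<in> polyfun"
  shows "(\<lambda>y. Determinant.det (Matrix.mat k k (\<lambda>(i, j). B i j y))) \<in> polyfun"
proof -
  have "Determinant.det (Matrix.mat k k (\<lambda>(i, j). B i j y)) =
      (\<Sum>p\<in>{p. p permutes {0..<k}}. signof p * (\<Prod>i = 0..<k. B i (p i) y))" for y
    unfolding Determinant.det_def
    by (auto intro!: sum.cong prod.cong simp: permutes_in_image[of _ "{0..<k}", simplified])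
  moreover have "(\<lambda>y. \<Sum>p\<in>{p. p permutes {0..<k}}. signof p * (\<Prod>i = 0..<k. B i (p i) y)) \<in> polyfun"
  proof (intro polyfun_sum polyfun.mult[OF polyfun.const] polyfun_prod)
    fix p i assume "p \<in> {p. p permutes {0..<k}}" "i \<in> {0..<k}"
    then show "B i (p i) \<in> polyfun"
      using assms[of i "p i"] permutes_in_image[of p "{0..<k}" i] by simp
  qed
  ultimately show ?thesis by simp
qed

lemma polyfun_cofactor:
  assumes B: "\<And>i j. i < k \<Longrightarrow> j < k \<Longrightarrow> (\<lambda>y. B i j y) \<in> polyfun" and "r < k" "c < k"
  shows "(\<lambda>y. cofactor (Matrix.mat k k (\<lambda>(i, j). B i j y)) r c) \<in> polyfun"
proof -
  define B' where "B' i j = B (if i < r then i else Suc i) (if j < c then j else Suc j)" for i j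
  have "mat_delete (Matrix.mat k k (\<lambda>(i, j). B i j y)) r c = Matrix.mat (k - 1) (k - 1) (\<lambda>(i, j). B' i j y)" for y
    by (rule eq_matI) (auto simp: mat_delete_def B'_def)
  moreover have "(\<lambda>y. (- 1) ^ (r + c) * Determinant.det (Matrix.mat (k - 1) (k - 1) (\<lambda>(i, j). B' i j y))) \<in> polyfun"
  proof (intro polyfun.mult[OF polyfun.const] polyfun_det)
    fix i j assume "i < k - 1" "j < k - 1"
    then show "B' i j \<in> polyfun" unfolding B'_def using B by simp
  qed
  ultimately show ?thesis unfolding cofactor_def by simp
qed

text \<open>A is the adjugate of the matrix with rows S and columns T, carried back from numbered
  rows and columns, and \<delta> is its determinant; both are polynomial in y. The last clause
  detects invertibility from a one-sided inverse by multiplicativity of the determinant.\<close>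

lemma polyfun_cramer:
  fixes H :: "'s \<Rightarrow> 't \<Rightarrow> ('i \<Rightarrow> complex) \<Rightarrow> complex"
  assumes S: "finite S" "card S = k" and T: "finite T" "card T = k"
    and H: "\<And>s t. s \<in> S \<Longrightarrow> t \<in> T \<Longrightarrow> H s t \<in> polyfun"
  obtains \<delta> A where "\<delta> \<in> polyfun" "\<And>t s. t \<in> T \<Longrightarrow> s \<in> S \<Longrightarrow> A t s \<in> polyfun"
    "\<And>y s s'. s \<in> S \<Longrightarrow> s' \<in> S \<Longrightarrow> (\<Sum>t\<in>T. H s t y * A t s' y) = (if s = s' then \<delta> y else 0)"
    "\<And>y t t'. t \<in> T \<Longrightarrow> t' \<in> T \<Longrightarrow> (\<Sum>s\<in>S. A t s y * H s t' y) = (if t = t' then \<delta> y else 0)"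
    "\<And>y X. (\<And>s s'. s \<in> S \<Longrightarrow> s' \<in> S \<Longrightarrow> (\<Sum>t\<in>T. H s t y * X t s') = (if s = s' then 1 else 0)) \<Longrightarrow> \<delta> y \<noteq> 0"
proof -
  obtain e where e: "bij_betw e {0..<k} S" using ex_bij_betw_nat_finite[OF S(1)] S(2) by blast
  obtain f where f: "bij_betw f {0..<k} T" using ex_bij_betw_nat_finite[OF T(1)] T(2) by blast
  let ?ei = "inv_into {0..<k} e" and ?fi = "inv_into {0..<k} f"
  have ei: "?ei s < k" "e (?ei s) = s" if "s \<in> S" for s
    using e that bij_betw_inv_into_right[OF e that] bij_betwE[OF bij_betw_inv_into[OF e]] by auto
  have fi: "?fi t < k" "f (?fi t) = t" if "t \<in> T" for t
    using f that bij_betw_inv_into_right[OF f that] bij_betwE[OF bij_betw_inv_into[OF f]] by auto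
  have eii: "?ei (e i) = i" "e i \<in> S" if "i < k" for i
    using bij_betw_inv_into_left[OF e, of i] bij_betwE[OF e] that by auto
  have fii: "?fi (f i) = i" "f i \<in> T" if "i < k" for i
    using bij_betw_inv_into_left[OF f, of i] bij_betwE[OF f] that by auto
  have eeq: "?ei s = ?ei s' \<longleftrightarrow> s = s'" if "s \<in> S" "s' \<in> S" for s s' using ei that by metis
  have feq: "?fi s = ?fi s' \<longleftrightarrow> s = s'" if "s \<in> T" "s' \<in> T" for s s' using fi that by metis
  define M where "M y = Matrix.mat k k (\<lambda>(i, j). H (e i) (f j) y)" for y
  have Mc: "M y \<in> carrier_mat k k" for y unfolding M_def by simp
  have adc: "adj_mat (M y) \<in> carrier_mat k k" for y using adj_mat(1)[OF Mc] .
  define \<delta> where "\<delta> y = Determinant.det (M y)" for y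
  define A where "A t s y = adj_mat (M y) $$ (?fi t, ?ei s)" for t s y
  have sumT: "(\<Sum>t\<in>T. g t) = (\<Sum>j = 0..<k. g (f j))" for g :: "'t \<Rightarrow> complex"
    using sum.reindex_bij_betw[OF f, of g] by simp
  have sumS: "(\<Sum>s\<in>S. g s) = (\<Sum>j = 0..<k. g (e j))" for g :: "'s \<Rightarrow> complex"
    using sum.reindex_bij_betw[OF e, of g] by simp
  have HB: "(\<lambda>y. H (e i) (f j) y) \<in> polyfun" if "i < k" "j < k" for i j
    using H eii(2) fii(2) that by simp
  show thesis
  proof (rule that)
    show "\<delta> \<in> polyfun" unfolding \<delta>_def M_def by (rule polyfun_det[OF HB])
    show "A t s \<in> polyfun" if "t \<in> T" "s \<in> S" for t s
    proof -
      have "A t s = (\<lambda>y. cofactor (M y) (?ei s) (?fi t))"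
      proof
        fix y
        have "dim_row (M y) = k" "dim_col (M y) = k" unfolding M_def by simp_all
        then show "A t s y = cofactor (M y) (?ei s) (?fi t)"
          unfolding A_def adj_mat_def using ei(1)[OF that(2)] fi(1)[OF that(1)] by simp
      qed
      moreover have "(\<lambda>y. cofactor (M y) (?ei s) (?fi t)) \<in> polyfun"
        unfolding M_def by (rule polyfun_cofactor[OF HB ei(1)[OF that(2)] fi(1)[OF that(1)]])
      ultimately show ?thesis by simp
    qed
    show "(\<Sum>t\<in>T. H s t y * A t s' y) = (if s = s' then \<delta> y else 0)" if s: "s \<in> S" "s' \<in> S" for y s s'
    proof -
      have "(\<Sum>t\<in>T. H s t y * A t s' y) = (\<Sum>j = 0..<k. M y $$ (?ei s, j) * adj_mat (M y) $$ (j, ?ei s'))"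
        unfolding sumT A_def M_def using ei[OF s(1)] fii by (intro sum.cong) auto
      also have "\<dots> = (M y * adj_mat (M y)) $$ (?ei s, ?ei s')"
        using Mc[of y] adc[of y] ei(1)[OF s(1)] ei(1)[OF s(2)] by (simp add: scalar_prod_def)
      also have "\<dots> = (if s = s' then \<delta> y else 0)"
        unfolding adj_mat(2)[OF Mc] \<delta>_def using ei(1)[OF s(1)] ei(1)[OF s(2)] eeq[OF s] by simp
      finally show ?thesis .
    qed
    show "(\<Sum>s\<in>S. A t s y * H s t' y) = (if t = t' then \<delta> y else 0)" if t: "t \<in> T" "t' \<in> T" for y t t'
    proof -
      have "(\<Sum>s\<in>S. A t s y * H s t' y) = (\<Sum>j = 0..<k. adj_mat (M y) $$ (?fi t, j) * M y $$ (j, ?fi t'))"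
        unfolding sumS A_def M_def using fi[OF t(2)] eii by (intro sum.cong) auto
      also have "\<dots> = (adj_mat (M y) * M y) $$ (?fi t, ?fi t')"
        using Mc[of y] adc[of y] fi(1)[OF t(1)] fi(1)[OF t(2)] by (simp add: scalar_prod_def)
      also have "\<dots> = (if t = t' then \<delta> y else 0)"
        unfolding adj_mat(3)[OF Mc] \<delta>_def using fi(1)[OF t(1)] fi(1)[OF t(2)] feq[OF t] by simp
      finally show ?thesis .
    qed
    fix y X assume X: "\<And>s s'. s \<in> S \<Longrightarrow> s' \<in> S \<Longrightarrow> (\<Sum>t\<in>T. H s t y * X t s') = (if s = s' then 1 else 0)"
    define N where "N = Matrix.mat k k (\<lambda>(i, j). X (f i) (e j))"
    have Nc: "N \<in> carrier_mat k k" unfolding N_def by simp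
    have "M y * N = 1\<^sub>m k"
    proof (rule eq_matI)
      fix i j assume "i < dim_row (1\<^sub>m k)" "j < dim_col (1\<^sub>m k)"
      then have ij: "i < k" "j < k" by auto
      have "(M y * N) $$ (i, j) = (\<Sum>l = 0..<k. M y $$ (i, l) * N $$ (l, j))"
        using Mc[of y] Nc ij by (simp add: scalar_prod_def)
      also have "\<dots> = (\<Sum>t\<in>T. H (e i) t y * X t (e j))"
        unfolding sumT M_def N_def using ij by (intro sum.cong) auto
      also have "\<dots> = (if i = j then 1 else 0)"
        using X[of "e i" "e j"] eii ij by (metis)
      finally show "(M y * N) $$ (i, j) = 1\<^sub>m k $$ (i, j)" using ij by simp
    qed (use Mc[of y] Nc in auto)
    then have "Determinant.det (M y) * Determinant.det N = 1"
      using det_mult[OF Mc[of y] Nc] by (simp add: det_one)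
    then show "\<delta> y \<noteq> 0" unfolding \<delta>_def by auto
  qed
qed


section \<open>Charts of the product of Grassmannians\<close>

lemma subset_tuplesD:
  assumes "J \<in> subset_tuples n" "k \<in> {1..n}"
  shows "J k \<subseteq> {1..n+1}" "card (J k) = k" "finite (J k)"
proof -
  show "J k \<subseteq> {1..n+1}" "card (J k) = k" using assms unfolding subset_tuples_def by auto
  then show "finite (J k)" using finite_subset by blast
qed

section \<open>Dimension of subspaces of coordinate spaces\<close>

lemma coord_space_subspace: "cfun.subspace (coord_space C)"
  unfolding cfun.subspace_def coord_space_def cscale_def by auto

lemma W_subspace: "cfun.subspace (W n)"
  unfolding W_def by (rule coord_space_subspace)

text \<open>Reading off the coordinates in D is an isomorphism from T onto the functions on D; the
  vectors supplied by the last hypothesis are the dual basis.\<close>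

lemma dim_eq_card_coords:
  assumes T: "cfun.subspace T" and D: "finite D"
    and inj: "\<And>v. v \<in> T \<Longrightarrow> (\<forall>c\<in>D. v c = 0) \<Longrightarrow> v = 0"
    and ex: "\<And>c. c \<in> D \<Longrightarrow> \<exists>v\<in>T. \<forall>d\<in>D. v d = (if d = c then 1 else 0)"
  shows "cfun.dim T = card D"
proof -
  have "\<forall>c\<in>D. \<exists>v. v \<in> T \<and> (\<forall>d\<in>D. v d = (if d = c then 1 else 0))"
    by (rule ballI) (rule ex[unfolded Bex_def])
  from bchoice[OF this] obtain v where "\<forall>c\<in>D. v c \<in> T \<and> (\<forall>d\<in>D. v c d = (if d = c then 1 else 0))" ..
  then have v: "\<And>c. c \<in> D \<Longrightarrow> v c \<in> T" "\<And>c d. c \<in> D \<Longrightarrow> d \<in> D \<Longrightarrow> v c d = (if d = c then 1 else 0)"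
    by auto
  have injv: "inj_on v D"
  proof (rule inj_onI)
    fix c d assume "c \<in> D" "d \<in> D" "v c = v d"
    then show "c = d" using v(2)[of c c] v(2)[of d c] by (auto split: if_splits)
  qed
  show ?thesis
  proof (rule cfun.dim_unique[of "v ` D"])
    show "v ` D \<subseteq> T" using v(1) by blast
    show "card (v ` D) = card D" by (rule card_image[OF injv])
    show "T \<subseteq> cfun.span (v ` D)"
    proof
      fix x assume x: "x \<in> T"
      define y where "y = (\<Sum>c\<in>D. cscale (x c) (v c))"
      have ys: "y \<in> cfun.span (v ` D)" unfolding y_def
        by (intro cfun.span_sum cfun.span_scale cfun.span_base) auto
      have "y \<in> T" unfolding y_def using T v(1) by (intro cfun.subspace_sum cfun.subspace_scale) auto
      then have "x - y \<in> T" using x T cfun.subspace_diff by blast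
      moreover have "(x - y) d = 0" if "d \<in> D" for d
      proof -
        have "y d = (\<Sum>c\<in>D. x c * v c d)" unfolding y_def sum_fun_apply cscale_def ..
        also have "\<dots> = (\<Sum>c\<in>D. if c = d then x c else 0)" using v(2) that by (intro sum.cong) auto
        also have "\<dots> = x d" using that D by (simp add: sum.delta)
        finally show ?thesis by simp
      qed
      ultimately have "x - y = 0" using inj by blast
      then show "x \<in> cfun.span (v ` D)" using ys by simp
    qed
    show "cfun.independent (v ` D)"
    proof
      assume "cfun.dependent (v ` D)"
      then obtain u x where u: "x \<in> v ` D" "u x \<noteq> 0" "(\<Sum>x\<in>v ` D. cscale (u x) x) = 0"
        using cfun.dependent_finite[of "v ` D"] D by auto
      then obtain d where d: "d \<in> D" "x = v d" by blast
      have "(\<Sum>c\<in>D. cscale (u (v c)) (v c)) = 0" using u(3) injv by (simp add: sum.reindex)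
      then have "(\<Sum>c\<in>D. cscale (u (v c)) (v c)) d = 0" by simp
      moreover have "(\<Sum>c\<in>D. cscale (u (v c)) (v c)) d = (\<Sum>c\<in>D. if c = d then u (v c) else 0)"
        unfolding sum_fun_apply cscale_def using v(2) d(1) by (intro sum.cong) auto
      ultimately show False using d u D by (simp add: sum.delta)
    qed
  qed
qed

lemma dim_coord_space: "finite C \<Longrightarrow> cfun.dim (coord_space C) = card C"
proof (rule dim_eq_card_coords[OF coord_space_subspace])
  fix v :: "'a \<Rightarrow> complex" assume "v \<in> coord_space C" "\<forall>c\<in>C. v c = 0"
  then show "v = 0" unfolding coord_space_def by (auto simp: fun_eq_iff)
next
  fix c assume "c \<in> C"
  then show "\<exists>v\<in>coord_space C. \<forall>d\<in>C. v d = (if d = c then 1 else 0)"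
    by (intro bexI[of _ "\<lambda>d. if d = c then 1 else 0"]) (auto simp: coord_space_def)
qed

text \<open>The ambient function space may be infinite-dimensional, so the finiteness of bases has
  to come from the finite coordinate set C.\<close>

lemma finite_basis_in_coord_space:
  assumes C: "finite C" and V: "V \<subseteq> coord_space (C :: 'i set)"
  obtains B where "finite B" "B \<subseteq> V" "cfun.independent B" "V \<subseteq> cfun.span B" "card B = cfun.dim V"
proof -
  define F :: "('i \<Rightarrow> complex) set" where "F = (\<lambda>c d. if d = c then 1 else 0) ` C"
  have "coord_space C \<subseteq> cfun.span F"
  proof
    fix x assume x: "x \<in> coord_space C"
    have "(\<Sum>c\<in>C. cscale (x c) (\<lambda>d. if d = c then 1 else 0)) \<in> cfun.span F"
      unfolding F_def by (intro cfun.span_sum cfun.span_scale cfun.span_base) auto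
    moreover have "(\<Sum>c\<in>C. cscale (x c) (\<lambda>d. if d = c then 1 else 0)) = x"
    proof
      fix d
      have "(\<Sum>c\<in>C. cscale (x c) (\<lambda>d. if d = c then 1 else 0)) d = (\<Sum>c\<in>C. if c = d then x c else 0)"
        unfolding sum_fun_apply cscale_def by (intro sum.cong) auto
      then show "(\<Sum>c\<in>C. cscale (x c) (\<lambda>d. if d = c then 1 else 0)) d = x d"
        using x C unfolding coord_space_def by (auto simp: sum.delta)
    qed
    ultimately show "x \<in> cfun.span F" by simp
  qed
  then have VF: "V \<subseteq> cfun.span F" using V by blast
  obtain B where B: "B \<subseteq> V" "cfun.independent B" "V \<subseteq> cfun.span B" "card B = cfun.dim V"
    using cfun.basis_exists[of V] by blast
  have "finite F" unfolding F_def using C by blast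
  then have "finite B" using cfun.independent_span_bound[OF _ B(2), of F] VF B(1) by blast
  then show thesis using that B by blast
qed

lemma dim_mono_coord_space:
  assumes "finite C" "V \<subseteq> coord_space C" "U \<subseteq> V"
  shows "cfun.dim U \<le> cfun.dim V"
proof -
  obtain B where B: "finite B" "B \<subseteq> V" "cfun.independent B" "V \<subseteq> cfun.span B" "card B = cfun.dim V"
    using finite_basis_in_coord_space[OF assms(1,2)] .
  have "U \<subseteq> coord_space C" using assms by blast
  then obtain A where A: "finite A" "A \<subseteq> U" "cfun.independent A" "U \<subseteq> cfun.span A" "card A = cfun.dim U"
    using finite_basis_in_coord_space[OF assms(1)] by metis
  have "A \<subseteq> cfun.span B" using A(2) assms(3) B(4) by blast
  then show ?thesis using cfun.independent_span_bound[OF B(1) A(3)] A(5) B(5) by simp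
qed

lemma subspace_eq_of_dim:
  assumes "finite C" "V \<subseteq> coord_space C" "U \<subseteq> V" "cfun.subspace U" and d: "cfun.dim V \<le> cfun.dim U"
  shows "U = V"
proof (rule ccontr)
  assume "U \<noteq> V"
  then obtain v where v: "v \<in> V" "v \<notin> U" using assms(3) by blast
  obtain B where B: "finite B" "B \<subseteq> V" "cfun.independent B" "V \<subseteq> cfun.span B" "card B = cfun.dim V"
    using finite_basis_in_coord_space[OF assms(1,2)] .
  have "U \<subseteq> coord_space C" using assms by blast
  then obtain A where A: "finite A" "A \<subseteq> U" "cfun.independent A" "U \<subseteq> cfun.span A" "card A = cfun.dim U"
    using finite_basis_in_coord_space[OF assms(1)] by metis
  have "cfun.span A \<subseteq> U" using cfun.span_minimal[OF A(2) assms(4)] .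
  then have va: "v \<notin> cfun.span A" using v by blast
  then have "cfun.independent (insert v A)" using A(3) by (rule cfun.independent_insertI)
  moreover have "insert v A \<subseteq> cfun.span B" using A(2) assms(3) B(4) v by blast
  ultimately have "card (insert v A) \<le> card B" using cfun.independent_span_bound[OF B(1)] by blast
  moreover have "v \<notin> A" using va cfun.span_base by blast
  ultimately show False using A(1,5) B(5) d by simp
qed

text \<open>The spans used by \<open>chart\<close>, rewritten as solution sets of linear equations:
  incidence between subspaces then becomes a polynomial identity in the entries of m.\<close>

definition graph_space :: "nat \<Rightarrow> nat set \<Rightarrow> (nat \<Rightarrow> nat \<Rightarrow> complex) \<Rightarrow> (nat \<Rightarrow> complex) set" where
  "graph_space n K m = {x \<in> W n. \<forall>l\<in>{1..n+1} - K. x l = (\<Sum>j\<in>K. x j * m l j)}"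

definition graph_vec :: "nat \<Rightarrow> nat set \<Rightarrow> (nat \<Rightarrow> nat \<Rightarrow> complex) \<Rightarrow> nat \<Rightarrow> nat \<Rightarrow> complex" where
  "graph_vec n K m j = (\<lambda>l. (if l = j then 1 else 0) + (if l \<in> {1..n+1} - K then m l j else 0))"

lemma W_iff: "x \<in> W n \<longleftrightarrow> (\<forall>i. i \<notin> {1..n+1} \<longrightarrow> x i = 0)"
  unfolding W_def coord_space_def by simp

lemma graph_space_subspace: "cfun.subspace (graph_space n K m)"
proof (rule cfun.subspaceI)
  show "0 \<in> graph_space n K m" unfolding graph_space_def W_iff by simp
next
  fix x y assume "x \<in> graph_space n K m" "y \<in> graph_space n K m"
  then show "x + y \<in> graph_space n K m"
    unfolding graph_space_def W_iff by (auto simp: algebra_simps sum.distrib)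
next
  fix c x assume "x \<in> graph_space n K m"
  then show "cscale c x \<in> graph_space n K m"
    unfolding graph_space_def W_iff cscale_def by (auto simp: algebra_simps sum_distrib_left)
qed

lemma graph_vec_coord: "i \<in> K \<Longrightarrow> graph_vec n K m j i = (if i = j then 1 else 0)"
  unfolding graph_vec_def by simp

lemma graph_vec_in:
  assumes "K \<subseteq> {1..n+1}" "j \<in> K"
  shows "graph_vec n K m j \<in> graph_space n K m"
proof -
  have fin: "finite K" using assms finite_subset by blast
  have "(\<Sum>i\<in>K. graph_vec n K m j i * m l i) = m l j" for l
  proof -
    have "(\<Sum>i\<in>K. graph_vec n K m j i * m l i) = (\<Sum>i\<in>K. if i = j then m l i else 0)"
      by (intro sum.cong refl) (auto simp: graph_vec_coord)
    then show ?thesis using assms(2) fin by (simp add: sum.delta)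
  qed
  moreover have "graph_vec n K m j \<in> W n" using assms unfolding W_iff graph_vec_def by auto
  moreover have "graph_vec n K m j l = m l j" if "l \<in> {1..n+1} - K" for l
    using that assms(2) unfolding graph_vec_def by auto
  ultimately show ?thesis unfolding graph_space_def by simp
qed

lemma graph_space_expand:
  assumes "K \<subseteq> {1..n+1}" "x \<in> graph_space n K m"
  shows "x l = (\<Sum>j\<in>K. x j * graph_vec n K m j l)"
proof -
  have fin: "finite K" using assms finite_subset by blast
  show ?thesis
  proof (cases "l \<in> {1..n+1} - K")
    case True
    then have "(\<Sum>j\<in>K. x j * graph_vec n K m j l) = (\<Sum>j\<in>K. x j * m l j)"
      by (intro sum.cong) (auto simp: graph_vec_def)
    then show ?thesis using assms(2) True unfolding graph_space_def by simp
  next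
    case False
    then have "(\<Sum>j\<in>K. x j * graph_vec n K m j l) = (\<Sum>j\<in>K. if j = l then x j else 0)"
      by (intro sum.cong) (auto simp: graph_vec_def)
    also have "\<dots> = (if l \<in> K then x l else 0)" using fin by (simp add: sum.delta)
    also have "\<dots> = x l" using False assms unfolding graph_space_def W_iff by auto
    finally show ?thesis ..
  qed
qed

lemma graph_space_span:
  assumes "K \<subseteq> {1..n+1}"
  shows "graph_space n K m = cfun.span (graph_vec n K m ` K)"
proof
  show "cfun.span (graph_vec n K m ` K) \<subseteq> graph_space n K m"
    using graph_vec_in[OF assms] by (intro cfun.span_minimal graph_space_subspace) auto
  show "graph_space n K m \<subseteq> cfun.span (graph_vec n K m ` K)"
  proof
    fix x assume x: "x \<in> graph_space n K m"
    have "x = (\<Sum>j\<in>K. cscale (x j) (graph_vec n K m j))"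
      by (rule ext) (simp only: sum_fun_apply cscale_def graph_space_expand[OF assms x, symmetric])
    moreover have "(\<Sum>j\<in>K. cscale (x j) (graph_vec n K m j)) \<in> cfun.span (graph_vec n K m ` K)"
      by (intro cfun.span_sum cfun.span_scale cfun.span_base) auto
    ultimately show "x \<in> cfun.span (graph_vec n K m ` K)" by simp
  qed
qed

lemma dim_graph_space:
  assumes "K \<subseteq> {1..n+1}"
  shows "cfun.dim (graph_space n K m) = card K"
proof (rule dim_eq_card_coords[OF graph_space_subspace])
  show "finite K" using assms finite_subset by blast
  show "v = 0" if "v \<in> graph_space n K m" "\<forall>c\<in>K. v c = 0" for v
  proof
    fix l
    have "v l = (\<Sum>j\<in>K. v j * graph_vec n K m j l)" by (rule graph_space_expand[OF assms that(1)])
    also have "\<dots> = 0" using that(2) by (intro sum.neutral) simp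
    finally show "v l = 0 l" by simp
  qed
  show "\<exists>v\<in>graph_space n K m. \<forall>d\<in>K. v d = (if d = c then 1 else 0)" if "c \<in> K" for c
    using graph_vec_in[OF assms that, of m] by (intro bexI) (auto simp: graph_vec_coord)
qed

lemma chart_eq:
  assumes "J \<in> subset_tuples n" "k \<in> {1..n}"
  shows "chart n J a k = graph_space n (J k) (\<lambda>l j. a (k, l, j))"
proof -
  have "w j + (\<Sum>i\<in>{1..n+1} - J k. cscale (a (k, i, j)) (w i)) = graph_vec n (J k) (\<lambda>l j. a (k, l, j)) j" for j
  proof
    fix l
    have "(\<Sum>i\<in>{1..n+1} - J k. cscale (a (k, i, j)) (w i)) l =
        (\<Sum>i\<in>{1..n+1} - J k. if i = l then a (k, i, j) else 0)"
      unfolding sum_fun_apply by (intro sum.cong) (auto simp: cscale_def w_def)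
    also have "\<dots> = (if l \<in> {1..n+1} - J k then a (k, l, j) else 0)" by (simp add: sum.delta)
    finally show "(w j + (\<Sum>i\<in>{1..n+1} - J k. cscale (a (k, i, j)) (w i))) l =
        graph_vec n (J k) (\<lambda>l j. a (k, l, j)) j l"
      unfolding graph_vec_def by (simp add: w_def)
  qed
  then show ?thesis
    unfolding chart_def graph_space_span[OF subset_tuplesD(1)[OF assms]] using assms(2) by simp
qed

lemma chart_extensional: "chart n J a \<in> extensional {1..n}"
  unfolding chart_def by simp

lemma graph_space_W: "graph_space n K m \<subseteq> W n"
  unfolding graph_space_def by auto

lemma chart_in_prod_Gr:
  assumes "J \<in> subset_tuples n"
  shows "chart n J a \<in> prod_Gr n"
  unfolding prod_Gr_def
proof (rule PiE_I)
  fix k assume k: "k \<in> {1..n}"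
  show "chart n J a k \<in> Gr n k"
    unfolding chart_eq[OF assms k] Gr_def
    using graph_space_subspace graph_space_W dim_graph_space subset_tuplesD[OF assms k] by auto
next
  fix k assume "k \<notin> {1..n}"
  then show "chart n J a k = undefined" by (rule extensional_arb[OF chart_extensional])
qed

lemma graph_space_eq_coeff:
  assumes "K \<subseteq> {1..n+1}" "graph_space n K m = graph_space n K m'" "l \<in> {1..n+1} - K" "j \<in> K"
  shows "m l j = m' l j"
proof -
  have "graph_vec n K m j \<in> graph_space n K m'" using graph_vec_in[OF assms(1,4)] assms(2) by metis
  from graph_space_expand[OF assms(1) this, of l]
  have "graph_vec n K m j l = (\<Sum>i\<in>K. graph_vec n K m j i * graph_vec n K m' i l)" .
  also have "\<dots> = (\<Sum>i\<in>K. if i = j then graph_vec n K m' i l else 0)"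
    by (intro sum.cong) (auto simp: graph_vec_coord)
  also have "\<dots> = graph_vec n K m' j l"
    using assms finite_subset[of K "{1..n+1}"] by (simp add: sum.delta)
  finally show ?thesis using assms(3,4) unfolding graph_vec_def by auto
qed

lemma inj_on_chart:
  assumes J: "J \<in> subset_tuples n"
  shows "inj_on (chart n J) (coord_space (chart_coords n J))"
proof (rule inj_onI, rule ext)
  fix a b :: "nat \<times> nat \<times> nat \<Rightarrow> complex" and c :: "nat \<times> nat \<times> nat" assume ab: "a \<in> coord_space (chart_coords n J)" "b \<in> coord_space (chart_coords n J)"
    and eq: "chart n J a = chart n J b"
  obtain k l j where c: "c = (k, l, j)" by (cases c)
  show "a c = b c"
  proof (cases "c \<in> chart_coords n J")
    case True
    then have k: "k \<in> {1..n}" and lj: "l \<in> {1..n+1} - J k" "j \<in> J k" unfolding c chart_coords_def by auto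
    have e: "graph_space n (J k) (\<lambda>l j. a (k, l, j)) = graph_space n (J k) (\<lambda>l j. b (k, l, j))"
      using eq chart_eq[OF J k] by metis
    show ?thesis unfolding c by (rule graph_space_eq_coeff[OF subset_tuplesD(1)[OF J k] e lj])
  next
    case False
    then show ?thesis using ab unfolding c coord_space_def by simp
  qed
qed

text \<open>\<delta> is the minor with rows K of the basis matrix of the graph over K'. It is
  nonzero exactly when the subspace is also a graph over K, and Cramer's rule then expresses the new
  coordinates with denominator \<delta>.\<close>

lemma graph_transition:
  fixes a :: "nat \<times> nat \<times> nat \<Rightarrow> complex"
  assumes K: "K \<subseteq> {1..n+1}" and K': "K' \<subseteq> {1..n+1}" and card: "card K = card K'"
  obtains \<delta> N where "\<delta> \<in> polyfun" "\<And>l s. N l s \<in> polyfun"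
    "\<And>a. \<delta> a \<noteq> 0 \<Longrightarrow> \<exists>m. graph_space n K m = graph_space n K' (\<lambda>l j. a (k, l, j))"
    "\<And>a m. graph_space n K m = graph_space n K' (\<lambda>l j. a (k, l, j)) \<Longrightarrow> \<delta> a \<noteq> 0"
    "\<And>a m l s. graph_space n K m = graph_space n K' (\<lambda>l j. a (k, l, j)) \<Longrightarrow> l \<in> {1..n+1} - K \<Longrightarrow> s \<in> K \<Longrightarrow>
      m l s * \<delta> a = N l s a"
proof -
  let ?u = "\<lambda>t i a. graph_vec n K' (\<lambda>l j. a (k, l, j)) t i"
  let ?G = "\<lambda>a. graph_space n K' (\<lambda>l j. a (k, l, j))"
  have fin: "finite K" "finite K'" using K K' finite_subset by blast+
  have up: "(\<lambda>a. ?u t i a) \<in> polyfun" for t i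
    unfolding graph_vec_def by (intro polyfun.add polyfun.const polyfun_if polyfun.coord)
  obtain \<delta> A where dA: "\<delta> \<in> polyfun" "\<And>t s. t \<in> K' \<Longrightarrow> s \<in> K \<Longrightarrow> A t s \<in> polyfun"
    "\<And>a s s'. s \<in> K \<Longrightarrow> s' \<in> K \<Longrightarrow> (\<Sum>t\<in>K'. ?u t s a * A t s' a) = (if s = s' then \<delta> a else 0)"
    "\<And>a t t'. t \<in> K' \<Longrightarrow> t' \<in> K' \<Longrightarrow> (\<Sum>s\<in>K. A t s a * ?u t' s a) = (if t = t' then \<delta> a else 0)"
    "\<And>a X. (\<And>s s'. s \<in> K \<Longrightarrow> s' \<in> K \<Longrightarrow> (\<Sum>t\<in>K'. ?u t s a * X t s') = (if s = s' then 1 else 0)) \<Longrightarrow> \<delta> a \<noteq> 0"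
    using polyfun_cramer[OF fin(1) refl fin(2) card[symmetric], of "\<lambda>s t. ?u t s"] up by blast
  define N where "N l s a = (if s \<in> K then (\<Sum>t\<in>K'. A t s a * ?u t l a) else 0)" for l s a
  show thesis
  proof (rule that)
    show "\<delta> \<in> polyfun" by (rule dA(1))
    show "N l s \<in> polyfun" for l s
    proof (cases "s \<in> K")
      case True
      then have "(\<lambda>a. \<Sum>t\<in>K'. A t s a * ?u t l a) \<in> polyfun"
        by (intro polyfun_sum polyfun.mult up dA(2))
      then show ?thesis unfolding N_def using True by simp
    next
      case False
      then show ?thesis unfolding N_def by (simp add: polyfun.const)
    qed
    show "\<exists>m. graph_space n K m = ?G a" if d: "\<delta> a \<noteq> 0" for a
    proof -
      define v where "v s = (\<Sum>t\<in>K'. cscale (A t s a / \<delta> a) (graph_vec n K' (\<lambda>l j. a (k, l, j)) t))" for s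
      have vG: "v s \<in> ?G a" for s unfolding v_def
        using graph_vec_in[OF K']
        by (intro cfun.subspace_sum cfun.subspace_scale graph_space_subspace) auto
      have vl: "v s l = (\<Sum>t\<in>K'. A t s a / \<delta> a * ?u t l a)" for s l
        unfolding v_def sum_fun_apply cscale_def ..
      have vs: "v s s' = (if s' = s then 1 else 0)" if "s \<in> K" "s' \<in> K" for s s'
      proof -
        have "v s s' = (\<Sum>t\<in>K'. ?u t s' a * A t s a) / \<delta> a"
          unfolding vl sum_divide_distrib by (intro sum.cong) auto
        then show ?thesis unfolding dA(3)[OF that(2,1)] using d by simp
      qed
      define m where "m l s = v s l" for l s
      have "graph_space n K m \<subseteq> ?G a"
      proof
        fix x assume x: "x \<in> graph_space n K m"
        have "x = (\<Sum>s\<in>K. cscale (x s) (v s))"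
        proof
          fix l
          have "graph_vec n K m s l = v s l" if s: "s \<in> K" for s
          proof -
            consider "l \<in> {1..n+1} - K" | "l \<in> K" | "l \<notin> {1..n+1}" by blast
            then show ?thesis
            proof cases
              case 1 then show ?thesis using s unfolding graph_vec_def m_def by auto
            next
              case 2 then show ?thesis using vs[OF s 2] graph_vec_coord[OF 2] by simp
            next
              case 3
              then have "v s l = 0" using vG[of s] unfolding graph_space_def W_iff by blast
              then show ?thesis using 3 s K unfolding graph_vec_def by auto
            qed
          qed
          then show "x l = (\<Sum>s\<in>K. cscale (x s) (v s)) l"
            using graph_space_expand[OF K x, of l] by (simp add: sum_fun_apply cscale_def)
        qed
        also have "\<dots> \<in> ?G a"
          using vG by (intro cfun.subspace_sum cfun.subspace_scale graph_space_subspace)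
        finally show "x \<in> ?G a" .
      qed
      then have "graph_space n K m = ?G a"
      proof (rule subspace_eq_of_dim[rotated 2])
        show "?G a \<subseteq> coord_space {1..n+1}" using graph_space_W unfolding W_def .
      qed (use dim_graph_space[OF K] dim_graph_space[OF K'] card graph_space_subspace in auto)
      then show ?thesis by blast
    qed
    have main: "(\<Sum>t\<in>K'. ?u t s' a * graph_vec n K m s t) = (if s' = s then 1 else 0)"
      "m l s = (\<Sum>t\<in>K'. graph_vec n K m s t * ?u t l a)"
      if eq: "graph_space n K m = ?G a" and s: "s \<in> K" "s' \<in> K" and l: "l \<in> {1..n+1} - K" for a m s s' l
    proof -
      have gG: "graph_vec n K m s \<in> ?G a" using graph_vec_in[OF K s(1), of m] eq by simp
      have ex: "graph_vec n K m s i = (\<Sum>t\<in>K'. graph_vec n K m s t * ?u t i a)" for i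
        by (rule graph_space_expand[OF K' gG])
      have "(\<Sum>t\<in>K'. ?u t s' a * graph_vec n K m s t) = graph_vec n K m s s'"
        unfolding ex[of s'] by (intro sum.cong) auto
      then show "(\<Sum>t\<in>K'. ?u t s' a * graph_vec n K m s t) = (if s' = s then 1 else 0)"
        using graph_vec_coord[OF s(2)] by simp
      have "graph_vec n K m s l = m l s" using l s unfolding graph_vec_def by auto
      then show "m l s = (\<Sum>t\<in>K'. graph_vec n K m s t * ?u t l a)" using ex[of l] by simp
    qed
    have main1: "(\<Sum>t\<in>K'. ?u t s' a * graph_vec n K m s t) = (if s' = s then 1 else 0)"
      if eq: "graph_space n K m = ?G a" and s: "s \<in> K" "s' \<in> K" for a m s s'
    proof -
      have gG: "graph_vec n K m s \<in> ?G a" using graph_vec_in[OF K s(1), of m] eq by simp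
      have "(\<Sum>t\<in>K'. ?u t s' a * graph_vec n K m s t) = graph_vec n K m s s'"
        unfolding graph_space_expand[OF K' gG, of s'] by (intro sum.cong) auto
      then show ?thesis using graph_vec_coord[OF s(2)] by simp
    qed
    show "\<delta> a \<noteq> 0" if eq: "graph_space n K m = ?G a" for a m
      by (rule dA(5)[of a "\<lambda>t s. graph_vec n K m s t"]) (rule main1[OF eq])
    show "m l s * \<delta> a = N l s a" if eq: "graph_space n K m = ?G a" and l: "l \<in> {1..n+1} - K" and s: "s \<in> K" for a m l s
    proof -
      have inv: "graph_vec n K m s t * \<delta> a = A t s a" if t: "t \<in> K'" for t
      proof -
        have "A t s a = (\<Sum>s'\<in>K. if s' = s then A t s' a else 0)" using s fin by (simp add: sum.delta)
        also have "\<dots> = (\<Sum>s'\<in>K. A t s' a * (\<Sum>t'\<in>K'. ?u t' s' a * graph_vec n K m s t'))"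
          using main1[OF eq s] by (intro sum.cong) auto
        also have "\<dots> = (\<Sum>t'\<in>K'. (\<Sum>s'\<in>K. A t s' a * ?u t' s' a) * graph_vec n K m s t')"
          unfolding sum_distrib_left sum_distrib_right by (subst sum.swap) (simp add: mult.assoc)
        also have "\<dots> = (\<Sum>t'\<in>K'. if t' = t then \<delta> a * graph_vec n K m s t' else 0)"
          using dA(4)[OF t] by (intro sum.cong) auto
        also have "\<dots> = \<delta> a * graph_vec n K m s t" using t fin by (simp add: sum.delta)
        finally show ?thesis by simp
      qed
      have "m l s * \<delta> a = (\<Sum>t\<in>K'. graph_vec n K m s t * \<delta> a * ?u t l a)"
        unfolding main(2)[OF eq s s l] sum_distrib_right by (intro sum.cong) auto
      also have "\<dots> = N l s a" unfolding N_def using inv s by (simp cong: sum.cong)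
      finally show ?thesis .
    qed
  qed
qed


text \<open>The minors of the n factors are multiplied into one common denominator, the form
  required by \<open>polyfun_clear_denominator\<close> and \<open>rational_image\<close>.\<close>

lemma chart_transition:
  assumes J: "J \<in> subset_tuples n" and J': "J' \<in> subset_tuples n"
  obtains \<delta> N where "\<delta> \<in> polyfun" "\<And>c. N c \<in> polyfun"
    "\<And>a. \<delta> a \<noteq> 0 \<Longrightarrow> \<exists>b\<in>coord_space (chart_coords n J). chart n J b = chart n J' a"
    "\<And>a b. chart n J b = chart n J' a \<Longrightarrow> \<delta> a \<noteq> 0"
    "\<And>a b c. chart n J b = chart n J' a \<Longrightarrow> c \<in> chart_coords n J \<Longrightarrow> b c * \<delta> a = N c a"
proof -
  define Q where "Q k \<delta> N \<longleftrightarrow> \<delta> \<in> polyfun \<and> (\<forall>l s. N l s \<in> polyfun) \<and>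
    (\<forall>a. \<delta> a \<noteq> 0 \<longrightarrow> (\<exists>m. graph_space n (J k) m = chart n J' a k)) \<and>
    (\<forall>a m. graph_space n (J k) m = chart n J' a k \<longrightarrow> \<delta> a \<noteq> 0 \<and>
      (\<forall>l\<in>{1..n+1} - J k. \<forall>s\<in>J k. m l s * \<delta> a = N l s a))"
    for k and \<delta> :: "(nat \<times> nat \<times> nat \<Rightarrow> complex) \<Rightarrow> complex"
      and N :: "nat \<Rightarrow> nat \<Rightarrow> (nat \<times> nat \<times> nat \<Rightarrow> complex) \<Rightarrow> complex"
  have "\<exists>\<delta> N. Q k \<delta> N" if k: "k \<in> {1..n}" for k
  proof -
    have card: "card (J k) = card (J' k)"
      using subset_tuplesD(2)[OF J k] subset_tuplesD(2)[OF J' k] by simp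
    show ?thesis
    proof (rule graph_transition[OF subset_tuplesD(1)[OF J k] subset_tuplesD(1)[OF J' k] card, where k = k], goal_cases)
      case (1 \<delta> N)
      then have "Q k \<delta> N" unfolding Q_def chart_eq[OF J' k] by simp
      then have "\<exists>N. Q k \<delta> N" by (rule exI[of _ N])
      then show ?case by (rule exI[of _ \<delta>])
    qed
  qed
  then have "\<forall>k\<in>{1..n}. \<exists>\<delta> N. Q k \<delta> N" by (rule ballI)
  from bchoice[OF this] obtain \<delta> where "\<forall>k\<in>{1..n}. \<exists>N. Q k (\<delta> k) N" ..
  from bchoice[OF this] obtain N where Q: "\<forall>k\<in>{1..n}. Q k (\<delta> k) (N k)" ..
  have dp: "\<delta> k \<in> polyfun" and Np: "N k l s \<in> polyfun" if "k \<in> {1..n}" for k l s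
    using Q that unfolding Q_def by simp_all
  have dk: "\<exists>m. graph_space n (J k) m = chart n J' a k" if "k \<in> {1..n}" "\<delta> k a \<noteq> 0" for k a
    using Q that unfolding Q_def by simp
  have Nk: "\<delta> k a \<noteq> 0" "\<And>l s. l \<in> {1..n+1} - J k \<Longrightarrow> s \<in> J k \<Longrightarrow> b (k, l, s) * \<delta> k a = N k l s a"
    if "k \<in> {1..n}" "chart n J b = chart n J' a" for k a b
  proof -
    have "graph_space n (J k) (\<lambda>l s. b (k, l, s)) = chart n J' a k"
      using that chart_eq[OF J that(1)] by metis
    moreover have "\<forall>a m. graph_space n (J k) m = chart n J' a k \<longrightarrow> \<delta> k a \<noteq> 0 \<and>
      (\<forall>l\<in>{1..n+1} - J k. \<forall>s\<in>J k. m l s * \<delta> k a = N k l s a)"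
      using Q[rule_format, OF that(1)] unfolding Q_def by (elim conjE)
    ultimately have "\<delta> k a \<noteq> 0 \<and> (\<forall>l\<in>{1..n+1} - J k. \<forall>s\<in>J k. b (k, l, s) * \<delta> k a = N k l s a)"
      by blast
    then show "\<delta> k a \<noteq> 0" "\<And>l s. l \<in> {1..n+1} - J k \<Longrightarrow> s \<in> J k \<Longrightarrow> b (k, l, s) * \<delta> k a = N k l s a"
      by simp_all
  qed
  define D where "D a = (\<Prod>k\<in>{1..n}. \<delta> k a)" for a
  define M where "M c a = (case c of (k, l, s) \<Rightarrow>
    if k \<in> {1..n} then (\<Prod>k'\<in>{1..n} - {k}. \<delta> k' a) * N k l s a else 0)" for c a
  show thesis
  proof (rule that[of D M])
    show "D \<in> polyfun" unfolding D_def by (intro polyfun_prod dp)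
    show "M c \<in> polyfun" for c
    proof -
      obtain k l s where c: "c = (k, l, s)" by (cases c)
      show ?thesis
      proof (cases "k \<in> {1..n}")
        case True
        then have "(\<lambda>a. (\<Prod>k'\<in>{1..n} - {k}. \<delta> k' a) * N k l s a) \<in> polyfun"
          by (intro polyfun.mult polyfun_prod dp Np) auto
        then show ?thesis using True unfolding M_def c by simp
      next
        case False
        have "M c = (\<lambda>a. 0)" using False unfolding M_def c by auto
        then show ?thesis by (simp add: polyfun.const)
      qed
    qed
    show "\<exists>b\<in>coord_space (chart_coords n J). chart n J b = chart n J' a" if "D a \<noteq> 0" for a
    proof -
      have "\<forall>k\<in>{1..n}. \<exists>m. graph_space n (J k) m = chart n J' a k"
        using that dk unfolding D_def by auto
      from bchoice[OF this] obtain m where m: "\<forall>k\<in>{1..n}. graph_space n (J k) (m k) = chart n J' a k" ..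
      define b where "b c = (if c \<in> chart_coords n J then case c of (k, l, s) \<Rightarrow> m k l s else 0)" for c
      have "chart n J b = chart n J' a"
      proof (rule extensionalityI[OF chart_extensional chart_extensional])
        fix k assume k: "k \<in> {1..n}"
        have "graph_space n (J k) (\<lambda>l s. b (k, l, s)) = graph_space n (J k) (m k)"
          unfolding graph_space_def b_def chart_coords_def using k
          by (intro Collect_cong conj_cong refl ball_cong arg_cong2[where f = "(=)"] sum.cong) auto
        then show "chart n J b k = chart n J' a k" using m k chart_eq[OF J k] by metis
      qed
      moreover have "b \<in> coord_space (chart_coords n J)" unfolding coord_space_def b_def by simp
      ultimately show ?thesis by blast
    qed
    show "D a \<noteq> 0" if "chart n J b = chart n J' a" for a b
      using Nk(1)[OF _ that] unfolding D_def by simp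
    show "b c * D a = M c a" if ch: "chart n J b = chart n J' a" and cc: "c \<in> chart_coords n J" for a b c
    proof -
      obtain k l s where c: "c = (k, l, s)" by (cases c)
      have k: "k \<in> {1..n}" and ls: "l \<in> {1..n+1} - J k" "s \<in> J k"
        using cc unfolding c chart_coords_def by auto
      have "D a = \<delta> k a * (\<Prod>k'\<in>{1..n} - {k}. \<delta> k' a)"
        unfolding D_def using k by (intro prod.remove) auto
      then have "b c * D a = (b (k, l, s) * \<delta> k a) * (\<Prod>k'\<in>{1..n} - {k}. \<delta> k' a)"
        unfolding c by simp
      also have "\<dots> = M c a" unfolding Nk(2)[OF k ch ls] M_def c using k by simp
      finally show ?thesis .
    qed
  qed
qed

text \<open>Seen from another chart, a point lies in the range of chart J iff \<delta> is nonzero,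
  and there each equation f of A becomes a polynomial g f up to a power of \<delta>. The complement
  of the image is therefore cut out by the products \<delta> * g f.\<close>

lemma zariski_open_chart:
  assumes J: "J \<in> subset_tuples n" and A: "algebraic_set (chart_coords n J) A"
  shows "zariski_open n (chart n J ` (coord_space (chart_coords n J) - A))"
  unfolding zariski_open_def
proof (intro conjI ballI)
  let ?U = "chart n J ` (coord_space (chart_coords n J) - A)"
  show "?U \<subseteq> prod_Gr n" using chart_in_prod_Gr[OF J] by blast
  fix J' assume J': "J' \<in> subset_tuples n"
  obtain \<delta> N where dN: "\<delta> \<in> polyfun" "\<And>c. N c \<in> polyfun"
    "\<And>a. \<delta> a \<noteq> 0 \<Longrightarrow> \<exists>b\<in>coord_space (chart_coords n J). chart n J b = chart n J' a"
    "\<And>a b. chart n J b = chart n J' a \<Longrightarrow> \<delta> a \<noteq> 0"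
    "\<And>a b c. chart n J b = chart n J' a \<Longrightarrow> c \<in> chart_coords n J \<Longrightarrow> b c * \<delta> a = N c a"
    using chart_transition[OF J J'] by blast
  obtain F where F: "F \<subseteq> polyfun" "A = zero_locus (chart_coords n J) F"
    using A unfolding algebraic_set_def by blast
  have "\<forall>f\<in>F. \<exists>e g. g \<in> polyfun \<and> (\<forall>x y. x \<in> coord_space (chart_coords n J) \<longrightarrow>
      (\<forall>c\<in>chart_coords n J. x c * \<delta> y = N c y) \<longrightarrow> f x * \<delta> y ^ e = g y)"
  proof
    fix f assume "f \<in> F"
    then have "f \<in> polyfun" using F by blast
    from polyfun_clear_denominator[OF this dN(1,2)]
    show "\<exists>e g. g \<in> polyfun \<and> (\<forall>x y. x \<in> coord_space (chart_coords n J) \<longrightarrow>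
      (\<forall>c\<in>chart_coords n J. x c * \<delta> y = N c y) \<longrightarrow> f x * \<delta> y ^ e = g y)" .
  qed
  from bchoice[OF this] obtain e where "\<forall>f\<in>F. \<exists>g. g \<in> polyfun \<and> (\<forall>x y. x \<in> coord_space (chart_coords n J) \<longrightarrow>
      (\<forall>c\<in>chart_coords n J. x c * \<delta> y = N c y) \<longrightarrow> f x * \<delta> y ^ e f = g y)" ..
  from bchoice[OF this] obtain g where g: "\<forall>f\<in>F. g f \<in> polyfun \<and> (\<forall>x y. x \<in> coord_space (chart_coords n J) \<longrightarrow>
      (\<forall>c\<in>chart_coords n J. x c * \<delta> y = N c y) \<longrightarrow> f x * \<delta> y ^ e f = g f y)" ..
  show "algebraic_set (chart_coords n J') (chart_preimage n J' (- ?U))"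
  proof (rule algebraic_setI[of "(\<lambda>f a. \<delta> a * g f a) ` F"])
    show "(\<lambda>f a. \<delta> a * g f a) ` F \<subseteq> polyfun"
    proof
      fix h assume "h \<in> (\<lambda>f a. \<delta> a * g f a) ` F"
      then obtain f where f: "f \<in> F" "h = (\<lambda>a. \<delta> a * g f a)" by (rule imageE) simp
      then have "g f \<in> polyfun" using g by simp
      then show "h \<in> polyfun" unfolding f(2) by (intro polyfun.mult dN(1))
    qed
    fix a
    have "chart n J' a \<in> ?U \<longleftrightarrow> (\<exists>f\<in>F. \<delta> a * g f a \<noteq> 0)" if a: "a \<in> coord_space (chart_coords n J')"
    proof (cases "\<delta> a = 0")
      case True
      then have "chart n J' a \<notin> ?U" using dN(4) by (metis imageE)
      then show ?thesis using True by simp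
    next
      case False
      then obtain b where b: "b \<in> coord_space (chart_coords n J)" "chart n J b = chart n J' a"
        using dN(3) by blast
      have "f b * \<delta> a ^ e f = g f a" if "f \<in> F" for f
        using g[rule_format, OF that] b(1) dN(5)[OF b(2)] by simp
      then have "(\<exists>f\<in>F. \<delta> a * g f a \<noteq> 0) \<longleftrightarrow> (\<exists>f\<in>F. f b \<noteq> 0)" using False by (metis mult_eq_0_iff power_eq_0_iff)
      also have "\<dots> \<longleftrightarrow> b \<notin> A" using b(1) unfolding F(2) zero_locus_def by simp
      also have "\<dots> \<longleftrightarrow> chart n J b \<in> ?U"
      proof
        assume "chart n J b \<in> ?U"
        then obtain b' where "b' \<in> coord_space (chart_coords n J)" "b' \<notin> A" "chart n J b = chart n J b'" by blast
        then show "b \<notin> A" using inj_onD[OF inj_on_chart[OF J]] b(1) by metis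
      qed (use b(1) in blast)
      finally show ?thesis using b(2) by simp
    qed
    then show "a \<in> chart_preimage n J' (- ?U) \<longleftrightarrow> a \<in> coord_space (chart_coords n J') \<and>
        (\<forall>f\<in>(\<lambda>f a. \<delta> a * g f a) ` F. f a = 0)"
      unfolding chart_preimage_def by auto
  qed
qed

lemma openin_chart_range:
  assumes "J \<in> subset_tuples n"
  shows "openin (zariski n) (chart n J ` coord_space (chart_coords n J))"
  using zariski_open_chart[OF assms algebraic_set_empty] unfolding openin_zariski by simp

lemma homeomorphic_chart:
  assumes J: "J \<in> subset_tuples n"
  shows "homeomorphic_map (zar (chart_coords n J))
    (subtopology (zariski n) (chart n J ` coord_space (chart_coords n J))) (chart n J)"
proof (rule bijective_open_imp_homeomorphic_map)
  let ?C = "coord_space (chart_coords n J)"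
  have sub: "chart n J ` ?C \<subseteq> topspace (zariski n)"
    by (rule openin_subset[OF openin_chart_range[OF J]])
  show "inj_on (chart n J) (topspace (zar (chart_coords n J)))" using inj_on_chart[OF J] by simp
  show top: "chart n J ` topspace (zar (chart_coords n J)) = topspace (subtopology (zariski n) (chart n J ` ?C))"
    using sub by auto
  show "continuous_map (zar (chart_coords n J)) (subtopology (zariski n) (chart n J ` ?C)) (chart n J)"
    unfolding continuous_map_def
  proof (intro conjI allI impI)
    show "chart n J \<in> topspace (zar (chart_coords n J)) \<rightarrow> topspace (subtopology (zariski n) (chart n J ` ?C))"
      using sub by auto
    fix V assume "openin (subtopology (zariski n) (chart n J ` ?C)) V"
    then obtain T where T: "zariski_open n T" "V = T \<inter> chart n J ` ?C"
      unfolding openin_subtopology openin_zariski by blast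
    have "?C - {x \<in> ?C. chart n J x \<in> V} = chart_preimage n J (- T)"
      unfolding T(2) chart_preimage_def by blast
    moreover have "algebraic_set (chart_coords n J) (chart_preimage n J (- T))"
      using T(1) J unfolding zariski_open_def by blast
    ultimately show "openin (zar (chart_coords n J)) {x \<in> topspace (zar (chart_coords n J)). chart n J x \<in> V}"
      unfolding openin_zar topspace_zar by auto
  qed
  show "open_map (zar (chart_coords n J)) (subtopology (zariski n) (chart n J ` ?C)) (chart n J)"
    unfolding open_map_def
  proof (intro allI impI)
    fix U assume "openin (zar (chart_coords n J)) U"
    then have U: "U \<subseteq> ?C" "algebraic_set (chart_coords n J) (?C - U)" unfolding openin_zar by auto
    have "?C - (?C - U) = U" using U(1) by blast
    then have "openin (zariski n) (chart n J ` U)"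
      using zariski_open_chart[OF J U(2)] unfolding openin_zariski by simp
    then show "openin (subtopology (zariski n) (chart n J ` ?C)) (chart n J ` U)"
      unfolding openin_open_subtopology[OF openin_chart_range[OF J]] using U(1) by auto
  qed
qed


section \<open>Tangent spaces and triangular systems of equations\<close>

text \<open>Testing against all differentiable curves, not only lines, builds in the chain rule: one
  functional serves both the lines in \<open>zariski_tangent\<close> and curves inside the
  variety.\<close>

definition is_differential :: "(('i \<Rightarrow> complex) \<Rightarrow> complex) \<Rightarrow> ('i \<Rightarrow> complex) \<Rightarrow> (('i \<Rightarrow> complex) \<Rightarrow> complex) \<Rightarrow> bool" where
  "is_differential f a \<phi> \<longleftrightarrow> (\<forall>u v. \<phi> (u + v) = \<phi> u + \<phi> v) \<and> (\<forall>c v. \<phi> (cscale c v) = c * \<phi> v) \<and>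
    (\<forall>\<gamma> v. \<gamma> 0 = a \<longrightarrow> (\<forall>i. ((\<lambda>t. \<gamma> t i) has_field_derivative v i) (at 0)) \<longrightarrow>
      ((\<lambda>t. f (\<gamma> t)) has_field_derivative \<phi> v) (at 0))"

lemma is_differentialD:
  assumes "is_differential f a \<phi>"
  shows "\<phi> (u + v) = \<phi> u + \<phi> v" "\<phi> (cscale c v) = c * \<phi> v"
    "\<gamma> 0 = a \<Longrightarrow> (\<And>i. ((\<lambda>t. \<gamma> t i) has_field_derivative v i) (at 0)) \<Longrightarrow>
      ((\<lambda>t. f (\<gamma> t)) has_field_derivative \<phi> v) (at 0)"
  using assms unfolding is_differential_def by simp_all

lemma polyfun_differential:
  assumes "f \<in> polyfun"
  shows "\<exists>\<phi>. is_differential f a \<phi>"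
  using assms
  proof induction
    case (const c)
    have *: "is_differential (\<lambda>a. c) a (\<lambda>v. 0)" unfolding is_differential_def by (intro conjI allI impI) simp_all
    show ?case by (rule exI) (rule *)
  next
    case (coord i)
    have *: "is_differential (\<lambda>a. a i) a (\<lambda>v. v i)" unfolding is_differential_def cscale_def
      by (intro conjI allI impI, simp, simp) (rule spec)
    show ?case by (rule exI) (rule *)
  next
    case (add f g)
    then obtain \<phi> m where lm: "is_differential f a \<phi>" "is_differential g a m" by (elim exE) (rule that)
    have *: "is_differential (\<lambda>x. f x + g x) a (\<lambda>v. \<phi> v + m v)" unfolding is_differential_def
    proof (intro conjI allI impI)
      fix u v show "\<phi> (u + v) + m (u + v) = \<phi> u + m u + (\<phi> v + m v)"
        by (simp only: is_differentialD(1)[OF lm(1)] is_differentialD(1)[OF lm(2)] add_ac)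
    next
      fix c v show "\<phi> (cscale c v) + m (cscale c v) = c * (\<phi> v + m v)"
        by (simp only: is_differentialD(2)[OF lm(1)] is_differentialD(2)[OF lm(2)] distrib_left)
    next
      fix \<gamma> :: "complex \<Rightarrow> 'a \<Rightarrow> complex" and v
      assume g: "\<gamma> 0 = a" "\<forall>i. ((\<lambda>t. \<gamma> t i) has_field_derivative v i) (at 0)"
      show "((\<lambda>t. f (\<gamma> t) + g (\<gamma> t)) has_field_derivative \<phi> v + m v) (at 0)"
        by (rule DERIV_add[OF is_differentialD(3)[OF lm(1) g(1) spec[OF g(2)]]
          is_differentialD(3)[OF lm(2) g(1) spec[OF g(2)]]])
    qed
    show ?case by (rule exI) (rule *)
  next
    case (mult f g)
    then obtain \<phi> m where lm: "is_differential f a \<phi>" "is_differential g a m" by (elim exE) (rule that)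
    have *: "is_differential (\<lambda>x. f x * g x) a (\<lambda>v. \<phi> v * g a + m v * f a)" unfolding is_differential_def
    proof (intro conjI allI impI)
      fix u v show "\<phi> (u + v) * g a + m (u + v) * f a = \<phi> u * g a + m u * f a + (\<phi> v * g a + m v * f a)"
        by (simp only: is_differentialD(1)[OF lm(1)] is_differentialD(1)[OF lm(2)] distrib_right add_ac)
    next
      fix c v show "\<phi> (cscale c v) * g a + m (cscale c v) * f a = c * (\<phi> v * g a + m v * f a)"
        by (simp only: is_differentialD(2)[OF lm(1)] is_differentialD(2)[OF lm(2)] distrib_left mult.assoc)
    next
      fix \<gamma> :: "complex \<Rightarrow> 'a \<Rightarrow> complex" and v
      assume g: "\<gamma> 0 = a" "\<forall>i. ((\<lambda>t. \<gamma> t i) has_field_derivative v i) (at 0)"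
      have "((\<lambda>t. f (\<gamma> t) * g (\<gamma> t)) has_field_derivative \<phi> v * g (\<gamma> 0) + m v * f (\<gamma> 0)) (at 0)"
        by (rule DERIV_mult[OF is_differentialD(3)[OF lm(1) g(1) spec[OF g(2)]]
          is_differentialD(3)[OF lm(2) g(1) spec[OF g(2)]]])
      then show "((\<lambda>t. f (\<gamma> t) * g (\<gamma> t)) has_field_derivative \<phi> v * g a + m v * f a) (at 0)"
        unfolding g(1) .
    qed
    show ?case by (rule exI) (rule *)
  qed

lemma has_field_derivative_line:
  "((\<lambda>t. (a + cscale t v) i) has_field_derivative v i) (at 0)"
  unfolding cscale_def plus_fun_def by (auto intro!: derivative_eq_intros)

lemma line_at_0: "a + cscale 0 v = a"
  unfolding cscale_def by (simp add: fun_eq_iff)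

lemma zariski_tangent_subspace: "cfun.subspace (zariski_tangent C Y a)"
proof -
  have lin: "deriv (\<lambda>t. f (a + cscale t 0)) 0 = 0"
    "deriv (\<lambda>t. f (a + cscale t (u + v))) 0 = deriv (\<lambda>t. f (a + cscale t u)) 0 + deriv (\<lambda>t. f (a + cscale t v)) 0"
    "deriv (\<lambda>t. f (a + cscale t (cscale c v))) 0 = c * deriv (\<lambda>t. f (a + cscale t v)) 0"
    if fp: "f \<in> polyfun" for f u v c
  proof -
    obtain \<phi> where \<phi>: "is_differential f a \<phi>" using polyfun_differential[OF fp] by blast
    note l = is_differentialD[OF \<phi>]
    have d: "deriv (\<lambda>t. f (a + cscale t v)) 0 = \<phi> v" for v
      by (rule DERIV_imp_deriv[OF l(3)[of "\<lambda>t. a + cscale t v", OF line_at_0 has_field_derivative_line]])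
    have "\<phi> 0 = 0" using l(2)[of 0 0] by (simp add: cscale_def zero_fun_def)
    then show "deriv (\<lambda>t. f (a + cscale t 0)) 0 = 0"
      "deriv (\<lambda>t. f (a + cscale t (u + v))) 0 = deriv (\<lambda>t. f (a + cscale t u)) 0 + deriv (\<lambda>t. f (a + cscale t v)) 0"
      "deriv (\<lambda>t. f (a + cscale t (cscale c v))) 0 = c * deriv (\<lambda>t. f (a + cscale t v)) 0"
      unfolding d l(1,2) by simp_all
  qed
  show ?thesis
  proof (rule cfun.subspaceI)
    show "0 \<in> zariski_tangent C Y a"
      unfolding zariski_tangent_def vanishing_ideal_def using lin(1) by (simp add: coord_space_def)
    fix u v assume "u \<in> zariski_tangent C Y a" "v \<in> zariski_tangent C Y a"
    then show "u + v \<in> zariski_tangent C Y a"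
      unfolding zariski_tangent_def vanishing_ideal_def using lin(2)
      by (simp add: cfun.subspace_add[OF coord_space_subspace])
  next
    fix c v assume "v \<in> zariski_tangent C Y a"
    then show "cscale c v \<in> zariski_tangent C Y a"
      unfolding zariski_tangent_def vanishing_ideal_def using lin(3)
      by (simp add: cfun.subspace_scale[OF coord_space_subspace])
  qed
qed

text \<open>A function in the ideal is constantly 0 along the curve, so its differential kills the
  velocity. This bounds tangent spaces from below without generators of the ideal.\<close>

lemma zariski_tangent_curve:
  assumes "\<And>t. \<gamma> t \<in> Y" "\<gamma> 0 = a" "\<And>i. ((\<lambda>t. \<gamma> t i) has_field_derivative v i) (at 0)" "v \<in> coord_space C"
  shows "v \<in> zariski_tangent C Y a"
  unfolding zariski_tangent_def
proof (intro CollectI conjI ballI)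
  fix f assume f: "f \<in> vanishing_ideal Y"
  then have fY: "f y = 0" if "y \<in> Y" for y using that unfolding vanishing_ideal_def by auto
  have fp: "f \<in> polyfun" using f unfolding vanishing_ideal_def by auto
  obtain \<phi> where \<phi>: "is_differential f a \<phi>" using polyfun_differential[OF fp] by blast
  note l = is_differentialD[OF \<phi>]
  have "((\<lambda>t. f (\<gamma> t)) has_field_derivative \<phi> v) (at 0)" by (rule l(3)[OF assms(2,3)])
  then have "((\<lambda>t. 0) has_field_derivative \<phi> v) (at (0::complex))" using fY[OF assms(1)] by simp
  then have "\<phi> v = 0" using DERIV_unique[OF _ DERIV_const] by blast
  moreover have "deriv (\<lambda>t. f (a + cscale t v)) 0 = \<phi> v"
    by (rule DERIV_imp_deriv[OF l(3)[of "\<lambda>t. a + cscale t v", OF line_at_0 has_field_derivative_line]])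
  ultimately show "deriv (\<lambda>t. f (a + cscale t v)) 0 = 0" by simp
qed (rule assms(4))

lemma continuous_map_zar:
  assumes "\<And>c. g c \<in> polyfun" "\<And>y. y \<in> coord_space D \<Longrightarrow> (\<lambda>c. g c y) \<in> coord_space C"
  shows "continuous_map (zar D) (zar C) (\<lambda>y c. g c y)"
  unfolding continuous_map_closedin
proof (intro conjI allI impI ballI)
  show "(\<lambda>y c. g c y) \<in> topspace (zar D) \<rightarrow> topspace (zar C)" using assms(2) by simp
  fix A assume "closedin (zar C) A"
  then obtain F where F: "F \<subseteq> polyfun" "A = zero_locus C F" unfolding closedin_zar algebraic_set_def by blast
  show "closedin (zar D) {y \<in> topspace (zar D). (\<lambda>c. g c y) \<in> A}"
    unfolding closedin_zar
  proof (rule algebraic_setI[of "(\<lambda>f y. f (\<lambda>c. g c y)) ` F"])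
    show "(\<lambda>f y. f (\<lambda>c. g c y)) ` F \<subseteq> polyfun"
    proof
      fix h assume "h \<in> (\<lambda>f y. f (\<lambda>c. g c y)) ` F"
      then obtain f where f: "f \<in> F" "h = (\<lambda>y. f (\<lambda>c. g c y))" by (rule imageE) simp
      then have "f \<in> polyfun" using F(1) by (simp add: subset_iff)
      then show "h \<in> polyfun" unfolding f(2) by (rule polyfun_compose[OF _ assms(1)])
    qed
  qed (use assms(2) in \<open>auto simp: F(2) zero_locus_def\<close>)
qed

section \<open>Graphs of polynomial maps over a coordinate space\<close>

definition restrict_coords :: "'i set \<Rightarrow> ('i \<Rightarrow> complex) \<Rightarrow> 'i \<Rightarrow> complex" where
  "restrict_coords D a = (\<lambda>c. if c \<in> D then a c else 0)"

text \<open>The coordinates in D are free, and the equation of c determines the coordinate c.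
  Triangularity is imposed semantically by \<open>dep\<close>: the value of p c depends only on
  coordinates of smaller rank, and on those outside C, which are 0 for solutions.\<close>

locale triangular_system =
  fixes C D :: "'i set" and p :: "'i \<Rightarrow> ('i \<Rightarrow> complex) \<Rightarrow> complex" and r :: "'i \<Rightarrow> nat"
  assumes fin: "finite C" and DC: "D \<subseteq> C"
    and poly: "\<And>c. c \<in> C - D \<Longrightarrow> p c \<in> polyfun"
    and dep: "\<And>c a b. c \<in> C - D \<Longrightarrow> (\<And>d. d \<in> C \<Longrightarrow> r d < r c \<Longrightarrow> a d = b d) \<Longrightarrow>
      (\<And>d. d \<notin> C \<Longrightarrow> a d = b d) \<Longrightarrow> p c a = p c b"
begin

definition solutions :: "('i \<Rightarrow> complex) set" where
  "solutions = {a \<in> coord_space C. \<forall>c\<in>C - D. a c = p c a}"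

definition step :: "('i \<Rightarrow> ('i \<Rightarrow> complex) \<Rightarrow> complex) \<Rightarrow> 'i \<Rightarrow> ('i \<Rightarrow> complex) \<Rightarrow> complex" where
  "step \<psi> c y = (if c \<in> D then y c else if c \<in> C then p c (\<lambda>d. \<psi> d y) else 0)"

text \<open>Repeated substitution starting from zero makes the coordinate c stable after r c + 1
  rounds, so once the number of rounds exceeds all ranks a polynomial fixed point is
  reached.\<close>

lemma param_exists:
  "\<exists>\<psi>. (\<forall>c. \<psi> c \<in> polyfun) \<and> (\<forall>c y. \<psi> c y = step \<psi> c y)"
proof -
  define \<psi> where "\<psi> N = (step ^^ N) (\<lambda>c y. 0)" for N
  have \<psi>0: "\<psi> 0 = (\<lambda>c y. 0)" and \<psi>S: "\<psi> (Suc N) = step (\<psi> N)" for N unfolding \<psi>_def by simp_all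
  have pf: "\<psi> N c \<in> polyfun" for N c
  proof (induction N arbitrary: c)
    case 0 show ?case unfolding \<psi>0 by (rule polyfun.const)
  next
    case (Suc N)
    consider "c \<in> D" | "c \<in> C - D" | "c \<notin> C" using DC by blast
    then show ?case
    proof cases
      case 1
      then have "\<psi> (Suc N) c = (\<lambda>y. y c)" unfolding \<psi>S step_def by auto
      then show ?thesis by (simp add: polyfun.coord)
    next
      case 2
      then have "\<psi> (Suc N) c = (\<lambda>y. p c (\<lambda>d. \<psi> N d y))" unfolding \<psi>S step_def by auto
      moreover have "(\<lambda>y. p c (\<lambda>d. \<psi> N d y)) \<in> polyfun" by (rule polyfun_compose[OF poly[OF 2] Suc.IH])
      ultimately show ?thesis by simp
    next
      case 3
      then have "c \<notin> D" using DC by blast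
      then have "\<psi> (Suc N) c = (\<lambda>y. 0)" unfolding \<psi>S step_def using 3 by (intro ext) simp
      then show ?thesis by (simp add: polyfun.const)
    qed
  qed
  have stable: "r c < N \<Longrightarrow> \<psi> (Suc N) c y = \<psi> N c y" for N c y
  proof (induction N arbitrary: c)
    case (Suc N)
    have out: "\<psi> M d y = 0" if "d \<notin> C" for M d
      using that DC by (cases M) (auto simp: \<psi>0 \<psi>S step_def)
    show ?case
    proof (cases "c \<in> C - D")
      case True
      have "p c (\<lambda>d. \<psi> (Suc N) d y) = p c (\<lambda>d. \<psi> N d y)"
        by (rule dep[OF True]) (use Suc out in auto)
      then show ?thesis using True unfolding \<psi>S[of "Suc N"] \<psi>S[of N] step_def by (simp add: \<psi>S step_def)
    next
      case False
      then show ?thesis unfolding \<psi>S step_def by auto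
    qed
  qed simp
  define N where "N = Suc (Max (insert 0 (r ` C)))"
  have N: "r c < N" if "c \<in> C" for c
    unfolding N_def using fin that by (simp add: less_Suc_eq_le)
  have "\<psi> N c y = step (\<psi> N) c y" for c y
  proof (cases "c \<in> C")
    case True then show ?thesis using stable[OF N[OF True], of y] unfolding \<psi>S by simp
  next
    case False
    then show ?thesis unfolding N_def \<psi>S step_def using DC by auto
  qed
  then show ?thesis using pf by blast
qed

definition param :: "'i \<Rightarrow> ('i \<Rightarrow> complex) \<Rightarrow> complex" where
  "param = (SOME \<psi>. (\<forall>c. \<psi> c \<in> polyfun) \<and> (\<forall>c y. \<psi> c y = step \<psi> c y))"

lemma param_poly: "param c \<in> polyfun"
  and param_step: "param c y = step param c y"
  using someI_ex[OF param_exists] unfolding param_def[symmetric] by blast+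

lemma param_solution: "(\<lambda>c. param c y) \<in> solutions"
  unfolding solutions_def coord_space_def
proof (intro CollectI conjI ballI allI impI)
  show "param c y = 0" if "c \<notin> C" for c using that DC param_step[of c y] unfolding step_def by auto
  show "param c y = p c (\<lambda>c. param c y)" if "c \<in> C - D" for c
    using that param_step[of c y] unfolding step_def by auto
qed

lemma param_D: "c \<in> D \<Longrightarrow> param c y = y c"
  using param_step[of c y] unfolding step_def by simp

lemma solution_param:
  assumes a: "a \<in> solutions"
  shows "a c = param c (restrict_coords D a)"
proof (induction "r c" arbitrary: c rule: less_induct)
  case less
  have out: "a d = 0" "param d (restrict_coords D a) = 0" if "d \<notin> C" for d
    using that a param_solution[of "restrict_coords D a"] unfolding solutions_def coord_space_def by auto
  consider "c \<in> D" | "c \<in> C - D" | "c \<notin> C" using DC by blast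
  then show ?case
  proof cases
    case 1 then show ?thesis unfolding param_D[OF 1] restrict_coords_def by simp
  next
    case 2
    have "a c = p c a" using a 2 unfolding solutions_def by blast
    also have "\<dots> = p c (\<lambda>d. param d (restrict_coords D a))"
      by (rule dep[OF 2]) (use less out in auto)
    also have "\<dots> = param c (restrict_coords D a)"
      using param_solution[of "restrict_coords D a"] 2 unfolding solutions_def by simp
    finally show ?thesis .
  next
    case 3 then show ?thesis using out by simp
  qed
qed

lemma homeomorphic_param:
  "homeomorphic_map (zar D) (subtopology (zar C) solutions) (\<lambda>y c. param c y)"
proof -
  have sub: "solutions \<subseteq> coord_space C" unfolding solutions_def by blast
  have "homeomorphic_maps (zar D) (subtopology (zar C) solutions) (\<lambda>y c. param c y) (restrict_coords D)"
    unfolding homeomorphic_maps_def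
  proof (intro conjI ballI)
    show "continuous_map (zar D) (subtopology (zar C) solutions) (\<lambda>y c. param c y)"
      unfolding continuous_map_in_subtopology
    proof
      show "continuous_map (zar D) (zar C) (\<lambda>y c. param c y)"
        by (rule continuous_map_zar[OF param_poly]) (use param_solution sub in blast)
      show "(\<lambda>y c. param c y) \<in> topspace (zar D) \<rightarrow> solutions" using param_solution by blast
    qed
    have "continuous_map (zar C) (zar D) (\<lambda>a c. if c \<in> D then a c else 0)"
      by (rule continuous_map_zar) (auto simp: coord_space_def intro!: polyfun_if polyfun.coord polyfun.const)
    then have "continuous_map (zar C) (zar D) (restrict_coords D)" unfolding restrict_coords_def .
    then show "continuous_map (subtopology (zar C) solutions) (zar D) (restrict_coords D)"
      by (rule continuous_map_from_subtopology)
    show "restrict_coords D (\<lambda>c. param c y) = y" if "y \<in> topspace (zar D)" for y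
      using that param_D unfolding restrict_coords_def topspace_zar coord_space_def by (auto simp: fun_eq_iff)
    show "(\<lambda>c. param c (restrict_coords D a)) = a" if "a \<in> topspace (subtopology (zar C) solutions)" for a
      using that solution_param[of a] by (intro ext) (simp del: restrict_coords_def)
  qed
  then show ?thesis using homeomorphic_map_maps by blast
qed

text \<open>The functions x c - \<open>param c (restrict_coords D x)\<close> lie in the ideal and
  force a tangent vector that vanishes on D to vanish. In the other direction, the images of
  coordinate lines under \<open>param\<close> are curves in the solution set whose velocities have
  the prescribed entries on D.\<close>

lemma dim_tangent:
  assumes a: "a \<in> solutions"
  shows "cfun.dim (zariski_tangent C solutions a) = card D"
proof (rule dim_eq_card_coords[OF zariski_tangent_subspace])
  show "finite D" using fin DC finite_subset by blast
  let ?y = "restrict_coords D a"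
  fix v assume v: "v \<in> zariski_tangent C solutions a" and vD: "\<forall>c\<in>D. v c = 0"
  have vC: "v \<in> coord_space C" using v unfolding zariski_tangent_def by blast
  show "v = 0"
  proof
    fix c
    consider "c \<in> D" | "c \<notin> C" | "c \<in> C - D" by blast
    then show "v c = 0 c"
    proof cases
      case 3
      define f where "f x = x c - param c (restrict_coords D x)" for x
      have "f \<in> vanishing_ideal solutions" unfolding vanishing_ideal_def
      proof (intro CollectI conjI ballI)
        show "f \<in> polyfun" unfolding f_def restrict_coords_def
          by (intro polyfun_diff polyfun.coord polyfun_compose[OF param_poly] polyfun_if polyfun.const)
        show "f x = 0" if "x \<in> solutions" for x
          using solution_param[OF that, of c] unfolding f_def by simp
      qed
      then have "deriv (\<lambda>t. f (a + cscale t v)) 0 = 0" using v unfolding zariski_tangent_def by blast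
      moreover have "f (a + cscale t v) = a c + t * v c - param c ?y" for t
      proof -
        have "restrict_coords D (a + cscale t v) = ?y" using vD unfolding restrict_coords_def cscale_def by auto
        then show ?thesis unfolding f_def by (simp add: cscale_def)
      qed
      moreover have "((\<lambda>t. a c + t * v c - param c ?y) has_field_derivative v c) (at 0)"
        by (auto intro!: derivative_eq_intros)
      ultimately show ?thesis using DERIV_imp_deriv by fastforce
    qed (use vD vC in \<open>auto simp: coord_space_def\<close>)
  qed
next
  let ?y = "restrict_coords D a"
  fix c assume c: "c \<in> D"
  define e where "e = (\<lambda>d. if d = c then 1 else 0 :: complex)"
  have "\<exists>D. ((\<lambda>t. param d (?y + cscale t e)) has_field_derivative D) (at 0)" for d
  proof -
    obtain \<phi> where \<phi>: "is_differential (param d) ?y \<phi>" using polyfun_differential[OF param_poly] by blast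
    note l = is_differentialD[OF \<phi>]
    from l(3)[of "\<lambda>t. ?y + cscale t e", OF line_at_0 has_field_derivative_line] show ?thesis by (rule exI)
  qed
  then have "\<forall>d. \<exists>D. ((\<lambda>t. param d (?y + cscale t e)) has_field_derivative D) (at 0)" by (rule allI)
  from choice[OF this] obtain v where
    v: "\<forall>d. ((\<lambda>t. param d (?y + cscale t e)) has_field_derivative v d) (at 0)" ..
  have vD: "v d = (if d = c then 1 else 0)" if "d \<in> D" for d
  proof -
    have "((\<lambda>t. (?y + cscale t e) d) has_field_derivative v d) (at 0)"
      using v[rule_format, of d] unfolding param_D[OF that] .
    from DERIV_unique[OF this has_field_derivative_line] show ?thesis unfolding e_def by simp
  qed
  have vC: "v \<in> coord_space C" unfolding coord_space_def
  proof (intro CollectI allI impI)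
    fix d assume "d \<notin> C"
    then have "param d y = 0" for y using param_solution[of y] unfolding solutions_def coord_space_def by blast
    then have "((\<lambda>t. 0) has_field_derivative v d) (at (0::complex))" using v[rule_format, of d] by simp
    then show "v d = 0" using DERIV_unique[OF _ DERIV_const] by blast
  qed
  have "v \<in> zariski_tangent C solutions a"
  proof (rule zariski_tangent_curve[where \<gamma> = "\<lambda>t d. param d (?y + cscale t e)"])
    show "(\<lambda>d. param d (?y + cscale t e)) \<in> solutions" for t by (rule param_solution)
    show "(\<lambda>d. param d (?y + cscale 0 e)) = a"
      unfolding line_at_0 using solution_param[OF a] by (intro ext) (rule sym)
  qed (use v vC in simp_all)
  then show "\<exists>v\<in>zariski_tangent C solutions a. \<forall>d\<in>D. v d = (if d = c then 1 else 0)"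
    using vD by blast
qed

end


section \<open>The equations of the degenerate flag variety\<close>

lemma admissible_subset: "admissible n S \<Longrightarrow> S \<in> subset_tuples n"
  unfolding admissible_def by simp

lemma admissible_step: "admissible n S \<Longrightarrow> k \<in> {1..<n} \<Longrightarrow> i \<in> S k \<Longrightarrow> i \<noteq> k + 1 \<Longrightarrow> i \<in> S (k + 1)"
  unfolding admissible_def by auto

text \<open>The step from k to k + 1 can lose only the index k + 1.\<close>

lemma admissible_stays:
  assumes "admissible n S" "1 \<le> k" "k \<le> k'" "k' \<le> n" "i \<in> S k" "i \<notin> {k<..k'}"
  shows "i \<in> S k'"
  using assms(3,4,6)
proof (induction rule: dec_induct)
  case base then show ?case using assms by simp
next
  case (step m)
  then show ?case using admissible_step[OF assms(1), of m i] assms(2) by auto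
qed

text \<open>The coordinate l of the incidence condition for the projected basis vector with label j
  at vertex k. The projection removes the left side when l = k + 1 and the linear term on the right
  when j = k + 1. Labels i in S k other than j do not enter, as that basis vector has coordinate 0
  there.\<close>

definition flag_eq :: "(nat \<Rightarrow> nat set) \<Rightarrow> (nat \<times> nat \<times> nat \<Rightarrow> complex) \<Rightarrow> nat \<Rightarrow> nat \<Rightarrow> nat \<Rightarrow> bool" where
  "flag_eq S a k l j \<longleftrightarrow> (if l = k + 1 then 0 else a (k, l, j)) =
     (if j = k + 1 then 0 else a (k + 1, l, j)) + (\<Sum>i\<in>S (k + 1) - S k - {k + 1}. a (k + 1, l, i) * a (k, i, j))"

lemma pr_sum: "pr k (\<Sum>j\<in>A. f j) = (\<Sum>j\<in>A. pr k (f j))"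
  by (rule ext) (simp add: pr_def sum_fun_apply)

lemma pr_cscale: "pr k (cscale c v) = cscale c (pr k v)"
  by (rule ext) (simp add: pr_def cscale_def)

lemma chart_in_deg_flag_iff:
  assumes S: "S \<in> subset_tuples n"
  shows "chart n S a \<in> deg_flag n \<longleftrightarrow> (\<forall>k\<in>{1..<n}. \<forall>j\<in>S k.
    pr (k + 1) (graph_vec n (S k) (\<lambda>l j. a (k, l, j)) j) \<in> chart n S a (k + 1))"
proof -
  have "pr (k + 1) ` chart n S a k \<subseteq> chart n S a (k + 1) \<longleftrightarrow>
    (\<forall>j\<in>S k. pr (k + 1) (graph_vec n (S k) (\<lambda>l j. a (k, l, j)) j) \<in> chart n S a (k + 1))"
    if k: "k \<in> {1..<n}" for k
  proof
    have k1: "k \<in> {1..n}" "k + 1 \<in> {1..n}" using k by auto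
    note K = subset_tuplesD(1)[OF S k1(1)]
    {
      assume "pr (k + 1) ` chart n S a k \<subseteq> chart n S a (k + 1)"
      then show "\<forall>j\<in>S k. pr (k + 1) (graph_vec n (S k) (\<lambda>l j. a (k, l, j)) j) \<in> chart n S a (k + 1)"
        using graph_vec_in[OF K] unfolding chart_eq[OF S k1(1)] by blast
    }
    assume *: "\<forall>j\<in>S k. pr (k + 1) (graph_vec n (S k) (\<lambda>l j. a (k, l, j)) j) \<in> chart n S a (k + 1)"
    show "pr (k + 1) ` chart n S a k \<subseteq> chart n S a (k + 1)"
    proof
      fix y assume "y \<in> pr (k + 1) ` chart n S a k"
      then obtain x where x: "x \<in> graph_space n (S k) (\<lambda>l j. a (k, l, j))" "y = pr (k + 1) x"
        unfolding chart_eq[OF S k1(1)] by blast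
      let ?g = "graph_vec n (S k) (\<lambda>l j. a (k, l, j))"
      have "x = (\<Sum>j\<in>S k. cscale (x j) (?g j))"
        by (rule ext) (simp only: sum_fun_apply cscale_def graph_space_expand[OF K x(1), symmetric])
      then have "pr (k + 1) x = pr (k + 1) (\<Sum>j\<in>S k. cscale (x j) (?g j))" by simp
      then have "y = (\<Sum>j\<in>S k. cscale (x j) (pr (k + 1) (?g j)))" unfolding x(2) pr_sum pr_cscale .
      also have "\<dots> \<in> chart n S a (k + 1)"
        using * unfolding chart_eq[OF S k1(2)]
        by (intro cfun.subspace_sum cfun.subspace_scale graph_space_subspace) auto
      finally show "y \<in> chart n S a (k + 1)" .
    qed
  qed
  then show ?thesis unfolding deg_flag_def using chart_in_prod_Gr[OF S] by simp
qed

lemma chart_in_deg_flag_eqs: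
  assumes S: "admissible n S"
  shows "chart n S a \<in> deg_flag n \<longleftrightarrow>
    (\<forall>k\<in>{1..<n}. \<forall>l\<in>{1..n+1} - S (k + 1). \<forall>j\<in>S k. flag_eq S a k l j)"
proof -
  have "pr (k + 1) (graph_vec n (S k) (\<lambda>l j. a (k, l, j)) j) \<in> chart n S a (k + 1) \<longleftrightarrow>
    (\<forall>l\<in>{1..n+1} - S (k + 1). flag_eq S a k l j)" if k: "k \<in> {1..<n}" and j: "j \<in> S k" for k j
  proof -
    have k1: "k \<in> {1..n}" "k + 1 \<in> {1..n}" using k by auto
    note S' = admissible_subset[OF S]
    note K = subset_tuplesD(1)[OF S' k1(1)]
    let ?g = "graph_vec n (S k) (\<lambda>l j. a (k, l, j)) j"
    have W: "pr (k + 1) ?g \<in> W n"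
      using graph_vec_in[OF K j] unfolding graph_space_def W_iff pr_def by auto
    have "(pr (k + 1) ?g) l = (\<Sum>i\<in>S (k + 1). (pr (k + 1) ?g) i * a (k + 1, l, i)) \<longleftrightarrow> flag_eq S a k l j"
      if l: "l \<in> {1..n+1} - S (k + 1)" for l
    proof -
      \<comment> \<open>Admissibility guarantees that the coordinate l of the basis vector is a
        matrix entry and not a pivot.\<close>
      have "l \<noteq> k + 1 \<Longrightarrow> l \<notin> S k" using admissible_step[OF S k, of l] l by auto
      then have 1: "(pr (k + 1) ?g) l = (if l = k + 1 then 0 else a (k, l, j))"
        using l j unfolding pr_def graph_vec_def by auto
      let ?D = "S (k + 1) - S k - {k + 1}"
      have fin: "finite (S (k + 1))" using subset_tuplesD(3)[OF S' k1(2)] .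
      have D: "(\<Sum>i\<in>?D. (pr (k + 1) ?g) i * a (k + 1, l, i)) = (\<Sum>i\<in>?D. a (k + 1, l, i) * a (k, i, j))"
      proof (rule sum.cong[OF refl])
        fix i assume i: "i \<in> ?D"
        then have "i \<in> {1..n+1}" "i \<noteq> j" using subset_tuplesD(1)[OF S' k1(2)] j by auto
        then show "(pr (k + 1) ?g) i * a (k + 1, l, i) = a (k + 1, l, i) * a (k, i, j)"
          using i unfolding pr_def graph_vec_def by simp
      qed
      have R: "(\<Sum>i\<in>S (k + 1) - ?D. (pr (k + 1) ?g) i * a (k + 1, l, i)) = (if j = k + 1 then 0 else a (k + 1, l, j))"
      proof -
        have "(\<Sum>i\<in>S (k + 1) - ?D. (pr (k + 1) ?g) i * a (k + 1, l, i)) =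
          (\<Sum>i\<in>S (k + 1) - ?D. if i = j then (if j = k + 1 then 0 else a (k + 1, l, j)) else 0)"
          by (intro sum.cong refl) (auto simp: pr_def graph_vec_def)
        also have "\<dots> = (if j \<in> S (k + 1) - ?D then (if j = k + 1 then 0 else a (k + 1, l, j)) else 0)"
          using fin by (simp add: sum.delta)
        also have "\<dots> = (if j = k + 1 then 0 else a (k + 1, l, j))"
          using j admissible_step[OF S k j] by auto
        finally show ?thesis .
      qed
      have "(\<Sum>i\<in>S (k + 1). (pr (k + 1) ?g) i * a (k + 1, l, i)) =
        (\<Sum>i\<in>S (k + 1) - ?D. (pr (k + 1) ?g) i * a (k + 1, l, i)) + (\<Sum>i\<in>?D. (pr (k + 1) ?g) i * a (k + 1, l, i))"
        by (rule sum.subset_diff[OF _ fin]) blast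
      then show ?thesis unfolding 1 D R flag_eq_def by simp
    qed
    then show ?thesis unfolding chart_eq[OF S' k1(2)] graph_space_def using W by simp
  qed
  then show ?thesis unfolding chart_in_deg_flag_iff[OF admissible_subset[OF S]] by blast
qed

lemma chart_preimage_deg_flag:
  assumes S: "admissible n S"
  shows "chart_preimage n S (deg_flag n) = {a \<in> coord_space (chart_coords n S).
    \<forall>k\<in>{1..<n}. \<forall>l\<in>{1..n+1} - S (k + 1). \<forall>j\<in>S k. flag_eq S a k l j}"
  unfolding chart_preimage_def chart_in_deg_flag_eqs[OF S] ..

section \<open>The points p_S and the number of equations\<close>

lemma finite_chart_coords:
  assumes "S \<in> subset_tuples n"
  shows "finite (chart_coords n S)"
proof (rule finite_subset)
  show "chart_coords n S \<subseteq> {1..n} \<times> {1..n+1} \<times> {1..n+1}"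
    unfolding chart_coords_def using subset_tuplesD(1)[OF assms] by auto
qed auto

lemma pt_eq_chart:
  assumes S: "S \<in> subset_tuples n"
  shows "pt n S = chart n S 0"
  unfolding pt_def chart_def
proof (intro restrict_ext)
  fix k
  have "w j + (\<Sum>i\<in>{1..n+1} - S k. cscale (0 (k, i, j)) (w i)) = w j" for j
    by (rule ext) (simp add: sum_fun_apply cscale_def)
  then show "cfun.span (w ` S k) =
    cfun.span ((\<lambda>j. w j + (\<Sum>i\<in>{1..n+1} - S k. cscale (0 (k, i, j)) (w i))) ` S k)" by simp
qed

text \<open>A graph over J contains vectors with coordinate 1 at each j in J, while vectors of p_S
  are supported in S. This settles the existential choice of chart in \<open>smooth_locus\<close> at
  p_S, and it also separates the cells.\<close>

lemma pt_only_chart: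
  assumes S: "S \<in> subset_tuples n" and J: "J \<in> subset_tuples n" and a: "a \<in> coord_space (chart_coords n J)"
    and eq: "chart n J a = pt n S"
  shows "J = S" "a = 0"
proof -
  have supp: "graph_vec n (J k) (\<lambda>l j. a (k, l, j)) j i = 0" if "k \<in> {1..n}" "j \<in> J k" "i \<notin> S k" for k j i
  proof -
    have "graph_vec n (J k) (\<lambda>l j. a (k, l, j)) j \<in> chart n J a k"
      unfolding chart_eq[OF J that(1)] by (rule graph_vec_in[OF subset_tuplesD(1)[OF J that(1)] that(2)])
    then have "graph_vec n (J k) (\<lambda>l j. a (k, l, j)) j \<in> graph_space n (S k) (\<lambda>l j. 0)"
      using chart_eq[OF S that(1), of 0] unfolding eq pt_eq_chart[OF S] by simp
    then show ?thesis using that(3) unfolding graph_space_def W_iff by (cases "i \<in> {1..n+1}") auto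
  qed
  have JS: "J k = S k" if k: "k \<in> {1..n}" for k
  proof (rule card_subset_eq[OF subset_tuplesD(3)[OF S k]])
    show "J k \<subseteq> S k"
    proof
      fix j assume j: "j \<in> J k"
      have "graph_vec n (J k) (\<lambda>l j. a (k, l, j)) j j = 1" using j graph_vec_coord by simp
      then show "j \<in> S k" using supp[OF k j, of j] by auto
    qed
    show "card (J k) = card (S k)" using subset_tuplesD(2)[OF S k] subset_tuplesD(2)[OF J k] by simp
  qed
  show "J = S"
  proof (rule extensionalityI[of _ "{1..n}"])
    show "J \<in> extensional {1..n}" "S \<in> extensional {1..n}"
      using J S unfolding subset_tuples_def PiE_def by auto
  qed (rule JS)
  show "a = 0"
  proof
    fix c :: "nat \<times> nat \<times> nat" obtain k l j where c: "c = (k, l, j)" by (cases c)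
    show "a c = 0 c"
    proof (cases "c \<in> chart_coords n J")
      case True
      then have k: "k \<in> {1..n}" and lj: "l \<in> {1..n+1} - J k" "j \<in> J k" unfolding c chart_coords_def by auto
      have "graph_vec n (J k) (\<lambda>l j. a (k, l, j)) j l = a (k, l, j)" using lj unfolding graph_vec_def by auto
      moreover have "l \<notin> S k" using lj JS[OF k] by blast
      ultimately show ?thesis using supp[OF k lj(2), of l] unfolding c by simp
    next
      case False
      then show ?thesis using a unfolding c coord_space_def by simp
    qed
  qed
qed

text \<open>Vertex k carries (n + 1 - k) k coordinates, and (n - k) k equations link it to k + 1;
  the surplus k sums to the expected dimension N.\<close>

lemma card_eqs: "card (chart_coords n S) = card {(k, l, j). k \<in> {1..<n} \<and> l \<in> {1..n+1} - S (k + 1) \<and> j \<in> S k} + n * (n + 1) div 2"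
  if S: "S \<in> subset_tuples n"
proof -
  have c1: "chart_coords n S = Sigma {1..n} (\<lambda>k. ({1..n+1} - S k) \<times> S k)" unfolding chart_coords_def by auto
  have c2: "{(k, l, j). k \<in> {1..<n} \<and> l \<in> {1..n+1} - S (k + 1) \<and> j \<in> S k} =
    Sigma {1..<n} (\<lambda>k. ({1..n+1} - S (k + 1)) \<times> S k)" by auto
  have cd: "card ({1..n+1} - S k) = n + 1 - k" if "k \<in> {1..n}" for k
    using subset_tuplesD[OF S that] by (simp add: card_Diff_subset)
  have "card (chart_coords n S) = (\<Sum>k\<in>{1..n}. (n + 1 - k) * k)"
    unfolding c1 using subset_tuplesD[OF S] cd by (subst card_SigmaI) (auto simp: card_cartesian_product)
  moreover have "card {(k, l, j). k \<in> {1..<n} \<and> l \<in> {1..n+1} - S (k + 1) \<and> j \<in> S k} = (\<Sum>k\<in>{1..<n}. (n - k) * k)"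
  proof -
    have "card (({1..n+1} - S (k + 1)) \<times> S k) = (n - k) * k" if "k \<in> {1..<n}" for k
      using cd[of "k + 1"] subset_tuplesD(2)[OF S, of k] that by (simp add: card_cartesian_product)
    then show ?thesis unfolding c2 using subset_tuplesD[OF S] by (subst card_SigmaI) auto
  qed
  moreover have "(\<Sum>k\<in>{1..n}. (n + 1 - k) * k) = (\<Sum>k\<in>{1..<n}. (n - k) * k) + n * (n + 1) div 2"
  proof -
    have "(\<Sum>k\<in>{1..n}. (n + 1 - k) * k) = (\<Sum>k\<in>{1..n}. (n - k) * k) + (\<Sum>k\<in>{1..n}. k)"
      unfolding sum.distrib[symmetric] by (intro sum.cong refl) (auto simp: Suc_diff_le)
    also have "(\<Sum>k\<in>{1..n}. (n - k) * k) = (\<Sum>k\<in>{1..<n}. (n - k) * k)"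
      by (rule sum.mono_neutral_right) auto
    also have "(\<Sum>k\<in>{1..n}. k) = n * (n + 1) div 2" using gauss_sum_from_Suc_0[of n, where 'a = nat] by simp
    finally show ?thesis .
  qed
  ultimately show ?thesis by simp
qed

section \<open>Tangent spaces at bad pairs\<close>

lemma dim_kernel_ge:
  fixes \<phi> :: "('i \<Rightarrow> complex) \<Rightarrow> complex"
  assumes "finite C" "V \<subseteq> coord_space C" "cfun.subspace V"
    and add: "\<And>u v. \<phi> (u + v) = \<phi> u + \<phi> v" and scale: "\<And>c v. \<phi> (cscale c v) = c * \<phi> v"
  shows "cfun.dim V \<le> cfun.dim {v \<in> V. \<phi> v = 0} + 1"
proof (cases "\<exists>v\<in>V. \<phi> v \<noteq> 0")
  case False
  then have "{v \<in> V. \<phi> v = 0} = V" by blast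
  then show ?thesis by simp
next
  case True
  then obtain v0 where v0: "v0 \<in> V" "\<phi> v0 \<noteq> 0" by blast
  define K where "K = {v \<in> V. \<phi> v = 0}"
  have "K \<subseteq> coord_space C" using assms(2) unfolding K_def by blast
  then obtain B where B: "finite B" "B \<subseteq> K" "cfun.independent B" "K \<subseteq> cfun.span B" "card B = cfun.dim K"
    using finite_basis_in_coord_space[OF assms(1)] by metis
  have "V \<subseteq> cfun.span (insert v0 B)"
  proof
    fix v assume v: "v \<in> V"
    define c where "c = - (\<phi> v / \<phi> v0)"
    have "v + cscale c v0 \<in> V" by (rule cfun.subspace_add[OF assms(3) v cfun.subspace_scale[OF assms(3) v0(1)]])
    moreover have "\<phi> (v + cscale c v0) = 0" unfolding add scale c_def using v0(2) by simp
    ultimately have "v + cscale c v0 \<in> K" unfolding K_def by simp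
    then have "v + cscale c v0 \<in> cfun.span B" using B(4) by blast
    then have 1: "v + cscale c v0 \<in> cfun.span (insert v0 B)" using cfun.span_mono[of B "insert v0 B"] by blast
    have "cscale c v0 \<in> cfun.span (insert v0 B)" by (intro cfun.span_scale cfun.span_base) simp
    from cfun.span_diff[OF 1 this] show "v \<in> cfun.span (insert v0 B)" by simp
  qed
  then have "cfun.dim V \<le> card (insert v0 B)" using B(1) by (intro cfun.dim_le_card) auto
  also have "\<dots> \<le> card B + 1" by (simp add: card_insert_if B(1))
  finally show ?thesis using B(5) unfolding K_def by simp
qed

lemma dim_kernels_ge:
  fixes \<phi> :: "'e \<Rightarrow> ('i \<Rightarrow> complex) \<Rightarrow> complex"
  assumes C: "finite C" and E: "finite E"
    and add: "\<And>e u v. \<phi> e (u + v) = \<phi> e u + \<phi> e v" and scale: "\<And>e c v. \<phi> e (cscale c v) = c * \<phi> e v"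
  shows "card C \<le> cfun.dim {v \<in> coord_space C. \<forall>e\<in>E. \<phi> e v = 0} + card E"
  using E
proof (induction E rule: finite_induct)
  case empty
  then show ?case using dim_coord_space[OF C] by simp
next
  case (insert e E)
  let ?V = "{v \<in> coord_space C. \<forall>e\<in>E. \<phi> e v = 0}"
  have z: "\<phi> e 0 = 0" for e using scale[of e 0 0] by (simp add: cscale_def zero_fun_def)
  have "cfun.subspace ?V"
    using coord_space_subspace[of C] unfolding cfun.subspace_def by (simp add: add scale z)
  then have "cfun.dim ?V \<le> cfun.dim {v \<in> ?V. \<phi> e v = 0} + 1"
    by (rule dim_kernel_ge[OF C _ _ add scale, rotated]) blast
  moreover have "{v \<in> ?V. \<phi> e v = 0} = {v \<in> coord_space C. \<forall>e\<in>insert e E. \<phi> e v = 0}" by auto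
  ultimately show ?case using insert by simp
qed

definition bad_pair :: "nat \<Rightarrow> (nat \<Rightarrow> nat set) \<Rightarrow> bool" where
  "bad_pair n S \<longleftrightarrow> (\<exists>l j. 2 \<le> l \<and> l \<le> j \<and> j \<le> n \<and> j \<in> S (l - 1) \<and> l \<notin> S j)"

definition eq_index :: "nat \<Rightarrow> (nat \<Rightarrow> nat set) \<Rightarrow> (nat \<times> nat \<times> nat) set" where
  "eq_index n S = {(k, l, j). k \<in> {1..<n} \<and> l \<in> {1..n+1} - S (k + 1) \<and> j \<in> S k}"

text \<open>The linear part of \<^term>\<open>flag_eq\<close>.\<close>

definition lin_eq :: "nat \<times> nat \<times> nat \<Rightarrow> (nat \<times> nat \<times> nat \<Rightarrow> complex) \<Rightarrow> complex" where
  "lin_eq = (\<lambda>(k, l, j) v. (if l = k + 1 then 0 else v (k, l, j)) - (if j = k + 1 then 0 else v (k + 1, l, j)))"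

text \<open>Linear equations link only coordinates with the same pair (l, j), so v splits into
  solutions u q, each supported on one pair q. A nonzero quadratic term of u q would need q = (l, i)
  = (i, j), hence a coordinate (k, j, j), which the chart does not have. Thus the whole line through
  u q satisfies the full equations.\<close>

lemma lin_solution_in_tangent:
  assumes S: "admissible n S" and v: "v \<in> coord_space (chart_coords n S)" "\<forall>e\<in>eq_index n S. lin_eq e v = 0"
  shows "v \<in> zariski_tangent (chart_coords n S) (chart_preimage n S (deg_flag n)) 0"
proof -
  let ?T = "zariski_tangent (chart_coords n S) (chart_preimage n S (deg_flag n)) 0"
  define u where "u q = (\<lambda>(k, l, j). if q = (l, j) then v (k, l, j) else 0)" for q
  have uC: "u q \<in> coord_space (chart_coords n S)" for q
    using v(1) unfolding u_def coord_space_def by auto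
  have "u q \<in> ?T" for q
  proof (rule zariski_tangent_curve[where \<gamma> = "\<lambda>t. cscale t (u q)"])
    fix t
    have "flag_eq S (cscale t (u q)) k l j"
      if k: "k \<in> {1..<n}" and l: "l \<in> {1..n+1} - S (k + 1)" and j: "j \<in> S k" for k l j
    proof -
      have "u q (k + 1, l, i) * u q (k, i, j) = 0" for i
      proof (rule ccontr)
        assume "\<not> ?thesis"
        then have "q = (l, i)" "q = (i, j)" "v (k, i, j) \<noteq> 0" unfolding u_def by (auto split: if_splits)
        then have "v (k, j, j) \<noteq> 0" by simp
        then show False using v(1) j unfolding coord_space_def chart_coords_def by blast
      qed
      then have q0: "(\<Sum>i\<in>S (k + 1) - S k - {k + 1}. cscale t (u q) (k + 1, l, i) * cscale t (u q) (k, i, j)) = 0"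
        by (intro sum.neutral) (auto simp: cscale_def)
      have "lin_eq (k, l, j) v = 0" using v(2) k l j unfolding eq_index_def by simp
      then show ?thesis unfolding flag_eq_def q0 by (simp add: lin_eq_def u_def cscale_def split: if_splits)
    qed
    moreover have "cscale t (u q) \<in> coord_space (chart_coords n S)"
      using uC coord_space_subspace cfun.subspace_scale by blast
    ultimately show "cscale t (u q) \<in> chart_preimage n S (deg_flag n)"
      unfolding chart_preimage_deg_flag[OF S] by blast
  next
    show "cscale 0 (u q) = 0" unfolding cscale_def by (simp add: fun_eq_iff)
    show "((\<lambda>t. cscale t (u q) i) has_field_derivative u q i) (at 0)" for i
      unfolding cscale_def by (auto intro!: derivative_eq_intros)
    show "u q \<in> coord_space (chart_coords n S)" by (rule uC)
  qed
  then have "(\<Sum>q\<in>{1..n+1} \<times> {1..n+1}. u q) \<in> ?T"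
    by (intro cfun.subspace_sum zariski_tangent_subspace)
  moreover have "(\<Sum>q\<in>{1..n+1} \<times> {1..n+1}. u q) = v"
  proof
    fix c :: "nat \<times> nat \<times> nat" obtain k l j where c: "c = (k, l, j)" by (cases c)
    have "(\<Sum>q\<in>{1..n+1} \<times> {1..n+1}. u q) c = (\<Sum>q\<in>{1..n+1} \<times> {1..n+1}. if q = (l, j) then v c else 0)"
      unfolding sum_fun_apply u_def c by simp
    also have "\<dots> = (if (l, j) \<in> {1..n+1} \<times> {1..n+1} then v c else 0)" by (rule sum.delta) simp
    also have "\<dots> = v c"
    proof (cases "c \<in> chart_coords n S")
      case True
      then have "k \<in> {1..n}" "l \<in> {1..n+1}" "j \<in> S k" unfolding c chart_coords_def by auto
      moreover from this have "j \<in> {1..n+1}" using subset_tuplesD(1)[OF admissible_subset[OF S], of k] by blast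
      ultimately show ?thesis by simp
    next
      case False
      then show ?thesis using v(1) unfolding c coord_space_def by simp
    qed
    finally show "(\<Sum>q\<in>{1..n+1} \<times> {1..n+1}. u q) c = v c" .
  qed
  ultimately show ?thesis by simp
qed

text \<open>For a bad pair \<open>(l, j)\<close> the linear equations \<open>(k, l, j)\<close>, \<open>l - 1 \<le> k < j\<close>, telescope to \<open>0 = 0\<close>, so one of
  them can be dropped when the dimension of their solution space is bounded from below.\<close>

lemma dim_tangent_bad:
  assumes S: "admissible n S" and bad: "bad_pair n S"
  shows "n * (n + 1) div 2 < cfun.dim (zariski_tangent (chart_coords n S) (chart_preimage n S (deg_flag n)) 0)"
proof -
  let ?C = "chart_coords n S" and ?E = "eq_index n S"
  note S' = admissible_subset[OF S]
  obtain l j where lj: "2 \<le> l" "l \<le> j" "j \<le> n" "j \<in> S (l - 1)" "l \<notin> S j"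
    using bad unfolding bad_pair_def by blast
  have jS: "j \<in> S k" if "l - 1 \<le> k" "k < j" for k
    by (rule admissible_stays[OF S _ that(1) _ lj(4)]) (use lj that in auto)
  have lS: "l \<notin> S k" if "l \<le> k" "k \<le> j" for k
    using admissible_stays[OF S _ that(2), of l] lj that by auto
  have l1: "l \<in> {1..n+1}" using lj by auto
  define e where "e = (l - 1, l, j)"
  have eE: "e \<in> ?E" unfolding e_def eq_index_def using lj l1 lS[of l] by auto
  have fC: "finite ?C" by (rule finite_chart_coords[OF S'])
  have fE: "finite ?E"
  proof (rule finite_subset)
    show "?E \<subseteq> {1..n} \<times> {1..n+1} \<times> {1..n+1}"
    proof
      fix x assume "x \<in> ?E"
      then obtain k l j where x: "x = (k, l, j)" "k \<in> {1..<n}" "l \<in> {1..n+1}" "j \<in> S k"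
        unfolding eq_index_def by blast
      then have "j \<in> {1..n+1}" using subset_tuplesD(1)[OF S', of k] by auto
      then show "x \<in> {1..n} \<times> {1..n+1} \<times> {1..n+1}" using x by auto
    qed
  qed auto
  have red: "lin_eq e v = 0" if v: "\<forall>e\<in>?E - {e}. lin_eq e v = 0" for v
  proof -
    have ch: "(if j = k + 1 then 0 else v (k + 1, l, j)) = v (k, l, j)" if "l \<le> k" "k < j" for k
    proof -
      have "(k, l, j) \<in> ?E - {e}" unfolding eq_index_def e_def using that lj l1 lS[of "k + 1"] jS[of k] by auto
      then have "lin_eq (k, l, j) v = 0" using v by blast
      then show ?thesis using that unfolding lin_eq_def by simp
    qed
    \<comment> \<open>The descent begins at k = j - 1, whose equation has no term at vertex j. The
      omitted equation at l - 1 has no term at vertex l - 1, so it reduces to the value at l just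
      shown to vanish, and to 0 = 0 when l = j.\<close>
    have "v (k, l, j) = 0" if "l \<le> k" "k < j" for k
      using that(2,1)
    proof (induction "j - k" arbitrary: k rule: less_induct)
      case less
      show ?case
      proof (cases "j = k + 1")
        case True then show ?thesis using ch[of k] less by simp
      next
        case False
        then have "v (k + 1, l, j) = 0" using less by simp
        then show ?thesis using ch[of k] less False by simp
      qed
    qed
    then have "l \<noteq> j \<Longrightarrow> v (l, l, j) = 0" using lj by simp
    then show ?thesis unfolding e_def lin_eq_def using lj by simp
  qed
  have "card ?C \<le> cfun.dim {v \<in> coord_space ?C. \<forall>e\<in>?E - {e}. lin_eq e v = 0} + card (?E - {e})"
  proof (rule dim_kernels_ge[OF fC])
    show "lin_eq e (u + v) = lin_eq e u + lin_eq e v" for e u v by (cases e) (simp add: lin_eq_def)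
    show "lin_eq e (cscale c v) = c * lin_eq e v" for e c v
      by (cases e) (simp add: lin_eq_def cscale_def algebra_simps)
  qed (use fE in simp)
  also have "card (?E - {e}) = card ?E - 1" using eE fE by simp
  finally have 1: "card ?C \<le> cfun.dim {v \<in> coord_space ?C. \<forall>e\<in>?E - {e}. lin_eq e v = 0} + (card ?E - 1)" .
  have "{v \<in> coord_space ?C. \<forall>e\<in>?E - {e}. lin_eq e v = 0} \<subseteq>
      zariski_tangent ?C (chart_preimage n S (deg_flag n)) 0"
    using lin_solution_in_tangent[OF S] red by blast
  then have 2: "cfun.dim {v \<in> coord_space ?C. \<forall>e\<in>?E - {e}. lin_eq e v = 0} \<le>
      cfun.dim (zariski_tangent ?C (chart_preimage n S (deg_flag n)) 0)"
    by (intro dim_mono_coord_space[OF fC]) (auto simp: zariski_tangent_def)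
  have "card ?E > 0" using eE fE by (auto simp: card_gt_0_iff)
  moreover have "card ?C = card ?E + n * (n + 1) div 2" unfolding eq_index_def by (rule card_eqs[OF S'])
  ultimately show ?thesis using 1 2 by linarith
qed

lemma bad_pair_not_smooth:
  assumes S: "admissible n S" and bad: "bad_pair n S"
    and le: "local_krull_dim (subtopology (zariski n) (deg_flag n)) (pt n S) \<le> enat (n * (n + 1) div 2)"
  shows "pt n S \<notin> smooth_locus n"
proof
  assume "pt n S \<in> smooth_locus n"
  then obtain J a where J: "J \<in> subset_tuples n" "a \<in> coord_space (chart_coords n J)" "chart n J a = pt n S"
    "enat (cfun.dim (zariski_tangent (chart_coords n J) (chart_preimage n J (deg_flag n)) a)) =
       local_krull_dim (subtopology (zariski n) (deg_flag n)) (pt n S)"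
    unfolding smooth_locus_def by blast
  have "J = S" "a = 0" using pt_only_chart[OF admissible_subset[OF S] J(1-3)] .
  then have "enat (cfun.dim (zariski_tangent (chart_coords n S) (chart_preimage n S (deg_flag n)) 0)) \<le> enat (n * (n + 1) div 2)"
    using J(4) le by simp
  then show False using dim_tangent_bad[OF S bad] by simp
qed


section \<open>Echelon form in the cyclic order\<close>

text \<open>The cyclic order \<open>k+1 < k+2 < \<dots> < n+1 < 1 < \<dots> < k\<close>: with respect to it the component at vertex \<open>k\<close> of every
  element of the group is triangular.\<close>

definition below :: "nat \<Rightarrow> nat \<Rightarrow> nat \<Rightarrow> bool" where
  "below k l j \<longleftrightarrow> (if k < j then k < l \<and> l < j else k < l \<or> l < j)"

definition cyc_rank :: "nat \<Rightarrow> nat \<Rightarrow> nat \<Rightarrow> nat" where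
  "cyc_rank n k i = (if k < i then i else i + n + 1)"

lemma below_irrefl: "\<not> below k j j"
  unfolding below_def by auto

lemma below_trans: "below k i l \<Longrightarrow> below k l j \<Longrightarrow> below k i j"
  unfolding below_def by (auto split: if_splits)

lemma below_total: "l \<noteq> j \<Longrightarrow> below k l j \<or> below k j l"
  unfolding below_def by (auto split: if_splits)

lemma below_asym: "below k l j \<Longrightarrow> \<not> below k j l"
  using below_trans below_irrefl by blast

lemma below_rank: "l \<in> {1..n+1} \<Longrightarrow> j \<in> {1..n+1} \<Longrightarrow> below k l j \<longleftrightarrow> cyc_rank n k l < cyc_rank n k j"
  unfolding below_def cyc_rank_def by auto

text \<open>Passing to vertex k + 1 moves the index k + 1 from the bottom to the top of the cyclic
  order and keeps the order of all others.\<close>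

lemma below_Suc: "below k l j \<Longrightarrow> l \<noteq> k + 1 \<Longrightarrow> j \<noteq> k + 1 \<Longrightarrow> below (k + 1) l j"
  unfolding below_def by (auto split: if_splits)

lemma below_bottom: "\<not> below k l (k + 1)"
  unfolding below_def by auto

definition leads :: "nat \<Rightarrow> (nat \<Rightarrow> complex) \<Rightarrow> nat \<Rightarrow> bool" where
  "leads k x j \<longleftrightarrow> x j \<noteq> 0 \<and> (\<forall>m. x m \<noteq> 0 \<longrightarrow> m = j \<or> below k m j)"

lemma leads_exists:
  assumes "x \<in> W n" "x \<noteq> 0"
  shows "\<exists>j\<in>{1..n+1}. leads k x j"
proof -
  define A where "A = {m. x m \<noteq> 0}"
  have A: "A \<subseteq> {1..n+1}" using assms(1) unfolding A_def W_iff by auto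
  then have fin: "finite A" using finite_subset by blast
  have "A \<noteq> {}" using assms(2) unfolding A_def by (auto simp: fun_eq_iff)
  then have "Max (cyc_rank n k ` A) \<in> cyc_rank n k ` A" using fin by simp
  then obtain j where j: "j \<in> A" "cyc_rank n k j = Max (cyc_rank n k ` A)" by auto
  have "m = j \<or> below k m j" if "m \<in> A" for m
  proof (rule ccontr)
    assume "\<not> ?thesis"
    then have "below k j m" using below_total[of m j k] by blast
    then have "cyc_rank n k j < cyc_rank n k m" using below_rank[of j n m k] A that j(1) by blast
    then show False using j(2) fin that by (metis Max_ge finite_imageI imageI leD)
  qed
  then show ?thesis using j(1) A unfolding leads_def A_def by auto
qed

text \<open>Gaussian elimination along the cyclic order: K is the set of leading indices, and by
  induction on the order a vector leading at j is normalised and cleared at the smaller pivots. A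
  vector of V vanishing on K has no possible leading index, so the reduced vectors span V.\<close>

lemma echelon_graph:
  assumes V: "cfun.subspace V" "V \<subseteq> W n" and K: "K \<subseteq> {1..n+1}"
    and l1: "\<And>x. x \<in> V \<Longrightarrow> x \<noteq> 0 \<Longrightarrow> \<exists>j\<in>K. leads k x j"
    and l2: "\<And>j. j \<in> K \<Longrightarrow> \<exists>x\<in>V. leads k x j"
  shows "\<exists>m. V = graph_space n K m \<and> (\<forall>l j. l \<notin> K \<longrightarrow> j \<in> K \<longrightarrow> \<not> below k l j \<longrightarrow> m l j = 0)"
proof -
  have fin: "finite K" using K finite_subset by blast
  have ex: "\<exists>u. u \<in> V \<and> (\<forall>i\<in>K. u i = (if i = j then 1 else 0)) \<and> leads k u j" if "j \<in> K" for j
    using that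
  proof (induction "cyc_rank n k j" arbitrary: j rule: less_induct)
    case less
    obtain x where x: "x \<in> V" "leads k x j" using l2[OF less.prems] by blast
    define y where "y = cscale (1 / x j) x"
    have yV: "y \<in> V" unfolding y_def using V(1) x(1) by (rule cfun.subspace_scale)
    have yj: "y j = 1" and yl: "leads k y j" using x(2) unfolding y_def leads_def cscale_def by auto
    define B where "B = {i \<in> K. below k i j}"
    have "\<forall>i\<in>B. \<exists>u. u \<in> V \<and> (\<forall>i'\<in>K. u i' = (if i' = i then 1 else 0)) \<and> leads k u i"
    proof
      fix i assume "i \<in> B"
      then have iK: "i \<in> K" "below k i j" unfolding B_def by auto
      then have "i \<in> {1..n+1}" "j \<in> {1..n+1}" using K less.prems by blast+
      then have "i \<in> K" "cyc_rank n k i < cyc_rank n k j" using below_rank[of i n j k] iK by blast+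
      then show "\<exists>u. u \<in> V \<and> (\<forall>i'\<in>K. u i' = (if i' = i then 1 else 0)) \<and> leads k u i" using less.hyps by blast
    qed
    from bchoice[OF this] obtain u where
      "\<forall>i\<in>B. u i \<in> V \<and> (\<forall>i'\<in>K. u i i' = (if i' = i then 1 else 0)) \<and> leads k (u i) i" ..
    then have u: "\<And>i. i \<in> B \<Longrightarrow> u i \<in> V" "\<And>i i'. i \<in> B \<Longrightarrow> i' \<in> K \<Longrightarrow> u i i' = (if i' = i then 1 else 0)"
      "\<And>i. i \<in> B \<Longrightarrow> leads k (u i) i" by simp_all
    define z where "z = y - (\<Sum>i\<in>B. cscale (y i) (u i))"
    have fB: "finite B" unfolding B_def using fin by simp
    have zi: "z i = y i - (\<Sum>i'\<in>B. y i' * u i' i)" for i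
      unfolding z_def by (simp add: sum_fun_apply cscale_def)
    have zV: "z \<in> V" unfolding z_def
      by (intro cfun.subspace_diff[OF V(1)] yV cfun.subspace_sum[OF V(1)] cfun.subspace_scale[OF V(1)] u(1))
    have zK: "z i = (if i = j then 1 else 0)" if i: "i \<in> K" for i
    proof -
      have "(\<Sum>i'\<in>B. y i' * u i' i) = (\<Sum>i'\<in>B. if i' = i then y i' else 0)"
        using u(2) i by (intro sum.cong) auto
      also have "\<dots> = (if i \<in> B then y i else 0)" using fB by (simp add: sum.delta)
      finally have "z i = (if i \<in> B then 0 else y i)" unfolding zi by simp
      moreover have "j \<notin> B" unfolding B_def using below_irrefl by simp
      moreover have "y i = 0" if "i \<noteq> j" "i \<notin> B" using yl that i unfolding leads_def B_def by blast
      ultimately show ?thesis using yj by auto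
    qed
    have "m = j \<or> below k m j" if "z m \<noteq> 0" for m
    proof (rule ccontr)
      assume n: "\<not> ?thesis"
      have "y m = 0" using yl n unfolding leads_def by blast
      moreover have "u i m = 0" if "i \<in> B" for i
      proof (rule ccontr)
        assume "u i m \<noteq> 0"
        then have "m = i \<or> below k m i" using u(3)[OF that] unfolding leads_def by blast
        then show False using n that below_trans unfolding B_def by blast
      qed
      ultimately show False using that unfolding zi by simp
    qed
    then have "leads k z j" unfolding leads_def using zK[OF less.prems] by simp
    then show ?case using zV zK by blast
  qed
  then have "\<forall>j\<in>K. \<exists>u. u \<in> V \<and> (\<forall>i\<in>K. u i = (if i = j then 1 else 0)) \<and> leads k u j" by (rule ballI)
  from bchoice[OF this] obtain u where
    "\<forall>j\<in>K. u j \<in> V \<and> (\<forall>i\<in>K. u j i = (if i = j then 1 else 0)) \<and> leads k (u j) j" ..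
  then have u: "\<And>j. j \<in> K \<Longrightarrow> u j \<in> V" "\<And>j i. j \<in> K \<Longrightarrow> i \<in> K \<Longrightarrow> u j i = (if i = j then 1 else 0)"
    "\<And>j. j \<in> K \<Longrightarrow> leads k (u j) j" by simp_all
  define m where "m l j = u j l" for l j
  have gv: "graph_vec n K m j = u j" if j: "j \<in> K" for j
  proof
    fix l
    consider "l \<in> K" | "l \<in> {1..n+1} - K" | "l \<notin> {1..n+1}" by blast
    then show "graph_vec n K m j l = u j l"
    proof cases
      case 1 then show ?thesis using u(2)[OF j 1] graph_vec_coord[OF 1] by simp
    next
      case 2 then show ?thesis using j unfolding graph_vec_def m_def by auto
    next
      case 3
      then have "u j l = 0" using u(1)[OF j] V(2) unfolding W_iff subset_iff by blast
      then show ?thesis using 3 j K unfolding graph_vec_def by auto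
    qed
  qed
  have "V = graph_space n K m"
  proof
    show "V \<subseteq> graph_space n K m"
    proof
      fix x assume x: "x \<in> V"
      define y where "y = x - (\<Sum>j\<in>K. cscale (x j) (u j))"
      have yV: "y \<in> V" unfolding y_def
        by (intro cfun.subspace_diff[OF V(1)] x cfun.subspace_sum[OF V(1)] cfun.subspace_scale[OF V(1)] u(1))
      have yi: "y i = x i - (\<Sum>j\<in>K. x j * u j i)" for i
        unfolding y_def by (simp add: sum_fun_apply cscale_def)
      have yK: "y i = 0" if i: "i \<in> K" for i
      proof -
        have "(\<Sum>j\<in>K. x j * u j i) = (\<Sum>j\<in>K. if j = i then x j else 0)"
          using u(2) i by (intro sum.cong) auto
        then show ?thesis unfolding yi using fin i by (simp add: sum.delta)
      qed
      have "y = 0"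
      proof (rule ccontr)
        assume "y \<noteq> 0"
        then obtain j where "j \<in> K" "leads k y j" using l1[OF yV] by blast
        then show False using yK unfolding leads_def by blast
      qed
      then have "x i = (\<Sum>j\<in>K. x j * m i j)" for i using yi[of i] unfolding m_def by simp
      then show "x \<in> graph_space n K m" unfolding graph_space_def using x V(2) by blast
    qed
    show "graph_space n K m \<subseteq> V"
      unfolding graph_space_span[OF K] using gv u(1) by (intro cfun.span_minimal V(1)) auto
  qed
  moreover have "m l j = 0" if "l \<notin> K" "j \<in> K" "\<not> below k l j" for l j
  proof (rule ccontr)
    assume "m l j \<noteq> 0"
    then have "l = j \<or> below k l j" using u(3)[OF that(2)] unfolding leads_def m_def by blast
    then show False using that by blast
  qed
  ultimately show ?thesis by (intro exI[of _ m]) blast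
qed

lemma graph_vec_leads:
  assumes "j \<in> K" "\<And>l. l \<in> {1..n+1} - K \<Longrightarrow> \<not> below k l j \<Longrightarrow> m l j = 0"
  shows "leads k (graph_vec n K m j) j"
proof -
  have "l = j \<or> below k l j" if "graph_vec n K m j l \<noteq> 0" for l
    using that assms unfolding graph_vec_def by (auto split: if_splits)
  moreover have "graph_vec n K m j j = 1" using assms(1) graph_vec_coord by simp
  ultimately show ?thesis unfolding leads_def by auto
qed

text \<open>The points of the variety in reduced echelon form with pivots S; \<open>cell_eq\<close>
  later identifies them with the orbit.\<close>

definition cell_coords :: "nat \<Rightarrow> (nat \<Rightarrow> nat set) \<Rightarrow> (nat \<times> nat \<times> nat \<Rightarrow> complex) set" where
  "cell_coords n S = {a \<in> chart_preimage n S (deg_flag n).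
     \<forall>k l j. (k, l, j) \<in> chart_coords n S \<longrightarrow> \<not> below k l j \<longrightarrow> a (k, l, j) = 0}"

text \<open>T k collects the leading indices of vectors in V k. The projection at k + 1 preserves
  every leading index except k + 1, so T is admissible. This yields the covering by cells
  independently of the group.\<close>

lemma deg_flag_in_cell_coords:
  assumes V: "V \<in> deg_flag n"
  shows "\<exists>T a. admissible n T \<and> a \<in> cell_coords n T \<and> V = chart n T a"
proof -
  define T where "T = (\<lambda>k\<in>{1..n}. {j. \<exists>x\<in>V k. leads k x j})"
  have Vk: "cfun.subspace (V k)" "V k \<subseteq> W n" "cfun.dim (V k) = k" if "k \<in> {1..n}" for k
    using V that unfolding deg_flag_def prod_Gr_def Gr_def by auto
  have Tk: "j \<in> T k \<longleftrightarrow> (\<exists>x\<in>V k. leads k x j)" if "k \<in> {1..n}" for k j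
    using that unfolding T_def by simp
  have TK: "T k \<subseteq> {1..n+1}" if k: "k \<in> {1..n}" for k
  proof
    fix j assume "j \<in> T k"
    then obtain x where "x \<in> V k" "leads k x j" using Tk[OF k] by blast
    then have "x \<in> W n" "x j \<noteq> 0" using Vk(2)[OF k] unfolding leads_def by auto
    then show "j \<in> {1..n+1}" unfolding W_iff by blast
  qed
  have "\<exists>m. V k = graph_space n (T k) m \<and> (\<forall>l j. l \<notin> T k \<longrightarrow> j \<in> T k \<longrightarrow> \<not> below k l j \<longrightarrow> m l j = 0)"
    if k: "k \<in> {1..n}" for k
  proof (rule echelon_graph[OF Vk(1,2)[OF k] TK[OF k]])
    fix x assume "x \<in> V k" "x \<noteq> 0"
    then show "\<exists>j\<in>T k. leads k x j" using leads_exists[of x n k] Vk(2)[OF k] Tk[OF k] by blast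
  qed (use Tk[OF k] in blast)
  then have "\<forall>k\<in>{1..n}. \<exists>m. V k = graph_space n (T k) m \<and>
    (\<forall>l j. l \<notin> T k \<longrightarrow> j \<in> T k \<longrightarrow> \<not> below k l j \<longrightarrow> m l j = 0)" by (rule ballI)
  from bchoice[OF this] obtain m where "\<forall>k\<in>{1..n}. V k = graph_space n (T k) (m k) \<and>
    (\<forall>l j. l \<notin> T k \<longrightarrow> j \<in> T k \<longrightarrow> \<not> below k l j \<longrightarrow> m k l j = 0)" ..
  then have m: "\<And>k. k \<in> {1..n} \<Longrightarrow> V k = graph_space n (T k) (m k)"
    "\<And>k l j. k \<in> {1..n} \<Longrightarrow> l \<notin> T k \<Longrightarrow> j \<in> T k \<Longrightarrow> \<not> below k l j \<Longrightarrow> m k l j = 0" by simp_all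
  have cT: "card (T k) = k" if "k \<in> {1..n}" for k
    using dim_graph_space[OF TK[OF that], of "m k"] m(1)[OF that] Vk(3)[OF that] by simp
  have TS: "T \<in> subset_tuples n"
    unfolding subset_tuples_def using TK cT by (auto simp: T_def)
  have adm: "admissible n T" unfolding admissible_def
  proof (intro conjI TS ballI subsetI)
    fix k j assume k: "k \<in> {1..<n}" and j: "j \<in> T k"
    have kk: "k \<in> {1..n}" "k + 1 \<in> {1..n}" using k by auto
    obtain x where x: "x \<in> V k" "leads k x j" using Tk[OF kk(1)] j by blast
    show "j \<in> T (k + 1) \<union> {k + 1}"
    proof (cases "j = k + 1")
      case False
      have "leads (k + 1) (pr (k + 1) x) j"
        using x(2) False below_Suc[of k _ j] unfolding leads_def pr_def by auto
      moreover have "pr (k + 1) x \<in> V (k + 1)" using V k x(1) unfolding deg_flag_def by blast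
      ultimately show ?thesis using Tk[OF kk(2)] by blast
    qed simp
  qed
  define a where "a c = (if c \<in> chart_coords n T then case c of (k, l, j) \<Rightarrow> m k l j else 0)" for c
  have "chart n T a = V"
  proof (rule extensionalityI[OF chart_extensional])
    show "V \<in> extensional {1..n}" using V unfolding deg_flag_def prod_Gr_def PiE_def by auto
    fix k assume k: "k \<in> {1..n}"
    have "graph_space n (T k) (\<lambda>l s. a (k, l, s)) = graph_space n (T k) (m k)"
      unfolding graph_space_def a_def chart_coords_def using k
      by (intro Collect_cong conj_cong refl ball_cong arg_cong2[where f = "(=)"] sum.cong) auto
    then show "chart n T a k = V k" using m(1)[OF k] chart_eq[OF TS k] by metis
  qed
  moreover have "a \<in> coord_space (chart_coords n T)" unfolding coord_space_def a_def by simp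
  moreover have "a (k, l, j) = 0" if "(k, l, j) \<in> chart_coords n T" "\<not> below k l j" for k l j
    using that m(2)[of k l j] unfolding a_def chart_coords_def by auto
  ultimately show ?thesis using adm V unfolding cell_coords_def chart_preimage_def by blast
qed


section \<open>Coordinates on the cells\<close>

text \<open>On a cell, the equations of the variety express the coordinates \<open>(k, l, j)\<close> through those at vertex \<open>k - 1\<close>
  unless \<open>j\<close> starts at \<open>k\<close>: then \<open>w j\<close> is not the image of a vector of the coordinate subspace at \<open>k - 1\<close>.\<close>

definition starts :: "(nat \<Rightarrow> nat set) \<Rightarrow> nat \<Rightarrow> nat \<Rightarrow> bool" where
  "starts S k j \<longleftrightarrow> j \<in> S k \<and> (k = 1 \<or> j \<notin> S (k - 1) \<or> j = k)"

definition cell_free :: "nat \<Rightarrow> (nat \<Rightarrow> nat set) \<Rightarrow> (nat \<times> nat \<times> nat) set" where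
  "cell_free n S = {(k, l, j) \<in> chart_coords n S. starts S k j \<and> below k l j}"

text \<open>The equation \<open>flag_eq\<close> at k - 1 solved for the coordinate (k, l, j); the
  echelon condition supplies 0 in the other positions.\<close>

definition cell_rhs :: "(nat \<Rightarrow> nat set) \<Rightarrow> nat \<times> nat \<times> nat \<Rightarrow> (nat \<times> nat \<times> nat \<Rightarrow> complex) \<Rightarrow> complex" where
  "cell_rhs S = (\<lambda>(k, l, j) a. if below k l j
     then (if l = k then 0 else a (k - 1, l, j)) - (\<Sum>i\<in>S k - S (k - 1) - {k}. a (k, l, i) * a (k - 1, i, j))
     else 0)"

text \<open>The quadratic term at vertex k involves coordinates (k, l, i) at the same vertex, but
  only with i starting there; these are ranked before the others.\<close>

definition cell_rank :: "(nat \<Rightarrow> nat set) \<Rightarrow> nat \<times> nat \<times> nat \<Rightarrow> nat" where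
  "cell_rank S = (\<lambda>(k, l, j). 2 * k + (if starts S k j then 0 else 1))"

lemma cell_nonfree:
  assumes S: "admissible n S" and c: "(k, l, j) \<in> chart_coords n S - cell_free n S" and b: "below k l j"
  shows "k - 1 \<in> {1..<n}" "j \<in> S (k - 1)" "j \<noteq> k" "\<not> starts S k j"
proof -
  have cc: "k \<in> {1..n}" "l \<in> {1..n+1} - S k" "j \<in> S k" using c unfolding chart_coords_def by auto
  show ns: "\<not> starts S k j" using c b unfolding cell_free_def by simp
  then show "j \<in> S (k - 1)" "j \<noteq> k" using cc unfolding starts_def by auto
  have "k \<noteq> 1" using ns cc(3) unfolding starts_def by blast
  then show "k - 1 \<in> {1..<n}" using cc(1) by auto
qed

lemma triangular_cell:
  assumes S: "admissible n S"
  shows "triangular_system (chart_coords n S) (cell_free n S) (cell_rhs S) (cell_rank S)"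
proof
  show "finite (chart_coords n S)" by (rule finite_chart_coords[OF admissible_subset[OF S]])
  show "cell_free n S \<subseteq> chart_coords n S" unfolding cell_free_def by blast
  fix c assume c: "c \<in> chart_coords n S - cell_free n S"
  obtain k l j where ce: "c = (k, l, j)" by (cases c)
  show "cell_rhs S c \<in> polyfun"
  proof -
    have "cell_rhs S c = (\<lambda>a. if below k l j
      then (if l = k then 0 else a (k - 1, l, j)) - (\<Sum>i\<in>S k - S (k - 1) - {k}. a (k, l, i) * a (k - 1, i, j)) else 0)"
      unfolding cell_rhs_def ce by simp
    moreover have "\<dots> \<in> polyfun"
      by (intro polyfun_if polyfun_diff polyfun_sum polyfun.mult polyfun.coord polyfun.const)
    ultimately show ?thesis by simp
  qed
  fix a b :: "nat \<times> nat \<times> nat \<Rightarrow> complex"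
  assume ab: "\<And>d. d \<in> chart_coords n S \<Longrightarrow> cell_rank S d < cell_rank S c \<Longrightarrow> a d = b d"
    "\<And>d. d \<notin> chart_coords n S \<Longrightarrow> a d = b d"
  then have ab: "cell_rank S d < cell_rank S c \<Longrightarrow> a d = b d" for d by blast
  show "cell_rhs S c a = cell_rhs S c b"
  proof (cases "below k l j")
    case True
    note nf = cell_nonfree[OF S c[unfolded ce] True]
    have r: "cell_rank S c = 2 * k + 1" using nf(4) unfolding ce cell_rank_def by simp
    have 1: "a (k - 1, x, y) = b (k - 1, x, y)" for x y
    proof (rule ab)
      have "cell_rank S (k - 1, x, y) \<le> 2 * (k - 1) + 1" by (simp add: cell_rank_def)
      then show "cell_rank S (k - 1, x, y) < cell_rank S c" using nf(1) unfolding r by auto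
    qed
    have 2: "a (k, l, i) = b (k, l, i)" if "i \<in> S k - S (k - 1) - {k}" for i
    proof (rule ab)
      have "starts S k i" using that unfolding starts_def by blast
      then show "cell_rank S (k, l, i) < cell_rank S c" unfolding r by (simp add: cell_rank_def)
    qed
    have "(\<Sum>i\<in>S k - S (k - 1) - {k}. a (k, l, i) * a (k - 1, i, j)) =
        (\<Sum>i\<in>S k - S (k - 1) - {k}. b (k, l, i) * b (k - 1, i, j))"
      unfolding 1 by (rule sum.cong[OF refl]) (simp only: 2)
    then show ?thesis unfolding ce cell_rhs_def prod.case 1 by (simp only:)
  next
    case False
    then show ?thesis unfolding ce cell_rhs_def by simp
  qed
qed

lemma cell_coords_solutions:
  assumes S: "admissible n S"
  shows "cell_coords n S = triangular_system.solutions (chart_coords n S) (cell_free n S) (cell_rhs S)"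
proof -
  interpret T: triangular_system "chart_coords n S" "cell_free n S" "cell_rhs S" "cell_rank S"
    by (rule triangular_cell[OF S])
  note eqs = chart_preimage_deg_flag[OF S]
  show ?thesis
  proof
    show "cell_coords n S \<subseteq> T.solutions"
    proof
      fix a assume a: "a \<in> cell_coords n S"
      then have aC: "a \<in> coord_space (chart_coords n S)"
        and fe: "\<And>k l j. k \<in> {1..<n} \<Longrightarrow> l \<in> {1..n+1} - S (k + 1) \<Longrightarrow> j \<in> S k \<Longrightarrow> flag_eq S a k l j"
        and tr: "\<And>k l j. (k, l, j) \<in> chart_coords n S \<Longrightarrow> \<not> below k l j \<Longrightarrow> a (k, l, j) = 0"
        unfolding cell_coords_def eqs by auto
      have "a c = cell_rhs S c a" if c: "c \<in> chart_coords n S - cell_free n S" for c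
      proof -
        obtain k l j where ce: "c = (k, l, j)" by (cases c)
        show ?thesis
        proof (cases "below k l j")
          case True
          note nf = cell_nonfree[OF S c[unfolded ce] True]
          have k1: "k - 1 + 1 = k" using nf(1) by auto
          have "l \<in> {1..n+1} - S k" using c unfolding ce chart_coords_def by auto
          then have "flag_eq S a (k - 1) l j" using fe[OF nf(1) _ nf(2), of l] unfolding k1 by blast
          then show ?thesis unfolding flag_eq_def k1 ce cell_rhs_def using nf(3) True by (simp add: algebra_simps)
        next
          case False
          then show ?thesis using tr[of k l j] c unfolding ce cell_rhs_def by simp
        qed
      qed
      then show "a \<in> T.solutions" unfolding T.solutions_def using aC by blast
    qed
    show "T.solutions \<subseteq> cell_coords n S"
    proof
      fix a assume a: "a \<in> T.solutions"
      then have aC: "a \<in> coord_space (chart_coords n S)"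
        and sol: "\<And>c. c \<in> chart_coords n S - cell_free n S \<Longrightarrow> a c = cell_rhs S c a"
        unfolding T.solutions_def by auto
      have tr: "a (k, l, j) = 0" if "\<not> below k l j" for k l j
      proof (cases "(k, l, j) \<in> chart_coords n S")
        case True
        then have "(k, l, j) \<in> chart_coords n S - cell_free n S" using that unfolding cell_free_def by simp
        then show ?thesis using sol that unfolding cell_rhs_def by simp
      next
        case False then show ?thesis using aC unfolding coord_space_def by blast
      qed
      have "flag_eq S a k l j" if k: "k \<in> {1..<n}" and l: "l \<in> {1..n+1} - S (k + 1)" and j: "j \<in> S k" for k l j
      proof (cases "j = k + 1")
        case True
        have "a (k, x, k + 1) = 0" for x using tr below_bottom by blast
        then show ?thesis unfolding flag_eq_def True by simp
      next
        case jk: False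
        have j1: "j \<in> S (k + 1)" using admissible_step[OF S k j jk] .
        show ?thesis
        proof (cases "below (k + 1) l j")
          case True
          have "(k + 1, l, j) \<in> chart_coords n S - cell_free n S"
            using k l j1 jk j unfolding chart_coords_def cell_free_def starts_def by auto
          from sol[OF this] show ?thesis
            unfolding flag_eq_def cell_rhs_def using True jk by simp
        next
          case False
          have "a (k + 1, l, j) = 0" using tr False by blast
          moreover have "l \<noteq> k + 1 \<Longrightarrow> a (k, l, j) = 0" using tr below_Suc[of k l j] jk False by blast
          moreover have "(\<Sum>i\<in>S (k + 1) - S k - {k + 1}. a (k + 1, l, i) * a (k, i, j)) = 0"
          proof (rule sum.neutral, rule ballI, rule ccontr)
            fix i assume i: "i \<in> S (k + 1) - S k - {k + 1}" and "a (k + 1, l, i) * a (k, i, j) \<noteq> 0"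
            then have "a (k + 1, l, i) \<noteq> 0" "a (k, i, j) \<noteq> 0" by auto
            then have "below (k + 1) l i" "below k i j" using tr by blast+
            moreover have "i \<noteq> k + 1" using i by blast
            ultimately show False using below_trans below_Suc[of k i j] jk False by blast
          qed
          ultimately show ?thesis unfolding flag_eq_def by simp
        qed
      qed
      then show "a \<in> cell_coords n S" unfolding cell_coords_def eqs using aC tr by blast
    qed
  qed
qed

section \<open>The group acts by triangular maps\<close>

lemma w_apply: "w i m = (if m = i then 1 else 0)"
  unfolding w_def by simp

lemma span_w:
  assumes "finite A"
  shows "cfun.span (w ` A) = coord_space A"
proof
  show "cfun.span (w ` A) \<subseteq> coord_space A"
    by (intro cfun.span_minimal coord_space_subspace) (auto simp: coord_space_def w_apply)
  show "coord_space A \<subseteq> cfun.span (w ` A)"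
  proof
    fix x assume x: "x \<in> coord_space A"
    have "x = (\<Sum>i\<in>A. cscale (x i) (w i))"
    proof
      fix m
      have "(\<Sum>i\<in>A. cscale (x i) (w i)) m = (\<Sum>i\<in>A. if i = m then x i else 0)"
        unfolding sum_fun_apply cscale_def by (intro sum.cong) (auto simp: w_apply)
      then show "x m = (\<Sum>i\<in>A. cscale (x i) (w i)) m"
        using assms x unfolding coord_space_def by (auto simp: sum.delta)
    qed
    moreover have "(\<Sum>i\<in>A. cscale (x i) (w i)) \<in> cfun.span (w ` A)"
      by (intro cfun.span_sum cfun.span_scale cfun.span_base) auto
    ultimately show "x \<in> cfun.span (w ` A)" by simp
  qed
qed

lemma w_in_W: "i \<in> {1..n+1} \<Longrightarrow> w i \<in> W n"
  unfolding W_iff by (auto simp: w_apply)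

lemma coord_space_mono: "A \<subseteq> B \<Longrightarrow> coord_space A \<subseteq> coord_space B"
  unfolding coord_space_def by blast

lemma rep_P_eq: "k \<in> {1..n} \<Longrightarrow> rep_P n k = coord_space {1..k}"
proof -
  assume "k \<in> {1..n}"
  then have "{w l | l. l \<in> {1..n} \<and> k \<in> {l..n}} = w ` {1..k}" by auto
  then show ?thesis unfolding rep_P_def using span_w[of "{1..k}"] by simp
qed

lemma rep_I_eq: "k \<in> {1..n} \<Longrightarrow> rep_I n k = coord_space {k+1..n+1}"
proof -
  assume k: "k \<in> {1..n}"
  have "{w (l + 1) | l. l \<in> {1..n} \<and> k \<in> {1..l}} = w ` {k+1..n+1}"
  proof
    show "w ` {k+1..n+1} \<subseteq> {w (l + 1) | l. l \<in> {1..n} \<and> k \<in> {1..l}}"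
    proof
      fix x assume "x \<in> w ` {k+1..n+1}"
      then obtain i where "x = w i" "i \<in> {k+1..n+1}" by blast
      then show "x \<in> {w (l + 1) | l. l \<in> {1..n} \<and> k \<in> {1..l}}" using k by (intro CollectI exI[of _ "i - 1"]) auto
    qed
  qed (use k in auto)
  then show ?thesis unfolding rep_I_def using span_w[of "{k+1..n+1}"] by simp
qed

lemma pt_eq_coord_space:
  assumes "S \<in> subset_tuples n" "k \<in> {1..n}"
  shows "pt n S k = coord_space (S k)"
  unfolding pt_def using assms(2) span_w[OF subset_tuplesD(3)[OF assms]] by simp

definition triangular_map :: "nat \<Rightarrow> nat \<Rightarrow> ((nat \<Rightarrow> complex) \<Rightarrow> nat \<Rightarrow> complex) \<Rightarrow> bool" where
  "triangular_map n k f \<longleftrightarrow> (\<forall>i\<in>{1..n+1}. leads k (f (w i)) i) \<and>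
     (\<forall>x\<in>W n. f x \<in> W n \<and> (\<forall>m. f x m = (\<Sum>i\<in>{1..n+1}. x i * f (w i) m)))"

lemma triangular_map_leads:
  assumes f: "triangular_map n k f" and x: "x \<in> W n" "leads k x j"
  shows "leads k (f x) j"
proof -
  have j: "j \<in> {1..n+1}" using x unfolding leads_def W_iff by blast
  have fx: "f x m = (\<Sum>i\<in>{1..n+1}. x i * f (w i) m)" for m using f x(1) unfolding triangular_map_def by blast
  have fw: "leads k (f (w i)) i" if "i \<in> {1..n+1}" for i using f that unfolding triangular_map_def by blast
  have "x i * f (w i) j = 0" if "i \<in> {1..n+1}" "i \<noteq> j" for i
  proof (rule ccontr)
    assume "x i * f (w i) j \<noteq> 0"
    then have "below k i j" "below k j i" using fw[OF that(1)] x(2) that(2) unfolding leads_def by auto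
    then show False using below_asym by blast
  qed
  then have "f x j = (\<Sum>i\<in>{1..n+1}. if i = j then x j * f (w j) j else 0)"
    unfolding fx by (intro sum.cong) auto
  also have "\<dots> = x j * f (w j) j" using j by (simp add: sum.delta)
  finally have nz: "f x j \<noteq> 0" using x(2) fw[OF j] unfolding leads_def by simp
  have "m = j \<or> below k m j" if m: "f x m \<noteq> 0" for m
  proof -
    obtain i where i: "i \<in> {1..n+1}" "x i * f (w i) m \<noteq> 0"
      using m unfolding fx by (meson sum.not_neutral_contains_not_neutral)
    then have "m = i \<or> below k m i" "i = j \<or> below k i j" using fw[OF i(1)] x(2) unfolding leads_def by auto
    then show ?thesis using below_trans by blast
  qed
  then show ?thesis using nz unfolding leads_def by blast
qed

lemma triangular_map_image:
  assumes f: "triangular_map n k f" and K: "K \<subseteq> {1..n+1}"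
  shows "\<exists>m. f ` coord_space K = graph_space n K m \<and>
    (\<forall>l j. l \<notin> K \<longrightarrow> j \<in> K \<longrightarrow> \<not> below k l j \<longrightarrow> m l j = 0)"
proof (rule echelon_graph[OF _ _ K])
  have KW: "coord_space K \<subseteq> W n" unfolding W_def by (rule coord_space_mono[OF K])
  have fx: "f x m = (\<Sum>i\<in>{1..n+1}. x i * f (w i) m)" if "x \<in> W n" for x m
    using f that unfolding triangular_map_def by blast
  have add: "f (x + y) = f x + f y" if "x \<in> coord_space K" "y \<in> coord_space K" for x y
  proof
    fix m
    have "x \<in> W n" "y \<in> W n" "x + y \<in> W n"
      using that KW cfun.subspace_add[OF W_subspace] by blast+
    then show "f (x + y) m = (f x + f y) m" by (simp add: fx distrib_right sum.distrib)
  qed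
  have scale: "f (cscale c x) = cscale c (f x)" if "x \<in> coord_space K" for x c
  proof
    fix m
    have "x \<in> W n" "cscale c x \<in> W n"
      using that KW cfun.subspace_scale[OF W_subspace] by blast+
    then show "f (cscale c x) m = (cscale c (f x)) m"
      by (simp only: fx) (simp only: fx cscale_def sum_distrib_left mult.assoc)
  qed
  have z: "0 \<in> coord_space K" unfolding coord_space_def by simp
  have "cscale 0 x = 0" for x :: "nat \<Rightarrow> complex" by (rule ext) (simp add: cscale_def)
  then have f0: "f 0 = 0" using scale[OF z, of 0] by simp
  show "cfun.subspace (f ` coord_space K)"
  proof (rule cfun.subspaceI)
    show "0 \<in> f ` coord_space K" using z f0 by (metis imageI)
    show "x + y \<in> f ` coord_space K" if xy: "x \<in> f ` coord_space K" "y \<in> f ` coord_space K" for x y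
    proof -
      obtain x' y' where *: "x' \<in> coord_space K" "x = f x'" "y' \<in> coord_space K" "y = f y'" using xy by blast
      have "x + y = f (x' + y')" using add[OF *(1,3)] *(2,4) by simp
      then show ?thesis using cfun.subspace_add[OF coord_space_subspace *(1,3)] by blast
    qed
    show "cscale c x \<in> f ` coord_space K" if xf: "x \<in> f ` coord_space K" for x c
    proof -
      obtain x' where *: "x' \<in> coord_space K" "x = f x'" using xf by blast
      have "cscale c x = f (cscale c x')" using scale[OF *(1)] *(2) by simp
      then show ?thesis using cfun.subspace_scale[OF coord_space_subspace *(1)] by blast
    qed
  qed
  show "f ` coord_space K \<subseteq> W n" using f KW unfolding triangular_map_def by blast
  show "\<exists>j\<in>K. leads k y j" if "y \<in> f ` coord_space K" "y \<noteq> 0" for y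
  proof -
    obtain x where x: "x \<in> coord_space K" "y = f x" using \<open>y \<in> f ` coord_space K\<close> by blast
    then have "x \<noteq> 0" using \<open>y \<noteq> 0\<close> f0 by auto
    then obtain j where j: "leads k x j" using leads_exists[of x n k] x(1) KW by blast
    have "j \<in> K" using j x(1) unfolding leads_def coord_space_def by blast
    then show ?thesis using triangular_map_leads[OF f _ j] x KW by blast
  qed
  show "\<exists>x\<in>f ` coord_space K. leads k x j" if j: "j \<in> K" for j
  proof -
    have "w j \<in> coord_space K" using j unfolding coord_space_def by (simp add: w_apply)
    moreover have "leads k (f (w j)) j" using f j K unfolding triangular_map_def by blast
    ultimately show ?thesis by blast
  qed
qed


lemma W_expand:
  assumes "x \<in> W n"
  shows "x = (\<Sum>i\<in>{1..n+1}. cscale (x i) (w i))"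
proof
  fix m
  have "(\<Sum>i\<in>{1..n+1}. cscale (x i) (w i)) m = (\<Sum>i\<in>{1..n+1}. if i = m then x i else 0)"
    unfolding sum_fun_apply cscale_def by (intro sum.cong) (auto simp: w_apply)
  also have "\<dots> = (if m \<in> {1..n+1} then x m else 0)" by (rule sum.delta) simp
  also have "\<dots> = x m" using assms unfolding W_iff by auto
  finally show "x m = (\<Sum>i\<in>{1..n+1}. cscale (x i) (w i)) m" by simp
qed

lemma lin_aut_expand:
  assumes f: "lin_aut n f" and x: "x \<in> W n"
  shows "f x m = (\<Sum>i\<in>{1..n+1}. x i * f (w i) m)"
proof -
  have sc: "f (cscale c v) = cscale c (f v)" if "v \<in> W n" for c v using f that unfolding lin_aut_def by blast
  have ad: "f (u + v) = f u + f v" if "u \<in> W n" "v \<in> W n" for u v using f that unfolding lin_aut_def by blast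
  have z: "0 \<in> W n" unfolding W_iff by simp
  have c0: "cscale 0 v = 0" for v :: "nat \<Rightarrow> complex" by (rule ext) (simp add: cscale_def)
  have f0: "f 0 = 0" using sc[OF z, of 0] unfolding c0 .
  have "f (\<Sum>i\<in>A. cscale (x i) (w i)) = (\<Sum>i\<in>A. cscale (x i) (f (w i)))" if A: "A \<subseteq> {1..n+1}" for A
  proof -
    have "finite A" using A finite_subset by blast
    then show ?thesis using A
    proof (induction A rule: finite_induct)
      case empty then show ?case by (simp only: sum.empty f0)
    next
      case (insert i A)
      have i: "w i \<in> W n" using insert.prems w_in_W by blast
      have "(\<Sum>i\<in>A. cscale (x i) (w i)) \<in> W n"
        using insert.prems w_in_W
        by (intro cfun.subspace_sum[OF W_subspace] cfun.subspace_scale[OF W_subspace]) blast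
      then have "f (cscale (x i) (w i) + (\<Sum>i\<in>A. cscale (x i) (w i))) =
          f (cscale (x i) (w i)) + f (\<Sum>i\<in>A. cscale (x i) (w i))"
        by (rule ad[OF cfun.subspace_scale[OF W_subspace i]])
      moreover have "f (\<Sum>i\<in>A. cscale (x i) (w i)) = (\<Sum>i\<in>A. cscale (x i) (f (w i)))"
        using insert by blast
      ultimately show ?case by (simp only: sum.insert[OF insert.hyps(1,2)] sc[OF i])
    qed
  qed
  from this[OF subset_refl] have "f x = (\<Sum>i\<in>{1..n+1}. cscale (x i) (f (w i)))"
    using W_expand[OF x] by simp
  then show ?thesis by (simp only: sum_fun_apply cscale_def)
qed

text \<open>If the diagonal entry at i vanished, the w m with m = i or m below i would all be mapped
  into the span of those strictly below i, a space of smaller dimension; a linear relation among the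
  images gives a nonzero kernel vector.\<close>

lemma injective_triangular_diag:
  assumes inj: "inj_on f (W n)" and f0: "f 0 = 0"
    and W: "\<And>x. x \<in> W n \<Longrightarrow> f x \<in> W n"
    and ex: "\<And>x m. x \<in> W n \<Longrightarrow> f x m = (\<Sum>i\<in>{1..n+1}. x i * f (w i) m)"
    and tri: "\<And>i m. i \<in> {1..n+1} \<Longrightarrow> f (w i) m \<noteq> 0 \<Longrightarrow> m = i \<or> below k m i"
    and i: "i \<in> {1..n+1}"
  shows "f (w i) i \<noteq> 0"
proof
  assume zero: "f (w i) i = 0"
  define F where "F = {m \<in> {1..n+1}. below k m i}"
  have fF: "finite F" unfolding F_def by simp
  have iF: "i \<notin> F" unfolding F_def using below_irrefl by simp
  define B where "B = w ` F"
  have cardB: "card B \<le> card F" unfolding B_def by (rule card_image_le[OF fF])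
  obtain e where e: "bij_betw e {0..<card (insert i F)} (insert i F)"
    using ex_bij_betw_nat_finite[of "insert i F"] fF by blast
  have eF: "e a \<in> insert i F" if "a < card (insert i F)" for a
    using bij_betwE[OF e] that by simp
  have in1: "m \<in> {1..n+1}" if "m \<in> insert i F" for m using that i unfolding F_def by blast
  have "f (w (e a)) \<in> cfun.span B" if a: "a < card (insert i F)" for a
    unfolding B_def span_w[OF fF]
  proof -
    have ea: "e a \<in> insert i F" using eF[OF a] .
    have "m \<in> F" if m: "f (w (e a)) m \<noteq> 0" for m
    proof -
      have "f (w (e a)) \<in> W n" using W w_in_W in1[OF ea] by blast
      then have m1: "m \<in> {1..n+1}" using m unfolding W_iff by blast
      have t: "m = e a \<or> below k m (e a)" using tri[OF in1[OF ea] m] .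
      show ?thesis
      proof (cases "e a = i")
        case True
        then have "m \<noteq> i" using m zero by auto
        then show ?thesis using t True m1 unfolding F_def by simp
      next
        case False
        then have "below k (e a) i" using ea unfolding F_def by simp
        then have "below k m i" using t below_trans by blast
        then show ?thesis using m1 unfolding F_def by simp
      qed
    qed
    then show "f (w (e a)) \<in> coord_space F" unfolding coord_space_def by blast
  qed
  moreover have "card B < card (insert i F)" using cardB fF iF by simp
  moreover have "finite B" unfolding B_def using fF by simp
  ultimately obtain c where c: "\<exists>a<card (insert i F). c a \<noteq> 0"
    "\<forall>x. (\<Sum>a<card (insert i F). c a * f (w (e a)) x) = 0"
    using family_dependent[of B "card (insert i F)" "\<lambda>a. f (w (e a))"] by blast
  define y where "y = (\<lambda>m. if m \<in> insert i F then c (inv_into {0..<card (insert i F)} e m) else 0)"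
  have ye: "y (e a) = c a" if "a < card (insert i F)" for a
    unfolding y_def using eF[OF that] bij_betw_inv_into_left[OF e, of a] that by simp
  have yW: "y \<in> W n" unfolding W_iff y_def using in1 by auto
  have "f y m = 0" for m
  proof -
    have "f y m = (\<Sum>j\<in>{1..n+1}. y j * f (w j) m)" by (rule ex[OF yW])
    also have "\<dots> = (\<Sum>j\<in>insert i F. y j * f (w j) m)"
      by (rule sum.mono_neutral_right) (use in1 in \<open>auto simp: y_def\<close>)
    also have "\<dots> = (\<Sum>a\<in>{0..<card (insert i F)}. y (e a) * f (w (e a)) m)"
      by (rule sum.reindex_bij_betw[OF e, symmetric])
    also have "\<dots> = (\<Sum>a<card (insert i F). c a * f (w (e a)) m)"
      by (rule sum.cong) (use ye in auto)
    finally show ?thesis using c(2) by simp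
  qed
  then have "f y = f 0" using f0 by (simp add: fun_eq_iff)
  moreover have "0 \<in> W n" unfolding W_iff by simp
  ultimately have "y = 0" using inj_onD[OF inj] yW by blast
  then have "c a = 0" if "a < card (insert i F)" for a using ye[OF that] by simp
  then show False using c(1) by blast
qed

text \<open>For i > k the vanishing component from I to P removes the coordinates up to k. Commuting
  with the projections does the rest: for i \<le> k they successively kill the coordinates i + 1,
  ..., k of the image of w i, and for i > k one argues backwards from vertex i, where w i has been
  killed, to exclude coordinates above i.\<close>

lemma grp_A_triangular:
  assumes g: "g \<in> grp_A n" and k: "k \<in> {1..n}"
  shows "triangular_map n k (g k)"
proof -
  have lin: "lin_aut n (g k)" if "k \<in> {1..n}" for k using g that unfolding grp_A_def aut_M_def by blast
  have com: "g (k + 1) (pr (k + 1) v) = pr (k + 1) (g k v)" if "k \<in> {1..<n}" "v \<in> W n" for k v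
    using g that unfolding grp_A_def aut_M_def by blast
  have gW: "g k x \<in> W n" if "k \<in> {1..n}" "x \<in> W n" for k x
    using lin[OF that(1)] that(2) unfolding lin_aut_def bij_betw_def by blast
  have c0: "cscale 0 v = 0" for v :: "nat \<Rightarrow> complex" by (rule ext) (simp add: cscale_def)
  have z: "0 \<in> W n" unfolding W_iff by simp
  have g0: "g k 0 = 0" if "k \<in> {1..n}" for k
  proof -
    have "g k (cscale 0 0) = cscale 0 (g k 0)" using lin[OF that] z unfolding lin_aut_def by blast
    then show ?thesis unfolding c0 .
  qed
  have I: "g k v \<in> coord_space {k+1..n+1}" if k: "k \<in> {1..n}" and v: "v \<in> coord_space {k+1..n+1}" for k v
  proof -
    have "v \<in> W n" using v coord_space_mono[of "{k+1..n+1}" "{1..n+1}"] unfolding W_def by auto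
    then have gv: "g k v \<in> W n" using gW[OF k] by blast
    define x where "x = (\<lambda>m. if m \<le> k then g k v m else 0)"
    define y where "y = (\<lambda>m. if m \<le> k then 0 else g k v m)"
    have xy: "g k v = x + y" unfolding x_def y_def by (rule ext) simp
    have "x \<in> coord_space {1..k}" "y \<in> coord_space {k+1..n+1}"
      using gv unfolding x_def y_def W_iff coord_space_def by auto
    then have "x = 0"
      using g k v xy unfolding grp_A_def rep_P_eq[OF k, symmetric] rep_I_eq[OF k, symmetric] by blast
    then show ?thesis using xy \<open>y \<in> coord_space {k+1..n+1}\<close> by simp
  qed
  have pw: "pr (k + 1) (w i) = (if i = k + 1 then 0 else w i)" for i k
    by (rule ext) (simp add: pr_def w_apply)
  have P: "g k (w i) m = 0" if "1 \<le> i" "i \<le> k" "k \<le> n" "m \<in> {i<..k}" for i k m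
    using that(2,3,4)
  proof (induction rule: dec_induct)
    case base then show ?case by simp
  next
    case (step k)
    have iW: "w i \<in> W n" using that(1) step by (intro w_in_W) auto
    have "g (k + 1) (pr (k + 1) (w i)) = pr (k + 1) (g k (w i))" using com[OF _ iW] step that(1) by simp
    then have "g (k + 1) (w i) = pr (k + 1) (g k (w i))" unfolding pw using step by simp
    then have "g (Suc k) (w i) m = (if m = k + 1 then 0 else g k (w i) m)" by (simp add: pr_def)
    then show ?case using step by auto
  qed
  have I2: "g k (w i) m = 0" if "1 \<le> k" "k < i" "i \<le> n + 1" "i < m" for i k m
    using that(1,2)
  proof (induction "i - k" arbitrary: k rule: less_induct)
    case less
    have k1: "k \<in> {1..n}" using less that(3) by auto
    have iW: "w i \<in> W n" using less that(3) by (intro w_in_W) auto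
    show ?case
    proof (cases "i = n + 1")
      case True
      then show ?thesis using gW[OF k1 iW] that(4) unfolding W_iff by auto
    next
      case False
      then have kn: "k \<in> {1..<n}" using less that(3) by auto
      have e: "g (k + 1) (pr (k + 1) (w i)) = pr (k + 1) (g k (w i))" by (rule com[OF kn iW])
      have mk: "m \<noteq> k + 1" using less that(4) by simp
      show ?thesis
      proof (cases "i = k + 1")
        case True
        then have "pr (k + 1) (g k (w i)) = 0" using e pw[of k i] g0[of "k + 1"] kn by simp
        then have "pr (k + 1) (g k (w i)) m = 0" by simp
        then show ?thesis using mk by (simp add: pr_def)
      next
        case False
        have "g (k + 1) (w i) m = 0" by (rule less.hyps) (use False less in auto)
        then have "pr (k + 1) (g k (w i)) m = 0" using e pw[of k i] False by simp
        then show ?thesis using mk by (simp add: pr_def)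
      qed
    qed
  qed
  have tri: "m = i \<or> below k m i" if i: "i \<in> {1..n+1}" and m: "g k (w i) m \<noteq> 0" for i m
  proof (cases "i \<le> k")
    case True
    have "\<not> (i < m \<and> m \<le> k)"
    proof
      assume "i < m \<and> m \<le> k"
      then have "g k (w i) m = 0" using True i k by (intro P) auto
      then show False using m by simp
    qed
    then show ?thesis using True unfolding below_def by auto
  next
    case False
    have "w i \<in> coord_space {k+1..n+1}" using i False unfolding coord_space_def by (auto simp: w_apply)
    then have "m \<in> {k+1..n+1}" using I[OF k] m unfolding coord_space_def by blast
    moreover have "\<not> i < m"
    proof
      assume "i < m"
      then have "g k (w i) m = 0" using False i k by (intro I2) auto
      then show False using m by simp
    qed
    ultimately show ?thesis using False unfolding below_def by auto
  qed
  have ex: "g k x m = (\<Sum>i\<in>{1..n+1}. x i * g k (w i) m)" if "x \<in> W n" for x m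
    by (rule lin_aut_expand[OF lin[OF k] that])
  have "g k (w i) i \<noteq> 0" if "i \<in> {1..n+1}" for i
  proof (rule injective_triangular_diag[OF _ g0[OF k] gW[OF k] ex tri that])
    show "inj_on (g k) (W n)" using lin[OF k] unfolding lin_aut_def bij_betw_def by blast
  qed
  then show ?thesis unfolding triangular_map_def leads_def
  proof (intro conjI ballI allI impI)
    fix i m assume "i \<in> {1..n+1}" "g k (w i) m \<noteq> 0"
    then show "m = i \<or> below k m i" by (rule tri)
  next
    fix x m assume x: "x \<in> W n"
    show "g k x \<in> W n" by (rule gW[OF k x])
    show "g k x m = (\<Sum>i\<in>{1..n+1}. x i * g k (w i) m)" by (rule ex[OF x])
  qed
qed

lemma cell_in_chart:
  assumes S: "admissible n S" and g: "g \<in> grp_A n"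
  shows "\<exists>a\<in>cell_coords n S. (\<lambda>k\<in>{1..n}. g k ` pt n S k) = chart n S a"
proof -
  note S' = admissible_subset[OF S]
  have "\<forall>k\<in>{1..n}. \<exists>m. g k ` pt n S k = graph_space n (S k) m \<and>
    (\<forall>l j. l \<notin> S k \<longrightarrow> j \<in> S k \<longrightarrow> \<not> below k l j \<longrightarrow> m l j = 0)"
  proof
    fix k assume k: "k \<in> {1..n}"
    show "\<exists>m. g k ` pt n S k = graph_space n (S k) m \<and>
      (\<forall>l j. l \<notin> S k \<longrightarrow> j \<in> S k \<longrightarrow> \<not> below k l j \<longrightarrow> m l j = 0)"
      unfolding pt_eq_coord_space[OF S' k]
      by (rule triangular_map_image[OF grp_A_triangular[OF g k] subset_tuplesD(1)[OF S' k]])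
  qed
  from bchoice[OF this] obtain m where "\<forall>k\<in>{1..n}. g k ` pt n S k = graph_space n (S k) (m k) \<and>
    (\<forall>l j. l \<notin> S k \<longrightarrow> j \<in> S k \<longrightarrow> \<not> below k l j \<longrightarrow> m k l j = 0)" ..
  then have m: "\<And>k. k \<in> {1..n} \<Longrightarrow> g k ` pt n S k = graph_space n (S k) (m k)"
    "\<And>k l j. k \<in> {1..n} \<Longrightarrow> l \<notin> S k \<Longrightarrow> j \<in> S k \<Longrightarrow> \<not> below k l j \<Longrightarrow> m k l j = 0" by simp_all
  define a where "a c = (if c \<in> chart_coords n S then case c of (k, l, j) \<Rightarrow> m k l j else 0)" for c
  have ch: "chart n S a k = g k ` pt n S k" if k: "k \<in> {1..n}" for k
  proof -
    have "graph_space n (S k) (\<lambda>l s. a (k, l, s)) = graph_space n (S k) (m k)"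
      unfolding graph_space_def a_def chart_coords_def using k
      by (intro Collect_cong conj_cong refl ball_cong arg_cong2[where f = "(=)"] sum.cong) auto
    then show ?thesis using m(1)[OF k] chart_eq[OF S' k] by metis
  qed
  have eq: "chart n S a = (\<lambda>k\<in>{1..n}. g k ` pt n S k)"
    by (rule extensionalityI[OF chart_extensional restrict_extensional]) (simp add: ch)
  have "chart n S a \<in> deg_flag n" unfolding deg_flag_def
  proof (intro CollectI conjI ballI)
    show "chart n S a \<in> prod_Gr n" by (rule chart_in_prod_Gr[OF S'])
    fix k assume k: "k \<in> {1..<n}"
    then have kk: "k \<in> {1..n}" "k + 1 \<in> {1..n}" by auto
    show "pr (k + 1) ` chart n S a k \<subseteq> chart n S a (k + 1)"
    proof
      fix y assume "y \<in> pr (k + 1) ` chart n S a k"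
      then obtain x where x: "x \<in> coord_space (S k)" "y = pr (k + 1) (g k x)"
        unfolding ch[OF kk(1)] pt_eq_coord_space[OF S' kk(1)] by blast
      have xW: "x \<in> W n" using x(1) coord_space_mono[OF subset_tuplesD(1)[OF S' kk(1)]] unfolding W_def by blast
      have "y = g (k + 1) (pr (k + 1) x)" using g k xW x(2) unfolding grp_A_def aut_M_def by auto
      moreover have "pr (k + 1) x \<in> coord_space (S (k + 1))"
        using x(1) admissible_step[OF S k] unfolding coord_space_def pr_def by auto
      ultimately show "y \<in> chart n S a (k + 1)"
        unfolding ch[OF kk(2)] pt_eq_coord_space[OF S' kk(2)] by blast
    qed
  qed
  moreover have "a \<in> coord_space (chart_coords n S)" unfolding coord_space_def a_def by simp
  moreover have "a (k, l, j) = 0" if "(k, l, j) \<in> chart_coords n S" "\<not> below k l j" for k l j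
    using that m(2)[of k l j] unfolding a_def chart_coords_def by auto
  ultimately have "a \<in> cell_coords n S" unfolding cell_coords_def chart_preimage_def by blast
  then show ?thesis using eq by metis
qed


section \<open>Transitivity of the group on the echelon points\<close>

lemma triangular_map_lin_aut:
  assumes f: "triangular_map n k f"
  shows "lin_aut n f"
proof -
  have fW: "f x \<in> W n" and fx: "f x m = (\<Sum>i\<in>{1..n+1}. x i * f (w i) m)" if "x \<in> W n" for x m
    using f that unfolding triangular_map_def by blast+
  have add: "f (u + v) = f u + f v" if uv: "u \<in> W n" "v \<in> W n" for u v
  proof
    fix m
    have "f (u + v) m = (\<Sum>i\<in>{1..n+1}. (u + v) i * f (w i) m)" by (rule fx[OF cfun.subspace_add[OF W_subspace uv]])
    also have "\<dots> = (\<Sum>i\<in>{1..n+1}. u i * f (w i) m + v i * f (w i) m)"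
      by (intro sum.cong refl) (simp add: distrib_right)
    also have "\<dots> = f u m + f v m" unfolding sum.distrib fx[OF uv(1), symmetric] fx[OF uv(2), symmetric] ..
    finally show "f (u + v) m = (f u + f v) m" by simp
  qed
  have scale: "f (cscale c v) = cscale c (f v)" if v: "v \<in> W n" for c v
  proof
    fix m
    have "f (cscale c v) m = (\<Sum>i\<in>{1..n+1}. cscale c v i * f (w i) m)"
      by (rule fx[OF cfun.subspace_scale[OF W_subspace v]])
    also have "\<dots> = c * (\<Sum>i\<in>{1..n+1}. v i * f (w i) m)"
      unfolding sum_distrib_left cscale_def by (intro sum.cong refl) (simp only: mult.assoc)
    also have "\<dots> = cscale c (f v) m" unfolding cscale_def fx[OF v, symmetric] ..
    finally show "f (cscale c v) m = cscale c (f v) m" .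
  qed
  have inj: "inj_on f (W n)"
  proof (rule inj_onI, rule ccontr)
    fix x y assume xy: "x \<in> W n" "y \<in> W n" "f x = f y" "x \<noteq> y"
    have d: "x - y \<in> W n" using cfun.subspace_diff[OF W_subspace xy(1,2)] .
    moreover have "x - y \<noteq> 0" using xy(4) by simp
    ultimately obtain j where "leads k (x - y) j" using leads_exists by blast
    from triangular_map_leads[OF f d this] have nz: "f (x - y) j \<noteq> 0" unfolding leads_def by blast
    have "f (x - y + y) = f (x - y) + f y" by (rule add[OF d xy(2)])
    then have "f (x - y) = 0" using xy(3) by simp
    then show False using nz by simp
  qed
  obtain m where "f ` coord_space {1..n+1} = graph_space n {1..n+1} m"
    using triangular_map_image[OF f subset_refl] by blast
  moreover have "graph_space n {1..n+1} m = W n" unfolding graph_space_def by simp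
  ultimately have "f ` W n = W n" unfolding W_def by simp
  then show ?thesis unfolding lin_aut_def bij_betw_def using inj add scale by blast
qed

context
  fixes n :: nat and S :: "nat \<Rightarrow> nat set" and a :: "nat \<times> nat \<times> nat \<Rightarrow> complex"
  assumes S: "admissible n S" and a: "a \<in> cell_coords n S"
begin

text \<open>The automorphism carrying \<open>p\<^sub>S\<close> to the point with coordinates \<open>a\<close>: the string \<open>P\<^sub>i\<close> (or \<open>I\<^sub>i\<^sub>-\<^sub>1\<close>) is sent to the
  string through the basis vector of that point which belongs to \<open>i\<close> at the first vertex where \<open>i \<in> S k\<close>.\<close>

definition gen :: "nat \<Rightarrow> nat \<Rightarrow> nat \<Rightarrow> complex" where
  "gen k j = graph_vec n (S k) (\<lambda>l s. a (k, l, s)) j"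

definition img_P :: "nat \<Rightarrow> nat \<Rightarrow> complex" where
  "img_P i = (if \<exists>k. i \<le> k \<and> k \<le> n \<and> i \<in> S k then gen (LEAST k. i \<le> k \<and> k \<le> n \<and> i \<in> S k) i else w i)"

definition img_I :: "nat \<Rightarrow> nat \<Rightarrow> complex" where
  "img_I i = (if \<exists>k. 1 \<le> k \<and> k < i \<and> i \<in> S k then gen (LEAST k. 1 \<le> k \<and> k < i \<and> i \<in> S k) i else w i)"

text \<open>The truncations follow the quiver: for i \<le> k the coordinates i + 1, ..., k have been
  projected away along the string, and for i > k nothing may remain in the coordinates of P, since
  the component from I to P must be zero.\<close>

definition img :: "nat \<Rightarrow> nat \<Rightarrow> nat \<Rightarrow> complex" where
  "img k i = (if i \<le> k then (\<lambda>m. if i < m \<and> m \<le> k then 0 else img_P i m) else (\<lambda>m. if m \<le> k then 0 else img_I i m))"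

definition aut :: "nat \<Rightarrow> (nat \<Rightarrow> complex) \<Rightarrow> nat \<Rightarrow> complex" where
  "aut k x = (\<lambda>m. \<Sum>i\<in>{1..n+1}. x i * img k i m)"

lemma gen_props:
  assumes k: "k \<in> {1..n}" and j: "j \<in> S k"
  shows "gen k j j = 1" "gen k j m \<noteq> 0 \<Longrightarrow> m = j \<or> below k m j" "gen k j \<in> W n" "gen k j \<in> chart n S a k"
proof -
  note K = subset_tuplesD(1)[OF admissible_subset[OF S] k]
  have "a (k, l, j) = 0" if "l \<in> {1..n+1} - S k" "\<not> below k l j" for l
    using a k j that unfolding cell_coords_def chart_coords_def by blast
  then have ld: "leads k (gen k j) j" unfolding gen_def by (intro graph_vec_leads j) blast
  show "gen k j j = 1" unfolding gen_def using graph_vec_coord[OF j] by simp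
  show "gen k j m \<noteq> 0 \<Longrightarrow> m = j \<or> below k m j" using ld unfolding leads_def by blast
  have "gen k j \<in> graph_space n (S k) (\<lambda>l s. a (k, l, s))" unfolding gen_def by (rule graph_vec_in[OF K j])
  then show "gen k j \<in> W n" "gen k j \<in> chart n S a k"
    unfolding chart_eq[OF admissible_subset[OF S] k] graph_space_def by blast+
qed

lemma first_P:
  assumes "1 \<le> i" "\<exists>k. i \<le> k \<and> k \<le> n \<and> i \<in> S k"
  obtains s where "i \<le> s" "s \<in> {1..n}" "i \<in> S s" "img_P i = gen s i" "\<And>k. i \<le> k \<Longrightarrow> k \<le> n \<Longrightarrow> i \<in> S k \<Longrightarrow> s \<le> k"
proof -
  define s where "s = (LEAST k. i \<le> k \<and> k \<le> n \<and> i \<in> S k)"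
  have s: "i \<le> s \<and> s \<le> n \<and> i \<in> S s" unfolding s_def by (rule LeastI_ex[OF assms(2)])
  have "s \<le> k" if "i \<le> k" "k \<le> n" "i \<in> S k" for k unfolding s_def by (rule Least_le) (use that in blast)
  moreover have "img_P i = gen s i" unfolding img_P_def s_def using assms(2) by simp
  ultimately show thesis using that[of s] s assms(1) by auto
qed

lemma first_I:
  assumes "i \<le> n + 1" "\<exists>k. 1 \<le> k \<and> k < i \<and> i \<in> S k"
  obtains s where "s < i" "s \<in> {1..n}" "i \<in> S s" "img_I i = gen s i" "\<And>k. 1 \<le> k \<Longrightarrow> k < i \<Longrightarrow> i \<in> S k \<Longrightarrow> s \<le> k"
proof -
  define s where "s = (LEAST k. 1 \<le> k \<and> k < i \<and> i \<in> S k)"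
  have s: "1 \<le> s \<and> s < i \<and> i \<in> S s" unfolding s_def by (rule LeastI_ex[OF assms(2)])
  have "s \<le> k" if "1 \<le> k" "k < i" "i \<in> S k" for k unfolding s_def by (rule Least_le) (use that in blast)
  moreover have "img_I i = gen s i" unfolding img_I_def s_def using assms(2) by simp
  ultimately show thesis using that[of s] s assms(1) by auto
qed

lemma img_P_props:
  assumes i: "i \<in> {1..n+1}"
  shows "img_P i i = 1" "img_P i \<in> W n"
proof -
  have "img_P i i = 1 \<and> img_P i \<in> W n"
  proof (cases "\<exists>k. i \<le> k \<and> k \<le> n \<and> i \<in> S k")
    case True
    obtain s where "i \<le> s" "s \<in> {1..n}" "i \<in> S s" "img_P i = gen s i" using first_P[OF _ True] i by auto
    then show ?thesis using gen_props by simp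
  next
    case False
    then show ?thesis unfolding img_P_def if_not_P[OF False] using w_in_W[OF i] by (simp add: w_apply)
  qed
  then show "img_P i i = 1" "img_P i \<in> W n" by blast+
qed

lemma img_I_props:
  assumes i: "i \<in> {1..n+1}"
  shows "img_I i i = 1" "img_I i \<in> W n" "img_I i m \<noteq> 0 \<Longrightarrow> m \<le> i"
proof -
  have "img_I i i = 1 \<and> img_I i \<in> W n \<and> (img_I i m \<noteq> 0 \<longrightarrow> m \<le> i)"
  proof (cases "\<exists>k. 1 \<le> k \<and> k < i \<and> i \<in> S k")
    case True
    obtain s where s: "s < i" "s \<in> {1..n}" "i \<in> S s" "img_I i = gen s i" using first_I[OF _ True] i by auto
    have "gen s i m \<noteq> 0 \<Longrightarrow> m \<le> i" using gen_props(2)[OF s(2,3), of m] s(1) unfolding below_def by auto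
    then show ?thesis using gen_props[OF s(2,3)] s(4) by simp
  next
    case False
    then show ?thesis unfolding img_I_def if_not_P[OF False] using w_in_W[OF i] by (simp add: w_apply)
  qed
  then show "img_I i i = 1" "img_I i \<in> W n" "img_I i m \<noteq> 0 \<Longrightarrow> m \<le> i" by blast+
qed

lemma img_leads:
  assumes k: "k \<in> {1..n}" and i: "i \<in> {1..n+1}"
  shows "leads k (img k i) i" "img k i \<in> W n"
proof -
  show "leads k (img k i) i"
  proof (cases "i \<le> k")
    case True
    have "m = i \<or> below k m i" if "img k i m \<noteq> 0" for m
      using that True unfolding img_def below_def by (auto split: if_splits)
    then show ?thesis unfolding leads_def using img_P_props(1)[OF i] True by (simp add: img_def)
  next
    case False
    have "m = i \<or> below k m i" if "img k i m \<noteq> 0" for m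
      using that False img_I_props(3)[OF i, of m] unfolding img_def below_def by (auto split: if_splits)
    then show ?thesis unfolding leads_def using img_I_props(1)[OF i] False by (simp add: img_def)
  qed
  show "img k i \<in> W n"
    using img_P_props(2)[OF i] img_I_props(2)[OF i] unfolding W_iff img_def by auto
qed

lemma img_step: "i \<noteq> k + 1 \<Longrightarrow> img (k + 1) i = pr (k + 1) (img k i)"
  unfolding img_def pr_def by (rule ext) auto

text \<open>This is where the string of I ends: truncation removes the coordinates up to k and
  \<open>img_I\<close> has none beyond k + 1, so only the coordinate that the projection kills is
  left.\<close>

lemma img_last:
  assumes "k + 1 \<in> {1..n+1}"
  shows "pr (k + 1) (img k (k + 1)) = 0"
proof
  fix m
  show "pr (k + 1) (img k (k + 1)) m = 0 m"
    using img_I_props(3)[OF assms, of m] unfolding img_def pr_def by (cases "m \<le> k + 1") auto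
qed

lemma aut_w: "i \<in> {1..n+1} \<Longrightarrow> aut k (w i) = img k i"
proof
  fix m assume i: "i \<in> {1..n+1}"
  have "aut k (w i) m = (\<Sum>j\<in>{1..n+1}. if j = i then img k j m else 0)"
    unfolding aut_def by (intro sum.cong refl) (auto simp: w_apply)
  also have "\<dots> = (if i \<in> {1..n+1} then img k i m else 0)" by (rule sum.delta) simp
  finally show "aut k (w i) m = img k i m" using i by simp
qed

lemma aut_triangular:
  assumes k: "k \<in> {1..n}"
  shows "triangular_map n k (aut k)"
  unfolding triangular_map_def
proof (intro conjI ballI allI)
  fix i assume i: "i \<in> {1..n+1}"
  show "leads k (aut k (w i)) i" unfolding aut_w[OF i] by (rule img_leads(1)[OF k i])
next
  fix x m assume "x \<in> W n"
  have "img k i m = 0" if "i \<in> {1..n+1}" "m \<notin> {1..n+1}" for i m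
    using img_leads(2)[OF k that(1)] that(2) unfolding W_iff by blast
  then show "aut k x \<in> W n" unfolding W_iff aut_def by (auto intro!: sum.neutral)
  show "aut k x m = (\<Sum>i\<in>{1..n+1}. x i * aut k (w i) m)"
  proof -
    have "(\<Sum>i\<in>{1..n+1}. x i * aut k (w i) m) = (\<Sum>i\<in>{1..n+1}. x i * img k i m)"
      by (rule sum.cong[OF refl]) (simp only: aut_w)
    then show ?thesis unfolding aut_def by simp
  qed
qed

lemma aut_commute:
  assumes k: "k \<in> {1..<n}"
  shows "aut (k + 1) (pr (k + 1) v) = pr (k + 1) (aut k v)"
proof
  fix m
  have "pr (k + 1) v i * img (k + 1) i m = (if m = k + 1 then 0 else v i * img k i m)"
    if "i \<in> {1..n+1}" for i
  proof (cases "i = k + 1")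
    case True
    have "pr (k + 1) (img k (k + 1)) m = 0" using img_last[of k] k by simp
    then show ?thesis unfolding True by (simp add: pr_def split: if_splits)
  next
    case False
    then show ?thesis unfolding img_step[OF False] by (simp add: pr_def)
  qed
  then have "aut (k + 1) (pr (k + 1) v) m = (\<Sum>i\<in>{1..n+1}. if m = k + 1 then 0 else v i * img k i m)"
    unfolding aut_def by (rule sum.cong[OF refl])
  also have "\<dots> = (if m = k + 1 then 0 else aut k v m)" unfolding aut_def by simp
  finally show "aut (k + 1) (pr (k + 1) v) m = pr (k + 1) (aut k v) m" by (simp add: pr_def)
qed

lemma aut_grp_A: "aut \<in> grp_A n"
proof -
  have "x = 0" if k: "k \<in> {1..n}" and v: "v \<in> coord_space {k+1..n+1}" and x: "x \<in> coord_space {1..k}"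
    and y: "y \<in> coord_space {k+1..n+1}" and eq: "aut k v = x + y" for k v x y
  proof
    fix m
    show "x m = 0 m"
    proof (cases "m \<in> {1..k}")
      case True
      have "v i * img k i m = 0" for i
      proof (cases "i \<le> k")
        case True then show ?thesis using v unfolding coord_space_def by auto
      next
        case False then show ?thesis using \<open>m \<in> {1..k}\<close> unfolding img_def by simp
      qed
      then have "aut k v m = 0" unfolding aut_def by (intro sum.neutral) blast
      moreover have "y m = 0" using y True unfolding coord_space_def by auto
      ultimately show ?thesis using eq by simp
    next
      case False then show ?thesis using x unfolding coord_space_def by simp
    qed
  qed
  then show ?thesis unfolding grp_A_def aut_M_def
    using triangular_map_lin_aut[OF aut_triangular] aut_commute rep_P_eq rep_I_eq by auto
qed

lemma chart_a_flag: "chart n S a \<in> deg_flag n"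
  using a unfolding cell_coords_def chart_preimage_def by blast

text \<open>At the first vertex s of the string the image is the basis vector \<open>gen s i\<close>
  itself, because its echelon form already has zeros where \<open>img\<close> truncates. From there
  the flag condition carries it to the later vertices.\<close>

lemma img_in_chart:
  assumes k: "k \<in> {1..n}" and i: "i \<in> S k"
  shows "img k i \<in> chart n S a k"
proof -
  have i1: "i \<in> {1..n+1}" using i subset_tuplesD(1)[OF admissible_subset[OF S] k] by blast
  have step: "img (j + 1) i \<in> chart n S a (j + 1)"
    if "img j i \<in> chart n S a j" "j \<in> {1..<n}" "i \<noteq> j + 1" for j
    unfolding img_step[OF that(3)] using that chart_a_flag unfolding deg_flag_def by blast
  have main: "img k i \<in> chart n S a k"
    if s: "s \<in> {1..n}" "s \<le> k" "img s i = gen s i" "i \<in> S s" and ne: "i \<notin> {s<..k}" for s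
  proof -
    have "img j i \<in> chart n S a j" if "s \<le> j" "j \<le> k" for j
      using that
    proof (induction rule: dec_induct)
      case base then show ?case using gen_props(4)[OF s(1,4)] s(3) by simp
    next
      case (step j)
      have "img (j + 1) i \<in> chart n S a (j + 1)"
      proof (rule \<open>\<And>j. img j i \<in> chart n S a j \<Longrightarrow> j \<in> {1..<n} \<Longrightarrow> i \<noteq> j + 1 \<Longrightarrow> img (j + 1) i \<in> chart n S a (j + 1)\<close>)
        show "img j i \<in> chart n S a j" using step by simp
        show "j \<in> {1..<n}" using step s(1) k by auto
        show "i \<noteq> j + 1" using ne step by auto
      qed
      then show ?case by simp
    qed
    then show ?thesis using s(2) by blast
  qed
  show ?thesis
  proof (cases "i \<le> k")
    case True
    have ex: "\<exists>k. i \<le> k \<and> k \<le> n \<and> i \<in> S k" using True i k by auto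
    obtain s where s: "i \<le> s" "s \<in> {1..n}" "i \<in> S s" "img_P i = gen s i"
      "\<And>k. i \<le> k \<Longrightarrow> k \<le> n \<Longrightarrow> i \<in> S k \<Longrightarrow> s \<le> k" using first_P[OF _ ex] i1 by auto
    have "img s i = gen s i"
    proof
      fix m
      have "gen s i m = 0" if "i < m" "m \<le> s"
        using gen_props(2)[OF s(2,3), of m] that s(1) unfolding below_def by auto
      then show "img s i m = gen s i m" unfolding img_def using s(1,4) by auto
    qed
    then show ?thesis using s True i k by (intro main[of s]) auto
  next
    case False
    have ex: "\<exists>k. 1 \<le> k \<and> k < i \<and> i \<in> S k" using False i k by auto
    obtain s where s: "s < i" "s \<in> {1..n}" "i \<in> S s" "img_I i = gen s i"
      "\<And>k. 1 \<le> k \<Longrightarrow> k < i \<Longrightarrow> i \<in> S k \<Longrightarrow> s \<le> k" using first_I[OF _ ex] i1 by auto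
    have "img s i = gen s i"
    proof
      fix m
      have "gen s i m = 0" if "m \<le> s"
        using gen_props(2)[OF s(2,3), of m] that s(1) unfolding below_def by auto
      then show "img s i m = gen s i m" unfolding img_def using s(1,4) by auto
    qed
    then show ?thesis using s False i k by (intro main[of s]) auto
  qed
qed

lemma aut_pt:
  assumes k: "k \<in> {1..n}"
  shows "aut k ` pt n S k = chart n S a k"
proof -
  note S' = admissible_subset[OF S]
  note K = subset_tuplesD(1)[OF S' k]
  have sub: "aut k ` coord_space (S k) \<subseteq> chart n S a k"
  proof
    fix y assume "y \<in> aut k ` coord_space (S k)"
    then obtain x where x: "x \<in> coord_space (S k)" "y = aut k x" by blast
    have "y = (\<Sum>i\<in>S k. cscale (x i) (img k i))"
    proof
      fix m
      have "(\<Sum>i\<in>{1..n+1}. x i * img k i m) = (\<Sum>i\<in>S k. x i * img k i m)"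
        by (rule sum.mono_neutral_right) (use K x(1) in \<open>auto simp: coord_space_def\<close>)
      then show "y m = (\<Sum>i\<in>S k. cscale (x i) (img k i)) m"
        unfolding x(2) aut_def sum_fun_apply cscale_def .
    qed
    also have "\<dots> \<in> chart n S a k"
      using img_in_chart[OF k] unfolding chart_eq[OF S' k]
      by (intro cfun.subspace_sum cfun.subspace_scale graph_space_subspace)
    finally show "y \<in> chart n S a k" .
  qed
  obtain m where m: "aut k ` coord_space (S k) = graph_space n (S k) m"
    using triangular_map_image[OF aut_triangular[OF k] K] by blast
  have "graph_space n (S k) m = graph_space n (S k) (\<lambda>l j. a (k, l, j))"
  proof (rule subspace_eq_of_dim)
    show "graph_space n (S k) (\<lambda>l j. a (k, l, j)) \<subseteq> coord_space {1..n+1}" using graph_space_W unfolding W_def .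
    show "graph_space n (S k) m \<subseteq> graph_space n (S k) (\<lambda>l j. a (k, l, j))"
      using sub unfolding m chart_eq[OF S' k] .
  qed (simp_all add: graph_space_subspace dim_graph_space[OF K])
  then show ?thesis unfolding pt_eq_coord_space[OF S' k] m chart_eq[OF S' k] .
qed

lemma chart_in_cell: "chart n S a \<in> cell n S"
proof -
  have "chart n S a = (\<lambda>k\<in>{1..n}. aut k ` pt n S k)"
    by (rule extensionalityI[OF chart_extensional restrict_extensional]) (simp add: aut_pt)
  then show ?thesis unfolding cell_def using aut_grp_A by blast
qed

end

lemma cell_eq:
  assumes S: "admissible n S"
  shows "cell n S = chart n S ` cell_coords n S"
proof
  show "cell n S \<subseteq> chart n S ` cell_coords n S"
    unfolding cell_def using cell_in_chart[OF S] by blast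
  show "chart n S ` cell_coords n S \<subseteq> cell n S" using chart_in_cell[OF S] by blast
qed

lemma pt_in_cell:
  assumes S: "admissible n S"
  shows "pt n S \<in> cell n S"
proof -
  have "chart n S 0 \<in> deg_flag n" unfolding chart_in_deg_flag_eqs[OF S] flag_eq_def by simp
  then have "0 \<in> cell_coords n S" unfolding cell_coords_def chart_preimage_def by (simp add: coord_space_def)
  then show ?thesis unfolding cell_eq[OF S] pt_eq_chart[OF admissible_subset[OF S]] by blast
qed

text \<open>The point p_S belongs to its own cell and lies in no chart other than that of S.\<close>

lemma inj_on_cell: "inj_on (cell n) {S. admissible n S}"
proof (rule inj_onI)
  fix S T assume ST: "S \<in> {S. admissible n S}" "T \<in> {S. admissible n S}" "cell n S = cell n T"
  then have "pt n S \<in> chart n T ` cell_coords n T" using pt_in_cell[of n S] cell_eq[of n T] by auto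
  then obtain a where a: "a \<in> cell_coords n T" "chart n T a = pt n S" by auto
  then have "a \<in> coord_space (chart_coords n T)" unfolding cell_coords_def chart_preimage_def by blast
  then show "S = T" using pt_only_chart(1)[of S n T a] a ST admissible_subset by blast
qed


section \<open>Dimension of the cells\<close>

lemma krull_dim_chart_image:
  assumes J: "J \<in> subset_tuples n" and A: "A \<subseteq> coord_space (chart_coords n J)"
  shows "homeomorphic_map (subtopology (zar (chart_coords n J)) A) (subtopology (zariski n) (chart n J ` A)) (chart n J)"
    and "krull_dim (subtopology (zariski n) (chart n J ` A)) = krull_dim (subtopology (zar (chart_coords n J)) A)"
proof -
  let ?P = "chart n J ` coord_space (chart_coords n J)"
  have AP: "chart n J ` A \<subseteq> ?P" using A by blast
  have PT: "?P \<subseteq> topspace (zariski n)" by (rule openin_subset[OF openin_chart_range[OF J]])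
  have "homeomorphic_map (subtopology (zar (chart_coords n J)) A)
    (subtopology (subtopology (zariski n) ?P) (chart n J ` A)) (chart n J)"
  proof (rule homeomorphic_map_subtopologies[OF homeomorphic_chart[OF J]])
    have "topspace (zar (chart_coords n J)) \<inter> A = A" using A by auto
    moreover have "topspace (subtopology (zariski n) ?P) \<inter> chart n J ` A = chart n J ` A"
      using AP PT by auto
    ultimately show "chart n J ` (topspace (zar (chart_coords n J)) \<inter> A) =
      topspace (subtopology (zariski n) ?P) \<inter> chart n J ` A" by simp
  qed
  moreover have "subtopology (subtopology (zariski n) ?P) (chart n J ` A) = subtopology (zariski n) (chart n J ` A)"
    unfolding subtopology_subtopology using AP by (simp add: inf.absorb2)
  ultimately show h: "homeomorphic_map (subtopology (zar (chart_coords n J)) A)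
      (subtopology (zariski n) (chart n J ` A)) (chart n J)" by simp
  show "krull_dim (subtopology (zariski n) (chart n J ` A)) = krull_dim (subtopology (zar (chart_coords n J)) A)"
    using krull_dim_homeomorphic[OF h] by simp
qed

lemma finite_cell_free: "S \<in> subset_tuples n \<Longrightarrow> finite (cell_free n S)"
  using finite_subset[OF _ finite_chart_coords[of S n], of "cell_free n S"] unfolding cell_free_def by blast

lemma krull_dim_cell:
  assumes S: "admissible n S"
  shows "krull_dim (subtopology (zariski n) (cell n S)) = enat (card (cell_free n S))"
proof -
  interpret T: triangular_system "chart_coords n S" "cell_free n S" "cell_rhs S" "cell_rank S"
    by (rule triangular_cell[OF S])
  have sub: "cell_coords n S \<subseteq> coord_space (chart_coords n S)"
    unfolding cell_coords_def chart_preimage_def by blast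
  have "krull_dim (subtopology (zariski n) (cell n S)) = krull_dim (subtopology (zar (chart_coords n S)) (cell_coords n S))"
    unfolding cell_eq[OF S] by (rule krull_dim_chart_image(2)[OF admissible_subset[OF S] sub])
  also have "\<dots> = krull_dim (zar (cell_free n S))"
    using krull_dim_homeomorphic[OF T.homeomorphic_param] unfolding cell_coords_solutions[OF S] by simp
  also have "\<dots> = enat (card (cell_free n S))"
    by (rule krull_dim_zar[OF finite_cell_free[OF admissible_subset[OF S]]])
  finally show ?thesis .
qed

lemma card_cell_free:
  assumes S: "S \<in> subset_tuples n"
  shows "card (cell_free n S) = (\<Sum>k\<in>{1..n}. \<Sum>j | starts S k j. card {l \<in> {1..n+1} - S k. below k l j})"
proof -
  have fin: "finite {j. starts S k j}" if "k \<in> {1..n}" for k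
    by (rule finite_subset[OF _ subset_tuplesD(3)[OF S that]]) (auto simp: starts_def)
  have "cell_free n S = (\<lambda>(k, j, l). (k, l, j)) `
    (SIGMA k:{1..n}. SIGMA j:{j. starts S k j}. {l \<in> {1..n+1} - S k. below k l j})" (is "_ = ?f ` ?X")
  proof
    show "cell_free n S \<subseteq> ?f ` ?X"
    proof
      fix c assume c: "c \<in> cell_free n S"
      obtain k l j where ce: "c = (k, l, j)" by (cases c)
      have "(k, j, l) \<in> ?X" using c unfolding ce cell_free_def chart_coords_def by auto
      then show "c \<in> ?f ` ?X" unfolding ce by force
    qed
    show "?f ` ?X \<subseteq> cell_free n S" unfolding cell_free_def chart_coords_def starts_def by auto
  qed
  moreover have "inj_on ?f ?X" by (auto simp: inj_on_def)
  ultimately have "card (cell_free n S) = card ?X" by (simp add: card_image)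
  also have "\<dots> = (\<Sum>k\<in>{1..n}. card (SIGMA j:{j. starts S k j}. {l \<in> {1..n+1} - S k. below k l j}))"
    using fin by (intro card_SigmaI) auto
  also have "\<dots> = (\<Sum>k\<in>{1..n}. \<Sum>j | starts S k j. card {l \<in> {1..n+1} - S k. below k l j})"
    using fin by (intro sum.cong refl card_SigmaI) auto
  finally show ?thesis .
qed

lemma sum_codim:
  fixes n :: nat
  shows "(\<Sum>k\<in>{1..n}. n + 1 - k) = n * (n + 1) div 2"
proof -
  have "(\<Sum>k\<in>{1..n}. n + 1 - k) = (\<Sum>k\<in>{1..n}. k)"
    by (rule sum.reindex_bij_witness[of _ "\<lambda>k. n + 1 - k" "\<lambda>k. n + 1 - k"]) auto
  then show ?thesis using gauss_sum_from_Suc_0[of n, where 'a = nat] by simp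
qed

text \<open>A vertex \<open>e\<close> with \<open>e \<in> S (e - 1)\<close> has two starting vectors instead of one. The surplus is compensated at the
  start \<open>k < e\<close> of the string through \<open>(e - 1, e)\<close>, where only the indices between \<open>k\<close> and \<open>e\<close> are below \<open>e\<close>.\<close>

lemma card_cell_free_le:
  assumes S: "admissible n S"
  shows "card (cell_free n S) \<le> n * (n + 1) div 2"
proof -
  note S' = admissible_subset[OF S]
  define E where "E = {e \<in> {2..n}. e \<in> S (e - 1)}"
  define f where "f k j = card {l \<in> {1..n+1} - S k. below k l j}" for k j
  \<comment> \<open>For k < j only the indices strictly between k and j are below j, so the count
    stays under n + 1 - k by at least n + 1 - j; g records this slack.\<close>
  define g where "g k j = (if k < j \<and> j \<le> n then n + 1 - j else 0)" for k j
  have fin: "finite {j. starts S k j}" if "k \<in> {1..n}" for k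
    by (rule finite_subset[OF _ subset_tuplesD(3)[OF S' that]]) (auto simp: starts_def)
  have cs: "card {j. starts S k j} = 1 + (if k \<in> E then 1 else 0)" if k: "k \<in> {1..n}" for k
  proof (cases "k = 1")
    case True
    then have "{j. starts S k j} = S 1" unfolding starts_def by auto
    then show ?thesis using True subset_tuplesD(2)[OF S' k] unfolding E_def by simp
  next
    case False
    have k1: "k - 1 \<in> {1..n}" "k - 1 \<in> {1..<n}" "k - 1 + 1 = k" using k False by auto
    have "{j. starts S k j} = S k - (S (k - 1) - {k})" using False unfolding starts_def by auto
    moreover have "S (k - 1) - {k} \<subseteq> S k" using admissible_step[OF S k1(2)] unfolding k1(3) by blast
    moreover have fi: "finite (S (k - 1))" by (rule subset_tuplesD(3)[OF S' k1(1)])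
    ultimately have "card {j. starts S k j} = k - card (S (k - 1) - {k})"
      using subset_tuplesD(2)[OF S' k] by (simp add: card_Diff_subset)
    moreover have "card (S (k - 1) - {k}) = k - 1 - (if k \<in> S (k - 1) then 1 else 0)"
      using subset_tuplesD(2)[OF S' k1(1)] fi by (simp add: card_Diff_singleton_if)
    moreover have "k \<in> E \<longleftrightarrow> k \<in> S (k - 1)" using k False unfolding E_def by auto
    ultimately show ?thesis using k False by auto
  qed
  have fg: "f k j + g k j \<le> n + 1 - k" if k: "k \<in> {1..n}" for k j
  proof (cases "k < j \<and> j \<le> n")
    case True
    have "f k j \<le> card {k<..<j}" unfolding f_def by (rule card_mono) (use True in \<open>auto simp: below_def\<close>)
    moreover have "g k j = n + 1 - j" unfolding g_def using True by simp
    moreover have "card {k<..<j} = j - Suc k" by simp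
    ultimately show ?thesis using True by linarith
  next
    case False
    have "f k j \<le> card ({1..n+1} - S k)" unfolding f_def by (rule card_mono) auto
    also have "\<dots> = n + 1 - k" using subset_tuplesD[OF S' k] by (simp add: card_Diff_subset)
    finally show ?thesis unfolding g_def if_not_P[OF False] by simp
  qed
  have "(\<Sum>k\<in>{1..n}. \<Sum>j | starts S k j. f k j + g k j) \<le> (\<Sum>k\<in>{1..n}. \<Sum>j | starts S k j. n + 1 - k)"
    using fg by (intro sum_mono) auto
  also have "\<dots> = (\<Sum>k\<in>{1..n}. (n + 1 - k) + (if k \<in> E then n + 1 - k else 0))"
    using cs by (intro sum.cong) auto
  also have "\<dots> = n * (n + 1) div 2 + (\<Sum>k\<in>{1..n}. if k \<in> E then n + 1 - k else 0)"
    unfolding sum.distrib sum_codim ..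
  also have "(\<Sum>k\<in>{1..n}. if k \<in> E then n + 1 - k else 0) = (\<Sum>e\<in>E. n + 1 - e)"
    by (rule sum.mono_neutral_cong_right) (auto simp: E_def)
  finally have up: "(\<Sum>k\<in>{1..n}. \<Sum>j | starts S k j. f k j) + (\<Sum>k\<in>{1..n}. \<Sum>j | starts S k j. g k j) \<le>
      n * (n + 1) div 2 + (\<Sum>e\<in>E. n + 1 - e)" unfolding sum.distrib .
  \<comment> \<open>The string through (e - 1, e) starts here, strictly before e, so distinct e draw
    on distinct slack terms g (s e) e.\<close>
  define s where "s e = (LEAST k. 1 \<le> k \<and> e \<in> S k)" for e
  have s: "1 \<le> s e \<and> e \<in> S (s e)" "s e \<le> e - 1" if "e \<in> E" for e
  proof -
    have *: "1 \<le> e - 1 \<and> e \<in> S (e - 1)" using that unfolding E_def by auto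
    show "1 \<le> s e \<and> e \<in> S (s e)" unfolding s_def by (rule LeastI[of _ "e - 1"]) (rule *)
    show "s e \<le> e - 1" unfolding s_def by (rule Least_le) (rule *)
  qed
  have ss: "starts S (s e) e" if "e \<in> E" for e
  proof -
    have "\<not> (1 \<le> s e - 1 \<and> e \<in> S (s e - 1))"
    proof
      assume "1 \<le> s e - 1 \<and> e \<in> S (s e - 1)"
      then have "s e \<le> s e - 1" unfolding s_def by (rule Least_le)
      then show False using s(1)[OF that] by linarith
    qed
    then show ?thesis using s(1)[OF that] unfolding starts_def by auto
  qed
  have finE: "finite E" unfolding E_def by simp
  have "(\<Sum>e\<in>E. n + 1 - e) = (\<Sum>e\<in>E. g (s e) e)"
  proof (rule sum.cong[OF refl])
    fix e assume e: "e \<in> E"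
    then show "n + 1 - e = g (s e) e" using s(2)[OF e] unfolding g_def E_def by auto
  qed
  also have "\<dots> = (\<Sum>(k, j)\<in>(\<lambda>e. (s e, e)) ` E. g k j)"
    by (subst sum.reindex) (auto simp: inj_on_def)
  also have "\<dots> \<le> (\<Sum>(k, j)\<in>(SIGMA k:{1..n}. {j. starts S k j}). g k j)"
  proof (rule sum_mono2)
    show "finite (SIGMA k:{1..n}. {j. starts S k j})" using fin by (intro finite_SigmaI) auto
    show "(\<lambda>e. (s e, e)) ` E \<subseteq> (SIGMA k:{1..n}. {j. starts S k j})"
    proof
      fix x assume "x \<in> (\<lambda>e. (s e, e)) ` E"
      then obtain e where e: "e \<in> E" "x = (s e, e)" by blast
      then have "s e \<le> n" using s(2)[OF e(1)] unfolding E_def by auto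
      then show "x \<in> (SIGMA k:{1..n}. {j. starts S k j})" using e s(1)[OF e(1)] ss[OF e(1)] by auto
    qed
  qed auto
  also have "\<dots> = (\<Sum>k\<in>{1..n}. \<Sum>j | starts S k j. g k j)"
    using fin by (intro sum.Sigma[symmetric]) auto
  finally have "(\<Sum>k\<in>{1..n}. \<Sum>j | starts S k j. f k j) \<le> n * (n + 1) div 2" using up by linarith
  then show ?thesis unfolding card_cell_free[OF S'] f_def .
qed

lemma finite_admissible: "finite {S. admissible n S}"
proof (rule finite_subset)
  show "{S. admissible n S} \<subseteq> subset_tuples n" unfolding admissible_def by blast
  show "finite (subset_tuples n)" unfolding subset_tuples_def by (intro finite_PiE) auto
qed

text \<open>The polynomial parametrisation of the cell of T is composed with the rational transition
  from chart T to chart S.\<close>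

lemma rational_image_cell:
  assumes S: "S \<in> subset_tuples n" and T: "admissible n T"
  shows "rational_image (chart_coords n S) (n * (n + 1) div 2)
    {x \<in> coord_space (chart_coords n S). chart n S x \<in> cell n T}"
proof -
  interpret T: triangular_system "chart_coords n T" "cell_free n T" "cell_rhs T" "cell_rank T"
    by (rule triangular_cell[OF T])
  show ?thesis
  proof (rule chart_transition[OF S admissible_subset[OF T]], goal_cases)
    case (1 \<delta> N)
    define h where "h y = \<delta> (\<lambda>c. T.param c y)" for y
    define p where "p c y = N c (\<lambda>c. T.param c y)" for c y
    have hp: "h \<in> polyfun" unfolding h_def by (rule polyfun_compose[OF 1(1) T.param_poly])
    have pp: "p c \<in> polyfun" for c unfolding p_def by (rule polyfun_compose[OF 1(2) T.param_poly])
    have cover: "\<exists>y\<in>coord_space (cell_free n T). h y \<noteq> 0 \<and> (\<forall>c\<in>chart_coords n S. x c * h y = p c y)"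
      if x: "x \<in> {x \<in> coord_space (chart_coords n S). chart n S x \<in> cell n T}" for x
    proof -
      obtain b where b: "b \<in> T.solutions" "chart n S x = chart n T b"
        using x unfolding cell_eq[OF T] cell_coords_solutions[OF T] by blast
      define y where "y = restrict_coords (cell_free n T) b"
      have "(\<lambda>c. T.param c y) = b" unfolding y_def by (rule ext) (rule T.solution_param[OF b(1), symmetric])
      then have "h y \<noteq> 0" "\<forall>c\<in>chart_coords n S. x c * h y = p c y"
        unfolding h_def p_def using 1(4)[OF b(2)] 1(5)[OF b(2)] by simp_all
      moreover have "y \<in> coord_space (cell_free n T)" unfolding y_def restrict_coords_def coord_space_def by simp
      ultimately show ?thesis by blast
    qed
    show ?case unfolding rational_image_def
    proof (rule exI[of _ "cell_free n T"], rule exI[of _ h], rule exI[of _ p], intro conjI allI ballI)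
      show "finite (cell_free n T)" by (rule finite_cell_free[OF admissible_subset[OF T]])
      show "card (cell_free n T) \<le> n * (n + 1) div 2" by (rule card_cell_free_le[OF T])
    qed (use hp pp cover in simp_all)
  qed
qed

lemma deg_flag_inter_chart:
  "deg_flag n \<inter> chart n S ` coord_space (chart_coords n S) = chart n S ` chart_preimage n S (deg_flag n)"
  unfolding chart_preimage_def by blast

text \<open>The trace of a single chart is already a neighbourhood, and it is covered by the
  finitely many cells, each a rational image with at most N parameters.\<close>

lemma local_krull_dim_le:
  assumes S: "S \<in> subset_tuples n" and a: "a \<in> chart_preimage n S (deg_flag n)"
  shows "local_krull_dim (subtopology (zariski n) (deg_flag n)) (chart n S a) \<le> enat (n * (n + 1) div 2)"
proof -
  let ?X = "chart_preimage n S (deg_flag n)" and ?C = "chart_coords n S"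
  let ?U = "chart n S ` ?X"
  have XC: "?X \<subseteq> coord_space ?C" unfolding chart_preimage_def by blast
  have U: "openin (subtopology (zariski n) (deg_flag n)) ?U"
    unfolding deg_flag_inter_chart[symmetric]
    by (rule openin_subtopology_Int2[OF openin_chart_range[OF S]])
  have UX: "?U \<subseteq> deg_flag n" unfolding chart_preimage_def by blast
  have "local_krull_dim (subtopology (zariski n) (deg_flag n)) (chart n S a) \<le>
      krull_dim (subtopology (subtopology (zariski n) (deg_flag n)) ?U)"
    unfolding local_krull_dim_def by (rule INF_lower) (use U a in blast)
  also have "subtopology (subtopology (zariski n) (deg_flag n)) ?U = subtopology (zariski n) ?U"
    unfolding subtopology_subtopology using UX by (simp add: inf.absorb2)
  also have "krull_dim (subtopology (zariski n) ?U) = krull_dim (subtopology (zar ?C) ?X)"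
    by (rule krull_dim_chart_image(2)[OF S XC])
  also have "\<dots> \<le> enat (n * (n + 1) div 2)"
  proof (rule krull_dim_rational_image_le[OF XC])
    let ?E = "(\<lambda>T. {x \<in> coord_space ?C. chart n S x \<in> cell n T}) ` {T. admissible n T}"
    show "finite ?E" using finite_admissible by blast
    show "?X \<subseteq> \<Union>?E"
    proof
      fix x assume x: "x \<in> ?X"
      then have "chart n S x \<in> deg_flag n" unfolding chart_preimage_def by blast
      then obtain T b where "admissible n T" "b \<in> cell_coords n T" "chart n S x = chart n T b"
        using deg_flag_in_cell_coords by blast
      then have "admissible n T" "chart n S x \<in> cell n T" using cell_eq by auto
      then show "x \<in> \<Union>?E" using x XC by blast
    qed
    fix Z assume "Z \<in> ?E"
    then obtain T where T: "admissible n T" "Z = {x \<in> coord_space ?C. chart n S x \<in> cell n T}" by blast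
    show "rational_image ?C (n * (n + 1) div 2) (Z \<inter> ?X)"
      using rational_image_cell[OF S T(1)] unfolding rational_image_def T(2) by (elim exE conjE) blast
  qed
  finally show ?thesis .
qed

lemma bad_pair_cell_not_smooth:
  assumes S: "admissible n S" and bad: "bad_pair n S"
  shows "\<not> cell n S \<subseteq> smooth_locus n"
proof -
  have "0 \<in> chart_preimage n S (deg_flag n)"
    unfolding chart_preimage_deg_flag[OF S] flag_eq_def by (simp add: coord_space_def)
  from local_krull_dim_le[OF admissible_subset[OF S] this]
  have "pt n S \<notin> smooth_locus n"
    unfolding pt_eq_chart[OF admissible_subset[OF S], symmetric] by (rule bad_pair_not_smooth[OF S bad])
  then show ?thesis using pt_in_cell[OF S] by blast
qed


section \<open>The smooth cells\<close>

definition perm_flag :: "nat \<Rightarrow> (nat \<Rightarrow> nat) \<Rightarrow> nat \<Rightarrow> nat set" where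
  "perm_flag n \<pi> = (\<lambda>k\<in>{1..n}. {i \<in> {1..n+1}. \<pi> i \<le> k})"

lemma perm_flag_iff: "k \<in> {1..n} \<Longrightarrow> i \<in> perm_flag n \<pi> k \<longleftrightarrow> i \<in> {1..n+1} \<and> \<pi> i \<le> k"
  unfolding perm_flag_def by simp

lemma perm_range: "\<pi> permutes {1..n+1} \<Longrightarrow> i \<in> {1..n+1} \<Longrightarrow> 1 \<le> \<pi> i \<and> \<pi> i \<le> n + 1"
  using permutes_in_image[of \<pi> "{1..n+1}" i] by simp

lemma perm_inj: "\<pi> permutes A \<Longrightarrow> \<pi> i = \<pi> j \<longleftrightarrow> i = j"
  using permutes_inj[of \<pi> A] by (simp add: inj_eq)

lemma card_perm_le:
  assumes "\<pi> permutes {1..n+1}" "k \<le> n + 1"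
  shows "card {i \<in> {1..n+1}. \<pi> i \<le> k} = k"
proof -
  have "bij_betw \<pi> {i \<in> {1..n+1}. \<pi> i \<le> k} {1..k}"
  proof (rule bij_betw_imageI)
    show "inj_on \<pi> {i \<in> {1..n+1}. \<pi> i \<le> k}"
      by (rule inj_on_subset[OF permutes_inj[OF assms(1)] subset_UNIV])
    show "\<pi> ` {i \<in> {1..n+1}. \<pi> i \<le> k} = {1..k}"
    proof (intro equalityI subsetI)
      fix x assume "x \<in> \<pi> ` {i \<in> {1..n+1}. \<pi> i \<le> k}"
      then obtain i where "i \<in> {1..n+1}" "\<pi> i \<le> k" "x = \<pi> i" by blast
      then show "x \<in> {1..k}" using perm_range[OF assms(1), of i] by simp
    next
      fix x assume x: "x \<in> {1..k}"
      then have "x \<in> {1..n+1}" using assms(2) by simp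
      then have "x \<in> \<pi> ` {1..n+1}" by (simp only: permutes_image[OF assms(1)])
      then obtain i where "i \<in> {1..n+1}" "x = \<pi> i" by blast
      then show "x \<in> \<pi> ` {i \<in> {1..n+1}. \<pi> i \<le> k}" using x by simp
    qed
  qed
  then show ?thesis using bij_betw_same_card by fastforce
qed

lemma card_perm_gt:
  assumes "\<pi> permutes {1..n+1}" "k \<le> n + 1"
  shows "card {i \<in> {1..n+1}. k < \<pi> i} = n + 1 - k"
proof -
  let ?A = "{i \<in> {1..n+1}. \<pi> i \<le> k}"
  have "card ({1..n+1} - ?A) = card {1..n+1} - card ?A"
    by (rule card_Diff_subset) (simp, blast)
  moreover have "{1..n+1} - ?A = {i \<in> {1..n+1}. k < \<pi> i}" by auto
  ultimately show ?thesis by (simp only: card_perm_le[OF assms] card_atLeastAtMost diff_Suc_1)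
qed

lemma perm_flag_admissible:
  assumes "\<pi> permutes {1..n+1}"
  shows "admissible n (perm_flag n \<pi>)"
  unfolding admissible_def subset_tuples_def
proof (intro conjI PiE_I CollectI ballI)
  fix k assume k: "k \<in> {1..n}"
  show "perm_flag n \<pi> k \<subseteq> {1..n+1}" unfolding perm_flag_def using k by auto
  show "card (perm_flag n \<pi> k) = k" unfolding perm_flag_def using k card_perm_le[OF assms, of k] by simp
next
  fix k assume "k \<notin> {1..n}"
  then show "perm_flag n \<pi> k = undefined" unfolding perm_flag_def by (simp only: restrict_apply if_False)
next
  fix k assume "k \<in> {1..<n}"
  then show "perm_flag n \<pi> k \<subseteq> perm_flag n \<pi> (k + 1) \<union> {k + 1}" unfolding perm_flag_def by auto
qed

lemma sum_perm_codim:
  fixes n :: nat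
  assumes "\<pi> permutes {1..n+1}"
  shows "(\<Sum>j\<in>{1..n+1}. n + 1 - \<pi> j) = n * (n + 1) div 2"
proof -
  have "(\<Sum>j\<in>{1..n+1}. n + 1 - \<pi> j) = (\<Sum>k\<in>{1..n+1}. n + 1 - k)"
    using sum.permute[OF assms, of "\<lambda>k. n + 1 - k"] by (simp add: comp_def)
  also have "\<dots> = (\<Sum>k\<in>{1..n}. n + 1 - k)"
    by (rule sum.mono_neutral_right) auto
  also note sum_codim[of n]
  finally show ?thesis .
qed

context
  fixes n :: nat and \<pi> :: "nat \<Rightarrow> nat"
  assumes perm: "\<pi> permutes {1..n+1}" and nc: "nocross \<pi>"
begin

abbreviation (input) "S \<equiv> perm_flag n \<pi>"

text \<open>For fixed \<open>l\<close> and \<open>j\<close> the equations link the coordinates \<open>(k, l, j)\<close> at neighbouring vertices, except where one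
  of the linear terms is missing. Exactly one of the coordinates may be chosen freely, and the others are
  determined by moving away from its vertex in both directions.\<close>

definition free_vertex :: "nat \<Rightarrow> nat \<Rightarrow> nat" where
  "free_vertex l j = (if \<pi> j < j \<and> j < \<pi> l then j else \<pi> j)"

definition chart_free :: "(nat \<times> nat \<times> nat) set" where
  "chart_free = {(k, l, j) \<in> chart_coords n S. k = free_vertex l j}"

definition quad :: "nat \<Rightarrow> nat \<Rightarrow> nat \<Rightarrow> (nat \<times> nat \<times> nat \<Rightarrow> complex) \<Rightarrow> complex" where
  "quad k l j a = (\<Sum>i\<in>S (k + 1) - S k - {k + 1}. a (k + 1, l, i) * a (k, i, j))"

text \<open>Before the free vertex the equation at k is solved for its left side; after it, the
  equation at k - 1 is solved for the linear term on its right side.\<close>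

definition chart_rhs :: "nat \<times> nat \<times> nat \<Rightarrow> (nat \<times> nat \<times> nat \<Rightarrow> complex) \<Rightarrow> complex" where
  "chart_rhs = (\<lambda>(k, l, j) a. if k < free_vertex l j
     then (if j = k + 1 then 0 else a (k + 1, l, j)) + quad k l j a
     else (if l = k then 0 else a (k - 1, l, j)) - quad (k - 1) l j a)"

text \<open>A quadratic term passes through an index i with \<pi> i strictly between \<pi> j and
  \<pi> l, so both factors have a smaller gap. The gap dominates because 2 n + 2 exceeds the second
  summand, which orders the vertices by moving away from the free one.\<close>

definition chart_rank :: "nat \<times> nat \<times> nat \<Rightarrow> nat" where
  "chart_rank = (\<lambda>(k, l, j). (\<pi> l - \<pi> j) * (2 * n + 2) + (if k < free_vertex l j then n + 1 - k else k))"

lemma coords_iff: "(k, l, j) \<in> chart_coords n S \<longleftrightarrow>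
    k \<in> {1..n} \<and> l \<in> {1..n+1} \<and> j \<in> {1..n+1} \<and> \<pi> j \<le> k \<and> k < \<pi> l"
proof (cases "k \<in> {1..n}")
  case True
  have "(k, l, j) \<in> chart_coords n S \<longleftrightarrow> l \<in> {1..n+1} \<and> l \<notin> S k \<and> j \<in> S k"
    unfolding chart_coords_def using True by simp
  then show ?thesis unfolding perm_flag_iff[OF True] using True not_le[of "\<pi> l" k] by blast
qed (auto simp: chart_coords_def)

text \<open>The place where non-crossing is used. A vertex k \<ge> \<pi> j before the free one
  exists only if the free vertex is j, with \<pi> j < j < \<pi> l. Then l = k + 1 would give \<pi> j
  < l < j < \<pi> l, so the left side to be solved for is present.\<close>

lemma before_free:
  assumes "(k, l, j) \<in> chart_coords n S" "k < free_vertex l j"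
  shows "k \<in> {1..<n}" "k + 1 < \<pi> l" "l \<noteq> k + 1" "free_vertex l j = j"
proof -
  note c = assms(1)[unfolded coords_iff]
  have j: "\<pi> j < j" "j < \<pi> l" using c assms(2) unfolding free_vertex_def by (auto split: if_splits)
  then show fj: "free_vertex l j = j" unfolding free_vertex_def by simp
  have "\<pi> l \<le> n + 1" using c perm_range[OF perm, of l] by simp
  then show "k \<in> {1..<n}" using c assms(2) j fj by auto
  show "k + 1 < \<pi> l" using assms(2) j fj by simp
  show "l \<noteq> k + 1"
  proof
    assume l: "l = k + 1"
    have "l \<noteq> j" using j by auto
    then have "\<pi> j < l \<and> l < j \<and> j < \<pi> l" using l c assms(2) j fj by auto
    then show False using nc unfolding nocross_def by blast
  qed
qed

text \<open>The linear term on the right would be missing only for j = k; but then \<pi> j < j <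
  \<pi> l, and k itself would be the free vertex.\<close>

lemma after_free:
  assumes "(k, l, j) \<in> chart_coords n S" "free_vertex l j < k"
  shows "k - 1 \<in> {1..<n}" "\<pi> j \<le> k - 1" "j \<noteq> k"
proof -
  note c = assms(1)[unfolded coords_iff]
  have p: "\<pi> j \<le> free_vertex l j" unfolding free_vertex_def by auto
  then show "\<pi> j \<le> k - 1" using assms(2) by simp
  have "1 \<le> \<pi> j" using c perm_range[OF perm, of j] by simp
  then show "k - 1 \<in> {1..<n}" using c p assms(2) by auto
  show "j \<noteq> k" using assms(2) p c unfolding free_vertex_def by (auto split: if_splits)
qed

lemma new_index: "k \<in> {1..<n} \<Longrightarrow> i \<in> S (k + 1) - S k - {k + 1} \<Longrightarrow> \<pi> i = k + 1"
  using perm_flag_iff[of k n i \<pi>] perm_flag_iff[of "k + 1" n i \<pi>] by auto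

lemma quad_cong:
  assumes k: "k \<in> {1..<n}" and r: "\<pi> j \<le> k" "k + 1 < \<pi> l"
    and ab: "\<And>d. chart_rank d < (\<pi> l - \<pi> j) * (2 * n + 2) \<Longrightarrow> a d = b d"
  shows "quad k l j a = quad k l j b"
  unfolding quad_def
proof (rule sum.cong[OF refl])
  fix i assume i: "i \<in> S (k + 1) - S k - {k + 1}"
  have pi: "\<pi> i = k + 1" by (rule new_index[OF k i])
  have lt: "chart_rank (k', l', j') < (\<pi> l - \<pi> j) * (2 * n + 2)"
    if "k' \<le> n" "\<pi> l' - \<pi> j' < \<pi> l - \<pi> j" for k' l' j'
  proof -
    have "chart_rank (k', l', j') \<le> (\<pi> l' - \<pi> j') * (2 * n + 2) + (n + 1)"
      unfolding chart_rank_def using that(1) by auto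
    also have "\<dots> < (\<pi> l' - \<pi> j' + 1) * (2 * n + 2)" by (simp add: algebra_simps)
    also have "\<dots> \<le> (\<pi> l - \<pi> j) * (2 * n + 2)" using that(2) by (intro mult_le_mono1) simp
    finally show ?thesis .
  qed
  have "a (k + 1, l, i) = b (k + 1, l, i)" "a (k, i, j) = b (k, i, j)"
    using k r pi by (intro ab lt; auto)+
  then show "a (k + 1, l, i) * a (k, i, j) = b (k + 1, l, i) * b (k, i, j)" by simp
qed

lemma quad_poly: "quad k l j \<in> polyfun"
  unfolding quad_def by (intro polyfun_sum polyfun.mult polyfun.coord)

lemma triangular_chart: "triangular_system (chart_coords n S) chart_free chart_rhs chart_rank"
proof
  show "finite (chart_coords n S)"
    by (rule finite_chart_coords[OF admissible_subset[OF perm_flag_admissible[OF perm]]])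
  show "chart_free \<subseteq> chart_coords n S" unfolding chart_free_def by blast
  fix c assume c: "c \<in> chart_coords n S - chart_free"
  obtain k l j where ce: "c = (k, l, j)" by (cases c)
  show "chart_rhs c \<in> polyfun"
  proof -
    have "chart_rhs c = (\<lambda>a. if k < free_vertex l j
      then (if j = k + 1 then 0 else a (k + 1, l, j)) + quad k l j a
      else (if l = k then 0 else a (k - 1, l, j)) - quad (k - 1) l j a)"
      unfolding chart_rhs_def ce by simp
    moreover have "\<dots> \<in> polyfun"
      by (intro polyfun_if polyfun_diff polyfun.add polyfun.coord polyfun.const quad_poly)
    ultimately show ?thesis by simp
  qed
  fix a b :: "nat \<times> nat \<times> nat \<Rightarrow> complex"
  assume ab: "\<And>d. d \<in> chart_coords n S \<Longrightarrow> chart_rank d < chart_rank c \<Longrightarrow> a d = b d"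
    "\<And>d. d \<notin> chart_coords n S \<Longrightarrow> a d = b d"
  then have ab: "chart_rank d < chart_rank c \<Longrightarrow> a d = b d" for d by blast
  have cc: "(k, l, j) \<in> chart_coords n S" "k \<noteq> free_vertex l j" using c unfolding ce chart_free_def by auto
  have ab': "a d = b d" if "chart_rank d < (\<pi> l - \<pi> j) * (2 * n + 2)" for d
    using that by (intro ab) (simp add: ce chart_rank_def)
  show "chart_rhs c a = chart_rhs c b"
  proof (cases "k < free_vertex l j")
    case True
    note bf = before_free[OF cc(1) True]
    have q: "quad k l j a = quad k l j b"
      by (rule quad_cong[OF bf(1) _ bf(2) ab']) (use cc(1) coords_iff in auto)
    have "a (k + 1, l, j) = b (k + 1, l, j)" if "j \<noteq> k + 1"
    proof (rule ab)
      have "k + 1 < free_vertex l j" using that True bf(4) by simp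
      then show "chart_rank (k + 1, l, j) < chart_rank c" unfolding ce chart_rank_def using True bf(1) by auto
    qed
    then show ?thesis unfolding chart_rhs_def ce using True q by simp
  next
    case False
    then have lt: "free_vertex l j < k" using cc(2) by simp
    note af = after_free[OF cc(1) lt]
    have k1: "k - 1 + 1 = k" using lt by simp
    have q: "quad (k - 1) l j a = quad (k - 1) l j b"
      by (rule quad_cong[OF af(1,2) _ ab']) (use cc(1) coords_iff k1 in auto)
    have "a (k - 1, l, j) = b (k - 1, l, j)"
      by (rule ab) (use lt in \<open>auto simp: ce chart_rank_def\<close>)
    then show ?thesis unfolding chart_rhs_def ce using False q by simp
  qed
qed

text \<open>Every equation is used exactly once: the one at k determines vertex k if k lies before
  the free vertex, and vertex k + 1 otherwise.\<close>

lemma chart_solutions: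
  "chart_preimage n S (deg_flag n) = triangular_system.solutions (chart_coords n S) chart_free chart_rhs"
proof -
  interpret T: triangular_system "chart_coords n S" chart_free chart_rhs chart_rank
    by (rule triangular_chart)
  have adm: "admissible n S" by (rule perm_flag_admissible[OF perm])
  have fe: "flag_eq S a k l j \<longleftrightarrow>
      (if l = k + 1 then 0 else a (k, l, j)) = (if j = k + 1 then 0 else a (k + 1, l, j)) + quad k l j a" for a k l j
    unfolding flag_eq_def quad_def ..
  have idx: "k \<in> {1..<n} \<and> l \<in> {1..n+1} - S (k + 1) \<and> j \<in> S k \<longleftrightarrow>
      k \<in> {1..<n} \<and> l \<in> {1..n+1} \<and> k + 1 < \<pi> l \<and> j \<in> {1..n+1} \<and> \<pi> j \<le> k" for k l j
    using perm_flag_iff[of k n j \<pi>] perm_flag_iff[of "k + 1" n l \<pi>] by auto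
  have eqs: "a \<in> chart_preimage n S (deg_flag n) \<longleftrightarrow> a \<in> coord_space (chart_coords n S) \<and>
     (\<forall>k l j. k \<in> {1..<n} \<and> l \<in> {1..n+1} - S (k + 1) \<and> j \<in> S k \<longrightarrow> flag_eq S a k l j)" for a
    unfolding chart_preimage_deg_flag[OF adm] by blast
  show ?thesis
  proof (intro equalityI subsetI)
    fix a assume "a \<in> chart_preimage n S (deg_flag n)"
    then have aC: "a \<in> coord_space (chart_coords n S)"
      and fl: "\<And>k l j. k \<in> {1..<n} \<Longrightarrow> l \<in> {1..n+1} \<Longrightarrow> k + 1 < \<pi> l \<Longrightarrow> j \<in> {1..n+1} \<Longrightarrow> \<pi> j \<le> k \<Longrightarrow> flag_eq S a k l j"
      unfolding eqs idx by auto
    have "a c = chart_rhs c a" if c: "c \<in> chart_coords n S - chart_free" for c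
    proof -
      obtain k l j where ce: "c = (k, l, j)" by (cases c)
      have cc: "(k, l, j) \<in> chart_coords n S" "k \<noteq> free_vertex l j" using c unfolding ce chart_free_def by auto
      note ci = cc(1)[unfolded coords_iff]
      show ?thesis
      proof (cases "k < free_vertex l j")
        case True
        note bf = before_free[OF cc(1) True]
        have "flag_eq S a k l j" using fl[OF bf(1) _ bf(2)] ci by simp
        then show ?thesis unfolding fe chart_rhs_def ce using True bf(3) by simp
      next
        case False
        then have lt: "free_vertex l j < k" using cc(2) by simp
        note af = after_free[OF cc(1) lt]
        have k1: "k - 1 + 1 = k" using lt by simp
        have "flag_eq S a (k - 1) l j" using fl[OF af(1) _ _ _ af(2), of l] ci unfolding k1 by simp
        then show ?thesis unfolding fe chart_rhs_def ce k1 using False af(3) by (simp add: algebra_simps)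
      qed
    qed
    then show "a \<in> T.solutions" unfolding T.solutions_def using aC by blast
  next
    fix a assume "a \<in> T.solutions"
    then have aC: "a \<in> coord_space (chart_coords n S)"
      and sol: "\<And>c. c \<in> chart_coords n S - chart_free \<Longrightarrow> a c = chart_rhs c a"
      unfolding T.solutions_def by auto
    have "flag_eq S a k l j" if k: "k \<in> {1..<n}" and l: "l \<in> {1..n+1}" "k + 1 < \<pi> l" and j: "j \<in> {1..n+1}" "\<pi> j \<le> k" for k l j
    proof (cases "k < free_vertex l j")
      case True
      have c: "(k, l, j) \<in> chart_coords n S" unfolding coords_iff using k l j by auto
      note bf = before_free[OF c True]
      have "(k, l, j) \<in> chart_coords n S - chart_free" using c True unfolding chart_free_def by auto
      from sol[OF this] show ?thesis unfolding fe chart_rhs_def using True bf(3) by simp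
    next
      case False
      have c: "(k + 1, l, j) \<in> chart_coords n S" unfolding coords_iff using k l j by auto
      have lt: "free_vertex l j < k + 1" using False by simp
      note af = after_free[OF c lt]
      have "(k + 1, l, j) \<in> chart_coords n S - chart_free" using c lt unfolding chart_free_def by auto
      from sol[OF this] show ?thesis unfolding fe chart_rhs_def using lt af(3) by (simp add: algebra_simps)
    qed
    then show "a \<in> chart_preimage n S (deg_flag n)" unfolding eqs idx using aC by blast
  qed
qed

text \<open>There is one free coordinate for each pair with \<pi> j < \<pi> l, since the vertices
  available to the pair run from \<pi> j to \<pi> l - 1 and contain the free one.\<close>

lemma card_chart_free: "card chart_free = n * (n + 1) div 2"
proof -
  have "chart_free = (\<lambda>(j, l). (free_vertex l j, l, j)) ` (SIGMA j:{1..n+1}. {l \<in> {1..n+1}. \<pi> j < \<pi> l})"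
    (is "_ = ?f ` ?X")
  proof
    show "chart_free \<subseteq> ?f ` ?X"
    proof
      fix c assume c: "c \<in> chart_free"
      obtain k l j where ce: "c = (k, l, j)" by (cases c)
      have "(j, l) \<in> ?X" "k = free_vertex l j" using c unfolding ce chart_free_def by (auto simp: coords_iff)
      then show "c \<in> ?f ` ?X" unfolding ce by force
    qed
    show "?f ` ?X \<subseteq> chart_free"
    proof
      fix c assume "c \<in> ?f ` ?X"
      then obtain j l where jl: "j \<in> {1..n+1}" "l \<in> {1..n+1}" "\<pi> j < \<pi> l" "c = (free_vertex l j, l, j)" by auto
      have "1 \<le> \<pi> j" "\<pi> l \<le> n + 1" using perm_range[OF perm] jl by auto
      then show "c \<in> chart_free" unfolding chart_free_def jl(4) using jl(1-3) by (auto simp: coords_iff free_vertex_def)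
    qed
  qed
  moreover have "inj_on ?f ?X" by (auto simp: inj_on_def)
  ultimately have "card chart_free = card ?X" by (simp add: card_image)
  also have "\<dots> = (\<Sum>j\<in>{1..n+1}. card {l \<in> {1..n+1}. \<pi> j < \<pi> l})" by (rule card_SigmaI) auto
  also have "\<dots> = (\<Sum>j\<in>{1..n+1}. n + 1 - \<pi> j)"
    using card_perm_gt[OF perm] perm_range[OF perm] by (intro sum.cong) auto
  finally show ?thesis using sum_perm_codim[OF perm] by simp
qed

text \<open>The chart presents the variety near the point as an affine space of dimension N. Any
  neighbourhood pulls back to a nonempty open subset of it, which has full dimension; the upper
  bound is the general one.\<close>

lemma perm_flag_local_dim:
  assumes a: "a \<in> chart_preimage n S (deg_flag n)"
  shows "local_krull_dim (subtopology (zariski n) (deg_flag n)) (chart n S a) = enat (n * (n + 1) div 2)"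
proof (rule antisym)
  note S' = admissible_subset[OF perm_flag_admissible[OF perm]]
  show "local_krull_dim (subtopology (zariski n) (deg_flag n)) (chart n S a) \<le> enat (n * (n + 1) div 2)"
    by (rule local_krull_dim_le[OF S' a])
  interpret T: triangular_system "chart_coords n S" chart_free chart_rhs chart_rank
    by (rule triangular_chart)
  let ?X = "chart_preimage n S (deg_flag n)" and ?C = "chart_coords n S"
  define \<Psi> where "\<Psi> = chart n S \<circ> (\<lambda>y c. T.param c y)"
  have XC: "?X \<subseteq> coord_space ?C" unfolding chart_preimage_def by blast
  have "homeomorphic_map (zar chart_free) (subtopology (zar ?C) ?X) (\<lambda>y c. T.param c y)"
    using T.homeomorphic_param unfolding chart_solutions .
  from homeomorphic_map_compose[OF this krull_dim_chart_image(1)[OF S' XC]]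
  have h: "homeomorphic_map (zar chart_free) (subtopology (zariski n) (chart n S ` ?X)) \<Psi>" unfolding \<Psi>_def .
  have XP: "chart n S ` ?X \<subseteq> topspace (zariski n)"
    using openin_subset[OF openin_chart_range[OF S']] XC by blast
  have surj: "\<Psi> ` coord_space chart_free = chart n S ` ?X"
    using homeomorphic_imp_surjective_map[OF h] XP by auto
  show "enat (n * (n + 1) div 2) \<le> local_krull_dim (subtopology (zariski n) (deg_flag n)) (chart n S a)"
    unfolding local_krull_dim_def
  proof (rule INF_greatest)
    fix U assume "U \<in> {U. openin (subtopology (zariski n) (deg_flag n)) U \<and> chart n S a \<in> U}"
    then have U: "openin (subtopology (zariski n) (deg_flag n)) U" and aU: "chart n S a \<in> U" by simp_all
    from U obtain O' where O': "openin (zariski n) O'" "U = O' \<inter> deg_flag n"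
      unfolding openin_subtopology by blast
    define U' where "U' = {y \<in> coord_space chart_free. \<Psi> y \<in> U}"
    have imgX: "\<Psi> y \<in> chart n S ` ?X" if "y \<in> coord_space chart_free" for y
      using that unfolding surj[symmetric] by (rule imageI)
    have XU: "chart n S ` ?X \<subseteq> deg_flag n" unfolding chart_preimage_def by blast
    have "openin (subtopology (zariski n) (chart n S ` ?X)) (U \<inter> chart n S ` ?X)"
      unfolding openin_subtopology O'(2) by (rule exI[of _ O']) (use O'(1) XU in blast)
    then have "openin (zar chart_free) {y \<in> topspace (zar chart_free). \<Psi> y \<in> U \<inter> chart n S ` ?X}"
      by (rule openin_continuous_map_preimage[OF homeomorphic_imp_continuous_map[OF h]])
    moreover have "{y \<in> topspace (zar chart_free). \<Psi> y \<in> U \<inter> chart n S ` ?X} = U'"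
      unfolding U'_def topspace_zar using imgX by blast
    ultimately have oU': "openin (zar chart_free) U'" by simp
    have "chart n S a \<in> \<Psi> ` coord_space chart_free" unfolding surj using a by (rule imageI)
    then obtain y where "y \<in> coord_space chart_free" "chart n S a = \<Psi> y" by (rule imageE)
    then have "U' \<noteq> {}" unfolding U'_def using aU by auto
    have fin: "finite chart_free" by (rule finite_subset[OF T.DC T.fin])
    have "enat (card chart_free) \<le> krull_dim (subtopology (zar chart_free) U')"
      by (rule krull_dim_open_ge[OF fin oU' \<open>U' \<noteq> {}\<close>])
    also have "\<dots> = krull_dim (subtopology (subtopology (zariski n) (chart n S ` ?X)) (U \<inter> chart n S ` ?X))"
    proof (rule krull_dim_homeomorphic, rule homeomorphic_map_subtopologies[OF h])
      have "\<Psi> ` U' = U \<inter> chart n S ` ?X" unfolding U'_def surj[symmetric] by blast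
      moreover have "topspace (zar chart_free) \<inter> U' = U'" unfolding U'_def by auto
      moreover have "topspace (subtopology (zariski n) (chart n S ` ?X)) \<inter> (U \<inter> chart n S ` ?X) = U \<inter> chart n S ` ?X"
        using XP by auto
      ultimately show "\<Psi> ` (topspace (zar chart_free) \<inter> U') =
        topspace (subtopology (zariski n) (chart n S ` ?X)) \<inter> (U \<inter> chart n S ` ?X)" by simp
    qed
    also have "subtopology (subtopology (zariski n) (chart n S ` ?X)) (U \<inter> chart n S ` ?X) =
      subtopology (zariski n) (U \<inter> chart n S ` ?X)"
      unfolding subtopology_subtopology by (rule arg_cong[where f = "subtopology (zariski n)"]) blast
    also have "krull_dim (subtopology (zariski n) (U \<inter> chart n S ` ?X)) \<le> krull_dim (subtopology (zariski n) U)"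
      by (rule krull_dim_subset_le) blast
    also have "subtopology (zariski n) U = subtopology (subtopology (zariski n) (deg_flag n)) U"
      unfolding subtopology_subtopology by (rule arg_cong[where f = "subtopology (zariski n)"]) (use O' in blast)
    finally show "enat (n * (n + 1) div 2) \<le> krull_dim (subtopology (subtopology (zariski n) (deg_flag n)) U)"
      unfolding card_chart_free .
  qed
qed

lemma perm_flag_smooth: "cell n S \<subseteq> smooth_locus n"
proof
  fix V assume "V \<in> cell n S"
  note adm = perm_flag_admissible[OF perm]
  note S' = admissible_subset[OF adm]
  interpret T: triangular_system "chart_coords n S" chart_free chart_rhs chart_rank
    by (rule triangular_chart)
  obtain a where a: "a \<in> chart_preimage n S (deg_flag n)" "V = chart n S a"
    using \<open>V \<in> cell n S\<close> unfolding cell_eq[OF adm] cell_coords_def by blast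
  have "cfun.dim (zariski_tangent (chart_coords n S) (chart_preimage n S (deg_flag n)) a) = card chart_free"
    using T.dim_tangent a(1) unfolding chart_solutions by blast
  then have "enat (cfun.dim (zariski_tangent (chart_coords n S) (chart_preimage n S (deg_flag n)) a)) =
      local_krull_dim (subtopology (zariski n) (deg_flag n)) V"
    unfolding a(2) perm_flag_local_dim[OF a(1)] card_chart_free by simp
  moreover have "V \<in> deg_flag n" "a \<in> coord_space (chart_coords n S)"
    using a unfolding chart_preimage_def by auto
  ultimately show "V \<in> smooth_locus n" unfolding smooth_locus_def using S' a(2) by blast
qed

section \<open>Cell dimensions in terms of the permutation\<close>

lemma perm_flag_starts:
  assumes k: "k \<in> {1..n}"
  shows "starts S k j \<longleftrightarrow> j \<in> {1..n+1} \<and> (k = \<pi> j \<or> (k = j \<and> \<pi> j < j))"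
proof -
  have p1: "1 \<le> \<pi> j" if "j \<in> {1..n+1}" using perm_range[OF perm that] by simp
  show ?thesis
  proof (cases "k = 1")
    case True
    then show ?thesis unfolding starts_def perm_flag_iff[OF k] using p1 by auto
  next
    case False
    then have "k - 1 \<in> {1..n}" using k by auto
    then show ?thesis unfolding starts_def perm_flag_iff[OF k] perm_flag_iff[OF \<open>k - 1 \<in> {1..n}\<close>]
      using k p1 False by auto
  qed
qed

text \<open>If \<pi> j < j, the string of j restarts at vertex j, where all n + 1 - j indices l with
  \<pi> l > j count; at \<pi> j the candidates are the j - \<pi> j - 1 indices between \<pi> j and
  j, less those with smaller \<pi>. Together with \<open>cross_count\<close> this makes n + 1 -
  \<pi> j. If \<pi> j \<ge> j, the cyclic order excludes exactly the l with j < l \<le> \<pi>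
  j.\<close>

lemma cross_count_complement:
  assumes j: "j \<in> {1..n+1}"
  defines "F \<equiv> \<lambda>k j. card {l \<in> {1..n+1}. k < \<pi> l \<and> below k l j}"
  shows "F (\<pi> j) j + (if \<pi> j < j then F j j else 0) + cross_count \<pi> j = n + 1 - \<pi> j"
proof -
  have pj: "1 \<le> \<pi> j" "\<pi> j \<le> n + 1" using perm_range[OF perm j] by auto
  have out: "\<pi> i = i" if "i \<notin> {1..n+1}" for i using permutes_not_in[OF perm that] .
  have rng: "i \<in> {1..n+1}" if "\<pi> i \<noteq> i" for i using out that by blast
  show ?thesis
  proof (cases "\<pi> j < j")
    case True
    have "l \<noteq> j" if "j < \<pi> l" for l using that True by auto
    then have "{l \<in> {1..n+1}. j < \<pi> l \<and> below j l j} = {l \<in> {1..n+1}. j < \<pi> l}"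
      unfolding below_def by fastforce
    then have Fjj: "F j j = n + 1 - j" unfolding F_def using card_perm_gt[OF perm, of j] j by simp
    have "{l. \<pi> j < l \<and> l < j} = {l \<in> {1..n+1}. \<pi> j < \<pi> l \<and> below (\<pi> j) l j} \<union> {i. \<pi> i < \<pi> j \<and> \<pi> j < i \<and> i < j}"
      (is "_ = ?A \<union> ?B")
    proof (intro equalityI subsetI)
      fix l assume "l \<in> {l. \<pi> j < l \<and> l < j}"
      then have l: "\<pi> j < l" "l < j" by auto
      then have "\<pi> l \<noteq> \<pi> j" using perm_inj[OF perm] by auto
      then show "l \<in> ?A \<union> ?B" using l True j unfolding below_def by auto
    qed (use True in \<open>auto simp: below_def\<close>)
    moreover have "?A \<inter> ?B = {}" by auto
    moreover have "finite ?A" by simp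
    moreover have "finite ?B" by (rule finite_subset[of _ "{..j}"]) auto
    ultimately have "card {l. \<pi> j < l \<and> l < j} = card ?A + card ?B" by (simp add: card_Un_disjoint)
    moreover have "card {l. \<pi> j < l \<and> l < j} = j - Suc (\<pi> j)"
      using card_greaterThanLessThan[of "\<pi> j" j] by (simp add: greaterThanLessThan_def greaterThan_def lessThan_def Collect_conj_eq)
    ultimately have "F (\<pi> j) j + card ?B = j - Suc (\<pi> j)" unfolding F_def by simp
    then show ?thesis using True Fjj j unfolding cross_count_def by simp
  next
    case False
    have "{l \<in> {1..n+1}. \<pi> j < \<pi> l} = {l \<in> {1..n+1}. \<pi> j < \<pi> l \<and> below (\<pi> j) l j} \<union> {l. j < l \<and> l \<le> \<pi> j \<and> \<pi> j < \<pi> l}"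
      (is "_ = ?A \<union> ?B")
    proof (intro equalityI subsetI)
      fix l assume "l \<in> {l \<in> {1..n+1}. \<pi> j < \<pi> l}"
      then have l: "l \<in> {1..n+1}" "\<pi> j < \<pi> l" by auto
      then have "l \<noteq> j" by auto
      then show "l \<in> ?A \<union> ?B" using l False unfolding below_def by auto
    next
      fix l assume "l \<in> ?A \<union> ?B"
      then show "l \<in> {l \<in> {1..n+1}. \<pi> j < \<pi> l}" using rng[of l] by auto
    qed
    moreover have "?A \<inter> ?B = {}" using False unfolding below_def by auto
    moreover have "finite ?A" by simp
    moreover have "finite ?B" by (rule finite_subset[of _ "{..\<pi> j}"]) auto
    ultimately have "card {l \<in> {1..n+1}. \<pi> j < \<pi> l} = card ?A + card ?B" by (simp add: card_Un_disjoint)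
    then show ?thesis using False card_perm_gt[OF perm pj(2)] unfolding F_def cross_count_def by simp
  qed
qed

lemma card_cell_free_perm: "card (cell_free n S) + stat \<pi> = n * (n + 1) div 2"
proof -
  define F where "F k j = card {l \<in> {1..n+1}. k < \<pi> l \<and> below k l j}" for k j
  \<comment> \<open>Adding the fictitious vertex n + 1 costs nothing and lets k run over all values
    of \<pi>, so that the sums can be exchanged.\<close>
  have Fn: "F (n + 1) j = 0" for j
  proof -
    have "\<not> n + 1 < \<pi> l" if "l \<in> {1..n+1}" for l using perm_range[OF perm that] by simp
    then have "{l \<in> {1..n+1}. n + 1 < \<pi> l \<and> below (n + 1) l j} = {}" by blast
    then show ?thesis unfolding F_def by (simp only: card.empty)
  qed
  have "card (cell_free n S) = (\<Sum>k\<in>{1..n}. \<Sum>j | starts S k j. F k j)"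
    unfolding card_cell_free[OF admissible_subset[OF perm_flag_admissible[OF perm]]]
  proof (intro sum.cong refl)
    fix k j assume k: "k \<in> {1..n}"
    have "{l \<in> {1..n+1} - S k. below k l j} = {l \<in> {1..n+1}. k < \<pi> l \<and> below k l j}"
      unfolding perm_flag_def using k by auto
    then show "card {l \<in> {1..n+1} - S k. below k l j} = F k j" unfolding F_def by (rule arg_cong)
  qed
  also have "\<dots> = (\<Sum>k\<in>{1..n}. \<Sum>j\<in>{1..n+1}. (if k = \<pi> j then F k j else 0) + (if k = j then (if \<pi> j < j then F k j else 0) else 0))"
  proof (rule sum.cong[OF refl])
    fix k assume k: "k \<in> {1..n}"
    have "{j. starts S k j} = {j \<in> {1..n+1}. k = \<pi> j \<or> (k = j \<and> \<pi> j < j)}"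
      unfolding perm_flag_starts[OF k] ..
    then have "(\<Sum>j | starts S k j. F k j) = (\<Sum>j\<in>{1..n+1}. if k = \<pi> j \<or> (k = j \<and> \<pi> j < j) then F k j else 0)"
      by (simp only:) (rule sum.inter_filter, simp)
    also have "\<dots> = (\<Sum>j\<in>{1..n+1}. (if k = \<pi> j then F k j else 0) + (if k = j then (if \<pi> j < j then F k j else 0) else 0))"
      by (intro sum.cong refl) auto
    finally show "(\<Sum>j | starts S k j. F k j) = \<dots>" .
  qed
  also have "\<dots> = (\<Sum>k\<in>{1..n+1}. \<Sum>j\<in>{1..n+1}. (if k = \<pi> j then F k j else 0) + (if k = j then (if \<pi> j < j then F k j else 0) else 0))"
  proof (rule sum.mono_neutral_left)
    show "\<forall>k\<in>{1..n+1} - {1..n}. (\<Sum>j\<in>{1..n+1}. (if k = \<pi> j then F k j else 0) + (if k = j then (if \<pi> j < j then F k j else 0) else 0)) = 0"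
    proof
      fix k assume "k \<in> {1..n+1} - {1..n}"
      then have "k = n + 1" by auto
      then show "(\<Sum>j\<in>{1..n+1}. (if k = \<pi> j then F k j else 0) + (if k = j then (if \<pi> j < j then F k j else 0) else 0)) = 0"
        using Fn by (intro sum.neutral) auto
    qed
  qed auto
  also have "\<dots> = (\<Sum>j\<in>{1..n+1}. \<Sum>k\<in>{1..n+1}. (if k = \<pi> j then F k j else 0) + (if k = j then (if \<pi> j < j then F k j else 0) else 0))"
    by (rule sum.swap)
  also have "\<dots> = (\<Sum>j\<in>{1..n+1}. F (\<pi> j) j + (if \<pi> j < j then F j j else 0))"
  proof (rule sum.cong[OF refl])
    fix j assume j: "j \<in> {1..n+1}"
    have "(\<Sum>k\<in>{1..n+1}. if k = \<pi> j then F k j else 0) = (if \<pi> j \<in> {1..n+1} then F (\<pi> j) j else 0)"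
      by (rule sum.delta) simp
    moreover have "(\<Sum>k\<in>{1..n+1}. if k = j then (if \<pi> j < j then F k j else 0) else 0) =
        (if j \<in> {1..n+1} then (if \<pi> j < j then F j j else 0) else 0)"
      by (rule sum.delta) simp
    ultimately show "(\<Sum>k\<in>{1..n+1}. (if k = \<pi> j then F k j else 0) + (if k = j then (if \<pi> j < j then F k j else 0) else 0)) =
        F (\<pi> j) j + (if \<pi> j < j then F j j else 0)"
      unfolding sum.distrib using j perm_range[OF perm j] by simp
  qed
  finally have cf: "card (cell_free n S) = (\<Sum>j\<in>{1..n+1}. F (\<pi> j) j + (if \<pi> j < j then F j j else 0))" .
  have st: "stat \<pi> = (\<Sum>j\<in>{1..n+1}. cross_count \<pi> j)" by (rule stat_eq_sum[OF perm]) auto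
  have "card (cell_free n S) + stat \<pi> =
      (\<Sum>j\<in>{1..n+1}. F (\<pi> j) j + (if \<pi> j < j then F j j else 0) + cross_count \<pi> j)"
    unfolding cf st by (rule sum.distrib[symmetric])
  also have "\<dots> = (\<Sum>j\<in>{1..n+1}. n + 1 - \<pi> j)"
  proof (rule sum.cong[OF refl])
    fix j assume j: "j \<in> {1..n+1}"
    show "F (\<pi> j) j + (if \<pi> j < j then F j j else 0) + cross_count \<pi> j = n + 1 - \<pi> j"
      unfolding F_def by (rule cross_count_complement[OF j])
  qed
  also have "\<dots> = n * (n + 1) div 2" by (rule sum_perm_codim[OF perm])
  finally show ?thesis .
qed

end

text \<open>For a set tuple without bad pairs the S k increase with k and have k elements, so
  exactly one index enters at each vertex and the entry times form a permutation. A crossing l < j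
  of it is the same as a bad pair (l, j) with l < j.\<close>

lemma bij_perm_flag:
  "bij_betw (perm_flag n) (nc_perms 1 (n + 1)) {S. admissible n S \<and> \<not> bad_pair n S}"
  unfolding bij_betw_def
proof (intro conjI equalityI subsetI)
  show "inj_on (perm_flag n) (nc_perms 1 (n + 1))"
  proof (rule inj_onI, rule ext)
    fix \<pi> \<rho> i assume p: "\<pi> \<in> nc_perms 1 (n + 1)" "\<rho> \<in> nc_perms 1 (n + 1)" and eq: "perm_flag n \<pi> = perm_flag n \<rho>"
    have pp: "\<pi> permutes {1..n+1}" "\<rho> permutes {1..n+1}" using p unfolding nc_perms_def by auto
    show "\<pi> i = \<rho> i"
    proof (cases "i \<in> {1..n+1}")
      case True
      have le: "\<pi> i \<le> k \<longleftrightarrow> \<rho> i \<le> k" if "k \<in> {1..n}" for k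
        using perm_flag_iff[OF that, of i \<pi>] perm_flag_iff[OF that, of i \<rho>] eq True by simp
      show ?thesis
      proof (rule ccontr)
        assume "\<pi> i \<noteq> \<rho> i"
        then consider "\<pi> i < \<rho> i" | "\<rho> i < \<pi> i" by linarith
        then show False
        proof cases
          case 1 then show False using le[of "\<pi> i"] perm_range[OF pp(1) True] perm_range[OF pp(2) True] by auto
        next
          case 2 then show False using le[of "\<rho> i"] perm_range[OF pp(1) True] perm_range[OF pp(2) True] by auto
        qed
      qed
    next
      case False
      then show ?thesis using permutes_not_in[OF pp(1)] permutes_not_in[OF pp(2)] by simp
    qed
  qed
next
  fix S assume "S \<in> perm_flag n ` nc_perms 1 (n + 1)"
  then obtain \<pi> where \<pi>: "\<pi> permutes {1..n+1}" "nocross \<pi>" "S = perm_flag n \<pi>" unfolding nc_perms_def by auto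
  have "\<not> bad_pair n S"
  proof
    assume "bad_pair n S"
    then obtain l j where lj: "2 \<le> l" "l \<le> j" "j \<le> n" "j \<in> S (l - 1)" "l \<notin> S j" unfolding bad_pair_def by blast
    have "l - 1 \<in> {1..n}" "j \<in> {1..n}" "l \<in> {1..n+1}" using lj by auto
    then have "\<pi> j \<le> l - 1" "j < \<pi> l"
      using lj(4,5) perm_flag_iff[of "l - 1" n j \<pi>] perm_flag_iff[of j n l \<pi>] unfolding \<pi>(3) by auto
    moreover from this have "l \<noteq> j" using lj by auto
    ultimately have "\<pi> j < l \<and> l < j \<and> j < \<pi> l" using lj by auto
    then show False using \<pi>(2) unfolding nocross_def by blast
  qed
  then show "S \<in> {S. admissible n S \<and> \<not> bad_pair n S}" using perm_flag_admissible[OF \<pi>(1)] \<pi>(3) by simp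
next
  fix S assume "S \<in> {S. admissible n S \<and> \<not> bad_pair n S}"
  then have adm: "admissible n S" and good: "\<not> bad_pair n S" by auto
  note S' = admissible_subset[OF adm]
  have step: "S k \<subseteq> S (k + 1)" if k: "k \<in> {1..<n}" for k
  proof
    fix i assume i: "i \<in> S k"
    show "i \<in> S (k + 1)"
    proof (cases "i = k + 1")
      case True
      show ?thesis
      proof (rule ccontr)
        assume "i \<notin> S (k + 1)"
        then have "bad_pair n S" unfolding bad_pair_def using True i k by (intro exI[of _ "k + 1"]) auto
        then show False using good by blast
      qed
    qed (use admissible_step[OF adm k i] in blast)
  qed
  have mono: "S k \<subseteq> S k'" if "1 \<le> k" "k \<le> k'" "k' \<le> n" for k k'
    using that(2,3)
  proof (induction rule: dec_induct)
    case (step m)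
    then show ?case using \<open>\<And>k. k \<in> {1..<n} \<Longrightarrow> S k \<subseteq> S (k + 1)\<close>[of m] that(1) by auto
  qed simp
  \<comment> \<open>The alternative k = n + 1 gives a value to the single index that never
    enters.\<close>
  define \<pi> where "\<pi> i = (if i \<in> {1..n+1} then (LEAST k. 1 \<le> k \<and> (k = n + 1 \<or> i \<in> S k)) else i)" for i
  have \<pi>1: "1 \<le> \<pi> i \<and> (\<pi> i = n + 1 \<or> i \<in> S (\<pi> i))" "\<pi> i \<le> n + 1" if "i \<in> {1..n+1}" for i
  proof -
    have *: "1 \<le> n + 1 \<and> (n + 1 = n + 1 \<or> i \<in> S (n + 1))" by simp
    show "1 \<le> \<pi> i \<and> (\<pi> i = n + 1 \<or> i \<in> S (\<pi> i))"
      unfolding \<pi>_def if_P[OF that] by (rule LeastI[of _ "n + 1"]) (rule *)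
    show "\<pi> i \<le> n + 1" unfolding \<pi>_def if_P[OF that] by (rule Least_le) (rule *)
  qed
  have \<pi>le: "\<pi> i \<le> k \<longleftrightarrow> i \<in> S k" if "i \<in> {1..n+1}" "k \<in> {1..n}" for i k
  proof
    assume "i \<in> S k"
    then have "1 \<le> k \<and> (k = n + 1 \<or> i \<in> S k)" using that by simp
    then show "\<pi> i \<le> k" unfolding \<pi>_def if_P[OF that(1)] by (rule Least_le)
  next
    assume "\<pi> i \<le> k"
    then show "i \<in> S k" using \<pi>1[OF that(1)] mono[of "\<pi> i" k] that(2) by auto
  qed
  have surj: "\<exists>i\<in>{1..n+1}. \<pi> i = k" if k: "k \<in> {1..n+1}" for k
  proof -
    define A where "A = {i \<in> {1..n+1}. \<pi> i \<le> k}"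
    define B where "B = {i \<in> {1..n+1}. \<pi> i \<le> k - 1}"
    have cA: "card {i \<in> {1..n+1}. \<pi> i \<le> m} = m" if m: "m \<le> n + 1" for m
    proof -
      consider "m = 0" | "m \<in> {1..n}" | "m = n + 1" using m by (cases "m = 0"; cases "m = n + 1") auto
      then show ?thesis
      proof cases
        case 1
        have "{i \<in> {1..n+1}. \<pi> i \<le> m} = {}" using \<pi>1(1) 1 by fastforce
        then show ?thesis using 1 by simp
      next
        case 2
        have "{i \<in> {1..n+1}. \<pi> i \<le> m} = S m" using \<pi>le[OF _ 2] subset_tuplesD(1)[OF S' 2] by blast
        then show ?thesis using subset_tuplesD(2)[OF S' 2] by simp
      next
        case 3
        have "{i \<in> {1..n+1}. \<pi> i \<le> m} = {1..n+1}" using \<pi>1(2) 3 by blast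
        then show ?thesis using 3 by simp
      qed
    qed
    have "card B < card A" unfolding A_def B_def 
    proof -
      have "card {i \<in> {1..n+1}. \<pi> i \<le> k - 1} = k - 1" by (rule cA) (use k in auto)
      moreover have "card {i \<in> {1..n+1}. \<pi> i \<le> k} = k" by (rule cA) (use k in auto)
      ultimately show "card {i \<in> {1..n+1}. \<pi> i \<le> k - 1} < card {i \<in> {1..n+1}. \<pi> i \<le> k}" using k by auto
    qed
    moreover have "finite B" unfolding B_def by simp
    ultimately have "\<not> A \<subseteq> B" using card_mono leD by blast
    then obtain i where "i \<in> A" "i \<notin> B" by blast
    then show ?thesis unfolding A_def B_def by (intro bexI[of _ i]) auto
  qed
  have perm: "\<pi> permutes {1..n+1}"
  proof (rule bij_imp_permutes)
    have "\<pi> ` {1..n+1} = {1..n+1}"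
    proof
      show "\<pi> ` {1..n+1} \<subseteq> {1..n+1}" using \<pi>1 by auto
      show "{1..n+1} \<subseteq> \<pi> ` {1..n+1}" using surj by blast
    qed
    then show "bij_betw \<pi> {1..n+1} {1..n+1}" by (simp add: bij_betw_def finite_surj_inj)
    show "\<pi> i = i" if "i \<notin> {1..n+1}" for i unfolding \<pi>_def if_not_P[OF that] ..
  qed
  have "nocross \<pi>" unfolding nocross_def
  proof (intro notI, elim exE conjE)
    fix l j assume *: "\<pi> j < l" "l < j" "j < \<pi> l"
    have "j \<in> {1..n+1}" using permutes_not_in[OF perm, of j] * by auto
    moreover have "l \<in> {1..n+1}" using permutes_not_in[OF perm, of l] * by auto
    moreover from \<open>l \<in> {1..n+1}\<close> have "\<pi> l \<le> n + 1" using \<pi>1 by blast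
    moreover have "1 \<le> \<pi> j" using \<pi>1 \<open>j \<in> {1..n+1}\<close> by blast
    ultimately have b: "2 \<le> l" "l \<le> j" "j \<le> n" using * by auto
    then have "l - 1 \<in> {1..n}" "j \<in> {1..n}" by auto
    then have "j \<in> S (l - 1)" "l \<notin> S j"
      using * \<pi>le[OF \<open>j \<in> {1..n+1}\<close>, of "l - 1"] \<pi>le[OF \<open>l \<in> {1..n+1}\<close>, of j] by auto
    then show False using good b unfolding bad_pair_def by blast
  qed
  moreover have "perm_flag n \<pi> = S"
  proof (rule extensionalityI[of _ "{1..n}"])
    show "perm_flag n \<pi> \<in> extensional {1..n}" unfolding perm_flag_def by simp
    show "S \<in> extensional {1..n}" using S' unfolding subset_tuples_def PiE_def by auto
    fix k assume k: "k \<in> {1..n}"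
    show "perm_flag n \<pi> k = S k"
      using perm_flag_iff[OF k, of _ \<pi>] \<pi>le[OF _ k] subset_tuplesD(1)[OF S' k] by blast
  qed
  ultimately show "S \<in> perm_flag n ` nc_perms 1 (n + 1)" using perm unfolding nc_perms_def by (intro image_eqI[of _ _ \<pi>]) auto
qed

theorem theorem1p3:
  fixes n :: nat
  assumes "n \<ge> 1"
  shows "poincare_smooth n = monom 1 (n * (n - 1) div 2) * schroeder_poly n"
proof -
  let ?G = "{S. admissible n S \<and> \<not> bad_pair n S}"
  have perm: "\<pi> permutes {1..n+1}" "nocross \<pi>" if "\<pi> \<in> nc_perms 1 (n + 1)" for \<pi>
    using that unfolding nc_perms_def by auto
  have iff: "cell n S \<subseteq> smooth_locus n \<longleftrightarrow> \<not> bad_pair n S" if S: "admissible n S" for S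
  proof
    assume "\<not> bad_pair n S"
    then have "S \<in> perm_flag n ` nc_perms 1 (n + 1)" using S bij_perm_flag[of n] unfolding bij_betw_def by blast
    then obtain \<pi> where "\<pi> \<in> nc_perms 1 (n + 1)" "S = perm_flag n \<pi>" by blast
    then show "cell n S \<subseteq> smooth_locus n" using perm_flag_smooth perm by blast
  qed (use bad_pair_cell_not_smooth[OF S] in blast)
  have cells: "smooth_cells n = cell n ` ?G" unfolding smooth_cells_def using iff by blast
  have inj: "inj_on (cell n) ?G" by (rule inj_on_subset[OF inj_on_cell]) blast
  have N: "n * (n + 1) div 2 = n * (n - 1) div 2 + n"
  proof -
    obtain m where "n = Suc m" using assms by (cases n) auto
    then show ?thesis by (simp add: algebra_simps)
  qed
  have st: "\<forall>\<pi>\<in>nc_perms 1 (n + 1). stat \<pi> \<le> n"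
    "(\<Sum>\<pi>\<in>nc_perms 1 (n + 1). monom 1 (n - stat \<pi>)) = schroeder_poly n"
    using nc_perms_sum[of 1 "n + 1"] by simp_all
  have "poincare_smooth n = (\<Sum>S\<in>?G. monom 1 (the_enat (krull_dim (subtopology (zariski n) (cell n S)))))"
    unfolding poincare_smooth_def cells using sum.reindex[OF inj] by simp
  also have "\<dots> = (\<Sum>S\<in>?G. monom 1 (card (cell_free n S)))"
    by (intro sum.cong refl) (simp add: krull_dim_cell)
  also have "\<dots> = (\<Sum>\<pi>\<in>nc_perms 1 (n + 1). monom 1 (card (cell_free n (perm_flag n \<pi>))))"
    by (rule sum.reindex_bij_betw[OF bij_perm_flag, symmetric])
  also have "\<dots> = (\<Sum>\<pi>\<in>nc_perms 1 (n + 1). monom 1 (n * (n - 1) div 2) * monom 1 (n - stat \<pi>))"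
  proof (rule sum.cong[OF refl])
    fix \<pi> assume p: "\<pi> \<in> nc_perms 1 (n + 1)"
    have "card (cell_free n (perm_flag n \<pi>)) + stat \<pi> = n * (n + 1) div 2"
      by (rule card_cell_free_perm[OF perm[OF p]])
    then have "card (cell_free n (perm_flag n \<pi>)) = n * (n - 1) div 2 + (n - stat \<pi>)"
      using N st(1) p by force
    then show "monom 1 (card (cell_free n (perm_flag n \<pi>))) =
        (monom 1 (n * (n - 1) div 2) * monom 1 (n - stat \<pi>) :: int poly)" by (simp add: mult_monom)
  qed
  also have "\<dots> = monom 1 (n * (n - 1) div 2) * schroeder_poly n"
    unfolding sum_distrib_left[symmetric] st(2) ..
  finally show ?thesis .
qed

end
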